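(* Let $X$ be a non-trivial (i.e. not identically zero) conformal Killing field on $\mathbb{R}^3$ which satisfies $X\cdot\operatorname{curl}X=0$ on $\mathbb{R}^3$. Let $A$ be a smooth magnetic potential on $\mathbb{R}^3$ for which the corresponding magnetic field $\operatorname{curl}A$ is everywhere parallel to $X$. Then the Weyl-Dirac operator $\mathcal{D}_A$ does not have a zero mode; that is, there is no non-zero $\psi\in L^2(\mathbb{R}^3,\mathbb{C}^2)$ in the domain of $\mathcal{D}_A$ with $\mathcal{D}_A\psi=0$.
   Context: A conformal Killing field on $\mathbb{R}^3$ (Euclidean metric) is a smooth vector field $X=(X_1,X_2,X_3):\mathbb{R}^3\to\mathbb{R}^3$ satisfying $\nabla_iX_j+\nabla_jX_i=\tfrac23(\operatorname{div}X)\,\delta_{ij}$ for all $i,j\in\{1,2,3\}$, where $\nabla_i=\partial/\partial x_i$. A smooth magnetic potential is a smooth vector field $A:\mathbb{R}^3\to\mathbb{R}^3$; its magnetic field is $B=\operatorname{curl}A$. The field $B$ is everywhere parallel to $X$ if $B(\mathbf{x})$ is a real scalar multiple of $X(\mathbf{x})$ at every $\mathbf{x}$ with $X(\mathbf{x})\neq0$ (the scalar may vanish and may depend on $\mathbf{x}$). The Weyl-Dirac operator is $\mathcal{D}_A=\sigma\cdot(-\mathrm{i}\nabla-A)=\sum_{j=1}^3\sigma_j(-\mathrm{i}\nabla_j-A_j)$, where $\sigma_1,\sigma_2,\sigma_3$ are the Pauli matrices. It acts on spinors, i.e. $\mathbb{C}^2$-valued functions on $\mathbb{R}^3$. Defined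 initially on $C^\infty_0(\mathbb{R}^3,\mathbb{C}^2)$ it has a unique self-adjoint extension in $L^2(\mathbb{R}^3,\mathbb{C}^2)$, which is also denoted $\mathcal{D}_A$. A zero mode is a non-zero $\psi\in L^2(\mathbb{R}^3,\mathbb{C}^2)$ in the domain of this extension with $\mathcal{D}_A\psi=0$. *)

theory Defs
  imports "HOL-Analysis.Analysis"
begin

section \<open>Vector calculus on \<open>\<real>\<^sup>3\<close>\<close>

primrec C_upto :: "nat \<Rightarrow> ('a::real_normed_vector \<Rightarrow> 'b::real_normed_vector) \<Rightarrow> bool" where
  "C_upto 0 f \<longleftrightarrow> continuous_on UNIV f"
| "C_upto (Suc k) f \<longleftrightarrow>
     (\<forall>x. f differentiable at x) \<and> (\<forall>v. C_upto k (\<lambda>x. frechet_derivative f (at x) v))"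

definition smooth :: "('a::real_normed_vector \<Rightarrow> 'b::real_normed_vector) \<Rightarrow> bool" where
  "smooth f \<longleftrightarrow> (\<forall>k. C_upto k f)"

definition partial :: "3 \<Rightarrow> (real^3 \<Rightarrow> 'b::real_normed_vector) \<Rightarrow> real^3 \<Rightarrow> 'b" where
  "partial j f x = vector_derivative (\<lambda>t. f (x + t *\<^sub>R axis j 1)) (at 0)"

definition divergence :: "(real^3 \<Rightarrow> real^3) \<Rightarrow> real^3 \<Rightarrow> real" where
  "divergence X x = (\<Sum>j\<in>UNIV. partial j (\<lambda>y. X y $ j) x)"

definition curl :: "(real^3 \<Rightarrow> real^3) \<Rightarrow> real^3 \<Rightarrow> real^3" where
  "curl X x = vector
     [partial 2 (\<lambda>y. X y $ 3) x - partial 3 (\<lambda>y. X y $ 2) x,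
      partial 3 (\<lambda>y. X y $ 1) x - partial 1 (\<lambda>y. X y $ 3) x,
      partial 1 (\<lambda>y. X y $ 2) x - partial 2 (\<lambda>y. X y $ 1) x]"

definition conformal_killing :: "(real^3 \<Rightarrow> real^3) \<Rightarrow> bool" where
  "conformal_killing X \<longleftrightarrow> smooth X \<and>
     (\<forall>x i j. partial i (\<lambda>y. X y $ j) x + partial j (\<lambda>y. X y $ i) x
        = 2 / 3 * divergence X x * (if i = j then 1 else 0))"

definition everywhere_parallel :: "(real^3 \<Rightarrow> real^3) \<Rightarrow> (real^3 \<Rightarrow> real^3) \<Rightarrow> bool" where
  "everywhere_parallel B X \<longleftrightarrow> (\<forall>x. X x \<noteq> 0 \<longrightarrow> (\<exists>c::real. B x = c *\<^sub>R X x))"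


section \<open>Operators in \<open>L\<^sup>2(\<real>\<^sup>3, \<complex>\<^sup>2)\<close>\<close>

text \<open>
  Elements of \<open>L\<^sup>2\<close> are handled through their representatives: functions that are
  equal almost everywhere stand for the same element.
\<close>

type_synonym spinor = "real^3 \<Rightarrow> complex^2"

definition L2 :: "spinor set" where
  "L2 = {\<psi> \<in> borel_measurable lborel. integrable lborel (\<lambda>x. (norm (\<psi> x))\<^sup>2)}"

definition L2_inner :: "spinor \<Rightarrow> spinor \<Rightarrow> complex" where
  "L2_inner \<phi> \<psi> = (LINT x|lborel. (\<Sum>i\<in>UNIV. cnj (\<phi> x $ i) * \<psi> x $ i))"

definition L2_dist :: "spinor \<Rightarrow> spinor \<Rightarrow> real" where
  "L2_dist \<phi> \<psi> = sqrt (LINT x|lborel. (norm (\<phi> x - \<psi> x))\<^sup>2)"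

text \<open>An unbounded operator is represented by its graph, a set of pairs of representatives.\<close>

type_synonym operator_graph = "(spinor \<times> spinor) set"

definition densely_defined :: "operator_graph \<Rightarrow> bool" where
  "densely_defined T \<longleftrightarrow> (\<forall>\<psi>\<in>L2. \<forall>\<epsilon>>0. \<exists>\<phi>\<in>Domain T. L2_dist \<phi> \<psi> < \<epsilon>)"

definition adjoint_graph :: "operator_graph \<Rightarrow> operator_graph" where
  "adjoint_graph T = {(\<psi>, \<eta>) \<in> L2 \<times> L2. \<forall>(\<phi>, \<xi>)\<in>T. L2_inner \<xi> \<psi> = L2_inner \<phi> \<eta>}"

text \<open>
  An adjoint is automatically a linear subspace of \<open>L\<^sup>2 \<times> L\<^sup>2\<close> that is closed under changing
  representatives, and it is single-valued up to null sets if the original domain is dense.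
  Hence these properties of \<open>T\<close> need not be demanded separately.
\<close>

definition self_adjoint :: "operator_graph \<Rightarrow> bool" where
  "self_adjoint T \<longleftrightarrow> densely_defined T \<and> T = adjoint_graph T"


section \<open>The Weyl-Dirac operator\<close>

definition pauli :: "3 \<Rightarrow> complex^2^2" where
  "pauli j = vector
     [vector [vector [0, 1], vector [1, 0]],
      vector [vector [0, - \<i>], vector [\<i>, 0]],
      vector [vector [1, 0], vector [0, - 1]]] $ j"

definition weyl_dirac_expr :: "(real^3 \<Rightarrow> real^3) \<Rightarrow> spinor \<Rightarrow> spinor" where
  "weyl_dirac_expr A \<psi> x =
     (\<Sum>j\<in>UNIV. pauli j *v (- \<i> *s partial j \<psi> x - of_real (A x $ j) *s \<psi> x))"

definition test_spinor :: "spinor \<Rightarrow> bool" where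
  "test_spinor \<phi> \<longleftrightarrow> smooth \<phi> \<and> compact (closure {x. \<phi> x \<noteq> 0})"

definition weyl_dirac_min :: "(real^3 \<Rightarrow> real^3) \<Rightarrow> operator_graph" where
  "weyl_dirac_min A = {(\<phi>, weyl_dirac_expr A \<phi>) | \<phi>. test_spinor \<phi>}"

text \<open>
  For smooth \<open>A\<close> the minimal operator is essentially self-adjoint, so the description below
  denotes its unique self-adjoint extension.
\<close>

definition weyl_dirac :: "(real^3 \<Rightarrow> real^3) \<Rightarrow> operator_graph" where
  "weyl_dirac A = (THE T. self_adjoint T \<and> weyl_dirac_min A \<subseteq> T)"

definition zero_mode :: "(real^3 \<Rightarrow> real^3) \<Rightarrow> spinor \<Rightarrow> bool" where
  "zero_mode A \<psi> \<longleftrightarrow>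
     \<psi> \<in> L2 \<and> \<not> (AE x in lborel. \<psi> x = 0) \<and> (\<psi>, \<lambda>x. 0) \<in> weyl_dirac A"

end

theory Submission
  imports Defs
begin



definition pd :: "'a::real_normed_vector \<Rightarrow> ('a \<Rightarrow> 'b::real_normed_vector) \<Rightarrow> 'a \<Rightarrow> 'b" where
  "pd v f x = frechet_derivative f (at x) v"

lemma has_derivative_pd:
  "f differentiable at x \<Longrightarrow> (f has_derivative (\<lambda>v. pd v f x)) (at x)"
  unfolding pd_def by (simp add: frechet_derivative_works eta_contract_eq)

lemma pd_eq: "(f has_derivative f') (at x) \<Longrightarrow> pd v f x = f' v"
  unfolding pd_def using frechet_derivative_at by metis

lemma C_upto_Suc_iff:
  "C_upto (Suc k) f \<longleftrightarrow> (\<forall>x. f differentiable at x) \<and> (\<forall>v. C_upto k (pd v f))"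
  unfolding pd_def [abs_def] by simp

declare C_upto.simps(2) [simp del]

lemma C_upto_SucI:
  assumes "\<And>x. (f has_derivative f' x) (at x)" "\<And>v. C_upto k (\<lambda>x. f' x v)"
  shows "C_upto (Suc k) f"
proof -
  have "pd v f = (\<lambda>x. f' x v)" for v
    using pd_eq [OF assms(1)] by (intro ext) auto
  then show ?thesis
    unfolding C_upto_Suc_iff using assms by (auto simp: differentiable_def)
qed

lemma C_upto_Suc_lower: "C_upto (Suc k) f \<Longrightarrow> C_upto k f"
proof (induction k arbitrary: f)
  case 0
  then show ?case
    by (auto simp: continuous_on_eq_continuous_at C_upto_Suc_iff differentiable_imp_continuous_within)
next
  case (Suc k)
  then show ?case unfolding C_upto_Suc_iff [of k] C_upto_Suc_iff [of "Suc k"] by blast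
qed

lemma C_upto_mono:
  assumes "C_upto n f" "k \<le> n"
  shows "C_upto k f"
  using assms(2,1) by (induction rule: dec_induct) (auto dest: C_upto_Suc_lower)

lemma C_upto_imp_continuous_on: "C_upto k f \<Longrightarrow> continuous_on S f"
  by (metis C_upto.simps(1) C_upto_mono continuous_on_subset le0 subset_UNIV)

lemma C_upto_has_derivative:
  "C_upto (Suc k) f \<Longrightarrow> (f has_derivative (\<lambda>v. pd v f x)) (at x)"
  by (auto simp: C_upto_Suc_iff has_derivative_pd)

lemma C_upto_pd: "C_upto (Suc k) f \<Longrightarrow> C_upto k (pd v f)"
  by (auto simp: C_upto_Suc_iff)

lemma C_upto_const [intro, simp]: "C_upto k (\<lambda>x. c)"
proof (induction k arbitrary: c)
  case (Suc k)
  show ?case by (rule C_upto_SucI [where f' = "\<lambda>x v. 0"]) (use Suc in \<open>auto\<close>)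
qed simp

lemma C_upto_linear:
  assumes h: "bounded_linear h" and "C_upto k f"
  shows "C_upto k (\<lambda>x. h (f x))"
  using assms(2)
proof (induction k arbitrary: f)
  case 0
  then show ?case using bounded_linear.continuous_on [OF h] by simp
next
  case (Suc k)
  show ?case
  proof (rule C_upto_SucI)
    show "((\<lambda>x. h (f x)) has_derivative (\<lambda>v. h (pd v f x))) (at x)" for x
      by (rule bounded_linear.has_derivative [OF h C_upto_has_derivative [OF Suc.prems]])
    show "C_upto k (\<lambda>x. h (pd v f x))" for v
      by (rule Suc.IH [OF C_upto_pd [OF Suc.prems]])
  qed
qed

lemma C_upto_id [intro, simp]: "C_upto k (\<lambda>x. x)"
proof (cases k)
  case (Suc n)
  show ?thesis unfolding Suc
    by (rule C_upto_SucI [where f' = "\<lambda>x v. v"]) (auto intro: derivative_eq_intros)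
qed simp

lemma C_upto_bounded_linear: "bounded_linear h \<Longrightarrow> C_upto k h"
  using C_upto_linear [OF _ C_upto_id] .

lemma C_upto_add:
  assumes "C_upto k f" "C_upto k g"
  shows "C_upto k (\<lambda>x. f x + g x)"
  using assms
proof (induction k arbitrary: f g)
  case 0
  then show ?case by (auto intro: continuous_intros)
next
  case (Suc k)
  show ?case
    by (rule C_upto_SucI, rule has_derivative_add [OF C_upto_has_derivative C_upto_has_derivative])
      (use Suc in \<open>auto intro: Suc.IH C_upto_pd\<close>)
qed

lemma C_upto_minus: "C_upto k f \<Longrightarrow> C_upto k (\<lambda>x. - f x)"
  by (rule C_upto_linear [OF bounded_linear_minus [OF bounded_linear_ident]])

lemma C_upto_diff: "C_upto k f \<Longrightarrow> C_upto k g \<Longrightarrow> C_upto k (\<lambda>x. f x - g x)"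
  using C_upto_add [of k f "\<lambda>x. - g x"] C_upto_minus [of k g] by simp

lemma C_upto_sum: "(\<And>i. i \<in> I \<Longrightarrow> C_upto k (f i)) \<Longrightarrow> C_upto k (\<lambda>x. \<Sum>i\<in>I. f i x)"
  by (induction I rule: infinite_finite_induct) (auto intro: C_upto_add)

lemma C_upto_bilinear:
  assumes B: "bounded_bilinear B" and "C_upto k f" "C_upto k g"
  shows "C_upto k (\<lambda>x. B (f x) (g x))"
  using assms(2,3)
proof (induction k arbitrary: f g)
  case 0
  then show ?case using bounded_bilinear.continuous_on [OF B] by simp
next
  case (Suc k)
  show ?case
  proof (rule C_upto_SucI)
    show "((\<lambda>x. B (f x) (g x)) has_derivative (\<lambda>v. B (f x) (pd v g x) + B (pd v f x) (g x))) (at x)" for x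
      by (rule bounded_bilinear.FDERIV [OF B C_upto_has_derivative C_upto_has_derivative]) (use Suc.prems in blast)+
    show "C_upto k (\<lambda>x. B (f x) (pd v g x) + B (pd v f x) (g x))" for v
      by (intro C_upto_add Suc.IH C_upto_pd Suc.prems C_upto_Suc_lower [OF Suc.prems(1)] C_upto_Suc_lower [OF Suc.prems(2)])
  qed
qed

lemmas C_upto_scaleR = C_upto_bilinear [OF bounded_bilinear_scaleR]
lemmas C_upto_mult = C_upto_bilinear [OF bounded_bilinear_mult]
lemmas C_upto_inner = C_upto_bilinear [OF bounded_bilinear_inner]
lemmas C_upto_nth = C_upto_linear [OF bounded_linear_vec_nth]

lemma pd_add_dir:
  assumes "f differentiable at x"
  shows "pd (u + v) f x = pd u f x + pd v f x" "pd (c *\<^sub>R u) f x = c *\<^sub>R pd u f x"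
proof -
  interpret bounded_linear "\<lambda>v. pd v f x"
    using has_derivative_bounded_linear [OF has_derivative_pd [OF assms]] .
  show "pd (u + v) f x = pd u f x + pd v f x" "pd (c *\<^sub>R u) f x = c *\<^sub>R pd u f x"
    by (simp_all add: add scaleR)
qed

lemma pd_basis_sum:
  fixes f :: "'a::euclidean_space \<Rightarrow> 'b::real_normed_vector"
  assumes "f differentiable at x"
  shows "pd v f x = (\<Sum>b\<in>Basis. (v \<bullet> b) *\<^sub>R pd b f x)"
proof -
  interpret bounded_linear "\<lambda>v. pd v f x"
    using has_derivative_bounded_linear [OF has_derivative_pd [OF assms]] .
  show ?thesis
    by (subst euclidean_representation [of v, symmetric]) (simp only: sum scaleR)
qed

lemma pd_eq_0:
  assumes "open S" "x \<in> S" "\<And>y. y \<in> S \<Longrightarrow> f y = 0"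
  shows "pd v f x = 0"
proof -
  have "(f has_derivative (\<lambda>v. 0)) (at x)"
    by (rule has_derivative_transform_within_open [of "\<lambda>_. 0" _ _ _ S]) (use assms in auto)
  then show ?thesis by (rule pd_eq)
qed

lemma partial_eq_pd:
  assumes "f differentiable at x"
  shows "partial j f x = pd (axis j 1) f x"
proof -
  have "((\<lambda>t. f (x + t *\<^sub>R axis j 1)) has_vector_derivative pd (axis j 1) f x) (at 0)"
    unfolding has_vector_derivative_def
  proof -
    have 1: "((\<lambda>t. x + t *\<^sub>R axis j 1) has_derivative (\<lambda>t. t *\<^sub>R axis j 1)) (at 0)"
      by (auto intro!: derivative_eq_intros)
    have 2: "(f has_derivative (\<lambda>v. pd v f x)) (at (x + 0 *\<^sub>R axis j 1))"
      using has_derivative_pd [OF assms] by simp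
    show "((\<lambda>t. f (x + t *\<^sub>R axis j 1)) has_derivative (\<lambda>t. t *\<^sub>R pd (axis j 1) f x)) (at 0)"
      using diff_chain_at [OF 1, of f "\<lambda>v. pd v f x"] 2 pd_add_dir(2) [OF assms]
      by (simp add: o_def)
  qed
  then show ?thesis unfolding partial_def by (rule vector_derivative_at)
qed

subsection \<open>Schwarz\<close>

lemma second_difference_mean_value:
  fixes f :: "'a::real_normed_vector \<Rightarrow> real"
  assumes f: "C_upto 2 f" and "h > 0"
  shows "\<exists>s t. 0 < s \<and> s < h \<and> 0 < t \<and> t < h \<and>
     f (x + h *\<^sub>R u + h *\<^sub>R v) - f (x + h *\<^sub>R u) - f (x + h *\<^sub>R v) + f x
       = h^2 * pd v (pd u f) (x + s *\<^sub>R u + t *\<^sub>R v)"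
proof -
  have f2: "C_upto (Suc (Suc 0)) f" using f by (simp only: numeral_2_eq_2)
  define g where "g s = f (x + h *\<^sub>R v + s *\<^sub>R u) - f (x + s *\<^sub>R u)" for s
  have dg: "(g has_real_derivative (pd u f (x + h *\<^sub>R v + s *\<^sub>R u) - pd u f (x + s *\<^sub>R u))) (at s)" for s
  proof -
    have lin: "((\<lambda>s. y + s *\<^sub>R u) has_derivative (\<lambda>r. r *\<^sub>R u)) (at s)" for y
      by (auto intro!: derivative_eq_intros)
    have "((\<lambda>s. f (y + s *\<^sub>R u)) has_derivative (\<lambda>r. r * pd u f (y + s *\<^sub>R u))) (at s)" for y
      using diff_chain_at [OF lin C_upto_has_derivative [OF f2]] pd_add_dir(2) [of f] f2
      by (simp add: o_def C_upto_Suc_iff)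
    from has_derivative_diff [OF this [of "x + h *\<^sub>R v"] this [of x]]
    show ?thesis
      unfolding g_def has_field_derivative_def
      by (rule has_derivative_eq_rhs) (auto simp: algebra_simps)
  qed
  obtain s where s: "0 < s" "s < h" "g h - g 0 = h * (pd u f (x + h *\<^sub>R v + s *\<^sub>R u) - pd u f (x + s *\<^sub>R u))"
    using MVT2 [OF \<open>h > 0\<close> dg] by auto
  have dk: "((\<lambda>t. pd u f (x + s *\<^sub>R u + t *\<^sub>R v)) has_real_derivative pd v (pd u f) (x + s *\<^sub>R u + t *\<^sub>R v)) (at t)" for t
  proof -
    have lin: "((\<lambda>t. x + s *\<^sub>R u + t *\<^sub>R v) has_derivative (\<lambda>r. r *\<^sub>R v)) (at t)"
      by (auto intro!: derivative_eq_intros)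
    have c: "C_upto (Suc 0) (pd u f)" using C_upto_pd [OF f2] .
    show ?thesis
      using diff_chain_at [OF lin C_upto_has_derivative [OF c]] pd_add_dir(2) [of "pd u f"] c
      by (simp add: o_def C_upto_Suc_iff has_field_derivative_def mult_commute_abs)
  qed
  obtain t where t: "0 < t" "t < h" "pd u f (x + s *\<^sub>R u + h *\<^sub>R v) - pd u f (x + s *\<^sub>R u) = h * pd v (pd u f) (x + s *\<^sub>R u + t *\<^sub>R v)"
    using MVT2 [OF \<open>h > 0\<close> dk] by auto
  have "f (x + h *\<^sub>R u + h *\<^sub>R v) - f (x + h *\<^sub>R u) - f (x + h *\<^sub>R v) + f x = g h - g 0"
    by (simp add: g_def ac_simps)
  also have "\<dots> = h^2 * pd v (pd u f) (x + s *\<^sub>R u + t *\<^sub>R v)"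
    using s(3) t(3) by (simp add: power2_eq_square ac_simps)
  finally show ?thesis using s t by blast
qed

lemma pd_commute_real:
  fixes f :: "'a::real_normed_vector \<Rightarrow> real"
  assumes f: "C_upto 2 f"
  shows "pd u (pd v f) x = pd v (pd u f) x"
proof -
  have f2: "C_upto (Suc (Suc 0)) f" using f by (simp only: numeral_2_eq_2)
  define h where "h n = inverse (real (Suc n))" for n
  have hpos: "h n > 0" for n by (simp add: h_def)
  have h0: "h \<longlonglongrightarrow> 0" unfolding h_def using LIMSEQ_inverse_real_of_nat .
  define \<Delta> where "\<Delta> n = (f (x + h n *\<^sub>R u + h n *\<^sub>R v) - f (x + h n *\<^sub>R u) - f (x + h n *\<^sub>R v) + f x) / (h n)^2" for n
  have key: "(\<lambda>n. \<Delta> n) \<longlonglongrightarrow> pd v' (pd u' f) x"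
    if sym: "\<And>n. \<Delta> n = (f (x + h n *\<^sub>R u' + h n *\<^sub>R v') - f (x + h n *\<^sub>R u') - f (x + h n *\<^sub>R v') + f x) / (h n)^2" for u' v'
  proof -
    have "\<exists>s t. 0 < s \<and> s < h n \<and> 0 < t \<and> t < h n \<and> \<Delta> n = pd v' (pd u' f) (x + s *\<^sub>R u' + t *\<^sub>R v')" for n
      using second_difference_mean_value [OF f hpos [of n], of x u' v'] hpos [of n]
      unfolding sym by (metis nonzero_mult_div_cancel_left power_eq_0_iff less_irrefl)
    then obtain s t where st: "\<And>n. 0 < s n" "\<And>n. s n < h n" "\<And>n. 0 < t n" "\<And>n. t n < h n"
      "\<And>n. \<Delta> n = pd v' (pd u' f) (x + s n *\<^sub>R u' + t n *\<^sub>R v')" by metis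
    have "s \<longlonglongrightarrow> 0" "t \<longlonglongrightarrow> 0"
      by (rule tendsto_sandwich [OF _ _ tendsto_const h0]; use st in \<open>auto intro!: always_eventually less_imp_le\<close>)+
    then have l: "(\<lambda>n. x + s n *\<^sub>R u' + t n *\<^sub>R v') \<longlonglongrightarrow> x"
      by (auto intro!: tendsto_eq_intros)
    have "continuous_on UNIV (pd v' (pd u' f))"
      using C_upto_pd [OF C_upto_pd [OF f2]] by simp
    from continuous_on_tendsto_compose [OF this l]
    show ?thesis unfolding st(5) by simp
  qed
  have "\<Delta> \<longlonglongrightarrow> pd v (pd u f) x" by (rule key) (simp add: \<Delta>_def)
  moreover have "\<Delta> \<longlonglongrightarrow> pd u (pd v f) x" by (rule key) (simp add: \<Delta>_def algebra_simps)
  ultimately show ?thesis using LIMSEQ_unique by blast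
qed

lemma pd_linear_comp:
  assumes "bounded_linear h" "f differentiable at x"
  shows "pd v (\<lambda>x. h (f x)) x = h (pd v f x)"
  by (rule pd_eq [OF bounded_linear.has_derivative [OF assms(1) has_derivative_pd [OF assms(2)]]])

lemma pd_commute:
  fixes f :: "'a::real_normed_vector \<Rightarrow> 'b::euclidean_space"
  assumes f: "C_upto 2 f"
  shows "pd u (pd v f) x = pd v (pd u f) x"
proof (rule euclidean_eqI)
  fix b :: 'b assume "b \<in> Basis"
  have f2: "C_upto (Suc (Suc 0)) f" using f by (simp only: numeral_2_eq_2)
  have bl: "bounded_linear (\<lambda>y. y \<bullet> b)" by (rule bounded_linear_inner_left)
  have d1: "pd w (\<lambda>x. f x \<bullet> b) = (\<lambda>x. pd w f x \<bullet> b)" for w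
    using f2 by (auto simp: C_upto_Suc_iff pd_linear_comp [OF bl])
  have d2: "pd w' (\<lambda>x. pd w f x \<bullet> b) x = pd w' (pd w f) x \<bullet> b" for w w'
    using pd_linear_comp [OF bl, of "pd w f"] f2 by (auto simp: C_upto_Suc_iff)
  have "C_upto 2 (\<lambda>x. f x \<bullet> b)" by (rule C_upto_linear [OF bl f])
  from pd_commute_real [OF this, of u v x]
  show "pd u (pd v f) x \<bullet> b = pd v (pd u f) x \<bullet> b" by (simp add: d1 d2)
qed



subsection \<open>bump\<close>

definition flat_exp :: "nat \<Rightarrow> real \<Rightarrow> real" where
  "flat_exp k t = (if t > 0 then exp (- 1 / t) / t ^ k else 0)"

lemma flat_exp_tendsto_0: "(flat_exp k \<longlongrightarrow> 0) (at 0)"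
proof -
  have "((\<lambda>t. (inverse t) ^ k / exp (inverse t)) \<longlongrightarrow> 0) (at_right (0::real))"
    by (rule filterlim_compose [OF tendsto_power_div_exp_0 filterlim_inverse_at_top_right])
  moreover have "eventually (\<lambda>t. (inverse t) ^ k / exp (inverse t) = flat_exp k t) (at_right (0::real))"
    by (rule eventually_at_rightI [of _ 1]) (auto simp: flat_exp_def field_simps exp_minus)
  ultimately have "(flat_exp k \<longlongrightarrow> 0) (at_right 0)"
    using Lim_transform_eventually by blast
  moreover have "(flat_exp k \<longlongrightarrow> 0) (at_left 0)"
    by (rule Lim_transform_eventually [OF tendsto_const], rule eventually_at_leftI [of "-1"]) (auto simp: flat_exp_def)
  ultimately show ?thesis by (simp add: filterlim_split_at)
qed

lemma flat_exp_has_derivative: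
  "(flat_exp k has_real_derivative flat_exp (k + 2) t - real k * flat_exp (k + 1) t) (at t)"
proof -
  consider "t > 0" | "t = 0" | "t < 0" by linarith
  then show ?thesis
  proof cases
    case 1
    have "((\<lambda>t. exp (- 1 / t) / t ^ k) has_real_derivative flat_exp (k + 2) t - real k * flat_exp (k + 1) t) (at t)"
    proof (rule DERIV_cong)
      show "((\<lambda>t. exp (- 1 / t) / t ^ k) has_real_derivative
          (exp (- 1 / t) * (1 / t\<^sup>2) * t ^ k - exp (- 1 / t) * (real k * t ^ (k - 1))) / (t ^ k * t ^ k)) (at t)"
        using 1 by (auto intro!: derivative_eq_intros simp: power2_eq_square)
      show "(exp (- 1 / t) * (1 / t\<^sup>2) * t ^ k - exp (- 1 / t) * (real k * t ^ (k - 1))) / (t ^ k * t ^ k)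
          = flat_exp (k + 2) t - real k * flat_exp (k + 1) t"
        using 1 by (cases k) (simp_all add: flat_exp_def field_simps power2_eq_square)
    qed
    then show ?thesis
      by (rule has_field_derivative_transform_within_open [of _ _ _ "{0<..}"]) (use 1 in \<open>auto simp: flat_exp_def\<close>)
  next
    case 2
    have "((\<lambda>h. (flat_exp k h - flat_exp k 0) / (h - 0)) \<longlongrightarrow> 0) (at 0)"
      by (rule Lim_transform_eventually [OF flat_exp_tendsto_0 [of "k + 1"]])
        (auto simp: flat_exp_def eventually_at intro!: exI [of _ 1])
    then show ?thesis using 2 by (simp add: has_field_derivative_iff flat_exp_def)
  next
    case 3
    have "((\<lambda>t. 0) has_real_derivative flat_exp (k + 2) t - real k * flat_exp (k + 1) t) (at t)"
      using 3 by (simp add: flat_exp_def)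
    then show ?thesis
      by (rule has_field_derivative_transform_within_open [of _ _ _ "{..<0}"]) (use 3 in \<open>auto simp: flat_exp_def\<close>)
  qed
qed

lemma C_upto_flat_exp_ball:
  fixes e :: real
  shows "C_upto n (\<lambda>x::'a::euclidean_space. flat_exp k (e - x \<bullet> x))"
proof (induction n arbitrary: k)
  case 0
  have "continuous_on UNIV (flat_exp k)"
    by (intro continuous_at_imp_continuous_on ballI DERIV_isCont [OF flat_exp_has_derivative])
  then have "continuous_on UNIV (flat_exp k \<circ> (\<lambda>x::'a. e - x \<bullet> x))"
    by (intro continuous_on_compose) (auto intro!: continuous_intros intro: continuous_on_subset)
  then show ?case by (simp add: o_def)
next
  case (Suc n)
  let ?g = "\<lambda>x::'a. flat_exp (k + 2) (e - x \<bullet> x) - real k * flat_exp (k + 1) (e - x \<bullet> x)"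
  show ?case
  proof (rule C_upto_SucI)
    fix x :: 'a
    have "((\<lambda>x. e - x \<bullet> x) has_derivative (\<lambda>v. - (2 * (x \<bullet> v)))) (at x)"
      by (auto intro!: derivative_eq_intros simp: inner_commute)
    from diff_chain_at [OF this flat_exp_has_derivative [of k "e - x \<bullet> x", unfolded has_field_derivative_def]]
    show "((\<lambda>x. flat_exp k (e - x \<bullet> x)) has_derivative (\<lambda>v. ?g x * - (2 * (x \<bullet> v)))) (at x)"
      by (simp add: o_def)
  next
    fix v :: 'a
    show "C_upto n (\<lambda>x. ?g x * - (2 * (x \<bullet> v)))"
      by (intro C_upto_mult C_upto_diff C_upto_minus C_upto_inner C_upto_const C_upto_id Suc)
  qed
qed

subsection \<open>compact supp\<close>

definition supp_in :: "('a::real_normed_vector \<Rightarrow> 'b::zero) \<Rightarrow> real \<Rightarrow> bool" where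
  "supp_in f r \<longleftrightarrow> (\<forall>x. r < norm x \<longrightarrow> f x = 0)"

lemma supp_inD: "supp_in f r \<Longrightarrow> r < norm x \<Longrightarrow> f x = 0"
  by (simp add: supp_in_def)

lemma supp_in_mono: "supp_in f r \<Longrightarrow> r \<le> s \<Longrightarrow> supp_in f s"
  by (auto simp: supp_in_def)

lemma open_norm_gt: "open {x::'a::real_normed_vector. r < norm x}"
  by (intro open_Collect_less continuous_intros)

lemma supp_in_pd: "supp_in f r \<Longrightarrow> supp_in (pd v f) r"
  unfolding supp_in_def using pd_eq_0 [OF open_norm_gt] by blast

lemma supp_in_bounded:
  fixes f :: "'a::euclidean_space \<Rightarrow> 'b::real_normed_vector"
  assumes "continuous_on UNIV f" "supp_in f r"
  obtains B where "B \<ge> 0" "\<And>x. norm (f x) \<le> B"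
proof -
  have "compact (f ` cball 0 r)"
    by (rule compact_continuous_image) (use assms continuous_on_subset in auto)
  then obtain B where B: "B > 0" "\<And>y. y \<in> f ` cball 0 r \<Longrightarrow> norm y \<le> B"
    using compact_imp_bounded bounded_pos by metis
  have "norm (f x) \<le> B" for x
    using B assms(2) by (cases "norm x \<le> r") (auto simp: supp_in_def)
  then show ?thesis using that [of B] B by auto
qed

lemma supp_in_integrable:
  fixes f :: "'a::euclidean_space \<Rightarrow> 'b::euclidean_space"
  assumes "continuous_on UNIV f" "supp_in f r"
  shows "integrable lborel f"
proof -
  have "integrable lborel (\<lambda>x. indicator (cball 0 r) x *\<^sub>R f x)"
    by (rule borel_integrable_compact) (use assms continuous_on_subset in auto)
  moreover have "(\<lambda>x. indicator (cball 0 r) x *\<^sub>R f x) = f"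
    using assms(2) by (auto simp: supp_in_def indicator_def)
  ultimately show ?thesis by simp
qed

lemma supp_in_uniform:
  fixes f :: "'a::euclidean_space \<Rightarrow> 'b::real_normed_vector"
  assumes f: "continuous_on UNIV f" "supp_in f r" and "e > 0"
  shows "\<exists>d>0. \<forall>x y. dist x y < d \<longrightarrow> dist (f x) (f y) < e"
proof -
  have "uniformly_continuous_on (cball 0 (r + 1)) f"
    by (rule compact_uniformly_continuous) (use f continuous_on_subset in auto)
  then obtain d where d: "d > 0" "\<And>x y. x \<in> cball 0 (r+1) \<Longrightarrow> y \<in> cball 0 (r+1) \<Longrightarrow> dist x y < d \<Longrightarrow> dist (f x) (f y) < e"
    unfolding uniformly_continuous_on_def using \<open>e > 0\<close> by metis
  show ?thesis
  proof (intro exI conjI allI impI)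
    show "min d 1 > 0" using d by simp
    fix x y :: 'a assume xy: "dist x y < min d 1"
    show "dist (f x) (f y) < e"
    proof (cases "norm x \<le> r + 1 \<and> norm y \<le> r + 1")
      case True
      then show ?thesis using d xy by (simp add: dist_commute)
    next
      case False
      have "\<bar>norm x - norm y\<bar> < 1"
        using xy norm_triangle_ineq3 [of x y] by (simp add: dist_norm)
      then have "r < norm x" "r < norm y" using False by linarith+
      then show ?thesis using f(2) \<open>e > 0\<close> by (simp add: supp_in_def)
    qed
  qed
qed

lemma uniform_linearization:
  fixes f :: "'a::euclidean_space \<Rightarrow> 'b::real_normed_vector"
  assumes f: "C_upto (Suc 0) f" "supp_in f r" and "e > 0"
  shows "\<exists>d>0. \<forall>x h. norm h < d \<longrightarrow> norm (f (x + h) - f x - pd h f x) \<le> e * norm h"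
proof -
  let ?e = "e / real DIM('a)"
  have e': "?e > 0" using \<open>e > 0\<close> by simp
  have "\<exists>d>0. \<forall>x y. dist x y < d \<longrightarrow> dist (pd b f x) (pd b f y) < ?e" for b
    using C_upto_pd [OF f(1)] by (intro supp_in_uniform [OF _ supp_in_pd [OF f(2)] e']) simp
  then obtain d where d: "\<And>b. d b > 0" "\<And>b x y. dist x y < d b \<Longrightarrow> dist (pd b f x) (pd b f y) < ?e"
    by metis
  define D where "D = Min (d ` Basis)"
  have D: "D > 0" "\<And>b. b \<in> Basis \<Longrightarrow> D \<le> d b"
    unfolding D_def using d(1) by (auto simp: nonempty_Basis)
  show ?thesis
  proof (intro exI conjI allI impI)
    show "D > 0" by (rule D)
    fix x h :: 'a assume h: "norm h < D"
    have "norm (f (x + h) - f x - (\<lambda>v. pd v f x) ((x + h) - x)) \<le> norm ((x + h) - x) * e"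
    proof (rule differentiable_bound_linearization [where S = "ball x D" and f' = "\<lambda>y v. pd v f y"])
      fix t :: real assume "t \<in> {0..1}"
      then have "norm (t *\<^sub>R h) < D"
        using h by (smt (verit) atLeastAtMost_iff mult_left_le_one_le norm_ge_zero norm_scaleR)
      then show "x + t *\<^sub>R (x + h - x) \<in> ball x D"
        by (simp add: dist_norm)
    next
      fix y assume "y \<in> ball x D"
      show "(f has_derivative (\<lambda>v. pd v f y)) (at y within ball x D)"
        by (rule has_derivative_at_withinI [OF C_upto_has_derivative [OF f(1)]])
    next
      fix y assume y: "y \<in> ball x D"
      have "onorm (\<lambda>v. pd v f y - pd v f x) \<le> e"
      proof (rule onorm_bound)
        fix v :: 'a
        have dd: "f differentiable at z" for z using f(1) by (simp add: C_upto_Suc_iff)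
        have "norm (pd v f y - pd v f x) = norm (\<Sum>b\<in>Basis. (v \<bullet> b) *\<^sub>R (pd b f y - pd b f x))"
          unfolding pd_basis_sum [OF dd, of v] by (simp add: scaleR_diff_right sum_subtractf)
        also have "\<dots> \<le> (\<Sum>b\<in>(Basis::'a set). norm v * ?e)"
        proof (rule sum_norm_le)
          fix b :: 'a assume b: "b \<in> Basis"
          have "dist y x < d b" using y D(2) [OF b] by (simp add: dist_commute)
          from d(2) [OF this] have "norm (pd b f y - pd b f x) \<le> ?e" by (simp add: dist_norm)
          then have "\<bar>v \<bullet> b\<bar> * norm (pd b f y - pd b f x) \<le> norm v * ?e"
            using Basis_le_norm [OF b, of v] by (intro mult_mono) auto
          then show "norm ((v \<bullet> b) *\<^sub>R (pd b f y - pd b f x)) \<le> norm v * ?e"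
            by simp
        qed
        also have "\<dots> = e * norm v" by simp
        finally show "norm (pd v f y - pd v f x) \<le> e * norm v" .
      qed (use \<open>e > 0\<close> in simp)
      then show "onorm ((\<lambda>v. pd v f y) - (\<lambda>v. pd v f x)) \<le> e"
        by (simp add: fun_diff_def)
    qed (use D in auto)
    then show "norm (f (x + h) - f x - pd h f x) \<le> e * norm h"
      by (simp add: mult.commute)
  qed
qed

lemma integral_translate:
  fixes f :: "'a::euclidean_space \<Rightarrow> 'b::{banach, second_countable_topology}"
  assumes "f \<in> borel_measurable borel"
  shows "(LINT x|lborel. f (x + h)) = (LINT x|lborel. f x)"
proof -
  have "(LINT x|lborel. f x) = (LINT x|distr lborel borel ((+) h). f x)"
    by (simp add: lborel_distr_plus)
  also have "\<dots> = (LINT x|lborel. f (x + h))"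
    using assms by (subst integral_distr) (simp_all add: add.commute)
  finally show ?thesis by simp
qed

definition conv :: "('a::euclidean_space \<Rightarrow> real) \<Rightarrow> ('a \<Rightarrow> 'b::euclidean_space) \<Rightarrow> 'a \<Rightarrow> 'b" where
  "conv \<rho> f x = (LINT y|lborel. \<rho> (x - y) *\<^sub>R f y)"

lemma integral_pd_eq_0:
  fixes f :: "'a::euclidean_space \<Rightarrow> 'b::euclidean_space"
  assumes f: "C_upto (Suc 0) f" "supp_in f r"
  shows "(LINT x|lborel. pd v f x) = 0"
proof (rule ccontr)
  assume n0: "(LINT x|lborel. pd v f x) \<noteq> 0"
  define V where "V = measure lborel (cball (0::'a) (r + 1))"
  define I where "I = norm (LINT x|lborel. pd v f x)"
  have I: "I > 0" using n0 by (simp add: I_def)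
  have dd: "f differentiable at z" for z using f(1) by (simp add: C_upto_Suc_iff)
  have "v \<noteq> 0" using n0 pd_add_dir(2) [OF dd, of 0 v] by auto
  have V0: "V \<ge> 0" by (simp add: V_def)
  define e where "e = I / (2 * (V + 1)) / norm v"
  have e: "e > 0" unfolding e_def using I V0 \<open>v \<noteq> 0\<close> by (intro divide_pos_pos mult_pos_pos) auto
  obtain d where d: "d > 0" "\<And>x h. norm h < d \<Longrightarrow> norm (f (x + h) - f x - pd h f x) \<le> e * norm h"
    using uniform_linearization [OF f e] by metis
  define t where "t = min d 1 / (2 * norm v)"
  have t: "t > 0" "norm (t *\<^sub>R v) < d" "norm (t *\<^sub>R v) < 1"
    unfolding t_def using d(1) \<open>v \<noteq> 0\<close> by auto
  define g where "g x = f (x + t *\<^sub>R v) - f x - t *\<^sub>R pd v f x" for x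
  have c: "continuous_on UNIV f" using f(1) by (rule C_upto_imp_continuous_on)
  have cp: "continuous_on UNIV (pd v f)" using C_upto_pd [OF f(1)] by simp
  have i1: "integrable lborel f" by (rule supp_in_integrable [OF c f(2)])
  have i2: "integrable lborel (pd v f)" by (rule supp_in_integrable [OF cp supp_in_pd [OF f(2)]])
  have i3: "integrable lborel (\<lambda>x. f (x + t *\<^sub>R v))"
  proof (rule supp_in_integrable)
    show "continuous_on UNIV (\<lambda>x. f (x + t *\<^sub>R v))"
      by (intro continuous_on_compose2 [OF c]) (auto intro!: continuous_intros)
    show "supp_in (\<lambda>x. f (x + t *\<^sub>R v)) (r + 1)"
      unfolding supp_in_def
    proof (intro allI impI)
      fix x :: 'a assume "r + 1 < norm x"
      then have "r < norm (x + t *\<^sub>R v)" using t(3) norm_diff_ineq [of x "t *\<^sub>R v"] by linarith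
      then show "f (x + t *\<^sub>R v) = 0" using f(2) by (simp add: supp_in_def)
    qed
  qed
  have "(LINT x|lborel. g x) = - (t *\<^sub>R (LINT x|lborel. pd v f x))"
    unfolding g_def using i1 i2 i3 integral_translate [of f "t *\<^sub>R v"] borel_measurable_continuous_onI [OF c]
    by (simp add: Bochner_Integration.integral_diff)
  then have "t * I = norm (LINT x|lborel. g x)" using t by (simp add: I_def)
  also have "\<dots> \<le> (LINT x|lborel. norm (g x))" by (rule integral_norm_bound)
  also have "\<dots> \<le> (LINT x|lborel. (e * t * norm v) * indicator (cball (0::'a) (r + 1)) x)"
  proof (rule integral_mono)
    show "integrable lborel (\<lambda>x. norm (g x))"
      unfolding g_def using i1 i2 i3 by (intro integrable_norm) auto
    show "integrable lborel (\<lambda>x. (e * t * norm v) * indicator (cball (0::'a) (r + 1)) x)"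
      by (intro integrable_mult_right integrable_real_indicator) (auto intro: emeasure_lborel_cball_finite [unfolded infinity_ennreal_def])
    fix x :: 'a
    show "norm (g x) \<le> (e * t * norm v) * indicator (cball 0 (r + 1)) x"
    proof (cases "norm x \<le> r + 1")
      case True
      then show ?thesis using d(2) [OF t(2), of x] t(1) unfolding g_def
        by (simp add: pd_add_dir(2) [OF dd])
    next
      case False
      then have "r < norm (x + t *\<^sub>R v)" using t(3) norm_diff_ineq [of x "t *\<^sub>R v"] by linarith
      with False show ?thesis using f(2) supp_in_pd [OF f(2), of v] by (simp add: g_def supp_in_def)
    qed
  qed
  also have "\<dots> = t * (e * norm v * V)" by (simp add: V_def)
  finally have "I \<le> e * norm v * V" using t by simp
  also have "\<dots> = I / 2 * (V / (V + 1))" unfolding e_def using \<open>v \<noteq> 0\<close> by simp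
  also have "\<dots> \<le> I / 2 * 1" using I V0 by (intro mult_left_mono) auto
  finally show False using I by simp
qed

lemma conv_integrable:
  fixes f :: "'a::euclidean_space \<Rightarrow> 'b::euclidean_space"
  assumes "continuous_on UNIV \<rho>" "supp_in \<rho> r" "integrable lborel f"
  shows "integrable lborel (\<lambda>y. \<rho> (x - y) *\<^sub>R f y)"
proof -
  obtain B where B: "B \<ge> 0" "\<And>x. norm (\<rho> x) \<le> B" using supp_in_bounded [OF assms(1,2)] by blast
  have m: "(\<lambda>y. \<rho> (x - y)) \<in> borel_measurable borel"
    by (intro borel_measurable_continuous_onI continuous_on_compose2 [OF assms(1)])
      (auto intro!: continuous_intros)
  show ?thesis
  proof (rule Bochner_Integration.integrable_bound [where f = "\<lambda>y. B * norm (f y)"])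
    show "(\<lambda>y. \<rho> (x - y) *\<^sub>R f y) \<in> borel_measurable lborel"
      using m assms(3) by simp
  qed (use assms(3) B in \<open>auto intro!: mult_right_mono\<close>)
qed

lemma conv_norm_le:
  fixes f :: "'a::euclidean_space \<Rightarrow> 'b::euclidean_space"
  assumes "continuous_on UNIV \<rho>" "supp_in \<rho> r" "integrable lborel f" "\<And>z. \<bar>\<rho> z\<bar> \<le> e"
  shows "norm (conv \<rho> f x) \<le> e * (LINT y|lborel. norm (f y))"
proof -
  have "norm (conv \<rho> f x) \<le> (LINT y|lborel. norm (\<rho> (x - y) *\<^sub>R f y))"
    unfolding conv_def by (rule integral_norm_bound)
  also have "\<dots> \<le> (LINT y|lborel. e * norm (f y))"
    by (rule integral_mono)
      (use assms in \<open>auto intro!: mult_right_mono integrable_norm conv_integrable [OF assms(1-3)] simp del: norm_scaleR\<close>, auto intro!: mult_right_mono)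
  finally show ?thesis by simp
qed

lemma conv_diff_kernel:
  fixes f :: "'a::euclidean_space \<Rightarrow> 'b::euclidean_space"
  assumes "continuous_on UNIV \<rho>" "supp_in \<rho> r" "continuous_on UNIV \<sigma>" "supp_in \<sigma> s" "integrable lborel f"
  shows "conv (\<lambda>z. \<rho> z + \<sigma> z) f x = conv \<rho> f x + conv \<sigma> f x"
    "conv (\<lambda>z. \<rho> z - \<sigma> z) f x = conv \<rho> f x - conv \<sigma> f x"
    "conv (\<lambda>z. c * \<rho> z) f x = c *\<^sub>R conv \<rho> f x"
  unfolding conv_def
  by (simp_all add: scaleR_add_left scaleR_diff_left Bochner_Integration.integral_add Bochner_Integration.integral_diff
      conv_integrable [OF assms(1,2,5)] conv_integrable [OF assms(3,4,5)] flip: scaleR_scaleR)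

lemma conv_shift: "conv \<rho> f (x + h) = conv (\<lambda>z. \<rho> (z + h)) f x"
  by (simp add: conv_def algebra_simps)

lemma supp_in_shift:
  fixes f :: "'a::real_normed_vector \<Rightarrow> 'b::zero"
  shows "supp_in f r \<Longrightarrow> supp_in (\<lambda>z. f (z + h)) (r + norm h)"
  unfolding supp_in_def
proof (intro allI impI)
  fix x :: 'a assume s: "\<forall>x. r < norm x \<longrightarrow> f x = 0" and "r + norm h < norm x"
  then have "r < norm (x + h)" using norm_diff_ineq [of x h] by linarith
  then show "f (x + h) = 0" using s by blast
qed

lemma conv_has_derivative:
  fixes f :: "'a::euclidean_space \<Rightarrow> 'b::euclidean_space"
  assumes \<rho>: "C_upto (Suc 0) \<rho>" "supp_in \<rho> r" and f: "integrable lborel f"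
  shows "(conv \<rho> f has_derivative (\<lambda>v. conv (pd v \<rho>) f x)) (at x)"
  unfolding has_derivative_at_alt
proof (intro conjI allI impI)
  have dd: "\<rho> differentiable at z" for z using \<rho>(1) by (simp add: C_upto_Suc_iff)
  have c: "continuous_on UNIV \<rho>" using \<rho>(1) by (rule C_upto_imp_continuous_on)
  have cp: "continuous_on UNIV (pd v \<rho>)" for v using C_upto_pd [OF \<rho>(1)] by simp
  note sp = supp_in_pd [OF \<rho>(2)]
  have pdl: "pd (u + v) \<rho> = (\<lambda>z. pd u \<rho> z + pd v \<rho> z)" "pd (a *\<^sub>R u) \<rho> = (\<lambda>z. a * pd u \<rho> z)" for u v a
    using pd_add_dir [OF dd] by (auto simp: fun_eq_iff)
  show "bounded_linear (\<lambda>v. conv (pd v \<rho>) f x)"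
  proof (intro linear_conv_bounded_linear [THEN iffD1] linearI)
    show "conv (pd (u + v) \<rho>) f x = conv (pd u \<rho>) f x + conv (pd v \<rho>) f x" for u v
      unfolding pdl by (rule conv_diff_kernel [OF cp sp cp sp f])
    show "conv (pd (a *\<^sub>R u) \<rho>) f x = a *\<^sub>R conv (pd u \<rho>) f x" for u a
      unfolding pdl by (rule conv_diff_kernel [OF cp sp cp sp f])
  qed
  fix e :: real assume e: "e > 0"
  define M where "M = (LINT y|lborel. norm (f y))"
  have M: "M \<ge> 0" by (simp add: M_def)
  have "e / (M + 1) > 0" using e M by simp
  from uniform_linearization [OF \<rho> this] obtain d where d: "d > 0"
    "\<And>x h. norm h < d \<Longrightarrow> norm (\<rho> (x + h) - \<rho> x - pd h \<rho> x) \<le> e / (M + 1) * norm h" by blast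
  show "\<exists>d>0. \<forall>y. norm (y - x) < d \<longrightarrow>
      norm (conv \<rho> f y - conv \<rho> f x - conv (pd (y - x) \<rho>) f x) \<le> e * norm (y - x)"
  proof (intro exI conjI allI impI, rule d)
    fix y assume y: "norm (y - x) < d"
    define h where "h = y - x"
    have ch: "continuous_on UNIV (\<lambda>z. \<rho> (z + h))"
      by (intro continuous_on_compose2 [OF c]) (auto intro!: continuous_intros)
    define s where "s = r + norm h"
    have s: "supp_in (\<lambda>z. \<rho> (z + h)) s" "supp_in \<rho> s" "supp_in (pd h \<rho>) s"
      unfolding s_def using supp_in_shift [OF \<rho>(2)] supp_in_mono [OF \<rho>(2)] supp_in_mono [OF sp] by auto
    have c1: "continuous_on UNIV (\<lambda>z. \<rho> (z + h) - \<rho> z)" by (intro continuous_intros ch c)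
    have c2: "continuous_on UNIV (\<lambda>z. \<rho> (z + h) - \<rho> z - pd h \<rho> z)" by (intro continuous_intros ch c cp)
    have s1: "supp_in (\<lambda>z. \<rho> (z + h) - \<rho> z) s" using s by (simp add: supp_in_def)
    have s2: "supp_in (\<lambda>z. \<rho> (z + h) - \<rho> z - pd h \<rho> z) s" using s by (simp add: supp_in_def)
    have "conv \<rho> f y - conv \<rho> f x - conv (pd (y - x) \<rho>) f x
        = conv (\<lambda>z. \<rho> (z + h)) f x - conv \<rho> f x - conv (pd h \<rho>) f x"
      by (simp add: h_def flip: conv_shift)
    also have "\<dots> = conv (\<lambda>z. \<rho> (z + h) - \<rho> z - pd h \<rho> z) f x"
      by (simp add: conv_diff_kernel(2) [OF c1 s1 cp s(3) f] conv_diff_kernel(2) [OF ch s(1) c s(2) f])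
    also have "norm \<dots> \<le> (e / (M + 1) * norm h) * M"
      unfolding M_def by (rule conv_norm_le [OF c2 s2 f]) (use d(2) [of h] y in \<open>auto simp: h_def M_def\<close>)
    also have "\<dots> = (e * norm h) * (M / (M + 1))" by simp
    also have "\<dots> \<le> (e * norm h) * 1" using e M by (intro mult_left_mono) auto
    finally show "norm (conv \<rho> f y - conv \<rho> f x - conv (pd (y - x) \<rho>) f x) \<le> e * norm (y - x)"
      by (simp add: h_def)
  qed
qed

lemma conv_C_upto:
  fixes f :: "'a::euclidean_space \<Rightarrow> 'b::euclidean_space"
  assumes "C_upto (Suc k) \<rho>" "supp_in \<rho> r" and f: "integrable lborel f"
  shows "C_upto (Suc k) (conv \<rho> f)"
  using assms(1,2)
proof (induction k arbitrary: \<rho>)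
  case 0
  have cont: "continuous_on UNIV (conv \<sigma> f)" if \<sigma>: "continuous_on UNIV \<sigma>" "supp_in \<sigma> r" for \<sigma>
    unfolding continuous_on_iff
  proof (intro ballI allI impI)
    fix x :: 'a and e :: real assume e: "e > 0"
    define M where "M = (LINT y|lborel. norm (f y))"
    have M: "M \<ge> 0" by (simp add: M_def)
    have e': "e / (M + 1) > 0" using e M by simp
    from supp_in_uniform [OF \<sigma> this] obtain d where d: "d > 0"
      "\<And>x y. dist x y < d \<Longrightarrow> dist (\<sigma> x) (\<sigma> y) < e / (M + 1)" by blast
    show "\<exists>d>0. \<forall>y\<in>UNIV. dist y x < d \<longrightarrow> dist (conv \<sigma> f y) (conv \<sigma> f x) < e"
    proof (intro exI conjI ballI impI, rule d)
      fix y assume y: "dist y x < d"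
      define h where "h = y - x"
      have ch: "continuous_on UNIV (\<lambda>z. \<sigma> (z + h))"
        by (intro continuous_on_compose2 [OF \<sigma>(1)]) (auto intro!: continuous_intros)
      have s: "supp_in (\<lambda>z. \<sigma> (z + h)) (r + norm h)" "supp_in \<sigma> (r + norm h)"
        using supp_in_shift [OF \<sigma>(2)] supp_in_mono [OF \<sigma>(2)] by auto
      have c2: "continuous_on UNIV (\<lambda>z. \<sigma> (z + h) - \<sigma> z)" by (intro continuous_intros ch \<sigma>)
      have s2: "supp_in (\<lambda>z. \<sigma> (z + h) - \<sigma> z) (r + norm h)" using s by (simp add: supp_in_def)
      have "conv \<sigma> f y - conv \<sigma> f x = conv (\<lambda>z. \<sigma> (z + h) - \<sigma> z) f x"
        unfolding conv_diff_kernel(2) [OF ch s(1) \<sigma>(1) s(2) f] by (simp add: h_def flip: conv_shift)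
      also have "norm \<dots> \<le> (e / (M + 1)) * M"
        unfolding M_def
        by (rule conv_norm_le [OF c2 s2 f])
          (use d(2) y in \<open>auto simp: h_def M_def dist_norm less_imp_le\<close>)
      also have "\<dots> = e * (M / (M + 1))" by simp
      also have "\<dots> < e * 1" using e M by (intro mult_strict_left_mono) auto
      finally show "dist (conv \<sigma> f y) (conv \<sigma> f x) < e" by (simp add: dist_norm)
    qed
  qed
  show ?case
    by (rule C_upto_SucI [OF conv_has_derivative [OF 0 f]])
      (use cont C_upto_pd [OF 0(1)] supp_in_pd [OF 0(2)] in auto)
next
  case (Suc k)
  show ?case
    by (rule C_upto_SucI [OF conv_has_derivative [OF C_upto_mono [OF Suc.prems(1)] Suc.prems(2) f]])
      (auto intro!: Suc.IH C_upto_pd Suc.prems supp_in_pd)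
qed

lemma conv_supp_in:
  assumes "supp_in \<rho> r" "supp_in f s"
  shows "supp_in (conv \<rho> f) (r + s)"
  unfolding supp_in_def
proof (intro allI impI)
  fix x :: 'a assume x: "r + s < norm x"
  have "\<rho> (x - y) *\<^sub>R f y = 0" for y
  proof (cases "norm y \<le> s")
    case True
    then have "r < norm (x - y)" using x norm_triangle_ineq2 [of x y] by linarith
    then show ?thesis using assms by (simp add: supp_in_def)
  next
    case False
    then show ?thesis using assms by (simp add: supp_in_def)
  qed
  then show "conv \<rho> f x = 0" by (simp only: conv_def integral_zero)
qed



subsection \<open>L2\<close>

definition sq_int :: "('a::euclidean_space \<Rightarrow> 'b::euclidean_space) \<Rightarrow> bool" where
  "sq_int f \<longleftrightarrow> f \<in> borel_measurable lborel \<and> integrable lborel (\<lambda>x. (norm (f x))\<^sup>2)"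

definition l2n :: "('a::euclidean_space \<Rightarrow> 'b::euclidean_space) \<Rightarrow> real" where
  "l2n f = sqrt (LINT x|lborel. (norm (f x))\<^sup>2)"

lemma sq_int_measurable [measurable_dest]: "sq_int f \<Longrightarrow> f \<in> borel_measurable lborel"
  by (simp add: sq_int_def)

lemma sq_int_bound:
  fixes f :: "'a::euclidean_space \<Rightarrow> 'b::euclidean_space" and g :: "'a \<Rightarrow> 'c::euclidean_space"
  assumes "sq_int f" "g \<in> borel_measurable lborel" "\<And>x. norm (g x) \<le> B * norm (f x)"
  shows "sq_int g"
proof -
  have "integrable lborel (\<lambda>x. (norm (g x))\<^sup>2)"
  proof (rule Bochner_Integration.integrable_bound [where f = "\<lambda>x. B\<^sup>2 * (norm (f x))\<^sup>2"])
    show "integrable lborel (\<lambda>x. B\<^sup>2 * (norm (f x))\<^sup>2)" using assms(1) by (simp add: sq_int_def)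
    show "AE x in lborel. norm ((norm (g x))\<^sup>2) \<le> norm (B\<^sup>2 * (norm (f x))\<^sup>2)"
      using power_mono [OF assms(3) norm_ge_zero, of _ 2] by (intro AE_I2) (simp add: power_mult_distrib abs_mult)
  qed (use assms(2) in measurable)
  then show ?thesis using assms(2) by (simp add: sq_int_def)
qed

lemma sq_int_add:
  assumes "sq_int f" "sq_int g"
  shows "sq_int (\<lambda>x. f x + g x)"
proof -
  have [measurable]: "f \<in> borel_measurable lborel" "g \<in> borel_measurable lborel"
    using assms by (auto simp: sq_int_def)
  have "integrable lborel (\<lambda>x. (norm (f x + g x))\<^sup>2)"
  proof (rule Bochner_Integration.integrable_bound [where f = "\<lambda>x. 2 * (norm (f x))\<^sup>2 + 2 * (norm (g x))\<^sup>2"])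
    show "integrable lborel (\<lambda>x. 2 * (norm (f x))\<^sup>2 + 2 * (norm (g x))\<^sup>2)"
      using assms by (simp add: sq_int_def)
    have "(norm (f x + g x))\<^sup>2 \<le> 2 * (norm (f x))\<^sup>2 + 2 * (norm (g x))\<^sup>2" for x
    proof -
      have "(norm (f x + g x))\<^sup>2 \<le> (norm (f x) + norm (g x))\<^sup>2"
        by (intro power_mono norm_triangle_ineq) simp
      also have "\<dots> \<le> 2 * (norm (f x))\<^sup>2 + 2 * (norm (g x))\<^sup>2"
        using zero_le_power2 [of "norm (f x) - norm (g x)"] by (simp add: power2_eq_square algebra_simps)
      finally show ?thesis .
    qed
    then show "AE x in lborel. norm ((norm (f x + g x))\<^sup>2) \<le> norm (2 * (norm (f x))\<^sup>2 + 2 * (norm (g x))\<^sup>2)"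
      by (intro AE_I2) simp
  qed measurable
  then show ?thesis by (simp add: sq_int_def)
qed

lemma sq_int_scaleR: "sq_int f \<Longrightarrow> sq_int (\<lambda>x. c *\<^sub>R f x)"
  by (rule sq_int_bound [where B = "\<bar>c\<bar>"]) (auto simp: sq_int_def)

lemma sq_int_minus: "sq_int f \<Longrightarrow> sq_int (\<lambda>x. - f x)"
  using sq_int_scaleR [of f "-1"] by simp

lemma sq_int_diff: "sq_int f \<Longrightarrow> sq_int g \<Longrightarrow> sq_int (\<lambda>x. f x - g x)"
  using sq_int_add [of f "\<lambda>x. - g x"] sq_int_minus [of g] by simp

lemma sq_int_linear:
  assumes "bounded_linear h" "sq_int f"
  shows "sq_int (\<lambda>x. h (f x))"
proof -
  obtain B where "\<And>x. norm (h x) \<le> norm x * B" using bounded_linear.bounded [OF assms(1)] by blast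
  moreover have "h \<in> borel_measurable borel"
    using linear_continuous_on [OF assms(1)] by (rule borel_measurable_continuous_onI)
  ultimately show ?thesis
    using assms(2) by (intro sq_int_bound [where B = B, OF assms(2)]) (auto simp: sq_int_def mult.commute)
qed

lemma sq_int_supp_in:
  fixes f :: "'a::euclidean_space \<Rightarrow> 'b::euclidean_space"
  assumes "continuous_on UNIV f" "supp_in f r"
  shows "sq_int f"
  unfolding sq_int_def
proof
  show "f \<in> borel_measurable lborel" using borel_measurable_continuous_onI [OF assms(1)] by simp
  show "integrable lborel (\<lambda>x. (norm (f x))\<^sup>2)"
    by (rule supp_in_integrable [where r = r]) (use assms in \<open>auto intro!: continuous_intros simp: supp_in_def\<close>)
qed

lemma sq_int_supp_in_integrable:
  assumes "sq_int f" "supp_in f r"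
  shows "integrable lborel f"
proof (rule Bochner_Integration.integrable_bound [where f = "\<lambda>x. indicator (cball 0 r) x + (norm (f x))\<^sup>2"])
  show "integrable lborel (\<lambda>x. indicator (cball 0 r) x + (norm (f x))\<^sup>2)"
    using assms(1) by (intro Bochner_Integration.integrable_add integrable_real_indicator)
      (auto intro: emeasure_lborel_cball_finite [unfolded infinity_ennreal_def] simp: sq_int_def)
  have "norm (f x) \<le> indicator (cball 0 r) x + (norm (f x))\<^sup>2" for x
  proof (cases "norm x \<le> r")
    case True
    have "norm (f x) \<le> 1 + (norm (f x))\<^sup>2"
      using zero_le_power2 [of "norm (f x) - 1 / 2"] by (simp add: power2_eq_square algebra_simps)
    then show ?thesis using True by simp
  next
    case False
    then show ?thesis using assms(2) by (simp add: supp_in_def)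
  qed
  then show "AE x in lborel. norm (f x) \<le> norm (indicat_real (cball 0 r) x + (norm (f x))\<^sup>2)"
    by (intro AE_I2) (auto intro: order_trans)
qed (use assms in \<open>simp add: sq_int_def\<close>)

lemma sq_int_inner_integrable:
  assumes "sq_int f" "sq_int g"
  shows "integrable lborel (\<lambda>x. f x \<bullet> g x)"
proof (rule Bochner_Integration.integrable_bound [where f = "\<lambda>x. (norm (f x))\<^sup>2 + (norm (g x))\<^sup>2"])
  show "integrable lborel (\<lambda>x. (norm (f x))\<^sup>2 + (norm (g x))\<^sup>2)"
    using assms by (simp add: sq_int_def)
  have "\<bar>f x \<bullet> g x\<bar> \<le> (norm (f x))\<^sup>2 + (norm (g x))\<^sup>2" for x
  proof -
    have "\<bar>f x \<bullet> g x\<bar> \<le> norm (f x) * norm (g x)" by (rule Cauchy_Schwarz_ineq2)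
    also have "\<dots> \<le> (norm (f x))\<^sup>2 + (norm (g x))\<^sup>2"
      using sum_squares_bound [of "norm (f x)" "norm (g x)"] mult_nonneg_nonneg [OF norm_ge_zero norm_ge_zero, of "f x" "g x"]
      by linarith
    finally show ?thesis .
  qed
  then show "AE x in lborel. norm (f x \<bullet> g x) \<le> norm ((norm (f x))\<^sup>2 + (norm (g x))\<^sup>2)"
    by (intro AE_I2) simp
qed (use assms in \<open>auto simp: sq_int_def intro: borel_measurable_inner\<close>)

lemma l2n_nonneg [simp]: "l2n f \<ge> 0"
  by (simp add: l2n_def)

lemma l2n_power2: "(l2n f)\<^sup>2 = (LINT x|lborel. (norm (f x))\<^sup>2)"
  by (simp add: l2n_def)

lemma l2n_cauchy_schwarz:
  assumes "sq_int f" "sq_int g"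
  shows "\<bar>LINT x|lborel. f x \<bullet> g x\<bar> \<le> l2n f * l2n g"
proof -
  define a b c where "a = (LINT x|lborel. (norm (f x))\<^sup>2)" "b = (LINT x|lborel. f x \<bullet> g x)"
    "c = (LINT x|lborel. (norm (g x))\<^sup>2)"
  have i: "integrable lborel (\<lambda>x. (norm (f x))\<^sup>2)" "integrable lborel (\<lambda>x. (norm (g x))\<^sup>2)"
    "integrable lborel (\<lambda>x. f x \<bullet> g x)"
    using assms sq_int_inner_integrable by (auto simp: sq_int_def)
  have quad: "0 \<le> t\<^sup>2 * a - 2 * t * b + c" for t
  proof -
    have "0 \<le> (LINT x|lborel. (norm (t *\<^sub>R f x - g x))\<^sup>2)" by simp
    also have "\<dots> = (LINT x|lborel. t\<^sup>2 * (norm (f x))\<^sup>2 - 2 * t * (f x \<bullet> g x) + (norm (g x))\<^sup>2)"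
      unfolding power2_norm_eq_inner by (simp add: inner_diff algebra_simps inner_commute power2_eq_square)
    also have "\<dots> = t\<^sup>2 * a - 2 * t * b + c"
      unfolding a_b_c_def using i by simp
    finally show ?thesis .
  qed
  have pos: "a \<ge> 0" "c \<ge> 0" by (simp_all add: a_b_c_def)
  have "b\<^sup>2 \<le> a * c"
  proof (cases "a = 0")
    case True
    have "b = 0"
    proof (rule ccontr)
      assume "b \<noteq> 0"
      then show False using quad [of "(c + 1) / (2 * b)"] True by simp
    qed
    then show ?thesis using pos by simp
  next
    case False
    then show ?thesis using quad [of "b / a"] pos by (simp add: field_simps power2_eq_square)
  qed
  then have "\<bar>b\<bar> \<le> sqrt (a * c)" by (intro real_le_rsqrt) simp
  then show ?thesis by (simp add: real_sqrt_mult l2n_def a_b_c_def)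
qed

lemma l2n_triangle:
  assumes "sq_int f" "sq_int g"
  shows "l2n (\<lambda>x. f x + g x) \<le> l2n f + l2n g"
proof (rule power2_le_imp_le)
  have i: "integrable lborel (\<lambda>x. (norm (f x))\<^sup>2)" "integrable lborel (\<lambda>x. (norm (g x))\<^sup>2)"
    "integrable lborel (\<lambda>x. f x \<bullet> g x)"
    using assms sq_int_inner_integrable by (auto simp: sq_int_def)
  have "(l2n (\<lambda>x. f x + g x))\<^sup>2 = (LINT x|lborel. (norm (f x))\<^sup>2 + 2 * (f x \<bullet> g x) + (norm (g x))\<^sup>2)"
    unfolding l2n_power2 power2_norm_eq_inner by (simp add: inner_add algebra_simps inner_commute)
  also have "\<dots> = (l2n f)\<^sup>2 + 2 * (LINT x|lborel. f x \<bullet> g x) + (l2n g)\<^sup>2"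
    unfolding l2n_power2 using i by simp
  also have "\<dots> \<le> (l2n f)\<^sup>2 + 2 * (l2n f * l2n g) + (l2n g)\<^sup>2"
    using l2n_cauchy_schwarz [OF assms] by linarith
  finally show "(l2n (\<lambda>x. f x + g x))\<^sup>2 \<le> (l2n f + l2n g)\<^sup>2" by (simp add: power2_sum)
qed simp

lemma l2n_minus: "l2n (\<lambda>x. - f x) = l2n f"
  by (simp add: l2n_def)

lemma l2n_diff_commute: "l2n (\<lambda>x. f x - g x) = l2n (\<lambda>x. g x - f x)"
  by (simp add: l2n_def norm_minus_commute)

lemma l2n_triangle_diff:
  assumes "sq_int f" "sq_int g" "sq_int h"
  shows "l2n (\<lambda>x. f x - h x) \<le> l2n (\<lambda>x. f x - g x) + l2n (\<lambda>x. g x - h x)"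
  using l2n_triangle [OF sq_int_diff [OF assms(1,2)] sq_int_diff [OF assms(2,3)]] by simp

lemma l2n_mono:
  assumes "sq_int f" "sq_int g" "\<And>x. norm (g x) \<le> B * norm (f x)" "B \<ge> 0"
  shows "l2n g \<le> B * l2n f"
proof (rule power2_le_imp_le)
  have "(LINT x|lborel. (norm (g x))\<^sup>2) \<le> (LINT x|lborel. B\<^sup>2 * (norm (f x))\<^sup>2)"
    by (rule integral_mono)
      (use assms power_mono [OF assms(3) norm_ge_zero, of _ 2] in \<open>auto simp: sq_int_def power_mult_distrib\<close>)
  then show "(l2n g)\<^sup>2 \<le> (B * l2n f)\<^sup>2" by (simp add: l2n_power2 power_mult_distrib)
qed (use assms in simp)

definition l2_lim :: "(nat \<Rightarrow> 'a::euclidean_space \<Rightarrow> 'b::euclidean_space) \<Rightarrow> ('a \<Rightarrow> 'b) \<Rightarrow> bool" where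
  "l2_lim F f \<longleftrightarrow> (\<forall>n. sq_int (F n)) \<and> sq_int f \<and> (\<lambda>n. l2n (\<lambda>x. F n x - f x)) \<longlonglongrightarrow> 0"

lemma l2_limI_bound:
  assumes "\<And>n. sq_int (F n)" "sq_int f" "\<And>n. l2n (\<lambda>x. F n x - f x) \<le> b n" "b \<longlonglongrightarrow> 0"
  shows "l2_lim F f"
  unfolding l2_lim_def using assms
  by (auto intro!: tendsto_sandwich [OF _ _ tendsto_const assms(4)])

lemma l2_lim_add:
  assumes "l2_lim F f" "l2_lim G g"
  shows "l2_lim (\<lambda>n x. F n x + G n x) (\<lambda>x. f x + g x)"
proof (rule l2_limI_bound)
  show "(\<lambda>n. l2n (\<lambda>x. F n x - f x) + l2n (\<lambda>x. G n x - g x)) \<longlonglongrightarrow> 0"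
    using assms by (auto simp: l2_lim_def intro: tendsto_add_zero)
  show "l2n (\<lambda>x. F n x + G n x - (f x + g x)) \<le> l2n (\<lambda>x. F n x - f x) + l2n (\<lambda>x. G n x - g x)" for n
    using l2n_triangle [of "\<lambda>x. F n x - f x" "\<lambda>x. G n x - g x"] assms
    by (simp add: l2_lim_def sq_int_diff algebra_simps)
qed (use assms in \<open>auto simp: l2_lim_def intro: sq_int_add\<close>)

lemma l2_lim_pointwise_bound:
  assumes "l2_lim F f" "\<And>n. sq_int (G n)" "sq_int g" "\<And>n x. norm (G n x - g x) \<le> B * norm (F n x - f x)" "B \<ge> 0"
  shows "l2_lim G g"
proof (rule l2_limI_bound)
  show "(\<lambda>n. B * l2n (\<lambda>x. F n x - f x)) \<longlonglongrightarrow> 0"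
    using assms(1) by (auto simp: l2_lim_def intro: tendsto_mult_right_zero)
  show "l2n (\<lambda>x. G n x - g x) \<le> B * l2n (\<lambda>x. F n x - f x)" for n
    by (rule l2n_mono) (use assms in \<open>auto simp: l2_lim_def intro: sq_int_diff\<close>)
qed (use assms in auto)

lemma l2_lim_linear:
  assumes h: "bounded_linear h" and "l2_lim F f"
  shows "l2_lim (\<lambda>n x. h (F n x)) (\<lambda>x. h (f x))"
proof -
  obtain B where B: "B > 0" "\<And>x. norm (h x) \<le> norm x * B" using bounded_linear.pos_bounded [OF h] by blast
  interpret bounded_linear h by fact
  show ?thesis
    by (rule l2_lim_pointwise_bound [OF assms(2), where B = B])
      (use assms B in \<open>auto simp: l2_lim_def mult.commute simp flip: diff intro: sq_int_linear\<close>)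
qed

lemma l2_lim_inner:
  assumes "l2_lim F f" "l2_lim G g"
  shows "(\<lambda>n. LINT x|lborel. F n x \<bullet> G n x) \<longlonglongrightarrow> (LINT x|lborel. f x \<bullet> g x)"
proof -
  have sq: "sq_int f" "sq_int g" "\<And>n. sq_int (F n)" "\<And>n. sq_int (G n)"
    "\<And>n. sq_int (\<lambda>x. F n x - f x)" "\<And>n. sq_int (\<lambda>x. G n x - g x)"
    using assms by (auto simp: l2_lim_def intro: sq_int_diff)
  have lim: "(\<lambda>n. l2n (\<lambda>x. F n x - f x)) \<longlonglongrightarrow> 0" "(\<lambda>n. l2n (\<lambda>x. G n x - g x)) \<longlonglongrightarrow> 0"
    using assms by (auto simp: l2_lim_def)
  let ?b = "\<lambda>n. l2n (\<lambda>x. F n x - f x) * l2n (\<lambda>x. G n x - g x) + l2n (\<lambda>x. F n x - f x) * l2n g + l2n f * l2n (\<lambda>x. G n x - g x)"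
  have "?b \<longlonglongrightarrow> 0" by (rule tendsto_eq_intros lim refl)+ simp
  moreover have "norm ((LINT x|lborel. F n x \<bullet> G n x) - (LINT x|lborel. f x \<bullet> g x)) \<le> ?b n" for n
  proof -
    have "(LINT x|lborel. F n x \<bullet> G n x) - (LINT x|lborel. f x \<bullet> g x)
      = (LINT x|lborel. (F n x - f x) \<bullet> (G n x - g x)) + (LINT x|lborel. (F n x - f x) \<bullet> g x) + (LINT x|lborel. f x \<bullet> (G n x - g x))"
      by (simp add: sq sq_int_inner_integrable flip: Bochner_Integration.integral_add Bochner_Integration.integral_diff)
        (simp add: inner_diff algebra_simps)
    then show ?thesis
      using l2n_cauchy_schwarz [OF sq(5) sq(6), of n n] l2n_cauchy_schwarz [OF sq(5) sq(2), of n]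
        l2n_cauchy_schwarz [OF sq(1) sq(6), of n] by (simp add: abs_le_iff)
  qed
  ultimately show ?thesis
    using Lim_null_comparison [of _ ?b] LIM_zero_cancel by (metis (no_types, lifting) always_eventually)
qed

lemma l2_lim_const: "sq_int f \<Longrightarrow> l2_lim (\<lambda>n. f) f"
  by (simp add: l2_lim_def l2n_def)

lemma l2_lim_weighted:
  fixes w :: "'a::euclidean_space \<Rightarrow> real"
  assumes F: "l2_lim F f" and w: "w \<in> borel_measurable lborel" "\<And>x. \<bar>w x\<bar> \<le> B"
  shows "(\<lambda>n. LINT x|lborel. w x * (norm (F n x))\<^sup>2) \<longlonglongrightarrow> (LINT x|lborel. w x * (norm (f x))\<^sup>2)"
proof -
  have "B \<ge> 0" using w(2) abs_ge_zero order_trans by blast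
  have sw: "sq_int (\<lambda>x. w x *\<^sub>R g x)" if "sq_int g" for g :: "'a \<Rightarrow> 'b"
    by (rule sq_int_bound [OF that, where B = B]) (use that w in \<open>auto simp: sq_int_def intro!: mult_right_mono\<close>)
  have "l2_lim (\<lambda>n x. w x *\<^sub>R F n x) (\<lambda>x. w x *\<^sub>R f x)"
    by (rule l2_lim_pointwise_bound [OF F, where B = B])
      (use F sw w \<open>B \<ge> 0\<close> in \<open>auto simp: l2_lim_def simp flip: scaleR_diff_right intro!: mult_right_mono\<close>)
  from l2_lim_inner [OF this F] show ?thesis by (simp add: power2_norm_eq_inner)
qed


subsection \<open>density\<close>

lemma l2n_tendsto_dominated:
  fixes F :: "nat \<Rightarrow> 'a::euclidean_space \<Rightarrow> 'b::euclidean_space"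
  assumes "\<And>n. F n \<in> borel_measurable lborel" "AE x in lborel. (\<lambda>n. F n x) \<longlonglongrightarrow> 0"
    "sq_int h" "\<And>n x. norm (F n x) \<le> norm (h x)"
  shows "(\<lambda>n. l2n (F n)) \<longlonglongrightarrow> 0"
proof -
  have "(\<lambda>n. LINT x|lborel. (norm (F n x))\<^sup>2) \<longlonglongrightarrow> (LINT x|(lborel::'a measure). (0::real))"
  proof (rule integral_dominated_convergence [where w = "\<lambda>x. (norm (h x))\<^sup>2"])
    show "AE x in lborel. (\<lambda>n. (norm (F n x))\<^sup>2) \<longlonglongrightarrow> 0"
      using assms(2) by eventually_elim (auto intro!: tendsto_eq_intros)
    show "AE x in lborel. norm ((norm (F n x))\<^sup>2) \<le> (norm (h x))\<^sup>2" for n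
      using assms(4) by (auto intro!: power_mono)
  qed (use assms in \<open>auto simp: sq_int_def\<close>)
  from tendsto_real_sqrt [OF this] show ?thesis by (simp add: l2n_def)
qed

definition clip :: "real \<Rightarrow> 'b::real_normed_vector \<Rightarrow> 'b" where
  "clip k y = (k / max k (norm y)) *\<^sub>R y"

lemma clip_continuous: "k > 0 \<Longrightarrow> continuous_on UNIV (clip k)"
  unfolding clip_def [abs_def] by (intro continuous_intros) (auto simp: max_def)

lemma norm_clip_le: "k > 0 \<Longrightarrow> norm (clip k y) \<le> k" "k > 0 \<Longrightarrow> norm (clip k y) \<le> norm y"
  unfolding clip_def by (auto simp: max_def field_simps)

lemma clip_eq: "k > 0 \<Longrightarrow> norm y \<le> k \<Longrightarrow> clip k y = y"
  by (simp add: clip_def max_def)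

definition tent :: "real \<Rightarrow> 'a::real_normed_vector \<Rightarrow> real" where
  "tent k x = max 0 (min 1 (k + 1 - norm x))"

lemma tent_continuous: "continuous_on UNIV (tent k)"
  unfolding tent_def [abs_def] by (intro continuous_intros)

lemma tent_bounds: "0 \<le> tent k x" "tent k x \<le> 1" "norm x \<le> k \<Longrightarrow> tent k x = 1" "k + 1 < norm x \<Longrightarrow> tent k x = 0"
  by (auto simp: tent_def)

lemma compactly_supported_dense:
  fixes f :: "'a::euclidean_space \<Rightarrow> 'b::euclidean_space"
  assumes f: "sq_int f" and e: "e > 0"
  obtains g r where "continuous_on UNIV g" "supp_in g r" "l2n (\<lambda>x. g x - f x) < e"
proof -
  have fm [measurable]: "f \<in> borel_measurable borel" using f by (simp add: sq_int_def)
  have "f \<in> borel_measurable lebesgue" using fm by (intro measurable_completion) simp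
  then have "f measurable_on UNIV" by (rule lebesgue_measurable_imp_measurable_on) simp
  then obtain N g where N: "negligible N" and g: "\<And>n. continuous_on UNIV (g n)"
    "\<And>x. x \<notin> N \<Longrightarrow> (\<lambda>n. g n x) \<longlonglongrightarrow> f x"
    unfolding measurable_on_def by auto
  have AEN: "AE x in lborel. x \<notin> N"
    using N unfolding negligible_iff_null_sets null_sets_completion_iff2 by (auto intro: AE_I')
  define F where "F k x = tent (real k + 1) x *\<^sub>R clip (real k + 1) (f x)" for k x
  have cm: "clip (real k + 1) \<in> borel_measurable borel" for k :: nat
    by (intro borel_measurable_continuous_onI clip_continuous) simp
  have tm: "tent k \<in> borel_measurable borel" for k
    by (intro borel_measurable_continuous_onI tent_continuous)
  have Fm [measurable]: "F k \<in> borel_measurable borel" for k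
    unfolding F_def using measurable_compose [OF fm cm] tm by measurable
  have Fle: "norm (F k x) \<le> 1 * norm (f x)" for k x
  proof -
    have "tent (real k + 1) x * norm (clip (real k + 1) (f x)) \<le> 1 * norm (f x)"
      using tent_bounds(1,2) [of "real k + 1" x] norm_clip_le(2) [of "real k + 1" "f x"]
      by (intro mult_mono) auto
    then show ?thesis by (simp add: F_def tent_bounds)
  qed
  have sF: "sq_int (F k)" for k
    by (rule sq_int_bound [OF f _ Fle]) simp
  have "(\<lambda>k. l2n (\<lambda>x. F k x - f x)) \<longlonglongrightarrow> 0"
  proof (rule l2n_tendsto_dominated)
    show "AE x in lborel. (\<lambda>k. F k x - f x) \<longlonglongrightarrow> 0"
    proof (intro AE_I2)
      fix x
      have "eventually (\<lambda>k. F k x - f x = 0) sequentially"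
        using eventually_ge_at_top [of "nat \<lceil>norm x\<rceil>"] eventually_ge_at_top [of "nat \<lceil>norm (f x)\<rceil>"]
      proof eventually_elim
        case (elim k)
        then have "norm x \<le> real k + 1" "norm (f x) \<le> real k + 1" by linarith+
        then show ?case by (simp add: F_def tent_bounds clip_eq)
      qed
      then show "(\<lambda>k. F k x - f x) \<longlonglongrightarrow> 0" by (rule tendsto_eventually)
    qed
    show "sq_int (\<lambda>x. 2 *\<^sub>R f x)" by (rule sq_int_scaleR [OF f])
    show "norm (F k x - f x) \<le> norm (2 *\<^sub>R f x)" for k x
      using norm_triangle_ineq4 [of "F k x" "f x"] Fle [of k x] by simp
  qed simp
  then have "eventually (\<lambda>k. l2n (\<lambda>x. F k x - f x) < e / 2) sequentially"
    using e by (intro order_tendstoD) auto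
  then obtain k where k: "l2n (\<lambda>x. F k x - f x) < e / 2"
    by (auto simp: eventually_sequentially)
  define G where "G n x = tent (real k + 1) x *\<^sub>R clip (real k + 1) (g n x)" for n x
  have Gc: "continuous_on UNIV (G n)" for n
    unfolding G_def
    by (intro continuous_intros tent_continuous continuous_on_compose2 [OF clip_continuous g(1)]) auto
  have Gs: "supp_in (G n) (real k + 2)" for n
    unfolding supp_in_def G_def by (auto simp: tent_bounds)
  have sG: "sq_int (G n)" for n by (rule sq_int_supp_in [OF Gc Gs])
  have "(\<lambda>n. l2n (\<lambda>x. G n x - F k x)) \<longlonglongrightarrow> 0"
  proof (rule l2n_tendsto_dominated)
    show "(\<lambda>x. G n x - F k x) \<in> borel_measurable lborel" for n
      using sq_int_measurable [OF sG] Fm by simp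
    show "AE x in lborel. (\<lambda>n. G n x - F k x) \<longlonglongrightarrow> 0"
      using AEN
    proof eventually_elim
      case (elim x)
      have "(\<lambda>n. clip (real k + 1) (g n x)) \<longlonglongrightarrow> clip (real k + 1) (f x)"
        by (rule continuous_on_tendsto_compose [OF clip_continuous g(2) [OF elim]]) auto
      then have "(\<lambda>n. G n x) \<longlonglongrightarrow> F k x" unfolding G_def F_def by (intro tendsto_intros)
      then show ?case by (simp add: LIM_zero)
    qed
    show "sq_int (\<lambda>x. tent (real k + 1) x *\<^sub>R (2 * (real k + 1)))"
      by (rule sq_int_supp_in [where r = "real k + 2"])
        (auto intro!: continuous_intros tent_continuous simp: supp_in_def tent_bounds)
    show "norm (G n x - F k x) \<le> norm (tent (real k + 1) x *\<^sub>R (2 * (real k + 1)))" for n x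
    proof -
      have kp: "0 < real k + 1" by simp
      have "norm (clip (real k + 1) (g n x) - clip (real k + 1) (f x)) \<le> 2 * (real k + 1)"
        using order_trans [OF norm_triangle_ineq4 add_mono [OF norm_clip_le(1) [OF kp] norm_clip_le(1) [OF kp]]]
        by (simp only: mult_2)
      then show ?thesis
        unfolding G_def F_def scaleR_diff_right [symmetric] using tent_bounds(1) [of "real k + 1" x]
        by (auto intro!: mult_left_mono)
    qed
  qed
  then have "eventually (\<lambda>n. l2n (\<lambda>x. G n x - F k x) < e / 2) sequentially"
    using e by (intro order_tendstoD) auto
  then obtain n where n: "l2n (\<lambda>x. G n x - F k x) < e / 2"
    by (auto simp: eventually_sequentially)
  have "l2n (\<lambda>x. G n x - f x) < e"
    using l2n_triangle_diff [OF sG sF f, of n k] n k by linarith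
  then show ?thesis using that Gc Gs by blast
qed

subsection \<open>mollifier\<close>

lemma conv_swap_integrable:
  fixes f :: "'a::euclidean_space \<Rightarrow> 'b::euclidean_space"
  assumes \<rho>: "continuous_on UNIV \<rho>" "supp_in \<rho> r" and f: "integrable lborel f"
  shows "integrable (lborel \<Otimes>\<^sub>M lborel) (\<lambda>(y, x). \<rho> (x - y) *\<^sub>R f y)"
proof (rule lborel_pair.Fubini_integrable)
  have m: "(\<lambda>(y, x). \<rho> (x - y)) \<in> borel_measurable (borel :: ('a \<times> 'a) measure)"
    by (intro borel_measurable_continuous_onI) 
      (auto simp: case_prod_unfold intro!: continuous_on_compose2 [OF \<rho>(1)] continuous_intros)
  then have "(\<lambda>(y, x). \<rho> (x - y)) \<in> borel_measurable (lborel \<Otimes>\<^sub>M lborel :: ('a \<times> 'a) measure)"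
    by (simp add: lborel_prod)
  moreover have "(\<lambda>(y, x). f y) \<in> borel_measurable (lborel \<Otimes>\<^sub>M (lborel :: 'a measure))"
    using f by measurable
  ultimately show "(\<lambda>(y, x). \<rho> (x - y) *\<^sub>R f y) \<in> borel_measurable (lborel \<Otimes>\<^sub>M (lborel :: 'a measure))"
    unfolding case_prod_unfold by (intro borel_measurable_scaleR)
  have eq: "(LINT x|lborel. norm (case (y, x) of (y, x) \<Rightarrow> \<rho> (x - y) *\<^sub>R f y)) = (LINT x|lborel. \<bar>\<rho> x\<bar>) * norm (f y)" for y
    using integral_translate [of "\<lambda>x. \<bar>\<rho> x\<bar>" "- y"] borel_measurable_continuous_onI [OF \<rho>(1)] by simp
  show "integrable lborel (\<lambda>y. LINT x|lborel. norm (case (y, x) of (y, x) \<Rightarrow> \<rho> (x - y) *\<^sub>R f y))"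
    unfolding eq using f by (intro integrable_mult_right integrable_norm)
  have c: "continuous_on UNIV (\<lambda>x. \<rho> (x - y))" for y
    by (intro continuous_on_compose2 [OF \<rho>(1)]) (auto intro!: continuous_intros)
  have "supp_in (\<lambda>x. \<rho> (x - y)) (r + norm y)" for y
    using supp_in_shift [OF \<rho>(2), of "- y"] by simp
  from supp_in_integrable [OF c this]
  show "AE y in lborel. integrable lborel (\<lambda>x. case (y, x) of (y, x) \<Rightarrow> \<rho> (x - y) *\<^sub>R f y)"
    by (auto intro!: integrable_scaleR_left)
qed

lemma conv_integrable_integral:
  fixes f :: "'a::euclidean_space \<Rightarrow> 'b::euclidean_space"
  assumes \<rho>: "continuous_on UNIV \<rho>" "supp_in \<rho> r" and f: "integrable lborel f"
  shows "integrable lborel (conv \<rho> f)"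
    "(LINT x|lborel. conv \<rho> f x) = (LINT x|lborel. \<rho> x) *\<^sub>R (LINT x|lborel. f x)"
proof -
  note i = conv_swap_integrable [OF assms]
  show "integrable lborel (conv \<rho> f)"
    using lborel_pair.integrable_snd [OF i] by (simp add: conv_def [abs_def])
  have inner: "(LINT x|lborel. \<rho> (x - y) *\<^sub>R f y) = (LINT x|lborel. \<rho> x) *\<^sub>R f y" for y
  proof -
    have "continuous_on UNIV (\<lambda>x. \<rho> (x - y))"
      by (intro continuous_on_compose2 [OF \<rho>(1)]) (auto intro!: continuous_intros)
    moreover have "supp_in (\<lambda>x. \<rho> (x - y)) (r + norm y)"
      using supp_in_shift [OF \<rho>(2), of "- y"] by simp
    ultimately have "integrable lborel (\<lambda>x. \<rho> (x - y))" by (rule supp_in_integrable)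
    then show ?thesis
      using integral_translate [of \<rho> "- y"] borel_measurable_continuous_onI [OF \<rho>(1)] by simp
  qed
  have "(LINT x|lborel. conv \<rho> f x) = (LINT y|lborel. LINT x|lborel. \<rho> (x - y) *\<^sub>R f y)"
    unfolding conv_def using lborel_pair.Fubini_integral [OF i] by simp
  also have "\<dots> = (LINT y|lborel. (LINT x|lborel. \<rho> x) *\<^sub>R f y)"
    unfolding inner ..
  finally show "(LINT x|lborel. conv \<rho> f x) = (LINT x|lborel. \<rho> x) *\<^sub>R (LINT x|lborel. f x)"
    by simp
qed


lemma conv_contraction:
  fixes f :: "'a::euclidean_space \<Rightarrow> 'b::euclidean_space"
  assumes \<rho>: "continuous_on UNIV \<rho>" "supp_in \<rho> r" "\<And>z. \<rho> z \<ge> 0" "(LINT z|lborel. \<rho> z) = 1" "\<And>z. \<rho> (- z) = \<rho> z"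
    and f: "integrable lborel f" "sq_int f"
  shows "sq_int (conv \<rho> f)" "l2n (conv \<rho> f) \<le> l2n f"
proof -
  let ?g = "\<lambda>x. (norm (f x))\<^sup>2"
  have g: "integrable lborel ?g" using f(2) by (simp add: sq_int_def)
  have pt: "(norm (conv \<rho> f x))\<^sup>2 \<le> conv \<rho> ?g x" for x
  proof -
    define t where "t = norm (conv \<rho> f x)"
    have tot: "(LINT y|lborel. \<rho> (x - y)) = 1" and toti: "integrable lborel (\<lambda>y. \<rho> (x - y))"
    proof -
      have c: "continuous_on UNIV (\<lambda>y. \<rho> (x - y))"
        by (intro continuous_on_compose2 [OF \<rho>(1)]) (auto intro!: continuous_intros)
      have "supp_in (\<lambda>y. \<rho> (x - y)) (r + norm x)"
        unfolding supp_in_def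
      proof (intro allI impI)
        fix y :: 'a assume "r + norm x < norm y"
        then have "r < norm (x - y)" using norm_triangle_ineq2 [of y x] by (simp add: norm_minus_commute)
        then show "\<rho> (x - y) = 0" using \<rho>(2) by (simp add: supp_in_def)
      qed
      then show "integrable lborel (\<lambda>y. \<rho> (x - y))" by (rule supp_in_integrable [OF c])
      have "\<rho> (x - y) = \<rho> (y + - x)" for y using \<rho>(5) [of "x - y"] by simp
      then show "(LINT y|lborel. \<rho> (x - y)) = 1"
        using integral_translate [of \<rho> "- x"] borel_measurable_continuous_onI [OF \<rho>(1)] \<rho>(4) by simp
    qed
    note i1 = conv_integrable [OF \<rho>(1,2) integrable_norm [OF f(1)], of x]
    note i2 = conv_integrable [OF \<rho>(1,2) g, of x]
    have "t \<le> (LINT y|lborel. norm (\<rho> (x - y) *\<^sub>R f y))"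
      unfolding t_def conv_def by (rule integral_norm_bound)
    then have "t \<le> (LINT y|lborel. \<rho> (x - y) * norm (f y))"
      using \<rho>(3) by simp
    then have "2 * t * t \<le> 2 * t * (LINT y|lborel. \<rho> (x - y) * norm (f y))"
      by (intro mult_left_mono) (simp_all add: t_def)
    also have "\<dots> = (LINT y|lborel. \<rho> (x - y) * (2 * t * norm (f y)))"
      by (simp add: mult.left_commute flip: integral_mult_right_zero)
    also have "\<dots> \<le> (LINT y|lborel. \<rho> (x - y) * t\<^sup>2 + \<rho> (x - y) * ?g y)"
    proof (rule integral_mono)
      show "integrable lborel (\<lambda>y. \<rho> (x - y) * (2 * t * norm (f y)))"
        using integrable_mult_right [OF i1, of "2 * t"] by (simp add: ac_simps)
      show "integrable lborel (\<lambda>y. \<rho> (x - y) * t\<^sup>2 + \<rho> (x - y) * ?g y)"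
        using toti i2 by auto
      fix y
      have "2 * t * norm (f y) \<le> t\<^sup>2 + ?g y" by (rule sum_squares_bound)
      then show "\<rho> (x - y) * (2 * t * norm (f y)) \<le> \<rho> (x - y) * t\<^sup>2 + \<rho> (x - y) * ?g y"
        using \<rho>(3) [of "x - y"] by (simp add: mult_left_mono flip: distrib_left)
    qed
    also have "\<dots> = t\<^sup>2 + conv \<rho> ?g x"
      using toti i2 tot by (simp add: conv_def)
    finally show ?thesis unfolding t_def [symmetric] by (simp add: power2_eq_square)
  qed
  note cg = conv_integrable_integral [OF \<rho>(1,2) g]
  have m: "conv \<rho> f \<in> borel_measurable lborel"
    using conv_integrable_integral(1) [OF \<rho>(1,2) f(1)] by simp
  have i: "integrable lborel (\<lambda>x. (norm (conv \<rho> f x))\<^sup>2)"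
    by (rule Bochner_Integration.integrable_bound [OF cg(1)])
      (use m pt in \<open>auto intro!: AE_I2 intro: order_trans [OF pt abs_ge_self]\<close>)
  then show "sq_int (conv \<rho> f)" using m by (simp add: sq_int_def)
  have "(LINT x|lborel. (norm (conv \<rho> f x))\<^sup>2) \<le> (LINT x|lborel. conv \<rho> ?g x)"
    by (rule integral_mono [OF i cg(1) pt])
  also have "\<dots> = (LINT x|lborel. ?g x)" using cg(2) \<rho>(4) by simp
  finally show "l2n (conv \<rho> f) \<le> l2n f" by (simp add: l2n_def)
qed

definition moll :: "real \<Rightarrow> 'a::euclidean_space \<Rightarrow> real" where
  "moll e x = flat_exp 0 (e\<^sup>2 - x \<bullet> x) / (LINT z|lborel. flat_exp 0 (e\<^sup>2 - (z::'a) \<bullet> z))"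

lemma flat_exp_ball_supp: "e > 0 \<Longrightarrow> supp_in (\<lambda>x::'a::euclidean_space. flat_exp k (e\<^sup>2 - x \<bullet> x)) e"
  unfolding supp_in_def flat_exp_def power2_norm_eq_inner [symmetric]
  by (smt (verit) norm_ge_zero power_mono)

lemma moll_C_upto: "C_upto k (moll e :: 'a::euclidean_space \<Rightarrow> real)"
proof -
  have "C_upto k (\<lambda>x::'a. flat_exp 0 (e\<^sup>2 - x \<bullet> x) * (1 / (LINT z|lborel. flat_exp 0 (e\<^sup>2 - (z::'a) \<bullet> z))))"
    by (intro C_upto_mult C_upto_flat_exp_ball C_upto_const)
  then show ?thesis by (simp add: moll_def [abs_def])
qed

lemma moll_supp_in: "e > 0 \<Longrightarrow> supp_in (moll e :: 'a::euclidean_space \<Rightarrow> real) e"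
  using flat_exp_ball_supp [of e 0] by (auto simp: supp_in_def moll_def)

lemma flat_exp_nonneg: "flat_exp k t \<ge> 0"
  by (simp add: flat_exp_def)

lemma moll_nonneg: "moll e x \<ge> 0"
  unfolding moll_def by (intro divide_nonneg_nonneg integral_nonneg_AE AE_I2 flat_exp_nonneg)

lemma moll_integral:
  assumes "e > 0"
  shows "(LINT z|lborel. moll e (z::'a::euclidean_space)) = 1"
proof -
  let ?g = "\<lambda>z::'a. flat_exp 0 (e\<^sup>2 - z \<bullet> z)"
  have c: "continuous_on UNIV ?g" using C_upto_flat_exp_ball [of 0] by simp
  have i: "integrable lborel ?g" by (rule supp_in_integrable [OF c flat_exp_ball_supp [OF assms]])
  have "(LINT z|lborel. ?g z) \<noteq> 0"
  proof
    assume "(LINT z|lborel. ?g z) = 0"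
    then have "AE z in lborel. ?g z = 0"
      using integral_nonneg_eq_0_iff_AE [OF i] flat_exp_nonneg by auto
    then have "AE z in lborel. z \<notin> ball (0::'a) e"
    proof eventually_elim
      case (elim z)
      then have "e\<^sup>2 \<le> (norm z)\<^sup>2" by (auto simp: flat_exp_def power2_norm_eq_inner split: if_splits)
      then show ?case using assms by (simp add: abs_le_square_iff [symmetric])
    qed
    then have "ball (0::'a) e \<in> null_sets lborel"
      by (subst AE_iff_null_sets) auto
    then show False
      using assms by (simp add: null_sets_def) (metis content_ball_pos emeasure_lborel_ball_finite ennreal_0 enn2real_0 less_irrefl measure_def)
  qed
  then show ?thesis unfolding moll_def by simp
qed

lemma l2_lim_conv_continuous:
  fixes g :: "'a::euclidean_space \<Rightarrow> 'b::euclidean_space"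
  assumes g: "continuous_on UNIV g" "supp_in g r" and d: "d > 0"
  shows "\<exists>e0>0. \<forall>e. 0 < e \<and> e < e0 \<longrightarrow> (\<forall>x. norm (conv (moll e) g x - g x) \<le> d)"
proof -
  from supp_in_uniform [OF g d] obtain e0 where e0: "e0 > 0"
    "\<And>x y. dist x y < e0 \<Longrightarrow> dist (g x) (g y) < d" by blast
  show ?thesis
  proof (intro exI conjI allI impI, rule e0)
    fix e :: real and x :: 'a assume e: "0 < e \<and> e < e0"
    have mc: "continuous_on UNIV (moll e :: 'a \<Rightarrow> real)" using moll_C_upto [of 0] by simp
    have ms: "supp_in (moll e :: 'a \<Rightarrow> real) e" using moll_supp_in e by blast
    have shiftc: "continuous_on UNIV (\<lambda>y. moll e (x - y))"
      by (intro continuous_on_compose2 [OF mc]) (auto intro!: continuous_intros)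
    have even: "moll e (x - y) = moll e (y - x)" for y
      by (simp add: moll_def inner_diff algebra_simps)
    have shifts: "supp_in (\<lambda>y. moll e (y - x)) (e + norm x)"
      using supp_in_shift [OF ms, of "- x"] by simp
    have i0: "integrable lborel (\<lambda>y. moll e (x - y))"
      by (rule supp_in_integrable [OF shiftc]) (use shifts in \<open>simp only: even\<close>)
    have one: "(LINT y|lborel. moll e (x - y)) = 1"
      unfolding even using integral_translate [of "moll e" "- x"] borel_measurable_continuous_onI [OF mc] e
      by (simp add: moll_integral)
    note i1 = conv_integrable [OF mc ms supp_in_integrable [OF g], of x]
    have "conv (moll e) g x - g x = (LINT y|lborel. moll e (x - y) *\<^sub>R g y) - (LINT y|lborel. moll e (x - y)) *\<^sub>R g x"
      by (simp add: conv_def one)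
    also have "\<dots> = (LINT y|lborel. moll e (x - y) *\<^sub>R g y - moll e (x - y) *\<^sub>R g x)"
      using i0 i1 by (subst Bochner_Integration.integral_diff) auto
    also have "norm \<dots> \<le> (LINT y|lborel. norm (moll e (x - y) *\<^sub>R g y - moll e (x - y) *\<^sub>R g x))"
      by (rule integral_norm_bound)
    also have "\<dots> \<le> (LINT y|lborel. moll e (x - y) * d)"
    proof (rule integral_mono)
      show "integrable lborel (\<lambda>y. norm (moll e (x - y) *\<^sub>R g y - moll e (x - y) *\<^sub>R g x))"
        using i0 i1 by auto
      show "integrable lborel (\<lambda>y. moll e (x - y) * d)" using i0 by simp
      fix y
      show "norm (moll e (x - y) *\<^sub>R g y - moll e (x - y) *\<^sub>R g x) \<le> moll e (x - y) * d"
      proof (cases "norm (x - y) \<le> e")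
        case True
        then have "norm (g y - g x) \<le> d"
          using e0(2) [of x y] e by (simp add: dist_norm norm_minus_commute less_imp_le)
        then show ?thesis
          by (simp add: moll_nonneg mult_left_mono flip: scaleR_diff_right)
      next
        case False
        then show ?thesis using ms by (simp add: supp_in_def)
      qed
    qed
    also have "\<dots> = d" using one by simp
    finally show "norm (conv (moll e) g x - g x) \<le> d" .
  qed
qed

definition mseq :: "nat \<Rightarrow> 'a::euclidean_space \<Rightarrow> real" where
  "mseq n = moll (inverse (real (Suc n)))"

lemma mseq:
  "C_upto k (mseq n)" "continuous_on UNIV (mseq n)" "supp_in (mseq n) (inverse (real (Suc n)))"
  "supp_in (mseq n) 1" "mseq n z \<ge> 0" "(LINT z|lborel. mseq n z) = 1" "mseq n (- z) = mseq n z"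
proof -
  show "supp_in (mseq n) (inverse (real (Suc n)))"
    unfolding mseq_def by (rule moll_supp_in) simp
  then show "supp_in (mseq n) 1"
    by (rule supp_in_mono) (simp add: inverse_le_1_iff)
  show "continuous_on UNIV (mseq n)"
    unfolding mseq_def using moll_C_upto [of 0] by simp
  show "mseq n z \<ge> 0" unfolding mseq_def by (rule moll_nonneg)
  show "(LINT z|lborel. mseq n z) = 1" unfolding mseq_def by (rule moll_integral) simp
  show "C_upto k (mseq n)" unfolding mseq_def by (rule moll_C_upto)
  show "mseq n (- z) = mseq n z" by (simp add: mseq_def moll_def)
qed

lemma conv_mseq_uniform:
  fixes g :: "'a::euclidean_space \<Rightarrow> 'b::euclidean_space"
  assumes g: "continuous_on UNIV g" "supp_in g r" and d: "d > 0"
  shows "eventually (\<lambda>n. \<forall>x. norm (conv (mseq n) g x - g x) \<le> d) sequentially"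
proof -
  obtain e0 where e0: "e0 > 0" "\<And>e x. 0 < e \<Longrightarrow> e < e0 \<Longrightarrow> norm (conv (moll e) g x - g x) \<le> d"
    using l2_lim_conv_continuous [OF g d] by blast
  have "eventually (\<lambda>n. inverse (real (Suc n)) < e0) sequentially"
    using order_tendstoD(2) [OF LIMSEQ_inverse_real_of_nat e0(1)] .
  then show ?thesis by eventually_elim (auto simp: mseq_def intro!: e0(2))
qed

lemma conv_diff_fun:
  fixes f :: "'a::euclidean_space \<Rightarrow> 'b::euclidean_space"
  assumes "continuous_on UNIV \<rho>" "supp_in \<rho> r" "integrable lborel f" "integrable lborel g"
  shows "conv \<rho> (\<lambda>y. f y - g y) x = conv \<rho> f x - conv \<rho> g x"
    "conv \<rho> (\<lambda>y. f y + g y) x = conv \<rho> f x + conv \<rho> g x"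
  unfolding conv_def using conv_integrable [OF assms(1,2,3)] conv_integrable [OF assms(1,2,4)]
  by (simp_all add: scaleR_diff_right scaleR_add_right)

lemma l2_lim_mollify:
  fixes f :: "'a::euclidean_space \<Rightarrow> 'b::euclidean_space"
  assumes f: "sq_int f" "supp_in f r"
  shows "l2_lim (\<lambda>n. conv (mseq n) f) f"
proof -
  have fi: "integrable lborel f" by (rule sq_int_supp_in_integrable [OF f])
  have sc: "sq_int (conv (mseq n) f)" for n
    by (rule conv_contraction(1) [OF mseq(2,3,5,6,7) fi f(1)])
  have "(\<lambda>n. l2n (\<lambda>x. conv (mseq n) f x - f x)) \<longlonglongrightarrow> 0"
  proof (rule LIMSEQ_I)
    fix d :: real assume d: "d > 0"
    obtain g s where g: "continuous_on UNIV g" "supp_in g s" "l2n (\<lambda>x. g x - f x) < d / 4"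
      using compactly_supported_dense [OF f(1), of "d / 4"] d by auto
    define R where "R = max s 0"
    have R: "R \<ge> 0" "supp_in g R" using supp_in_mono [OF g(2)] by (auto simp: R_def)
    have gi: "integrable lborel g" and gs: "sq_int g"
      using supp_in_integrable sq_int_supp_in g by blast+
    define V where "V = measure lborel (cball (0::'a) (R + 1))"
    have V: "V \<ge> 0" by (simp add: V_def)
    define c where "c = d / (4 * (sqrt V + 1))"
    have c: "c > 0" unfolding c_def using d V by (intro divide_pos_pos) (auto simp: add_nonneg_pos)
    have "eventually (\<lambda>n. \<forall>x. norm (conv (mseq n) g x - g x) \<le> c) sequentially"
      by (rule conv_mseq_uniform [OF g(1) R(2) c])
    then obtain N where N: "\<And>n x. n \<ge> N \<Longrightarrow> norm (conv (mseq n) g x - g x) \<le> c"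
      by (auto simp: eventually_sequentially)
    have "l2n (\<lambda>x. conv (mseq n) f x - f x) < d" if n: "n \<ge> N" for n
    proof -
      have scg: "sq_int (conv (mseq n) g)"
        by (rule conv_contraction(1) [OF mseq(2,3,5,6,7) gi gs])
      have fgi: "integrable lborel (\<lambda>x. f x - g x)" using fi gi by simp
      have "l2n (conv (mseq n) (\<lambda>x. f x - g x)) \<le> l2n (\<lambda>x. f x - g x)"
        by (rule conv_contraction(2) [OF mseq(2,3,5,6,7) fgi sq_int_diff [OF f(1) gs]])
      then have 1: "l2n (\<lambda>x. conv (mseq n) f x - conv (mseq n) g x) < d / 4"
        using g(3) by (simp add: conv_diff_fun(1) [OF mseq(2,3) fi gi, abs_def] l2n_diff_commute [of f g])
      have "supp_in (conv (mseq n) g) (1 + R)" by (rule conv_supp_in [OF mseq(4) R(2)])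
      then have s0: "conv (mseq n) g x - g x = 0" if "R + 1 < norm x" for x
        using R that by (simp add: supp_in_def)
      have "(l2n (\<lambda>x. conv (mseq n) g x - g x))\<^sup>2 \<le> (LINT x|lborel. c\<^sup>2 * indicator (cball (0::'a) (R + 1)) x)"
        unfolding l2n_power2
      proof (rule integral_mono)
        show "integrable lborel (\<lambda>x. c\<^sup>2 * indicator (cball (0::'a) (R + 1)) x)"
          by (intro integrable_mult_right integrable_real_indicator)
            (auto intro: emeasure_lborel_cball_finite [unfolded infinity_ennreal_def])
        show "integrable lborel (\<lambda>x. (norm (conv (mseq n) g x - g x))\<^sup>2)"
          using sq_int_diff [OF scg gs] by (simp add: sq_int_def)
        show "(norm (conv (mseq n) g x - g x))\<^sup>2 \<le> c\<^sup>2 * indicator (cball (0::'a) (R + 1)) x" for x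
          using power_mono [OF N [OF n] norm_ge_zero, of x 2] s0 [of x] by (cases "norm x \<le> R + 1") auto
      qed
      also have "\<dots> = (c * sqrt V)\<^sup>2" using V by (simp add: V_def power_mult_distrib)
      finally have "l2n (\<lambda>x. conv (mseq n) g x - g x) \<le> c * sqrt V"
        by (rule power2_le_imp_le) (use c V in auto)
      also have "\<dots> = d / 4 * (sqrt V / (sqrt V + 1))" by (simp add: c_def)
      also have "\<dots> \<le> d / 4 * 1"
      proof -
        have "sqrt V / (sqrt V + 1) \<le> 1"
          using real_sqrt_ge_zero [OF V] by (subst divide_le_eq_1_pos) linarith+
        then show ?thesis using d by (intro mult_left_mono) auto
      qed
      finally have 2: "l2n (\<lambda>x. conv (mseq n) g x - g x) \<le> d / 4" by simp
      show ?thesis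
        using l2n_triangle_diff [OF sc scg f(1), of n] l2n_triangle_diff [OF scg gs f(1)] 1 2 g(3) d by linarith
    qed
    then show "\<exists>N. \<forall>n\<ge>N. norm (l2n (\<lambda>x. conv (mseq n) f x - f x) - 0) < d"
      by auto
  qed
  then show ?thesis using sc f(1) by (simp add: l2_lim_def)
qed



subsection \<open>Pauli\<close>

definition imul :: "complex^2 \<Rightarrow> complex^2" where "imul f = \<i> *s f"

definition sig :: "real^3 \<Rightarrow> complex^2 \<Rightarrow> complex^2" where
  "sig v f = vector [of_real (v$3) * f$1 + (of_real (v$1) - \<i> * of_real (v$2)) * f$2,
                     (of_real (v$1) + \<i> * of_real (v$2)) * f$1 - of_real (v$3) * f$2]"

lemma sig_nth [simp]:
  "sig v f $ 1 = of_real (v$3) * f$1 + (of_real (v$1) - \<i> * of_real (v$2)) * f$2"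
  "sig v f $ 2 = (of_real (v$1) + \<i> * of_real (v$2)) * f$1 - of_real (v$3) * f$2"
  by (simp_all add: sig_def)

lemma imul_nth [simp]: "imul f $ i = \<i> * f $ i"
  by (simp add: imul_def)

lemma scaleR_complex: "r *\<^sub>R (z::complex) = of_real r * z"
  by (rule scaleR_conv_of_real)

lemma complex2_eq_iff: "(f::complex^2) = g \<longleftrightarrow> f$1 = g$1 \<and> f$2 = g$2"
  by (simp add: vec_eq_iff forall_2)

lemma imul_imul [simp]: "imul (imul f) = - f"
  by (simp add: complex2_eq_iff flip: mult.assoc)

lemma bounded_linear_imul: "bounded_linear imul"
  by (intro linear_conv_bounded_linear [THEN iffD1] linearI) (auto simp: complex2_eq_iff algebra_simps)

lemma bounded_bilinear_sig: "bounded_bilinear sig"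
  by (intro bilinear_conv_bounded_bilinear [THEN iffD1])
    (auto simp: bilinear_def complex2_eq_iff algebra_simps scaleR_complex intro!: linearI)

lemmas linear_imul = bounded_linear.linear [OF bounded_linear_imul]
lemmas imul_add = linear_add [OF linear_imul]
lemmas imul_diff = linear_diff [OF linear_imul]
lemmas imul_minus = linear_neg [OF linear_imul]
lemmas imul_scaleR = linear_scale [OF linear_imul]
lemmas imul_sum = linear_sum [OF linear_imul]
lemmas imul_zero = linear_0 [OF linear_imul]
lemmas imul_continuous_on = bounded_linear.continuous_on [OF bounded_linear_imul]
interpretation sigB: bounded_bilinear sig by (rule bounded_bilinear_sig)

declare imul_zero [simp] sigB.zero_left [simp] sigB.zero_right [simp]

lemma sig_imul [simp]: "sig u (imul f) = imul (sig u f)"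
  by (simp add: complex2_eq_iff algebra_simps)

lemma sig_sig: "sig u (sig v f) = (u \<bullet> v) *\<^sub>R f + imul (sig (cross3 u v) f)"
  by (simp add: complex2_eq_iff cross3_def inner_vec_def sum_3 scaleR_complex algebra_simps)

lemma complex2_inner: "(f::complex^2) \<bullet> g = Re (f$1) * Re (g$1) + Im (f$1) * Im (g$1) + Re (f$2) * Re (g$2) + Im (f$2) * Im (g$2)"
  by (simp add: inner_vec_def sum_2 inner_complex_def)

lemma sig_inner: "sig u f \<bullet> g = f \<bullet> sig u g"
  by (simp add: complex2_inner algebra_simps)

lemma imul_inner: "imul f \<bullet> g = - (f \<bullet> imul g)"
  by (simp add: complex2_inner algebra_simps)

lemma norm_imul [simp]: "norm (imul f) = norm f"
  by (simp add: norm_eq_sqrt_inner imul_inner)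

lemma norm_sig: "norm (sig u f) = norm u * norm f"
proof -
  have "(norm (sig u f))\<^sup>2 = (norm u * norm f)\<^sup>2"
    by (simp add: power2_norm_eq_inner sig_inner sig_sig power_mult_distrib sigB.zero_left imul_zero)
  then show ?thesis by (simp add: power2_eq_iff_nonneg)
qed

lemma inner_imul_self [simp]: "f \<bullet> imul f = 0" "imul f \<bullet> f = 0"
  using imul_inner [of f f] by (simp_all add: inner_commute)

abbreviation ax :: "3 \<Rightarrow> real^3" where "ax j \<equiv> axis j 1"

lemma pauli_eq_sig: "pauli j *v f = sig (ax j) f"
  using exhaust_3 [of j]
  by (auto simp: pauli_def complex2_eq_iff matrix_vector_mult_def sum_2 vector_3 axis_def)

lemma sum_sig_ax: "(\<Sum>j\<in>UNIV. (v $ j) *\<^sub>R sig (ax j) f) = sig v f"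
  by (simp add: complex2_eq_iff sum_3 axis_def scaleR_complex algebra_simps)

lemma pd_ax_sum:
  assumes "f differentiable at x"
  shows "pd v f x = (\<Sum>j\<in>UNIV. (v $ j) *\<^sub>R pd (ax j) f x)"
proof -
  interpret bounded_linear "\<lambda>v. pd v f x"
    using has_derivative_bounded_linear [OF has_derivative_pd [OF assms]] .
  have "v = (\<Sum>j\<in>UNIV. (v $ j) *\<^sub>R ax j)"
    by (simp add: vec_eq_iff sum_3 axis_def forall_3)
  then show ?thesis by (metis (mono_tags, lifting) scaleR sum sum.cong)
qed

subsection \<open>Dirac\<close>

definition dirac :: "(real^3 \<Rightarrow> real^3) \<Rightarrow> spinor \<Rightarrow> spinor" where
  "dirac A f x = - (\<Sum>j\<in>UNIV. imul (sig (ax j) (pd (ax j) f x))) - sig (A x) (f x)"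

lemma weyl_dirac_expr_eq:
  assumes "f differentiable at x"
  shows "weyl_dirac_expr A f x = dirac A f x"
proof -
  have "pauli j *v (- \<i> *s partial j f x - of_real (A x $ j) *s f x)
      = - imul (sig (ax j) (pd (ax j) f x)) - (A x $ j) *\<^sub>R sig (ax j) (f x)" for j
    unfolding pauli_eq_sig partial_eq_pd [OF assms]
    by (simp add: complex2_eq_iff scaleR_complex algebra_simps)
  then show ?thesis
    unfolding weyl_dirac_expr_def dirac_def sum_sig_ax [of "A x" "f x", symmetric]
    by (simp add: sum_subtractf sum_negf)
qed

lemma L2_eq_sq_int: "\<psi> \<in> L2 \<longleftrightarrow> sq_int \<psi>"
  by (simp add: L2_def sq_int_def)

lemma L2_inner_eq:
  assumes "sq_int \<phi>" "sq_int \<psi>"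
  shows "L2_inner \<phi> \<psi> = Complex (LINT x|lborel. \<phi> x \<bullet> \<psi> x) (LINT x|lborel. imul (\<phi> x) \<bullet> \<psi> x)"
proof -
  have "(\<Sum>i\<in>UNIV. cnj (\<phi> x $ i) * \<psi> x $ i)
      = of_real (\<phi> x \<bullet> \<psi> x) + \<i> * of_real (imul (\<phi> x) \<bullet> \<psi> x)" for x
    by (simp add: complex2_inner sum_2 complex_eq_iff algebra_simps)
  moreover have "integrable lborel (\<lambda>x. \<phi> x \<bullet> \<psi> x)" "integrable lborel (\<lambda>x. imul (\<phi> x) \<bullet> \<psi> x)"
    using assms by (auto intro: sq_int_inner_integrable sq_int_linear [OF bounded_linear_imul])
  ultimately have "L2_inner \<phi> \<psi> = of_real (LINT x|lborel. \<phi> x \<bullet> \<psi> x) + \<i> * of_real (LINT x|lborel. imul (\<phi> x) \<bullet> \<psi> x)"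
    unfolding L2_inner_def by (simp only:) (subst Bochner_Integration.integral_add; simp)
  then show ?thesis by (simp add: complex_eq_iff)
qed

lemma test_spinor_iff: "test_spinor \<phi> \<longleftrightarrow> smooth \<phi> \<and> (\<exists>r. supp_in \<phi> r)"
proof -
  have "compact (closure {x. \<phi> x \<noteq> 0}) \<longleftrightarrow> bounded {x. \<phi> x \<noteq> 0}"
    by (simp add: compact_closure)
  also have "\<dots> \<longleftrightarrow> (\<exists>r. supp_in \<phi> r)"
    unfolding bounded_iff supp_in_def by (auto simp: not_le [symmetric])
  finally show ?thesis by (simp add: test_spinor_def)
qed

lemma smoothD: "smooth f \<Longrightarrow> C_upto k f"
  by (simp add: smooth_def)

lemma sq_int_test:
  assumes "C_upto (Suc 0) f" "supp_in f r"
  shows "sq_int f" "sq_int (pd v f)"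
  using assms sq_int_supp_in [OF C_upto_imp_continuous_on [OF assms(1)] assms(2)]
    sq_int_supp_in [OF C_upto_imp_continuous_on [OF C_upto_pd [OF assms(1)]] supp_in_pd [OF assms(2)]] by auto

lemma continuous_on_sig:
  assumes "continuous_on S A" "continuous_on S f"
  shows "continuous_on S (\<lambda>x. sig (A x) (f x))"
  using assms by (rule bounded_bilinear.continuous_on [OF bounded_bilinear_sig])

lemma dirac_continuous:
  assumes "C_upto (Suc 0) f" "continuous_on UNIV A"
  shows "continuous_on UNIV (dirac A f)"
  unfolding dirac_def [abs_def]
  using C_upto_pd [OF assms(1)] C_upto_imp_continuous_on [OF assms(1)] assms(2)
  by (intro continuous_intros imul_continuous_on continuous_on_sig) auto

lemma dirac_supp_in: "supp_in f r \<Longrightarrow> supp_in (dirac A f) r"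
  using supp_in_pd [of f r] by (auto simp: supp_in_def dirac_def sigB.zero_right imul_zero)

lemma sq_int_dirac:
  "C_upto (Suc 0) f \<Longrightarrow> supp_in f r \<Longrightarrow> continuous_on UNIV A \<Longrightarrow> sq_int (dirac A f)"
  using sq_int_supp_in [OF dirac_continuous dirac_supp_in] by blast

lemma l2_lim_local_linear:
  fixes h :: "'d::euclidean_space \<Rightarrow> 'b::euclidean_space \<Rightarrow> 'c::euclidean_space" and A :: "'a::euclidean_space \<Rightarrow> 'd"
  assumes F: "l2_lim F f" "\<And>n. supp_in (F n) R" "supp_in f R"
    and A: "continuous_on UNIV A" and h: "bounded_bilinear h"
  shows "l2_lim (\<lambda>n x. h (A x) (F n x)) (\<lambda>x. h (A x) (f x))"
proof -
  interpret h: bounded_bilinear h by fact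
  obtain K where K: "K > 0" "\<And>a b. norm (h a b) \<le> norm a * norm b * K" using h.pos_bounded by blast
  have "compact (A ` cball 0 R)"
    by (rule compact_continuous_image) (use A continuous_on_subset in auto)
  then obtain B where B: "B > 0" "\<And>x. norm x \<le> R \<Longrightarrow> norm (A x) \<le> B"
    using compact_imp_bounded bounded_pos by (metis imageI mem_cball_0)
  have bd: "norm (h (A x) y) \<le> B * K * norm y" if "norm x \<le> R \<or> y = 0" for x y
  proof (cases "y = 0")
    case False
    have "norm (A x) * norm y * K \<le> B * norm y * K"
      using B(2) [of x] that False K(1) by (intro mult_right_mono) auto
    then show ?thesis using K(2) [of "A x" y] by (simp add: mult_ac)
  qed (simp add: h.zero_right)
  have Am: "A \<in> borel_measurable borel" using A by (rule borel_measurable_continuous_onI)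
  have hm: "(\<lambda>x. h (A x) (g x)) \<in> borel_measurable lborel" if "g \<in> borel_measurable lborel" for g :: "'a \<Rightarrow> 'b"
  proof -
    have "continuous_on UNIV (\<lambda>p. h (fst p) (snd p))"
      by (intro h.continuous_on continuous_intros)
    then have hb: "(\<lambda>p. h (fst p) (snd p)) \<in> borel_measurable (borel \<Otimes>\<^sub>M borel)"
      unfolding borel_prod by (rule borel_measurable_continuous_onI)
    have "(\<lambda>x. (A x, g x)) \<in> lborel \<rightarrow>\<^sub>M borel \<Otimes>\<^sub>M borel"
      using Am that by simp
    from measurable_compose [OF this hb] show ?thesis by simp
  qed
  have sq: "sq_int (\<lambda>x. h (A x) (g x))" if "sq_int g" "supp_in g R" for g :: "'a \<Rightarrow> 'b"
  proof (rule sq_int_bound [OF that(1) hm, where B = "B * K"])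
    show "g \<in> borel_measurable lborel" using that(1) by (simp add: sq_int_def)
    have "norm x \<le> R \<or> g x = 0" for x using supp_inD [OF that(2)] by (cases "norm x \<le> R") auto
    then show "norm (h (A x) (g x)) \<le> B * K * norm (g x)" for x by (rule bd)
  qed
  show ?thesis
  proof (rule l2_lim_pointwise_bound [OF F(1), where B = "B * K"])
    show "norm (h (A x) (F n x) - h (A x) (f x)) \<le> B * K * norm (F n x - f x)" for n x
      unfolding h.diff_right [symmetric]
    proof (rule bd)
      show "norm x \<le> R \<or> F n x - f x = 0"
        using supp_inD [OF F(2)] supp_inD [OF F(3)] by (cases "norm x \<le> R") auto
    qed
    show "sq_int (\<lambda>x. h (A x) (F n x))" for n
      by (rule sq [OF _ F(2)]) (use F(1) in \<open>simp add: l2_lim_def\<close>)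
    show "sq_int (\<lambda>x. h (A x) (f x))"
      by (rule sq [OF _ F(3)]) (use F(1) in \<open>simp add: l2_lim_def\<close>)
    show "0 \<le> B * K" using B K by simp
  qed
qed

lemma l2_lim_sum:
  assumes "finite I" "\<And>i. i \<in> I \<Longrightarrow> l2_lim (F i) (f i)"
  shows "l2_lim (\<lambda>n x. \<Sum>i\<in>I. F i n x) (\<lambda>x. \<Sum>i\<in>I. f i x)"
  using assms
  by (induction I rule: finite_induct)
    (auto intro!: l2_lim_add simp: l2_lim_const sq_int_supp_in [where r = 0] supp_in_def)

lemma l2_lim_minus: "l2_lim F f \<Longrightarrow> l2_lim (\<lambda>n x. - F n x) (\<lambda>x. - f x)"
  by (rule l2_lim_linear [OF bounded_linear_minus [OF bounded_linear_ident]])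

lemma l2_lim_diff: "l2_lim F f \<Longrightarrow> l2_lim G g \<Longrightarrow> l2_lim (\<lambda>n x. F n x - G n x) (\<lambda>x. f x - g x)"
  using l2_lim_add [OF _ l2_lim_minus, of F f G g] by simp

lemma l2_lim_dirac:
  assumes "l2_lim F f" "\<And>n. supp_in (F n) R" "supp_in f R" "continuous_on UNIV A"
    and "\<And>j. l2_lim (\<lambda>n. pd (ax j) (F n)) (pd (ax j) f)"
  shows "l2_lim (\<lambda>n. dirac A (F n)) (dirac A f)"
  unfolding dirac_def [abs_def]
  by (intro l2_lim_diff l2_lim_minus l2_lim_sum l2_lim_linear [OF bounded_linear_imul]
     l2_lim_linear [OF sigB.bounded_linear_right] l2_lim_local_linear [OF assms(1-4) bounded_bilinear_sig] assms(5) finite)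

lemma pd_reflect:
  assumes "\<rho> differentiable at (x - y)"
  shows "((\<lambda>y. \<rho> (x - y)) has_derivative (\<lambda>v. - pd v \<rho> (x - y))) (at y)"
proof -
  have "((\<lambda>y. x - y) has_derivative (\<lambda>v. - v)) (at y)" by (auto intro!: derivative_eq_intros)
  from diff_chain_at [OF this has_derivative_pd [OF assms]]
  show ?thesis using pd_add_dir(2) [OF assms, of "-1"] by (simp add: o_def)
qed

lemma C_upto_reflect: "C_upto k \<rho> \<Longrightarrow> C_upto k (\<lambda>y. \<rho> (x - y))"
proof (induction k arbitrary: \<rho>)
  case 0
  then have "continuous_on UNIV \<rho>" by simp
  then have "continuous_on UNIV (\<lambda>y. \<rho> (x - y))"
    by (rule continuous_on_compose2) (auto intro!: continuous_intros)
  then show ?case by simp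
next
  case (Suc k)
  have d: "\<rho> differentiable at z" for z using Suc.prems by (simp add: C_upto_Suc_iff)
  show ?case
  proof (rule C_upto_SucI)
    show "((\<lambda>y. \<rho> (x - y)) has_derivative (\<lambda>v. - pd v \<rho> (x - y))) (at y)" for y
      by (rule pd_reflect [OF d])
    show "C_upto k (\<lambda>y. - pd v \<rho> (x - y))" for v
      by (intro C_upto_minus Suc.IH C_upto_pd Suc.prems)
  qed
qed

lemma conv_pd_commute:
  fixes f :: "'a::euclidean_space \<Rightarrow> 'b::euclidean_space"
  assumes \<rho>: "C_upto (Suc 0) \<rho>" "supp_in \<rho> r" and f: "C_upto (Suc 0) f" "supp_in f s"
  shows "pd v (conv \<rho> f) x = conv \<rho> (pd v f) x"
proof -
  have c: "continuous_on UNIV \<rho>" "continuous_on UNIV (pd v \<rho>)" "continuous_on UNIV f" "continuous_on UNIV (pd v f)"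
    by (rule C_upto_imp_continuous_on, rule \<rho> C_upto_pd [OF \<rho>(1)] f C_upto_pd [OF f(1)])+
  note sp = \<rho>(2) supp_in_pd [OF \<rho>(2)] f(2) supp_in_pd [OF f(2)]
  note fi = supp_in_integrable [OF c(3) sp(3)] supp_in_integrable [OF c(4) sp(4)]
  define g where "g y = \<rho> (x - y) *\<^sub>R f y" for y
  have dd: "\<rho> differentiable at z" "f differentiable at z'" for z z' using \<rho>(1) f(1) by (auto simp: C_upto_Suc_iff)
  have g: "C_upto (Suc 0) g" unfolding g_def by (intro C_upto_scaleR C_upto_reflect \<rho> f)
  have gs: "supp_in g s" using f(2) by (simp add: g_def supp_in_def)
  have gd: "pd v g y = \<rho> (x - y) *\<^sub>R pd v f y - pd v \<rho> (x - y) *\<^sub>R f y" for y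
  proof -
    have "(g has_derivative (\<lambda>v. \<rho> (x - y) *\<^sub>R pd v f y + (- pd v \<rho> (x - y)) *\<^sub>R f y)) (at y)"
      unfolding g_def by (rule has_derivative_scaleR [OF pd_reflect [OF dd(1)] has_derivative_pd [OF dd(2)]])
    from pd_eq [OF this] show ?thesis by simp
  qed
  have "conv \<rho> (pd v f) x - conv (pd v \<rho>) f x = (LINT y|lborel. pd v g y)"
    unfolding gd conv_def using conv_integrable [OF c(1) sp(1) fi(2)] conv_integrable [OF c(2) sp(2) fi(1)] by simp
  also have "\<dots> = 0" by (rule integral_pd_eq_0 [OF g gs])
  finally show ?thesis using pd_eq [OF conv_has_derivative [OF \<rho> fi(1)]] by simp
qed

subsection \<open>weak\<close>

definition weak_dirac :: "(real^3 \<Rightarrow> real^3) \<Rightarrow> spinor \<Rightarrow> spinor \<Rightarrow> bool" where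
  "weak_dirac A \<psi> \<eta> \<longleftrightarrow> sq_int \<psi> \<and> sq_int \<eta> \<and>
     (\<forall>\<phi> r. C_upto (Suc 0) \<phi> \<longrightarrow> supp_in \<phi> r \<longrightarrow>
        (LINT x|lborel. dirac A \<phi> x \<bullet> \<psi> x) = (LINT x|lborel. \<phi> x \<bullet> \<eta> x))"

lemma weak_dirac_sq_int: "weak_dirac A \<psi> \<eta> \<Longrightarrow> sq_int \<psi>" "weak_dirac A \<psi> \<eta> \<Longrightarrow> sq_int \<eta>"
  by (simp_all add: weak_dirac_def)

lemma weak_diracD:
  assumes "weak_dirac A \<psi> \<eta>" "C_upto (Suc 0) \<phi>" "supp_in \<phi> r"
  shows "(LINT x|lborel. dirac A \<phi> x \<bullet> \<psi> x) = (LINT x|lborel. \<phi> x \<bullet> \<eta> x)"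
  using assms unfolding weak_dirac_def by blast

lemma test_spinorE:
  assumes "test_spinor \<phi>"
  obtains r where "supp_in \<phi> r" "\<And>k. C_upto k \<phi>" "\<And>x. \<phi> differentiable at x"
proof -
  obtain r where "supp_in \<phi> r" and s: "smooth \<phi>" using assms by (auto simp: test_spinor_iff)
  moreover have "\<phi> differentiable at x" for x using smoothD [OF s, of "Suc 0"] by (simp add: C_upto_Suc_iff)
  ultimately show ?thesis using that smoothD by blast
qed

lemma test_spinor_conv:
  assumes f: "sq_int f" "supp_in f r"
  shows "test_spinor (conv (mseq n) f)"
proof -
  have i: "integrable lborel f" by (rule sq_int_supp_in_integrable [OF f])
  have "C_upto (Suc k) (conv (mseq n) f)" for k
    by (rule conv_C_upto [OF mseq(1,4) i])
  then have "smooth (conv (mseq n) f)" unfolding smooth_def using C_upto_Suc_lower by blast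
  moreover have "supp_in (conv (mseq n) f) (1 + r)" by (rule conv_supp_in [OF mseq(4) f(2)])
  ultimately show ?thesis by (auto simp: test_spinor_iff)
qed

lemma mollify_C1_dirac:
  assumes f: "C_upto (Suc 0) f" "supp_in f r" and A: "continuous_on UNIV A"
  shows "l2_lim (\<lambda>n. conv (mseq n) f) f" "l2_lim (\<lambda>n. dirac A (conv (mseq n) f)) (dirac A f)"
proof -
  show 1: "l2_lim (\<lambda>n. conv (mseq n) f) f"
    by (rule l2_lim_mollify [OF sq_int_test(1) [OF f] f(2)])
  show "l2_lim (\<lambda>n. dirac A (conv (mseq n) f)) (dirac A f)"
  proof (rule l2_lim_dirac [OF 1 _ _ A])
    show "supp_in (conv (mseq n) f) (1 + r)" for n by (rule conv_supp_in [OF mseq(4) f(2)])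
    show "supp_in f (1 + r)" by (rule supp_in_mono [OF f(2)]) simp
    have "pd (ax j) (conv (mseq n) f) = conv (mseq n) (pd (ax j) f)" for n j
      using conv_pd_commute [OF mseq(1,4) f] by blast
    then show "l2_lim (\<lambda>n. pd (ax j) (conv (mseq n) f)) (pd (ax j) f)" for j
      using l2_lim_mollify [OF sq_int_test(2) [OF f] supp_in_pd [OF f(2)]] by simp
  qed
qed

lemma dirac_imul:
  assumes "f differentiable at x"
  shows "dirac A (\<lambda>x. imul (f x)) x = imul (dirac A f x)"
  unfolding dirac_def pd_linear_comp [OF bounded_linear_imul assms]
  by (simp add: imul_diff imul_minus imul_sum)

lemma adjoint_graph_min_iff:
  assumes A: "continuous_on UNIV A"
  shows "(\<psi>, \<eta>) \<in> adjoint_graph (weyl_dirac_min A) \<longleftrightarrow> weak_dirac A \<psi> \<eta>"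
proof
  assume L: "(\<psi>, \<eta>) \<in> adjoint_graph (weyl_dirac_min A)"
  then have sq: "sq_int \<psi>" "sq_int \<eta>"
    by (auto simp: adjoint_graph_def L2_eq_sq_int)
  have test: "(LINT x|lborel. dirac A \<phi> x \<bullet> \<psi> x) = (LINT x|lborel. \<phi> x \<bullet> \<eta> x)" if \<phi>: "test_spinor \<phi>" for \<phi>
  proof -
    from \<phi> obtain r where r: "supp_in \<phi> r" and s: "\<And>k. C_upto k \<phi>" and d: "\<And>x. \<phi> differentiable at x"
      by (rule test_spinorE) (simp only:)
    have "(\<phi>, weyl_dirac_expr A \<phi>) \<in> weyl_dirac_min A" using \<phi> by (auto simp: weyl_dirac_min_def)
    then have "L2_inner (weyl_dirac_expr A \<phi>) \<psi> = L2_inner \<phi> \<eta>"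
      using L by (auto simp: adjoint_graph_def)
    moreover have "weyl_dirac_expr A \<phi> = dirac A \<phi>" using weyl_dirac_expr_eq [OF d] by blast
    ultimately show ?thesis
      using sq sq_int_dirac [OF s r A] sq_int_test(1) [OF s r] by (simp add: L2_inner_eq)
  qed
  show "weak_dirac A \<psi> \<eta>"
    unfolding weak_dirac_def
  proof (intro conjI sq allI impI)
    fix \<phi> :: spinor and r assume \<phi>: "C_upto (Suc 0) \<phi>" "supp_in \<phi> r"
    note lim = mollify_C1_dirac [OF \<phi> A]
    have "(\<lambda>n. LINT x|lborel. conv (mseq n) \<phi> x \<bullet> \<eta> x) \<longlonglongrightarrow> (LINT x|lborel. \<phi> x \<bullet> \<eta> x)"
      by (rule l2_lim_inner [OF lim(1) l2_lim_const [OF sq(2)]])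
    moreover have "(\<lambda>n. LINT x|lborel. dirac A (conv (mseq n) \<phi>) x \<bullet> \<psi> x) \<longlonglongrightarrow> (LINT x|lborel. dirac A \<phi> x \<bullet> \<psi> x)"
      by (rule l2_lim_inner [OF lim(2) l2_lim_const [OF sq(1)]])
    ultimately show "(LINT x|lborel. dirac A \<phi> x \<bullet> \<psi> x) = (LINT x|lborel. \<phi> x \<bullet> \<eta> x)"
      using test [OF test_spinor_conv [OF sq_int_test(1) [OF \<phi>] \<phi>(2)]] LIMSEQ_unique by simp
  qed
next
  assume W: "weak_dirac A \<psi> \<eta>"
  then have sq: "sq_int \<psi>" "sq_int \<eta>" by (auto simp: weak_dirac_def)
  have "L2_inner \<xi> \<psi> = L2_inner \<phi> \<eta>" if "(\<phi>, \<xi>) \<in> weyl_dirac_min A" for \<phi> \<xi>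
  proof -
    from that have \<phi>: "test_spinor \<phi>" and \<xi>: "\<xi> = weyl_dirac_expr A \<phi>" by (auto simp: weyl_dirac_min_def)
    from \<phi> obtain r where r: "supp_in \<phi> r" and s: "\<And>k. C_upto k \<phi>" and d: "\<And>x. \<phi> differentiable at x"
      by (rule test_spinorE) (simp only:)
    have \<xi>: "\<xi> = dirac A \<phi>" unfolding \<xi> using weyl_dirac_expr_eq [OF d] by blast
    have s': "C_upto (Suc 0) (\<lambda>x. imul (\<phi> x))" by (rule C_upto_linear [OF bounded_linear_imul s])
    have r': "supp_in (\<lambda>x. imul (\<phi> x)) r" using r by (simp add: supp_in_def)
    have "(LINT x|lborel. \<xi> x \<bullet> \<psi> x) = (LINT x|lborel. \<phi> x \<bullet> \<eta> x)"
      unfolding \<xi> by (rule weak_diracD [OF W s r])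
    moreover have "(LINT x|lborel. dirac A (\<lambda>x. imul (\<phi> x)) x \<bullet> \<psi> x) = (LINT x|lborel. imul (\<phi> x) \<bullet> \<eta> x)"
      by (rule weak_diracD [OF W s' r'])
    then have "(LINT x|lborel. imul (\<xi> x) \<bullet> \<psi> x) = (LINT x|lborel. imul (\<phi> x) \<bullet> \<eta> x)"
      by (simp add: dirac_imul [OF d] \<xi>)
    ultimately show ?thesis
      using sq sq_int_dirac [OF s r A] sq_int_test(1) [OF s r] by (simp add: L2_inner_eq \<xi>)
  qed
  then show "(\<psi>, \<eta>) \<in> adjoint_graph (weyl_dirac_min A)"
    using sq by (auto simp: adjoint_graph_def L2_eq_sq_int)
qed



definition grad :: "(real^3 \<Rightarrow> real) \<Rightarrow> real^3 \<Rightarrow> real^3" where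
  "grad h x = (\<chi> j. pd (ax j) h x)"

lemma pd_eq_grad:
  assumes "h differentiable at x"
  shows "pd v h x = v \<bullet> grad h x"
  by (subst pd_ax_sum [OF assms]) (simp add: grad_def inner_vec_def)

lemma grad_eqI:
  assumes "(h has_derivative (\<lambda>v. v \<bullet> g)) (at x)"
  shows "grad h x = g"
  unfolding grad_def using pd_eq [OF assms] by (simp add: vec_eq_iff inner_axis' )

lemma grad_continuous: "C_upto (Suc 0) h \<Longrightarrow> continuous_on UNIV (grad h)"
  unfolding grad_def [abs_def] using C_upto_pd [of 0 h]
  by (intro continuous_on_vec_lambda) auto

lemma sig_sum_ax: "(\<Sum>j\<in>UNIV. sig (ax j) ((v $ j) *\<^sub>R f)) = sig v f"
  using sum_sig_ax [of v f] by (simp add: sigB.scaleR_right)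

lemma pd_scaleR:
  assumes "h differentiable at x" "f differentiable at x"
  shows "pd v (\<lambda>x. h x *\<^sub>R f x) x = h x *\<^sub>R pd v f x + pd v h x *\<^sub>R f x"
  by (rule pd_eq [OF has_derivative_scaleR [OF has_derivative_pd [OF assms(1)] has_derivative_pd [OF assms(2)]]])

lemma dirac_scaleR:
  assumes "h differentiable at x" "f differentiable at x"
  shows "dirac A (\<lambda>x. h x *\<^sub>R f x) x = h x *\<^sub>R dirac A f x - imul (sig (grad h x) (f x))"
proof -
  have "(\<Sum>j\<in>UNIV. imul (sig (ax j) (pd (ax j) (\<lambda>x. h x *\<^sub>R f x) x)))
     = h x *\<^sub>R (\<Sum>j\<in>UNIV. imul (sig (ax j) (pd (ax j) f x))) + imul (sig (grad h x) (f x))"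
    unfolding sig_sum_ax [of "grad h x" "f x", symmetric] pd_scaleR [OF assms]
    by (simp add: sigB.add_right sigB.scaleR_right imul_add imul_scaleR imul_sum sum.distrib scaleR_sum_right grad_def)
  then show ?thesis by (simp add: dirac_def sigB.scaleR_right scaleR_diff_right)
qed

lemma sq_int_local:
  fixes \<psi> :: "'a::euclidean_space \<Rightarrow> 'b::euclidean_space" and h :: "'c::euclidean_space \<Rightarrow> 'b \<Rightarrow> 'd::euclidean_space"
    and A :: "'a \<Rightarrow> 'c"
  assumes \<psi>: "sq_int \<psi>" and h: "bounded_bilinear h" and A: "continuous_on UNIV A" "supp_in A r"
  shows "sq_int (\<lambda>x. h (A x) (\<psi> x))" "supp_in (\<lambda>x. h (A x) (\<psi> x)) r"
proof -
  interpret h: bounded_bilinear h by fact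
  show "supp_in (\<lambda>x. h (A x) (\<psi> x)) r" using A(2) by (simp add: supp_in_def h.zero_left)
  obtain K where K: "K > 0" "\<And>a b. norm (h a b) \<le> norm a * norm b * K" using h.pos_bounded by blast
  obtain B where B: "B \<ge> 0" "\<And>x. norm (A x) \<le> B" using supp_in_bounded [OF A] by blast
  have Am: "A \<in> borel_measurable borel" using A(1) by (rule borel_measurable_continuous_onI)
  have "continuous_on UNIV (\<lambda>p. h (fst p) (snd p))"
    by (intro h.continuous_on continuous_intros)
  then have hb: "(\<lambda>p. h (fst p) (snd p)) \<in> borel_measurable (borel \<Otimes>\<^sub>M borel)"
    unfolding borel_prod by (rule borel_measurable_continuous_onI)
  have "(\<lambda>x. (A x, \<psi> x)) \<in> lborel \<rightarrow>\<^sub>M borel \<Otimes>\<^sub>M borel"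
    using Am \<psi> by (intro measurable_Pair) (auto simp: sq_int_def)
  from measurable_compose [OF this hb] have m: "(\<lambda>x. h (A x) (\<psi> x)) \<in> borel_measurable lborel" by simp
  have "norm (h (A x) (\<psi> x)) \<le> B * K * norm (\<psi> x)" for x
  proof -
    have "norm (A x) * norm (\<psi> x) * K \<le> B * norm (\<psi> x) * K"
      using B(2) [of x] K(1) by (intro mult_right_mono) auto
    then show ?thesis using K(2) [of "A x" "\<psi> x"] by (simp add: mult_ac)
  qed
  then show "sq_int (\<lambda>x. h (A x) (\<psi> x))" by (rule sq_int_bound [OF \<psi> m])
qed

lemma supp_in_grad: "supp_in h r \<Longrightarrow> supp_in (grad h) r"
  using supp_in_pd [of h r] by (simp add: supp_in_def grad_def vec_eq_iff)

lemma weak_dirac_localize: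
  assumes W: "weak_dirac A \<psi> \<eta>" and A: "continuous_on UNIV A" and h: "C_upto (Suc 0) h" "supp_in h r"
  shows "weak_dirac A (\<lambda>x. h x *\<^sub>R \<psi> x) (\<lambda>x. h x *\<^sub>R \<eta> x - imul (sig (grad h x) (\<psi> x)))"
  unfolding weak_dirac_def
proof (intro conjI allI impI)
  have sq: "sq_int \<psi>" "sq_int \<eta>" using W by (auto simp: weak_dirac_def)
  have hc: "continuous_on UNIV h" using h(1) by (rule C_upto_imp_continuous_on)
  note sg = sq_int_local [OF sq(1) bounded_bilinear_sig grad_continuous [OF h(1)] supp_in_grad [OF h(2)]]
  note sh = sq_int_local [OF sq(1) bounded_bilinear_scaleR hc h(2)] sq_int_local [OF sq(2) bounded_bilinear_scaleR hc h(2)]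
  show "sq_int (\<lambda>x. h x *\<^sub>R \<psi> x)" by (rule sh)
  show "sq_int (\<lambda>x. h x *\<^sub>R \<eta> x - imul (sig (grad h x) (\<psi> x)))"
    by (rule sq_int_diff [OF sh(3) sq_int_linear [OF bounded_linear_imul sg(1)]])
  fix \<phi> :: spinor and s assume \<phi>: "C_upto (Suc 0) \<phi>" "supp_in \<phi> s"
  have d: "h differentiable at x" "\<phi> differentiable at x" for x using h \<phi> by (auto simp: C_upto_Suc_iff)
  have "C_upto (Suc 0) (\<lambda>x. h x *\<^sub>R \<phi> x)" "supp_in (\<lambda>x. h x *\<^sub>R \<phi> x) s"
    by (rule C_upto_scaleR [OF h(1) \<phi>(1)]) (use \<phi>(2) in \<open>simp add: supp_in_def\<close>)
  then have "(LINT x|lborel. dirac A (\<lambda>x. h x *\<^sub>R \<phi> x) x \<bullet> \<psi> x) = (LINT x|lborel. (h x *\<^sub>R \<phi> x) \<bullet> \<eta> x)"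
    by (rule weak_diracD [OF W])
  then have eq: "(LINT x|lborel. dirac A \<phi> x \<bullet> (h x *\<^sub>R \<psi> x) + \<phi> x \<bullet> imul (sig (grad h x) (\<psi> x)))
      = (LINT x|lborel. \<phi> x \<bullet> (h x *\<^sub>R \<eta> x))"
    unfolding dirac_scaleR [OF d] by (simp add: inner_diff_left imul_inner sig_inner)
  have i: "integrable lborel (\<lambda>x. dirac A \<phi> x \<bullet> (h x *\<^sub>R \<psi> x))"
    "integrable lborel (\<lambda>x. \<phi> x \<bullet> imul (sig (grad h x) (\<psi> x)))"
    "integrable lborel (\<lambda>x. \<phi> x \<bullet> (h x *\<^sub>R \<eta> x))"
    by (intro sq_int_inner_integrable sh sq_int_dirac [OF \<phi> A] sq_int_test(1) [OF \<phi>]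
        sq_int_linear [OF bounded_linear_imul sg(1)])+
  show "(LINT x|lborel. dirac A \<phi> x \<bullet> (h x *\<^sub>R \<psi> x)) = (LINT x|lborel. \<phi> x \<bullet> (h x *\<^sub>R \<eta> x - imul (sig (grad h x) (\<psi> x))))"
    unfolding inner_diff_right using eq i by simp
qed

lemma conv_linear:
  fixes f :: "'a::euclidean_space \<Rightarrow> 'b::euclidean_space" and h :: "'b \<Rightarrow> 'c::euclidean_space"
  assumes "bounded_linear h" "continuous_on UNIV \<rho>" "supp_in \<rho> r" "integrable lborel f"
  shows "conv \<rho> (\<lambda>x. h (f x)) x = h (conv \<rho> f x)"
proof -
  interpret bounded_linear h by fact
  show ?thesis
    unfolding conv_def using integral_bounded_linear [OF assms(1) conv_integrable [OF assms(2-4)]]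
    by (simp add: scaleR)
qed

lemma dirac_conv:
  assumes W: "weak_dirac A f g" and A: "continuous_on UNIV A" and fs: "supp_in f r" and gs: "supp_in g r"
  shows "dirac A (conv (mseq n) f) x = conv (mseq n) g x + conv (mseq n) (\<lambda>x. sig (A x) (f x)) x - sig (A x) (conv (mseq n) f x)"
proof -
  define \<rho> :: "real^3 \<Rightarrow> real" where "\<rho> = mseq n"
  have \<rho>: "C_upto k \<rho>" "continuous_on UNIV \<rho>" "supp_in \<rho> 1" for k
    unfolding \<rho>_def by (rule mseq)+
  have rd: "\<rho> differentiable at z" for z using \<rho>(1) [of "Suc 0"] by (simp add: C_upto_Suc_iff)
  have pc: "continuous_on UNIV (pd v \<rho>)" for v by (rule C_upto_imp_continuous_on [OF C_upto_pd [OF \<rho>(1)]])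
  note ps = supp_in_pd [OF \<rho>(3)]
  have sq: "sq_int f" "sq_int g" using W by (auto simp: weak_dirac_def)
  have fi: "integrable lborel f" by (rule sq_int_supp_in_integrable [OF sq(1) fs])
  have gi: "integrable lborel g" by (rule sq_int_supp_in_integrable [OF sq(2) gs])
  define af where "af y = sig (A y) (f y)" for y
  have afi: "integrable lborel af"
  proof -
    have tc: "continuous_on UNIV (\<lambda>y. tent r y *\<^sub>R A y)" by (intro continuous_intros tent_continuous A)
    have ts: "supp_in (\<lambda>y. tent r y *\<^sub>R A y) (r + 1)" by (auto simp: supp_in_def tent_bounds)
    have "af = (\<lambda>y. sig (tent r y *\<^sub>R A y) (f y))"
    proof
      fix y show "af y = sig (tent r y *\<^sub>R A y) (f y)"
        using fs by (cases "norm y \<le> r") (auto simp: af_def tent_bounds supp_in_def)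
    qed
    then show ?thesis
      using sq_int_supp_in_integrable [OF sq_int_local [OF sq(1) bounded_bilinear_sig tc ts]] by simp
  qed
  have "s \<bullet> conv \<rho> g x = s \<bullet> (- (\<Sum>j\<in>UNIV. imul (sig (ax j) (conv (pd (ax j) \<rho>) f x))) - conv \<rho> af x)" for s
  proof -
    define \<phi> where "\<phi> y = \<rho> (x - y) *\<^sub>R s" for y
    have \<phi>: "C_upto (Suc 0) \<phi>" unfolding \<phi>_def by (rule C_upto_scaleR [OF C_upto_reflect [OF \<rho>(1)] C_upto_const])
    have \<phi>s: "supp_in \<phi> (1 + norm x)"
      unfolding supp_in_def
    proof (intro allI impI)
      fix y :: "real^3" assume "1 + norm x < norm y"
      then have "1 < norm (x - y)" using norm_triangle_ineq2 [of y x] by (simp add: norm_minus_commute)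
      then show "\<phi> y = 0" using \<rho>(3) by (simp add: \<phi>_def supp_in_def)
    qed
    have pd\<phi>: "pd v \<phi> y = - (pd v \<rho> (x - y) *\<^sub>R s)" for v y
    proof -
      have "(\<phi> has_derivative (\<lambda>v. (- pd v \<rho> (x - y)) *\<^sub>R s)) (at y)"
        unfolding \<phi>_def by (rule has_derivative_scaleR_left [OF pd_reflect [OF rd]])
      from pd_eq [OF this] show ?thesis by simp
    qed
    have D: "dirac A \<phi> y \<bullet> f y = (- (\<Sum>j\<in>UNIV. s \<bullet> imul (sig (ax j) (pd (ax j) \<rho> (x - y) *\<^sub>R f y)))) - s \<bullet> (\<rho> (x - y) *\<^sub>R af y)" for y
      unfolding dirac_def pd\<phi> af_def \<phi>_def
      by (simp add: inner_diff_left inner_sum_left imul_inner sig_inner sigB.minus_right imul_minus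
         sigB.scaleR_right imul_scaleR sum_negf)
    have pi: "integrable lborel (\<lambda>y. pd v \<rho> (x - y) *\<^sub>R f y)" for v by (rule conv_integrable [OF pc ps fi])
    have bl: "bounded_linear (\<lambda>z. s \<bullet> imul (sig (ax j) z))" for j
      by (intro bounded_linear_inner_right_comp bounded_linear_compose [OF bounded_linear_imul sigB.bounded_linear_right])
    have i1: "integrable lborel (\<lambda>y. s \<bullet> imul (sig (ax j) (pd (ax j) \<rho> (x - y) *\<^sub>R f y)))" for j
      by (rule integrable_bounded_linear [OF bl pi])
    have e1: "(LINT y|lborel. s \<bullet> imul (sig (ax j) (pd (ax j) \<rho> (x - y) *\<^sub>R f y))) = s \<bullet> imul (sig (ax j) (conv (pd (ax j) \<rho>) f x))" for j
      unfolding conv_def by (rule integral_bounded_linear [OF bl pi])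
    have i2: "integrable lborel (\<lambda>y. s \<bullet> (\<rho> (x - y) *\<^sub>R af y))"
      by (intro integrable_inner_right conv_integrable [OF \<rho>(2,3) afi])
    have e2: "(LINT y|lborel. s \<bullet> (\<rho> (x - y) *\<^sub>R af y)) = s \<bullet> conv \<rho> af x"
      unfolding conv_def by (intro integral_inner_right conv_integrable [OF \<rho>(2,3) afi])
    have "(LINT y|lborel. dirac A \<phi> y \<bullet> f y) = (LINT y|lborel. \<phi> y \<bullet> g y)"
      by (rule weak_diracD [OF W \<phi> \<phi>s])
    also have "\<dots> = (LINT y|lborel. s \<bullet> (\<rho> (x - y) *\<^sub>R g y))" by (simp add: \<phi>_def)
    also have "\<dots> = s \<bullet> conv \<rho> g x"
      unfolding conv_def by (intro integral_inner_right conv_integrable [OF \<rho>(2,3) gi])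
    finally have "s \<bullet> conv \<rho> g x = (LINT y|lborel. dirac A \<phi> y \<bullet> f y)" by simp
    also have "\<dots> = - (\<Sum>j\<in>UNIV. s \<bullet> imul (sig (ax j) (conv (pd (ax j) \<rho>) f x))) - s \<bullet> conv \<rho> af x"
      unfolding D using i1 i2 e1 e2 by (simp del: inner_scaleR_right)
    finally show ?thesis by (simp add: inner_diff_right inner_sum_right)
  qed
  then have "conv \<rho> g x = - (\<Sum>j\<in>UNIV. imul (sig (ax j) (conv (pd (ax j) \<rho>) f x))) - conv \<rho> af x"
    by (rule vector_eq_ldot [THEN iffD1, OF allI])
  moreover have "pd v (conv \<rho> f) x = conv (pd v \<rho>) f x" for v
    by (rule pd_eq [OF conv_has_derivative [OF \<rho>(1,3) fi]])
  ultimately have "dirac A (conv \<rho> f) x = conv \<rho> g x + conv \<rho> af x - sig (A x) (conv \<rho> f x)"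
    by (simp add: dirac_def)
  then show ?thesis by (simp add: \<rho>_def af_def [abs_def])
qed

lemma sq_int_sig_local:
  assumes "sq_int f" "supp_in f r" "continuous_on UNIV A"
  shows "sq_int (\<lambda>x. sig (A x) (f x))"
proof -
  have "l2_lim (\<lambda>n x. sig (A x) (f x)) (\<lambda>x. sig (A x) (f x))"
    by (rule l2_lim_local_linear [OF l2_lim_const assms(2,2,3) bounded_bilinear_sig]) (rule assms)
  then show ?thesis by (simp add: l2_lim_def)
qed

lemma l2_lim_dirac_mollify:
  assumes W: "weak_dirac A f g" and A: "continuous_on UNIV A" and fs: "supp_in f r" and gs: "supp_in g r"
  shows "l2_lim (\<lambda>n. conv (mseq n) f) f" "l2_lim (\<lambda>n. dirac A (conv (mseq n) f)) g"
proof -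
  have sq: "sq_int f" "sq_int g" using W by (auto simp: weak_dirac_def)
  show 1: "l2_lim (\<lambda>n. conv (mseq n) f) f" by (rule l2_lim_mollify [OF sq(1) fs])
  have as: "supp_in (\<lambda>x. sig (A x) (f x)) r" using fs by (simp add: supp_in_def)
  have "l2_lim (\<lambda>n x. conv (mseq n) g x + conv (mseq n) (\<lambda>x. sig (A x) (f x)) x - sig (A x) (conv (mseq n) f x))
     (\<lambda>x. g x + sig (A x) (f x) - sig (A x) (f x))"
  proof (intro l2_lim_diff l2_lim_add)
    show "l2_lim (\<lambda>n. conv (mseq n) g) g" by (rule l2_lim_mollify [OF sq(2) gs])
    show "l2_lim (\<lambda>n. conv (mseq n) (\<lambda>x. sig (A x) (f x))) (\<lambda>x. sig (A x) (f x))"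
      by (rule l2_lim_mollify [OF sq_int_sig_local [OF sq(1) fs A] as])
    show "l2_lim (\<lambda>n x. sig (A x) (conv (mseq n) f x)) (\<lambda>x. sig (A x) (f x))"
    proof (rule l2_lim_local_linear [OF 1 _ _ A bounded_bilinear_sig])
      show "supp_in (conv (mseq n) f) (1 + r)" for n by (rule conv_supp_in [OF mseq(4) fs])
      show "supp_in f (1 + r)" by (rule supp_in_mono [OF fs]) simp
    qed
  qed
  moreover have "dirac A (conv (mseq n) f) = (\<lambda>x. conv (mseq n) g x + conv (mseq n) (\<lambda>x. sig (A x) (f x)) x - sig (A x) (conv (mseq n) f x))" for n
    using dirac_conv [OF W A fs gs] by blast
  ultimately show "l2_lim (\<lambda>n. dirac A (conv (mseq n) f)) g" by simp
qed

subsection \<open>step\<close>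

definition sqpos :: "real \<Rightarrow> real" where "sqpos t = (max 0 t)\<^sup>2"

lemma sqpos_deriv: "(sqpos has_real_derivative 2 * max 0 t) (at t)"
proof -
  consider "t > 0" | "t = 0" | "t < 0" by linarith
  then show ?thesis
  proof cases
    case 1
    have "((\<lambda>t. t\<^sup>2) has_real_derivative 2 * max 0 t) (at t)"
      using 1 by (auto intro!: derivative_eq_intros)
    then show ?thesis
      by (rule has_field_derivative_transform_within_open [of _ _ _ "{0<..}"]) (use 1 in \<open>auto simp: sqpos_def\<close>)
  next
    case 2
    have "((\<lambda>h. (sqpos h - sqpos 0) / (h - 0)) \<longlongrightarrow> 0) (at 0)"
    proof (rule Lim_null_comparison [where g = "\<lambda>h. \<bar>h\<bar>"])
      show "eventually (\<lambda>h. norm ((sqpos h - sqpos 0) / (h - 0)) \<le> \<bar>h\<bar>) (at 0)"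
        by (auto simp: sqpos_def max_def power2_eq_square eventually_at intro!: exI [of _ 1])
    qed (auto intro!: tendsto_eq_intros)
    then show ?thesis using 2 by (simp add: has_field_derivative_iff)
  next
    case 3
    have "((\<lambda>t. 0) has_real_derivative 2 * max 0 t) (at t)" using 3 by simp
    then show ?thesis
      by (rule has_field_derivative_transform_within_open [of _ _ _ "{..<0}"]) (use 3 in \<open>auto simp: sqpos_def\<close>)
  qed
qed

definition step :: "real \<Rightarrow> real" where "step t = 1 - sqpos (1 - sqpos (t - 1))"
definition step' :: "real \<Rightarrow> real" where "step' t = 4 * max 0 (1 - sqpos (t - 1)) * max 0 (t - 1)"

lemma step_deriv: "(step has_real_derivative step' t) (at t)"
proof -
  have i: "((\<lambda>t. 1 - sqpos (t - 1)) has_real_derivative - (2 * max 0 (t - 1))) (at t)" for t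
    using DERIV_shift [of sqpos "2 * max 0 (t - 1)" t "-1"] sqpos_deriv [of "t - 1"]
    by (auto intro!: derivative_eq_intros)
  show ?thesis
    unfolding step_def step'_def
    by (rule DERIV_cong [OF DERIV_diff [OF DERIV_const DERIV_chain2 [OF sqpos_deriv i]]]) simp
qed

lemma step_vals: "t \<le> 1 \<Longrightarrow> step t = 0" "t \<ge> 2 \<Longrightarrow> step t = 1" "0 \<le> step t" "step t \<le> 1"
  "0 \<le> step' t" "step' t \<le> 4" "t \<le> 1 \<Longrightarrow> step' t = 0" "t \<ge> 2 \<Longrightarrow> step' t = 0"
proof -
  show a: "t \<le> 1 \<Longrightarrow> step t = 0" by (simp add: step_def sqpos_def)
  have s1: "sqpos (t - 1) \<ge> 1" if "t \<ge> 2" using that by (simp add: sqpos_def one_le_power)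
  then show "t \<ge> 2 \<Longrightarrow> step t = 1" by (simp add: step_def sqpos_def [of "1 - sqpos (t - 1)"])
  have "0 \<le> sqpos (t - 1)" by (simp add: sqpos_def)
  then have "max 0 (1 - sqpos (t - 1)) \<le> 1" by simp
  then have "sqpos (1 - sqpos (t - 1)) \<le> 1" unfolding sqpos_def [of "1 - sqpos (t - 1)"] by (simp add: power_le_one)
  then show "0 \<le> step t" "step t \<le> 1" by (auto simp: step_def sqpos_def)
  show "0 \<le> step' t" by (simp add: step'_def)
  show "t \<le> 1 \<Longrightarrow> step' t = 0" by (simp add: step'_def)
  show b: "t \<ge> 2 \<Longrightarrow> step' t = 0" using s1 by (simp add: step'_def)
  show "step' t \<le> 4"
  proof (cases "t \<ge> 2")
    case False
    have "max 0 (1 - sqpos (t - 1)) * max 0 (t - 1) \<le> 1 * 1"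
      using \<open>max 0 (1 - sqpos (t - 1)) \<le> 1\<close> False by (intro mult_mono) auto
    then show ?thesis by (simp add: step'_def)
  qed (simp add: b)
qed

lemma step'_continuous: "continuous_on UNIV step'"
proof -
  have "continuous_on UNIV sqpos"
    unfolding sqpos_def [abs_def] by (intro continuous_intros)
  then have "continuous_on UNIV (\<lambda>t. sqpos (t - 1))"
    by (rule continuous_on_compose2) (auto intro!: continuous_intros)
  then show ?thesis unfolding step'_def [abs_def] by (intro continuous_intros)
qed

lemma C1_step_compose:
  assumes u: "C_upto (Suc 0) u"
  shows "C_upto (Suc 0) (\<lambda>x. step (u x))" "pd v (\<lambda>x. step (u x)) x = step' (u x) * pd v u x"
proof -
  have d: "((\<lambda>x. step (u x)) has_derivative (\<lambda>v. step' (u x) * pd v u x)) (at x)" for x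
    using diff_chain_at [OF C_upto_has_derivative [OF u] step_deriv [unfolded has_field_derivative_def]]
    by (simp add: o_def)
  show "pd v (\<lambda>x. step (u x)) x = step' (u x) * pd v u x" by (rule pd_eq [OF d])
  show "C_upto (Suc 0) (\<lambda>x. step (u x))"
  proof (rule C_upto_SucI [OF d])
    show "C_upto 0 (\<lambda>x. step' (u x) * pd v u x)" for v
      using C_upto_pd [OF u] C_upto_imp_continuous_on [OF u]
      by (auto intro!: continuous_intros continuous_on_compose2 [OF step'_continuous])
  qed
qed

definition cutoff :: "real \<Rightarrow> real^3 \<Rightarrow> real" where
  "cutoff R x = step (3 - (x \<bullet> x) / R\<^sup>2)"

lemma cutoff:
  assumes R: "R > 0"
  shows "C_upto (Suc 0) (cutoff R)" "norm x \<le> R \<Longrightarrow> cutoff R x = 1" "supp_in (cutoff R) (2 * R)"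
    "0 \<le> cutoff R x" "cutoff R x \<le> 1" "norm (grad (cutoff R) x) \<le> 16 / R"
    "norm x < R \<Longrightarrow> grad (cutoff R) x = 0"
proof -
  define u where "u x = 3 - (x \<bullet> x) * (1 / R\<^sup>2)" for x :: "real^3"
  have u: "C_upto k u" for k
    unfolding u_def by (intro C_upto_diff C_upto_mult C_upto_inner C_upto_const C_upto_id)
  have cu: "cutoff R = (\<lambda>x. step (u x))" by (auto simp: cutoff_def u_def)
  show "C_upto (Suc 0) (cutoff R)" unfolding cu by (rule C1_step_compose [OF u])
  have R2: "R\<^sup>2 > 0" using R by simp
  have nx: "x \<bullet> x = (norm x)\<^sup>2" for x :: "real^3" by (simp add: power2_norm_eq_inner)
  show 1: "cutoff R x = 1" if "norm x \<le> R" for x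
    unfolding cu by (rule step_vals) (use power_mono [OF that, of 2] R2 in \<open>simp add: u_def nx divide_le_eq\<close>)
  show s: "supp_in (cutoff R) (2 * R)"
    unfolding supp_in_def
  proof (intro allI impI)
    fix x :: "real^3" assume "2 * R < norm x"
    then have "(2 * R)\<^sup>2 \<le> (norm x)\<^sup>2" using R by (intro power_mono) auto
    then have "4 \<le> (norm x)\<^sup>2 / R\<^sup>2" using R2 by (simp add: le_divide_eq power_mult_distrib)
    then show "cutoff R x = 0" unfolding cu by (intro step_vals) (simp add: u_def nx)
  qed
  show "0 \<le> cutoff R x" "cutoff R x \<le> 1" by (simp_all add: cutoff_def step_vals)
  have pu: "pd v u x = - 2 * (x \<bullet> v) / R\<^sup>2" for v x
  proof -
    have "((\<lambda>x. 3 - (x \<bullet> x) * k) has_derivative (\<lambda>v. - (2 * (x \<bullet> v) * k))) (at x)" for k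
      by (auto simp: inner_commute intro!: derivative_eq_intros)
    from pd_eq [OF this [of "1 / R\<^sup>2"]] show ?thesis by (simp add: u_def [abs_def])
  qed
  have g: "grad (cutoff R) x = (- 2 * step' (u x) / R\<^sup>2) *\<^sub>R x" for x
    unfolding grad_def cu C1_step_compose(2) [OF u] pu by (simp add: vec_eq_iff inner_axis)
  show "grad (cutoff R) x = 0" if "norm x < R"
  proof -
    have "u x \<ge> 2" using power_mono [of "norm x" R 2] that R2 by (simp add: u_def nx divide_le_eq)
    then show ?thesis by (simp add: g step_vals)
  qed
  show "norm (grad (cutoff R) x) \<le> 16 / R"
  proof (cases "norm x \<le> 2 * R")
    case True
    have "norm (grad (cutoff R) x) = 2 * step' (u x) / R\<^sup>2 * norm x"
      by (simp add: g step_vals abs_mult)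
    also have "\<dots> \<le> 2 * 4 / R\<^sup>2 * (2 * R)"
      using True R by (intro mult_mono divide_right_mono) (auto simp: step_vals)
    also have "\<dots> = 16 / R" using R by (simp add: power2_eq_square)
    finally show ?thesis .
  next
    case False
    then have "grad (cutoff R) x = 0" using supp_in_grad [OF s] by (simp add: supp_in_def)
    then show ?thesis using R by simp
  qed
qed



lemma dirac_symmetric:
  assumes f: "C_upto (Suc 0) f" "supp_in f r" and g: "C_upto (Suc 0) g" "supp_in g s" and A: "continuous_on UNIV A"
  shows "(LINT x|lborel. dirac A f x \<bullet> g x) = (LINT x|lborel. f x \<bullet> dirac A g x)"
proof -
  have d: "f differentiable at x" "g differentiable at x" for x using f g by (auto simp: C_upto_Suc_iff)
  define u where "u j x = imul (sig (ax j) (f x)) \<bullet> g x" for j x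
  have bl: "bounded_linear (\<lambda>z. imul (sig (ax j) z))" for j
    by (rule bounded_linear_compose [OF bounded_linear_imul sigB.bounded_linear_right])
  have u: "C_upto (Suc 0) (u j)" for j
    unfolding u_def by (rule C_upto_inner [OF C_upto_linear [OF bl f(1)] g(1)])
  have us: "supp_in (u j) r" for j using f(2) by (simp add: u_def supp_in_def)
  have pu: "pd (ax j) (u j) x = imul (sig (ax j) (f x)) \<bullet> pd (ax j) g x + imul (sig (ax j) (pd (ax j) f x)) \<bullet> g x" for j x
    unfolding u_def
    by (rule pd_eq [OF has_derivative_inner [OF bounded_linear.has_derivative [OF bl has_derivative_pd [OF d(1)]] has_derivative_pd [OF d(2)]]])
  have "f x \<bullet> dirac A g x - dirac A f x \<bullet> g x = (\<Sum>j\<in>UNIV. pd (ax j) (u j) x)" for x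
    unfolding pu dirac_def
    by (simp add: inner_diff_left inner_diff_right inner_sum_left inner_sum_right sig_inner imul_inner sum.distrib sum_negf sum_subtractf)
  moreover have "(LINT x|lborel. (\<Sum>j\<in>UNIV. pd (ax j) (u j) x)) = 0"
    by (subst Bochner_Integration.integral_sum)
      (auto simp: integral_pd_eq_0 [OF u us] intro!: supp_in_integrable [OF _ supp_in_pd [OF us]]
        C_upto_imp_continuous_on [OF C_upto_pd [OF u]])
  moreover have "integrable lborel (\<lambda>x. f x \<bullet> dirac A g x)" "integrable lborel (\<lambda>x. dirac A f x \<bullet> g x)"
    by (intro sq_int_inner_integrable sq_int_test(1) [OF f] sq_int_test(1) [OF g] sq_int_dirac [OF f A] sq_int_dirac [OF g A])+
  ultimately have "(LINT x|lborel. f x \<bullet> dirac A g x) - (LINT x|lborel. dirac A f x \<bullet> g x) = 0"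
    by (subst Bochner_Integration.integral_diff [symmetric]) simp_all
  then show ?thesis by simp
qed

lemma weak_dirac_test:
  assumes f: "C_upto (Suc 0) f" "supp_in f r" and A: "continuous_on UNIV A"
  shows "weak_dirac A f (dirac A f)"
  unfolding weak_dirac_def
  using dirac_symmetric [OF _ _ f A] sq_int_test(1) [OF f] sq_int_dirac [OF f A] by blast

lemma weak_dirac_imul:
  assumes W: "weak_dirac A \<psi> \<eta>"
  shows "weak_dirac A (\<lambda>x. imul (\<psi> x)) (\<lambda>x. imul (\<eta> x))"
  unfolding weak_dirac_def
proof (intro conjI allI impI)
  show "sq_int (\<lambda>x. imul (\<psi> x))" "sq_int (\<lambda>x. imul (\<eta> x))"
    using weak_dirac_sq_int [OF W] sq_int_linear [OF bounded_linear_imul] by blast+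
  fix \<phi> :: spinor and r assume \<phi>: "C_upto (Suc 0) \<phi>" "supp_in \<phi> r"
  have d: "\<phi> differentiable at x" for x using \<phi> by (auto simp: C_upto_Suc_iff)
  have "(LINT x|lborel. dirac A (\<lambda>x. imul (\<phi> x)) x \<bullet> \<psi> x) = (LINT x|lborel. imul (\<phi> x) \<bullet> \<eta> x)"
    by (rule weak_diracD [OF W C_upto_linear [OF bounded_linear_imul \<phi>(1)], where r = r])
      (use \<phi>(2) in \<open>simp add: supp_in_def\<close>)
  then show "(LINT x|lborel. dirac A \<phi> x \<bullet> imul (\<psi> x)) = (LINT x|lborel. \<phi> x \<bullet> imul (\<eta> x))"
    by (simp add: dirac_imul [OF d] imul_inner)
qed

lemma cut_approximation:
  assumes W: "weak_dirac A \<psi> \<eta>"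
  shows "l2_lim (\<lambda>n x. cutoff (real (Suc n)) x *\<^sub>R \<psi> x) \<psi>"
    "l2_lim (\<lambda>n x. cutoff (real (Suc n)) x *\<^sub>R \<eta> x - imul (sig (grad (cutoff (real (Suc n))) x) (\<psi> x))) \<eta>"
proof -
  have sq: "sq_int \<psi>" "sq_int \<eta>" using weak_dirac_sq_int [OF W] .
  have cc: "continuous_on UNIV (cutoff (real (Suc n)))" for n
    by (rule C_upto_imp_continuous_on [OF cutoff(1)]) simp
  have R: "real (Suc n) > 0" for n by simp
  have c: "l2_lim (\<lambda>n x. cutoff (real (Suc n)) x *\<^sub>R f x) f" if f: "sq_int f" for f :: spinor
    unfolding l2_lim_def
  proof (intro conjI allI f)
    show s: "sq_int (\<lambda>x. cutoff (real (Suc n)) x *\<^sub>R f x)" for n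
      by (rule sq_int_local(1) [OF f bounded_bilinear_scaleR cc cutoff(3) [OF R]])
    show "(\<lambda>n. l2n (\<lambda>x. cutoff (real (Suc n)) x *\<^sub>R f x - f x)) \<longlonglongrightarrow> 0"
    proof (rule l2n_tendsto_dominated [OF _ _ f])
      show "(\<lambda>x. cutoff (real (Suc n)) x *\<^sub>R f x - f x) \<in> borel_measurable lborel" for n
        by (rule sq_int_measurable [OF sq_int_diff [OF s f]])
      show "AE x in lborel. (\<lambda>n. cutoff (real (Suc n)) x *\<^sub>R f x - f x) \<longlonglongrightarrow> 0"
      proof (intro AE_I2)
        fix x
        have "eventually (\<lambda>n. cutoff (real (Suc n)) x *\<^sub>R f x - f x = 0) sequentially"
          using eventually_ge_at_top [of "nat \<lceil>norm x\<rceil>"]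
        proof eventually_elim
          case (elim n)
          then have "norm x \<le> real (Suc n)" by linarith
          then show ?case using cutoff(2) [OF R, of x n] by (simp del: of_nat_Suc)
        qed
        then show "(\<lambda>n. cutoff (real (Suc n)) x *\<^sub>R f x - f x) \<longlonglongrightarrow> 0" by (rule tendsto_eventually)
      qed
      fix n x
      have "cutoff (real (Suc n)) x *\<^sub>R f x - f x = (cutoff (real (Suc n)) x - 1) *\<^sub>R f x"
        by (simp add: algebra_simps)
      moreover have "\<bar>cutoff (real (Suc n)) x - 1\<bar> * norm (f x) \<le> 1 * norm (f x)"
        using cutoff(4,5) [OF R, of n x] by (intro mult_right_mono) auto
      ultimately show "norm (cutoff (real (Suc n)) x *\<^sub>R f x - f x) \<le> norm (f x)" by simp
    qed
  qed
  show "l2_lim (\<lambda>n x. cutoff (real (Suc n)) x *\<^sub>R \<psi> x) \<psi>" by (rule c [OF sq(1)])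
  have "l2_lim (\<lambda>n x. imul (sig (grad (cutoff (real (Suc n))) x) (\<psi> x))) (\<lambda>x. 0)"
  proof (rule l2_limI_bound)
    show s: "sq_int (\<lambda>x. imul (sig (grad (cutoff (real (Suc n))) x) (\<psi> x)))" for n
      by (intro sq_int_linear [OF bounded_linear_imul] sq_int_local(1) [OF sq(1) bounded_bilinear_sig grad_continuous [OF cutoff(1)] supp_in_grad [OF cutoff(3)]])
        simp_all
    show "sq_int (\<lambda>x. 0 :: complex^2)" by (rule sq_int_supp_in [where r = 0]) (auto simp: supp_in_def)
    show "(\<lambda>n. 16 / real (Suc n) * l2n \<psi>) \<longlonglongrightarrow> 0"
      by (intro tendsto_mult_left_zero) (use LIMSEQ_Suc [OF lim_const_over_n [of "16::real"]] in simp)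
    show "l2n (\<lambda>x. imul (sig (grad (cutoff (real (Suc n))) x) (\<psi> x)) - 0) \<le> 16 / real (Suc n) * l2n \<psi>" for n
    proof (rule l2n_mono [OF sq(1)])
      show "norm (imul (sig (grad (cutoff (real (Suc n))) x) (\<psi> x)) - 0) \<le> 16 / real (Suc n) * norm (\<psi> x)" for x
        using mult_right_mono [OF cutoff(6) [OF R, of n x] norm_ge_zero [of "\<psi> x"]] by (simp add: norm_sig)
    qed (use s in auto)
  qed
  from l2_lim_diff [OF c [OF sq(2)] this]
  show "l2_lim (\<lambda>n x. cutoff (real (Suc n)) x *\<^sub>R \<eta> x - imul (sig (grad (cutoff (real (Suc n))) x) (\<psi> x))) \<eta>"
    by simp
qed

lemma test_spinors_form_core:
  assumes W: "weak_dirac A \<psi> \<eta>" and A: "continuous_on UNIV A"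
  obtains \<Phi> where "\<And>n. test_spinor (\<Phi> n)" "l2_lim \<Phi> \<psi>" "l2_lim (\<lambda>n. dirac A (\<Phi> n)) \<eta>"
proof -
  have sq: "sq_int \<psi>" "sq_int \<eta>" using weak_dirac_sq_int [OF W] .
  have "\<exists>\<phi>. test_spinor \<phi> \<and> l2n (\<lambda>x. \<phi> x - \<psi> x) \<le> e \<and> l2n (\<lambda>x. dirac A \<phi> x - \<eta> x) \<le> e" if e: "e > 0" for e
  proof -
    note ca = cut_approximation [OF W, unfolded l2_lim_def]
    have "eventually (\<lambda>n. l2n (\<lambda>x. cutoff (real (Suc n)) x *\<^sub>R \<psi> x - \<psi> x) < e / 2 \<and>
        l2n (\<lambda>x. cutoff (real (Suc n)) x *\<^sub>R \<eta> x - imul (sig (grad (cutoff (real (Suc n))) x) (\<psi> x)) - \<eta> x) < e / 2) sequentially"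
      using ca e by (intro eventually_conj order_tendstoD(2)) auto
    then obtain n where n: "l2n (\<lambda>x. cutoff (real (Suc n)) x *\<^sub>R \<psi> x - \<psi> x) < e / 2"
       "l2n (\<lambda>x. cutoff (real (Suc n)) x *\<^sub>R \<eta> x - imul (sig (grad (cutoff (real (Suc n))) x) (\<psi> x)) - \<eta> x) < e / 2"
      by (auto simp: eventually_sequentially)
    define R where "R = real (Suc n)"
    have R: "R > 0" by (simp add: R_def)
    define f where "f x = cutoff R x *\<^sub>R \<psi> x" for x
    define g where "g x = cutoff R x *\<^sub>R \<eta> x - imul (sig (grad (cutoff R) x) (\<psi> x))" for x
    have fs: "supp_in f (2 * R)" and gs: "supp_in g (2 * R)"
      using cutoff(3) [OF R] supp_in_grad [OF cutoff(3) [OF R]] by (auto simp: f_def g_def supp_in_def)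
    have "weak_dirac A f g"
      unfolding f_def g_def by (rule weak_dirac_localize [OF W A cutoff(1,3) [OF R]])
    note lim = l2_lim_dirac_mollify [OF this A fs gs]
    have sf: "sq_int f" "sq_int g" using lim by (auto simp: l2_lim_def)
    have "eventually (\<lambda>m. l2n (\<lambda>x. conv (mseq m) f x - f x) < e / 2 \<and>
        l2n (\<lambda>x. dirac A (conv (mseq m) f) x - g x) < e / 2) sequentially"
      using lim e unfolding l2_lim_def by (intro eventually_conj order_tendstoD(2)) auto
    then obtain m where m: "l2n (\<lambda>x. conv (mseq m) f x - f x) < e / 2"
      "l2n (\<lambda>x. dirac A (conv (mseq m) f) x - g x) < e / 2"
      by (auto simp: eventually_sequentially)
    have s: "sq_int (conv (mseq m) f)" "sq_int (dirac A (conv (mseq m) f))"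
      using lim by (auto simp: l2_lim_def)
    have "l2n (\<lambda>x. f x - \<psi> x) < e / 2" "l2n (\<lambda>x. g x - \<eta> x) < e / 2"
      using n by (simp_all add: f_def g_def R_def)
    then have "l2n (\<lambda>x. conv (mseq m) f x - \<psi> x) \<le> e" "l2n (\<lambda>x. dirac A (conv (mseq m) f) x - \<eta> x) \<le> e"
      using l2n_triangle_diff [OF s(1) sf(1) sq(1)] l2n_triangle_diff [OF s(2) sf(2) sq(2)] m by linarith+
    then show ?thesis using test_spinor_conv [OF sf(1) fs] by blast
  qed
  from this [of "inverse (real (Suc n))" for n]
  have "\<exists>\<phi>. test_spinor \<phi> \<and> l2n (\<lambda>x. \<phi> x - \<psi> x) \<le> inverse (real (Suc n)) \<and> l2n (\<lambda>x. dirac A \<phi> x - \<eta> x) \<le> inverse (real (Suc n))" for n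
    by simp
  from choice [OF allI [OF this]] obtain \<Phi> where c: "\<forall>n. test_spinor (\<Phi> n) \<and>
      l2n (\<lambda>x. \<Phi> n x - \<psi> x) \<le> inverse (real (Suc n)) \<and> l2n (\<lambda>x. dirac A (\<Phi> n) x - \<eta> x) \<le> inverse (real (Suc n))" ..
  have \<Phi>: "test_spinor (\<Phi> n)" "l2n (\<lambda>x. \<Phi> n x - \<psi> x) \<le> inverse (real (Suc n))"
    "l2n (\<lambda>x. dirac A (\<Phi> n) x - \<eta> x) \<le> inverse (real (Suc n))" for n
    using c by simp_all
  have s: "sq_int (\<Phi> n)" "sq_int (dirac A (\<Phi> n))" for n
  proof -
    obtain r where r: "supp_in (\<Phi> n) r" and c: "\<And>k. C_upto k (\<Phi> n)"
      by (rule test_spinorE [OF \<Phi>(1)]) blast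
    show "sq_int (\<Phi> n)" "sq_int (dirac A (\<Phi> n))"
      using sq_int_test(1) [OF c r] sq_int_dirac [OF c r A] by auto
  qed
  show ?thesis
    by (rule that [OF \<Phi>(1) l2_limI_bound [OF s(1) sq(1) \<Phi>(2) LIMSEQ_inverse_real_of_nat]
        l2_limI_bound [OF s(2) sq(2) \<Phi>(3) LIMSEQ_inverse_real_of_nat]])
qed

lemma weak_dirac_symmetric:
  assumes W: "weak_dirac A \<psi> \<eta>" and V: "weak_dirac A \<phi> \<xi>" and A: "continuous_on UNIV A"
  shows "L2_inner \<xi> \<psi> = L2_inner \<phi> \<eta>"
proof -
  have key: "(LINT x|lborel. \<xi>' x \<bullet> \<psi> x) = (LINT x|lborel. \<phi>' x \<bullet> \<eta> x)" if V: "weak_dirac A \<phi>' \<xi>'" for \<phi>' \<xi>'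
  proof -
    obtain \<Phi> where \<Phi>: "\<And>n. test_spinor (\<Phi> n)" "l2_lim \<Phi> \<phi>'" "l2_lim (\<lambda>n. dirac A (\<Phi> n)) \<xi>'"
      using test_spinors_form_core [OF V A] by metis
    have "(LINT x|lborel. dirac A (\<Phi> n) x \<bullet> \<psi> x) = (LINT x|lborel. \<Phi> n x \<bullet> \<eta> x)" for n
      by (rule test_spinorE [OF \<Phi>(1) [of n]]) (rule weak_diracD [OF W])
    moreover note l2_lim_inner [OF \<Phi>(2) l2_lim_const [OF weak_dirac_sq_int(2) [OF W]]]
      l2_lim_inner [OF \<Phi>(3) l2_lim_const [OF weak_dirac_sq_int(1) [OF W]]]
    ultimately show ?thesis using LIMSEQ_unique by simp
  qed
  show ?thesis
    using key [OF V] key [OF weak_dirac_imul [OF V]] weak_dirac_sq_int [OF V] weak_dirac_sq_int [OF W]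
    by (simp add: L2_inner_eq)
qed

lemma adjoint_graph_antimono: "S \<subseteq> T \<Longrightarrow> adjoint_graph T \<subseteq> adjoint_graph S"
  unfolding adjoint_graph_def by blast

lemma weyl_dirac_min_subset_adjoint:
  assumes A: "continuous_on UNIV A"
  shows "weyl_dirac_min A \<subseteq> adjoint_graph (weyl_dirac_min A)"
proof
  fix p assume "p \<in> weyl_dirac_min A"
  then obtain \<phi> where p: "p = (\<phi>, weyl_dirac_expr A \<phi>)" and \<phi>: "test_spinor \<phi>"
    by (auto simp: weyl_dirac_min_def)
  obtain r where r: "supp_in \<phi> r" and c: "\<And>k. C_upto k \<phi>" and d: "\<And>x. \<phi> differentiable at x"
    by (rule test_spinorE [OF \<phi>]) blast
  have "weyl_dirac_expr A \<phi> = dirac A \<phi>" using weyl_dirac_expr_eq [OF d] by blast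
  then show "p \<in> adjoint_graph (weyl_dirac_min A)"
    using weak_dirac_test [OF c r A] by (simp add: p adjoint_graph_min_iff [OF A])
qed

lemma self_adjoint_adjoint_min:
  assumes A: "continuous_on UNIV A"
  shows "self_adjoint (adjoint_graph (weyl_dirac_min A))"
proof -
  let ?M = "weyl_dirac_min A" and ?T = "adjoint_graph (weyl_dirac_min A)"
  have "?T \<subseteq> adjoint_graph ?T"
  proof
    fix p assume "p \<in> ?T"
    then obtain \<psi> \<eta> where p: "p = (\<psi>, \<eta>)" and W: "weak_dirac A \<psi> \<eta>"
      using adjoint_graph_min_iff [OF A] by (cases p) auto
    have "L2_inner \<xi> \<psi> = L2_inner \<phi> \<eta>" if "(\<phi>, \<xi>) \<in> ?T" for \<phi> \<xi>
      using weak_dirac_symmetric [OF W _ A] that adjoint_graph_min_iff [OF A] by blast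
    then show "p \<in> adjoint_graph ?T"
      unfolding p adjoint_graph_def [of ?T] using weak_dirac_sq_int [OF W] by (auto simp: L2_eq_sq_int)
  qed
  moreover have "adjoint_graph ?T \<subseteq> ?T"
    by (rule adjoint_graph_antimono [OF weyl_dirac_min_subset_adjoint [OF A]])
  moreover have "densely_defined ?T"
    unfolding densely_defined_def
  proof (intro ballI allI impI)
    fix \<psi> :: spinor and e :: real assume \<psi>: "\<psi> \<in> L2" and e: "e > 0"
    then have s: "sq_int \<psi>" by (simp add: L2_eq_sq_int)
    obtain g r where g: "continuous_on UNIV g" "supp_in g r" "l2n (\<lambda>x. g x - \<psi> x) < e / 2"
      using compactly_supported_dense [OF s, of "e / 2"] e by auto
    have gs: "sq_int g" by (rule sq_int_supp_in [OF g(1,2)])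
    have lim: "l2_lim (\<lambda>n. conv (mseq n) g) g" by (rule l2_lim_mollify [OF gs g(2)])
    then have "eventually (\<lambda>n. l2n (\<lambda>x. conv (mseq n) g x - g x) < e / 2) sequentially"
      using e unfolding l2_lim_def by (intro order_tendstoD(2)) auto
    then obtain n where n: "l2n (\<lambda>x. conv (mseq n) g x - g x) < e / 2"
      by (auto simp: eventually_sequentially)
    define \<phi> where "\<phi> = conv (mseq n) g"
    have s\<phi>: "sq_int \<phi>" using lim by (auto simp: l2_lim_def \<phi>_def)
    have "l2n (\<lambda>x. \<phi> x - \<psi> x) < e"
      using l2n_triangle_diff [OF s\<phi> gs s] n g(3) by (simp add: \<phi>_def)
    then have "L2_dist \<phi> \<psi> < e" by (simp add: L2_dist_def l2n_def)
    moreover have "test_spinor \<phi>" unfolding \<phi>_def by (rule test_spinor_conv [OF gs g(2)])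
    then have "\<phi> \<in> Domain ?M" by (auto simp: weyl_dirac_min_def)
    then have "\<phi> \<in> Domain ?T" using weyl_dirac_min_subset_adjoint [OF A] by blast
    ultimately show "\<exists>\<phi>\<in>Domain ?T. L2_dist \<phi> \<psi> < e" by blast
  qed
  ultimately show ?thesis by (auto simp: self_adjoint_def)
qed

theorem weyl_dirac_eq_adjoint_min:
  assumes A: "continuous_on UNIV A"
  shows "weyl_dirac A = adjoint_graph (weyl_dirac_min A)"
  unfolding weyl_dirac_def
proof (rule the_equality)
  let ?M = "weyl_dirac_min A" and ?T = "adjoint_graph (weyl_dirac_min A)"
  show T: "self_adjoint ?T \<and> ?M \<subseteq> ?T"
    using self_adjoint_adjoint_min [OF A] weyl_dirac_min_subset_adjoint [OF A] by simp
  fix S assume S: "self_adjoint S \<and> ?M \<subseteq> S"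
  then have 1: "S \<subseteq> ?T" using adjoint_graph_antimono [of ?M S] by (auto simp: self_adjoint_def)
  have "adjoint_graph ?T \<subseteq> adjoint_graph S" by (rule adjoint_graph_antimono [OF 1])
  then have "?T \<subseteq> S" using S T by (auto simp: self_adjoint_def)
  with 1 show "S = ?T" by blast
qed

lemma zero_mode_iff:
  assumes A: "smooth A"
  shows "zero_mode A \<psi> \<longleftrightarrow> weak_dirac A \<psi> (\<lambda>x. 0) \<and> \<not> (AE x in lborel. \<psi> x = 0)"
  unfolding zero_mode_def weyl_dirac_eq_adjoint_min [OF C_upto_imp_continuous_on [OF smoothD [OF A, of 0]]]
    adjoint_graph_min_iff [OF C_upto_imp_continuous_on [OF smoothD [OF A, of 0]]]
  using weak_dirac_sq_int by (auto simp: L2_eq_sq_int)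



subsection \<open>curl and cov\<close>

lemma cross3_component: "cross3 u v = vector [u$2 * v$3 - u$3 * v$2, u$3 * v$1 - u$1 * v$3, u$1 * v$2 - u$2 * v$1]"
  by (simp add: cross3_def)

lemma cross3_nth [simp]:
  "cross3 u v $ 1 = u$2 * v$3 - u$3 * v$2" "cross3 u v $ 2 = u$3 * v$1 - u$1 * v$3" "cross3 u v $ 3 = u$1 * v$2 - u$2 * v$1"
  by (simp_all add: cross3_component)

lemma real3_eq_iff: "(u::real^3) = v \<longleftrightarrow> u$1 = v$1 \<and> u$2 = v$2 \<and> u$3 = v$3"
  by (simp add: vec_eq_iff forall_3)

lemma real3_inner: "(u::real^3) \<bullet> v = u$1 * v$1 + u$2 * v$2 + u$3 * v$3"
  by (simp add: inner_vec_def sum_3)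

lemma ax_nth [simp]: "ax 1 $ 1 = 1" "ax 1 $ 2 = 0" "ax 1 $ 3 = 0" "ax 2 $ 1 = 0" "ax 2 $ 2 = 1" "ax 2 $ 3 = 0"
  "ax 3 $ 1 = 0" "ax 3 $ 2 = 0" "ax 3 $ 3 = 1"
  by (simp_all add: axis_def)

lemma bounded_bilinear_cross3: "bounded_bilinear cross3"
  by (intro bilinear_conv_bounded_bilinear [THEN iffD1])
    (auto simp: bilinear_def real3_eq_iff algebra_simps intro!: linearI)

lemma differentiable_linear:
  "bounded_linear h \<Longrightarrow> f differentiable at x \<Longrightarrow> (\<lambda>x. h (f x)) differentiable at x"
  unfolding differentiable_def using bounded_linear.has_derivative by blast

lemma pd_nth: "A differentiable at x \<Longrightarrow> pd v (\<lambda>y. A y $ k) x = pd v A x $ k"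
  by (rule pd_linear_comp [OF bounded_linear_vec_nth])

lemma differentiable_nth: "A differentiable at x \<Longrightarrow> (\<lambda>y. A y $ k) differentiable at x"
  by (rule differentiable_linear [OF bounded_linear_vec_nth])

lemma partial_nth: "A differentiable at x \<Longrightarrow> partial j (\<lambda>y. A y $ k) x = pd (ax j) A x $ k"
  by (simp add: partial_eq_pd [OF differentiable_nth] pd_nth)

lemma curl_inner_cross3:
  assumes "A differentiable at x"
  shows "pd u A x \<bullet> v - pd v A x \<bullet> u = curl A x \<bullet> cross3 u v"
proof -
  have e: "pd w A x = w$1 *\<^sub>R pd (ax 1) A x + w$2 *\<^sub>R pd (ax 2) A x + w$3 *\<^sub>R pd (ax 3) A x" for w
    by (subst pd_ax_sum [OF assms]) (simp add: sum_3)
  show ?thesis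
    unfolding e [of u] e [of v]
    by (simp add: curl_def partial_nth [OF assms] real3_inner algebra_simps)
qed

definition cov :: "(real^3 \<Rightarrow> real^3) \<Rightarrow> real^3 \<Rightarrow> spinor \<Rightarrow> spinor" where
  "cov A v f x = pd v f x - (A x \<bullet> v) *\<^sub>R imul (f x)"

definition pdirac :: "(real^3 \<Rightarrow> real^3) \<Rightarrow> spinor \<Rightarrow> spinor" where
  "pdirac A f x = (\<Sum>j\<in>UNIV. sig (ax j) (cov A (ax j) f x))"

lemma dirac_eq_pdirac: "dirac A f x = - imul (pdirac A f x)"
proof -
  have "pdirac A f x = (\<Sum>j\<in>UNIV. sig (ax j) (pd (ax j) f x)) - imul (sig (A x) (f x))"
    unfolding pdirac_def cov_def sum_sig_ax [of "A x" "f x", symmetric]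
    by (simp add: sigB.diff_right sum_subtractf sigB.scaleR_right imul_sum imul_scaleR inner_axis)
  then show ?thesis by (simp add: dirac_def imul_diff imul_sum)
qed

lemma norm_dirac: "norm (dirac A f x) = norm (pdirac A f x)"
  by (simp add: dirac_eq_pdirac)

lemma cov_scaleR:
  assumes "h differentiable at x" "f differentiable at x"
  shows "cov A v (\<lambda>x. h x *\<^sub>R f x) x = pd v h x *\<^sub>R f x + h x *\<^sub>R cov A v f x"
  unfolding cov_def pd_scaleR [OF assms] by (simp add: imul_scaleR algebra_simps)

lemma cov_sig:
  assumes "V differentiable at x" "f differentiable at x"
  shows "cov A v (\<lambda>x. sig (V x) (f x)) x = sig (pd v V x) (f x) + sig (V x) (cov A v f x)"
proof -
  have "pd v (\<lambda>x. sig (V x) (f x)) x = sig (V x) (pd v f x) + sig (pd v V x) (f x)"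
    by (rule pd_eq [OF sigB.FDERIV [OF has_derivative_pd [OF assms(1)] has_derivative_pd [OF assms(2)]]])
  then show ?thesis by (simp add: cov_def sigB.diff_right sigB.scaleR_right)
qed

lemma cov_imul: "f differentiable at x \<Longrightarrow> cov A v (\<lambda>x. imul (f x)) x = imul (cov A v f x)"
  by (simp add: cov_def pd_linear_comp [OF bounded_linear_imul] imul_diff imul_scaleR imul_minus)

lemma pd_add: "f differentiable at x \<Longrightarrow> g differentiable at x \<Longrightarrow> pd v (\<lambda>x. f x + g x) x = pd v f x + pd v g x"
  by (rule pd_eq [OF has_derivative_add [OF has_derivative_pd has_derivative_pd]])

lemma pd_sum: "(\<And>i. i \<in> I \<Longrightarrow> f i differentiable at x) \<Longrightarrow> pd v (\<lambda>x. \<Sum>i\<in>I. f i x) x = (\<Sum>i\<in>I. pd v (f i) x)"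
  by (rule pd_eq [OF has_derivative_sum [OF has_derivative_pd]])

lemma cov_add: "f differentiable at x \<Longrightarrow> g differentiable at x \<Longrightarrow> cov A v (\<lambda>x. f x + g x) x = cov A v f x + cov A v g x"
  by (simp add: cov_def pd_add imul_add algebra_simps)

lemma cov_sum: "(\<And>i. i \<in> I \<Longrightarrow> f i differentiable at x) \<Longrightarrow> cov A v (\<lambda>x. \<Sum>i\<in>I. f i x) x = (\<Sum>i\<in>I. cov A v (f i) x)"
  by (simp add: cov_def pd_sum imul_sum scaleR_sum_right sum_subtractf)

lemma cov_ax_sum:
  assumes "f differentiable at x"
  shows "cov A v f x = (\<Sum>j\<in>UNIV. (v $ j) *\<^sub>R cov A (ax j) f x)"
proof -
  have "A x \<bullet> v = (\<Sum>j\<in>UNIV. v $ j * (A x $ j))" by (simp add: inner_vec_def mult.commute)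
  then show ?thesis
    unfolding cov_def
    by (subst pd_ax_sum [OF assms]) (simp add: scaleR_diff_right sum_subtractf scaleR_sum_left inner_axis)
qed

lemma cov_commute:
  assumes f: "C_upto 2 f" and A: "C_upto (Suc 0) A"
  shows "cov A u (cov A v f) x - cov A v (cov A u f) x = - (curl A x \<bullet> cross3 u v) *\<^sub>R imul (f x)"
proof -
  have f2: "C_upto (Suc (Suc 0)) f" using f by (simp only: numeral_2_eq_2)
  have d: "f differentiable at x" "pd w f differentiable at x" for w
    using f2 C_upto_pd [OF f2] by (auto simp: C_upto_Suc_iff)
  have dA: "A differentiable at x" using A by (simp add: C_upto_Suc_iff)
  have e: "cov A u (cov A v f) x = pd u (pd v f) x - (pd u A x \<bullet> v) *\<^sub>R imul (f x) - (A x \<bullet> v) *\<^sub>R imul (pd u f x)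
      - (A x \<bullet> u) *\<^sub>R imul (pd v f x) - (A x \<bullet> u) *\<^sub>R (A x \<bullet> v) *\<^sub>R f x" for u v
  proof -
    have "((\<lambda>y. pd v f y - (A y \<bullet> v) *\<^sub>R imul (f y)) has_derivative
        (\<lambda>u. pd u (pd v f) x - ((A x \<bullet> v) *\<^sub>R imul (pd u f x) + (pd u A x \<bullet> v) *\<^sub>R imul (f x)))) (at x)"
      by (intro has_derivative_diff has_derivative_scaleR has_derivative_pd d
          bounded_linear.has_derivative [OF bounded_linear_imul] has_derivative_inner_left dA)
    from pd_eq [OF this] have "pd u (cov A v f) x = pd u (pd v f) x - ((A x \<bullet> v) *\<^sub>R imul (pd u f x) + (pd u A x \<bullet> v) *\<^sub>R imul (f x))"
      by (simp add: cov_def [abs_def])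
    then show ?thesis
      by (simp add: cov_def [of A u "cov A v f"]) (simp add: cov_def imul_diff imul_scaleR algebra_simps)
  qed
  have "cov A u (cov A v f) x - cov A v (cov A u f) x = - (pd u A x \<bullet> v - pd v A x \<bullet> u) *\<^sub>R imul (f x)"
    unfolding e pd_commute [OF f, of u v] by (simp add: algebra_simps)
  then show ?thesis by (simp add: curl_inner_cross3 [OF dA])
qed

lemma cov_C_upto: "C_upto (Suc k) f \<Longrightarrow> C_upto k A \<Longrightarrow> C_upto k (cov A v f)"
  unfolding cov_def [abs_def]
  by (rule C_upto_diff [OF C_upto_pd C_upto_scaleR [OF C_upto_inner [OF _ C_upto_const] C_upto_linear [OF bounded_linear_imul C_upto_Suc_lower]]])

lemma pdirac_C_upto: "C_upto (Suc k) f \<Longrightarrow> C_upto k A \<Longrightarrow> C_upto k (pdirac A f)"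
  unfolding pdirac_def [abs_def]
  by (rule C_upto_sum [OF C_upto_linear [OF sigB.bounded_linear_right cov_C_upto]])

lemma cov_eq_0: "open S \<Longrightarrow> x \<in> S \<Longrightarrow> (\<And>y. y \<in> S \<Longrightarrow> f y = 0) \<Longrightarrow> cov A v f x = 0"
  unfolding cov_def by (simp add: pd_eq_0)

subsection \<open>Locale\<close>

locale conformal_dirac =
  fixes X rot A :: "real^3 \<Rightarrow> real^3" and lam :: "real^3 \<Rightarrow> real" and c :: "real^3"
  assumes dX: "\<And>x. (X has_derivative (\<lambda>u. lam x *\<^sub>R u + cross3 (rot x) u)) (at x)"
    and dlam: "\<And>x. (lam has_derivative (\<lambda>u. 2 * (c \<bullet> u))) (at x)"
    and drot: "\<And>x. (rot has_derivative (\<lambda>u. 2 *\<^sub>R cross3 c u)) (at x)"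
    and orth: "\<And>x. X x \<bullet> rot x = 0"
    and A_C1: "C_upto (Suc 0) A"
    and par: "\<And>x. cross3 (X x) (curl A x) = 0"
begin

lemma lam_C_upto: "C_upto k lam"
  by (rule C_upto_Suc_lower [OF C_upto_SucI [OF dlam C_upto_const]])

lemma rot_C_upto: "C_upto k rot"
  by (rule C_upto_Suc_lower [OF C_upto_SucI [OF drot C_upto_const]])

lemma X_C_upto: "C_upto k X"
  by (rule C_upto_Suc_lower [OF C_upto_SucI [OF dX]])
    (rule C_upto_add [OF C_upto_scaleR [OF lam_C_upto C_upto_const] C_upto_bilinear [OF bounded_bilinear_cross3 rot_C_upto C_upto_const]])

lemmas pd_X = pd_eq [OF dX]
lemmas pd_lam = pd_eq [OF dlam]
lemmas pd_rot = pd_eq [OF drot]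

lemma diffs [simp]: "X differentiable at x" "rot differentiable at x" "lam differentiable at x"
  using dX drot dlam by (auto simp: differentiable_def)

definition lie :: "spinor \<Rightarrow> spinor" where
  "lie f x = cov A (X x) f x + lam x *\<^sub>R f x + (1/2) *\<^sub>R imul (sig (rot x) (f x))"

definition zop :: "spinor \<Rightarrow> spinor" where
  "zop f x = lie f x - sig (X x) (pdirac A f x)"

lemma lie_sig:
  assumes f: "f differentiable at x"
  shows "lie (\<lambda>x. sig (X x) (f x)) x = sig (X x) (lie f x) + lam x *\<^sub>R sig (X x) (f x)"
proof -
  have "sig (rot x) (sig (X x) (f x)) = sig (X x) (sig (rot x) (f x)) + 2 *\<^sub>R imul (sig (cross3 (rot x) (X x)) (f x))"
    by (simp add: sig_sig inner_commute cross_skew [of "X x" "rot x"] sigB.minus_left imul_minus scaleR_2)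
  then show ?thesis
    unfolding lie_def cov_sig [OF diffs(1) f] pd_X
    by (simp add: sigB.add_left sigB.add_right sigB.scaleR_left sigB.scaleR_right imul_add imul_diff imul_scaleR scaleR_add_right scaleR_diff_right)
qed

lemma sum_sig_rot:
  "(\<Sum>j\<in>UNIV. sig (ax j) (\<Sum>k\<in>UNIV. (cross3 r (ax j) $ k) *\<^sub>R U k)) + (1/2) *\<^sub>R imul (\<Sum>j\<in>UNIV. sig (ax j) (sig r (U j)))
     = (1/2) *\<^sub>R imul (sig r (\<Sum>j\<in>UNIV. sig (ax j) (U j)))"
  by (simp add: complex2_eq_iff sum_3 scaleR_complex algebra_simps)

lemma sum_sig_c:
  "(\<Sum>j\<in>UNIV. sig (ax j) ((2 * (c \<bullet> ax j)) *\<^sub>R g)) + (1/2) *\<^sub>R imul (\<Sum>j\<in>UNIV. sig (ax j) (sig (2 *\<^sub>R cross3 c (ax j)) g)) = 0"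
  by (simp add: complex2_eq_iff sum_3 scaleR_complex inner_axis algebra_simps)

lemma pdirac_lie:
  assumes f: "C_upto 2 f"
  shows "pdirac A (lie f) x = lie (pdirac A f) x + lam x *\<^sub>R pdirac A f x"
proof -
  have f2: "C_upto (Suc (Suc 0)) f" using f by (simp only: numeral_2_eq_2)
  have d: "f differentiable at x" for x using f2 by (auto simp: C_upto_Suc_iff)
  have dc: "cov A v f differentiable at x" for v x
    using cov_C_upto [OF f2 A_C1] by (simp add: C_upto_Suc_iff)
  have dP: "pdirac A f differentiable at x" for x
    using pdirac_C_upto [OF f2 A_C1] by (simp add: C_upto_Suc_iff)
  define U where "U k = cov A (ax k) f" for k
  have dU: "U k differentiable at x" for k x using dc by (simp add: U_def)
  have lie_eq: "lie f = (\<lambda>x. (\<Sum>k\<in>UNIV. (X x $ k) *\<^sub>R U k x) + (lam x *\<^sub>R f x + (1/2) *\<^sub>R imul (sig (rot x) (f x))))"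
  proof -
    have "cov A (X x) f x = (\<Sum>k\<in>UNIV. (X x $ k) *\<^sub>R U k x)" for x
      unfolding U_def by (rule cov_ax_sum [OF d])
    then show ?thesis by (simp add: lie_def [abs_def] add.assoc)
  qed
  have Pd: "pdirac A f = (\<lambda>x. \<Sum>j\<in>UNIV. sig (ax j) (U j x))"
    unfolding U_def pdirac_def [abs_def] ..
  have dXk: "(\<lambda>x. X x $ k) differentiable at x" for k x by (rule differentiable_nth) simp
  have ds: "(\<lambda>x. sig (rot x) (f x)) differentiable at x" for x
    using sigB.FDERIV [OF drot has_derivative_pd [OF d]] by (auto simp: differentiable_def)
  have dhs: "(\<lambda>x. (1/2) *\<^sub>R imul (sig (rot x) (f x))) differentiable at x" for x
    by (intro derivative_intros differentiable_linear [OF bounded_linear_imul] ds)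
  have d1: "(\<lambda>x. (X x $ k) *\<^sub>R U k x) differentiable at x" for k x
    by (rule differentiable_scaleR [OF dXk dU])
  have d2: "(\<lambda>x. lam x *\<^sub>R f x) differentiable at x" for x
    by (rule differentiable_scaleR [OF diffs(3) d])
  have d3: "(\<lambda>x. \<Sum>k\<in>UNIV. (X x $ k) *\<^sub>R U k x) differentiable at x" for x
    by (rule differentiable_sum) (simp_all add: d1)
  have cj: "cov A (ax j) (lie f) x = (\<Sum>k\<in>UNIV. (pd (ax j) X x $ k) *\<^sub>R U k x) + (\<Sum>k\<in>UNIV. (X x $ k) *\<^sub>R cov A (ax j) (U k) x)
      + (2 * (c \<bullet> ax j)) *\<^sub>R f x + lam x *\<^sub>R U j x
      + (1/2) *\<^sub>R imul (sig (2 *\<^sub>R cross3 c (ax j)) (f x)) + (1/2) *\<^sub>R imul (sig (rot x) (U j x))" for j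
  proof -
    have "cov A (ax j) (lie f) x = (\<Sum>k\<in>UNIV. cov A (ax j) (\<lambda>x. (X x $ k) *\<^sub>R U k x) x)
        + (cov A (ax j) (\<lambda>x. lam x *\<^sub>R f x) x + cov A (ax j) (\<lambda>x. (1/2) *\<^sub>R imul (sig (rot x) (f x))) x)"
      unfolding lie_eq
      by (simp only: cov_add [OF d3 differentiable_add [OF d2 dhs]] cov_add [OF d2 dhs] cov_sum [OF d1])
    also have "cov A (ax j) (\<lambda>x. (1/2) *\<^sub>R imul (sig (rot x) (f x))) x
        = (1/2) *\<^sub>R imul (sig (2 *\<^sub>R cross3 c (ax j)) (f x)) + (1/2) *\<^sub>R imul (sig (rot x) (U j x))"
      using cov_scaleR [of "\<lambda>x. 1/2" x "\<lambda>x. imul (sig (rot x) (f x))" A "ax j"] ds [of x]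
      by (simp add: differentiable_linear [OF bounded_linear_imul] cov_imul cov_sig d pd_rot pd_eq [OF has_derivative_const]
           imul_add scaleR_add_right U_def)
    finally have "cov A (ax j) (lie f) x = (\<Sum>k\<in>UNIV. cov A (ax j) (\<lambda>x. (X x $ k) *\<^sub>R U k x) x)
        + (cov A (ax j) (\<lambda>x. lam x *\<^sub>R f x) x + ((1/2) *\<^sub>R imul (sig (2 *\<^sub>R cross3 c (ax j)) (f x)) + (1/2) *\<^sub>R imul (sig (rot x) (U j x))))" .
    moreover have "cov A (ax j) f x = U j x" by (simp add: U_def)
    ultimately show ?thesis
      by (simp add: cov_scaleR [OF dXk dU] cov_scaleR [OF diffs(3) d] pd_nth pd_lam sum.distrib add.assoc)
  qed
  have X1: "(\<Sum>k\<in>UNIV. (pd (ax j) X x $ k) *\<^sub>R U k x) = lam x *\<^sub>R U j x + (\<Sum>k\<in>UNIV. (cross3 (rot x) (ax j) $ k) *\<^sub>R U k x)" for j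
  proof -
    have "(\<Sum>k\<in>UNIV. (lam x * ax j $ k) *\<^sub>R U k x) = lam x *\<^sub>R U j x"
      using exhaust_3 [of j] by (auto simp: sum_3)
    then show ?thesis by (simp add: pd_X scaleR_add_left sum.distrib)
  qed
  define W where "W k j = cov A (ax k) (U j) x" for k j
  have comm: "cov A (ax j) (U k) x = W k j - (curl A x \<bullet> cross3 (ax j) (ax k)) *\<^sub>R imul (f x)" for j k
    using cov_commute [OF f A_C1, of "ax j" "ax k" x] unfolding U_def W_def by (simp add: algebra_simps)
  have curv: "(\<Sum>j\<in>UNIV. sig (ax j) (\<Sum>k\<in>UNIV. (X x $ k) *\<^sub>R (curl A x \<bullet> cross3 (ax j) (ax k)) *\<^sub>R imul (f x))) = 0"
  proof -
    have "(\<Sum>k\<in>UNIV. (X x $ k) *\<^sub>R (curl A x \<bullet> cross3 (ax j) (ax k)) *\<^sub>R imul (f x)) = (cross3 (X x) (curl A x) $ j) *\<^sub>R imul (f x)" for j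
      using exhaust_3 [of j] by (auto simp: sum_3 real3_inner complex2_eq_iff scaleR_complex algebra_simps)
    then show ?thesis using par by simp
  qed
  have swap: "(\<Sum>j\<in>UNIV. sig (ax j) (\<Sum>k\<in>UNIV. (X x $ k) *\<^sub>R cov A (ax j) (U k) x)) = cov A (X x) (pdirac A f) x"
  proof -
    have "(\<Sum>j\<in>UNIV. sig (ax j) (\<Sum>k\<in>UNIV. (X x $ k) *\<^sub>R cov A (ax j) (U k) x))
        = (\<Sum>j\<in>UNIV. sig (ax j) (\<Sum>k\<in>UNIV. (X x $ k) *\<^sub>R W k j))"
      unfolding comm
      using curv by (simp add: scaleR_diff_right sum_subtractf sigB.diff_right)
    also have "\<dots> = (\<Sum>k\<in>UNIV. (X x $ k) *\<^sub>R (\<Sum>j\<in>UNIV. sig (ax j) (W k j)))"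
      by (simp add: sigB.sum_right sigB.scaleR_right scaleR_sum_right) (rule sum.swap)
    also have "\<dots> = (\<Sum>k\<in>UNIV. (X x $ k) *\<^sub>R cov A (ax k) (pdirac A f) x)"
    proof -
      have "cov A (ax k) (pdirac A f) x = (\<Sum>j\<in>UNIV. sig (ax j) (cov A (ax k) (U j) x))" for k
        unfolding Pd
        by (subst cov_sum) (use cov_sig [OF differentiable_const dU] differentiable_linear [OF sigB.bounded_linear_right dU] in \<open>simp_all add: pd_eq [OF has_derivative_const]\<close>)
      then show ?thesis by (simp add: W_def)
    qed
    also have "\<dots> = cov A (X x) (pdirac A f) x" by (rule cov_ax_sum [OF dP, symmetric])
    finally show ?thesis .
  qed
  have "pdirac A (lie f) x = (\<Sum>j\<in>UNIV. sig (ax j) (lam x *\<^sub>R U j x)) + (\<Sum>j\<in>UNIV. sig (ax j) (\<Sum>k\<in>UNIV. (cross3 (rot x) (ax j) $ k) *\<^sub>R U k x))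
     + cov A (X x) (pdirac A f) x + (\<Sum>j\<in>UNIV. sig (ax j) ((2 * (c \<bullet> ax j)) *\<^sub>R f x)) + (\<Sum>j\<in>UNIV. sig (ax j) (lam x *\<^sub>R U j x))
     + (1/2) *\<^sub>R imul (\<Sum>j\<in>UNIV. sig (ax j) (sig (2 *\<^sub>R cross3 c (ax j)) (f x))) + (1/2) *\<^sub>R imul (\<Sum>j\<in>UNIV. sig (ax j) (sig (rot x) (U j x)))"
    unfolding pdirac_def [of A "lie f"] cj X1 swap [symmetric]
    by (simp only: sigB.add_right sum.distrib sigB.scaleR_right imul_sum scaleR_sum_right sig_imul add_ac)
  also have "\<dots> = (lam x *\<^sub>R pdirac A f x + cov A (X x) (pdirac A f) x + lam x *\<^sub>R pdirac A f x)
     + ((\<Sum>j\<in>UNIV. sig (ax j) ((2 * (c \<bullet> ax j)) *\<^sub>R f x)) + (1/2) *\<^sub>R imul (\<Sum>j\<in>UNIV. sig (ax j) (sig (2 *\<^sub>R cross3 c (ax j)) (f x))))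
     + ((\<Sum>j\<in>UNIV. sig (ax j) (\<Sum>k\<in>UNIV. (cross3 (rot x) (ax j) $ k) *\<^sub>R U k x)) + (1/2) *\<^sub>R imul (\<Sum>j\<in>UNIV. sig (ax j) (sig (rot x) (U j x))))"
    by (simp add: Pd sigB.scaleR_right scaleR_sum_right add_ac)
  also have "\<dots> = lie (pdirac A f) x + lam x *\<^sub>R pdirac A f x"
    unfolding sum_sig_c sum_sig_rot by (simp add: lie_def Pd)
  finally show ?thesis .
qed

end



lemma C1_zero_extension:
  fixes h :: "'a::euclidean_space \<Rightarrow> 'b::real_normed_vector"
  assumes U: "open U" and K: "compact K" "K \<subseteq> U" and h0: "\<And>x. x \<notin> K \<Longrightarrow> h x = 0"
    and dh: "\<And>x. x \<in> U \<Longrightarrow> (h has_derivative h' x) (at x)" and ch: "\<And>v. continuous_on U (\<lambda>x. h' x v)"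
  shows "C_upto (Suc 0) h"
proof -
  define H where "H x = (if x \<in> U then h' x else (\<lambda>v. 0))" for x
  have oK: "open (- K)" using K by (simp add: compact_imp_closed open_Compl)
  have dh0: "(h has_derivative (\<lambda>v. 0)) (at x)" if "x \<notin> K" for x
    by (rule has_derivative_transform_within_open [of "\<lambda>_. 0" _ _ _ "- K"]) (use that oK h0 in auto)
  have H: "(h has_derivative H x) (at x)" for x
    using dh dh0 [of x] K by (auto simp: H_def)
  have H0: "H x = (\<lambda>v. 0)" if "x \<notin> K" for x
    using has_derivative_unique [OF H dh0 [OF that]] .
  show ?thesis
  proof (rule C_upto_SucI [OF H])
    fix v
    have "continuous_on (U \<union> - K) (\<lambda>x. H x v)"
    proof (rule continuous_on_open_Un [OF U oK])
      show "continuous_on U (\<lambda>x. H x v)"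
        using ch [of v] by (rule continuous_on_eq) (simp add: H_def)
      show "continuous_on (- K) (\<lambda>x. H x v)"
        by (rule continuous_on_eq [OF continuous_on_const [of _ 0]]) (simp add: H0)
    qed
    moreover have "U \<union> - K = UNIV" using K by blast
    ultimately show "C_upto 0 (\<lambda>x. H x v)" by simp
  qed
qed

lemma compact_supp_in:
  fixes f :: "'a::euclidean_space \<Rightarrow> 'b::zero"
  assumes "compact K" "\<And>x. x \<notin> K \<Longrightarrow> f x = 0"
  shows "\<exists>r. supp_in f r"
proof -
  obtain r where "\<And>x. x \<in> K \<Longrightarrow> norm x \<le> r" using compact_imp_bounded [OF assms(1)] bounded_iff by blast
  then have "supp_in f r" unfolding supp_in_def using assms(2) by (meson not_le)
  then show ?thesis ..
qed

context conformal_dirac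
begin

lemma X_continuous: "continuous_on S X"
  by (rule C_upto_imp_continuous_on [OF X_C_upto])

lemma U_open: "open {x. X x \<noteq> 0}"
  by (intro open_Collect_neq X_continuous continuous_on_const)

lemma inner_pd_X: "X x \<bullet> pd v X x = lam x * (X x \<bullet> v) + cross3 (X x) (rot x) \<bullet> v"
  by (simp add: pd_X inner_add_right) (simp add: real3_inner algebra_simps)

lemma weight_has_derivative:
  assumes "X x \<noteq> 0"
  shows "((\<lambda>x. 1 / norm (X x)) has_derivative (\<lambda>v. - ((lam x * (X x \<bullet> v) + cross3 (X x) (rot x) \<bullet> v) / norm (X x) ^ 3))) (at x)"
proof -
  have n: "norm (X x) > 0" using assms by simp
  have "((\<lambda>x. norm (X x)) has_derivative (\<lambda>v. (X x \<bullet> pd v X x) / norm (X x))) (at x)"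
    using diff_chain_at [OF has_derivative_pd [OF diffs(1)] has_derivative_norm [OF assms]]
    by (simp add: o_def sgn_div_norm divide_inverse mult.commute inner_commute)
  from has_derivative_divide [OF has_derivative_const [of 1] this]
  have "((\<lambda>x. 1 / norm (X x)) has_derivative (\<lambda>v. - ((X x \<bullet> pd v X x) / norm (X x) ^ 3))) (at x)"
    using n by (auto simp: power3_eq_cube field_simps)
  then show ?thesis unfolding inner_pd_X .
qed

lemma div_weight:
  assumes g: "C_upto (Suc 0) g" and K: "compact K" "K \<subseteq> {x. X x \<noteq> 0}" "\<And>x. x \<notin> K \<Longrightarrow> g x = 0"
  shows "C_upto (Suc 0) (\<lambda>x. g x / norm (X x))"
    "pd v (\<lambda>x. g x / norm (X x)) x = pd v g x / norm (X x) - g x * (lam x * (X x \<bullet> v) + cross3 (X x) (rot x) \<bullet> v) / norm (X x) ^ 3"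
proof -
  define h' where "h' x v = pd v g x / norm (X x) - g x * (lam x * (X x \<bullet> v) + cross3 (X x) (rot x) \<bullet> v) / norm (X x) ^ 3" for x v
  have dg: "(g has_derivative (\<lambda>v. pd v g x)) (at x)" for x by (rule C_upto_has_derivative [OF g])
  have d: "((\<lambda>x. g x / norm (X x)) has_derivative h' x) (at x)" if "x \<in> {x. X x \<noteq> 0}" for x
  proof -
    have "((\<lambda>x. g x * (1 / norm (X x))) has_derivative (\<lambda>v. g x * (- ((lam x * (X x \<bullet> v) + cross3 (X x) (rot x) \<bullet> v) / norm (X x) ^ 3)) + pd v g x * (1 / norm (X x)))) (at x)"
      by (rule has_derivative_mult [OF dg weight_has_derivative]) (use that in simp)
    moreover have "(\<lambda>v. g x * (- ((lam x * (X x \<bullet> v) + cross3 (X x) (rot x) \<bullet> v) / norm (X x) ^ 3)) + pd v g x * (1 / norm (X x))) = h' x"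
      by (simp add: h'_def fun_eq_iff)
    ultimately show ?thesis by simp
  qed
  show "C_upto (Suc 0) (\<lambda>x. g x / norm (X x))"
  proof (rule C1_zero_extension [OF U_open K(1,2) _ d])
    show "continuous_on {x. X x \<noteq> 0} (\<lambda>x. h' x v)" for v
      unfolding h'_def
      by (intro continuous_intros X_continuous C_upto_imp_continuous_on [OF C_upto_pd [OF g]] C_upto_imp_continuous_on [OF g]
         C_upto_imp_continuous_on [OF lam_C_upto] bounded_bilinear.continuous_on [OF bounded_bilinear_cross3]
         C_upto_imp_continuous_on [OF rot_C_upto]) auto
  qed (use K in auto)
  show "pd v (\<lambda>x. g x / norm (X x)) x = h' x v"
  proof (cases "X x = 0")
    case True
    then have "x \<in> - K" using K by auto
    moreover have "open (- K)" using K by (simp add: compact_imp_closed open_Compl)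
    ultimately have "pd v (\<lambda>x. g x / norm (X x)) x = 0" by (intro pd_eq_0 [of "- K"]) (use K in auto)
    then show ?thesis using True by (simp add: h'_def)
  qed (rule pd_eq [OF d], simp)
qed

lemma div_weight_integrable:
  assumes h: "continuous_on UNIV h" and K: "compact K" "K \<subseteq> {x. X x \<noteq> 0}" "\<And>x. x \<notin> K \<Longrightarrow> h x = 0"
  shows "integrable lborel (\<lambda>x. h x / norm (X x))"
proof -
  have "integrable lborel (\<lambda>x. indicator K x *\<^sub>R (h x / norm (X x)))"
  proof (rule borel_integrable_compact [OF K(1)])
    show "continuous_on K (\<lambda>x. h x / norm (X x))"
      by (intro continuous_intros X_continuous continuous_on_subset [OF h]) (use K in auto)
  qed
  moreover have "(\<lambda>x. indicator K x *\<^sub>R (h x / norm (X x))) = (\<lambda>x. h x / norm (X x))"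
    using K(3) by (auto simp: indicator_def fun_eq_iff)
  ultimately show ?thesis by simp
qed

lemma integral_divergence_weight:
  assumes G: "\<And>j. C_upto (Suc 0) (G j)" and K: "compact K" "K \<subseteq> {x. X x \<noteq> 0}" "\<And>j x. x \<notin> K \<Longrightarrow> G j x = 0"
  shows "(LINT x|lborel. (\<Sum>j\<in>UNIV. pd (ax j) (\<lambda>x. G j x / norm (X x)) x)) = 0"
proof -
  have C: "C_upto (Suc 0) (\<lambda>x. G j x / norm (X x))" for j
    by (rule div_weight(1) [OF G K(1,2)]) (rule K(3))
  have "\<exists>r. supp_in (\<lambda>x. G j x / norm (X x)) r" for j
    by (rule compact_supp_in [OF K(1)]) (simp add: K(3))
  then obtain r where r: "\<And>j. supp_in (\<lambda>x. G j x / norm (X x)) (r j)" by metis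
  show ?thesis
    by (subst Bochner_Integration.integral_sum)
      (auto simp: integral_pd_eq_0 [OF C r] intro!: supp_in_integrable [OF _ supp_in_pd [OF r]]
        C_upto_imp_continuous_on [OF C_upto_pd [OF C]])
qed

lemma sum_divergence_weight:
  assumes G: "\<And>j. C_upto (Suc 0) (G j)" and K: "compact K" "K \<subseteq> {x. X x \<noteq> 0}" "\<And>j x. x \<notin> K \<Longrightarrow> G j x = 0"
  shows "(\<Sum>j\<in>UNIV. pd (ax j) (\<lambda>x. G j x / norm (X x)) x)
    = (\<Sum>j\<in>UNIV. pd (ax j) (G j) x) / norm (X x)
      - (\<Sum>j\<in>UNIV. G j x * (lam x * X x $ j + cross3 (X x) (rot x) $ j)) / norm (X x) ^ 3"
  using div_weight(2) [OF G K(1,2), of _ "ax j" x for j] K(3)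
  by (simp add: sum_subtractf sum_divide_distrib inner_axis)

lemma pd_inner:
  assumes "f differentiable at x" "g differentiable at x"
  shows "pd v (\<lambda>x. f x \<bullet> g x) x = f x \<bullet> pd v g x + pd v f x \<bullet> g x"
  by (rule pd_eq [OF has_derivative_inner [OF has_derivative_pd [OF assms(1)] has_derivative_pd [OF assms(2)]]])

lemma lie_skew:
  assumes f: "C_upto (Suc 0) f" and g: "C_upto (Suc 0) g"
    and K: "compact K" "K \<subseteq> {x. X x \<noteq> 0}" "\<And>x. x \<notin> K \<Longrightarrow> f x = 0"
  shows "(LINT x|lborel. (lie f x \<bullet> g x + f x \<bullet> lie g x) / norm (X x)) = 0"
proof -
  have d: "f differentiable at x" "g differentiable at x" for x using f g by (auto simp: C_upto_Suc_iff)
  define G where "G j x = X x $ j * (f x \<bullet> g x)" for j x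
  have G: "C_upto (Suc 0) (G j)" for j
    unfolding G_def by (rule C_upto_mult [OF C_upto_nth [OF X_C_upto] C_upto_inner [OF f g]])
  have G0: "x \<notin> K \<Longrightarrow> G j x = 0" for j x by (simp add: G_def K)
  have "(\<Sum>j\<in>UNIV. pd (ax j) (\<lambda>x. G j x / norm (X x)) x) = (lie f x \<bullet> g x + f x \<bullet> lie g x) / norm (X x)" for x
  proof (cases "X x = 0")
    case False
    have pg: "pd (ax j) (G j) x = X x $ j * (f x \<bullet> pd (ax j) g x + pd (ax j) f x \<bullet> g x) + pd (ax j) X x $ j * (f x \<bullet> g x)" for j
    proof -
      have "((\<lambda>x. X x $ j * (f x \<bullet> g x)) has_derivative
         (\<lambda>v. X x $ j * (f x \<bullet> pd v g x + pd v f x \<bullet> g x) + pd v X x $ j * (f x \<bullet> g x))) (at x)"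
        by (intro has_derivative_mult has_derivative_inner has_derivative_pd d
            bounded_linear.has_derivative [OF bounded_linear_vec_nth] diffs)
      then show ?thesis unfolding G_def by (rule pd_eq)
    qed
    have e: "pd (X x) h x = (\<Sum>j\<in>UNIV. (X x $ j) *\<^sub>R pd (ax j) h x)" if "h differentiable at x" for h :: spinor
      by (rule pd_ax_sum [OF that])
    have l: "lie f x \<bullet> g x + f x \<bullet> lie g x = pd (X x) f x \<bullet> g x + f x \<bullet> pd (X x) g x + 2 * lam x * (f x \<bullet> g x)"
      by (simp add: lie_def cov_def inner_add_left inner_add_right inner_diff_left inner_diff_right imul_inner sig_inner algebra_simps)
    have "(\<Sum>j\<in>UNIV. pd (ax j) (G j) x) = pd (X x) f x \<bullet> g x + f x \<bullet> pd (X x) g x + 3 * lam x * (f x \<bullet> g x)"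
      unfolding pg e [OF d(1)] e [OF d(2)]
      by (simp add: inner_sum_left inner_sum_right sum_3 pd_X algebra_simps)
    moreover have "(\<Sum>j\<in>UNIV. G j x * (lam x * X x $ j + cross3 (X x) (rot x) $ j)) = lam x * (f x \<bullet> g x) * (norm (X x))\<^sup>2"
      unfolding power2_norm_eq_inner by (simp add: sum_3 G_def real3_inner algebra_simps)
    ultimately have "(\<Sum>j\<in>UNIV. pd (ax j) (\<lambda>x. G j x / norm (X x)) x)
       = (pd (X x) f x \<bullet> g x + f x \<bullet> pd (X x) g x + 3 * lam x * (f x \<bullet> g x)) / norm (X x)
         - lam x * (f x \<bullet> g x) * (norm (X x))\<^sup>2 / norm (X x) ^ 3"
      using sum_divergence_weight [where G = G, OF G K(1,2) G0] by simp
    also have "\<dots> = (lie f x \<bullet> g x + f x \<bullet> lie g x) / norm (X x)"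
      unfolding l using False by (simp add: field_simps power2_eq_square power3_eq_cube)
    finally show ?thesis .
  qed (simp add: sum_divergence_weight [where G = G, OF G K(1,2) G0])
  then show ?thesis using integral_divergence_weight [where G = G, OF G K(1,2) G0] by simp
qed

lemma zop_eq:
  assumes "f differentiable at x"
  shows "zop f x = lam x *\<^sub>R f x + (1/2) *\<^sub>R imul (sig (rot x) (f x)) - (\<Sum>j\<in>UNIV. imul (sig (cross3 (X x) (ax j)) (cov A (ax j) f x)))"
proof -
  have "sig (X x) (pdirac A f x) = cov A (X x) f x + (\<Sum>j\<in>UNIV. imul (sig (cross3 (X x) (ax j)) (cov A (ax j) f x)))"
    unfolding pdirac_def sigB.sum_right sig_sig cov_ax_sum [OF assms, of A "X x"] by (simp add: sum.distrib inner_axis)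
  then show ?thesis by (simp add: zop_def lie_def algebra_simps)
qed

lemma zop_symmetric:
  assumes f: "C_upto (Suc 0) f" and g: "C_upto (Suc 0) g"
    and K: "compact K" "K \<subseteq> {x. X x \<noteq> 0}" "\<And>x. x \<notin> K \<Longrightarrow> f x = 0"
  shows "(LINT x|lborel. (zop f x \<bullet> g x - f x \<bullet> zop g x) / norm (X x)) = 0"
proof -
  have d: "f differentiable at x" "g differentiable at x" for x using f g by (auto simp: C_upto_Suc_iff)
  define G where "G j x = imul (sig (cross3 (X x) (ax j)) (f x)) \<bullet> g x" for j x
  have G: "C_upto (Suc 0) (G j)" for j
    unfolding G_def
    by (rule C_upto_inner [OF C_upto_linear [OF bounded_linear_imul C_upto_bilinear [OF bounded_bilinear_sig C_upto_bilinear [OF bounded_bilinear_cross3 X_C_upto C_upto_const] f]] g])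
  have G0: "x \<notin> K \<Longrightarrow> G j x = 0" for j x by (simp add: G_def K)
  have "(\<Sum>j\<in>UNIV. pd (ax j) (\<lambda>x. G j x / norm (X x)) x) = - ((zop f x \<bullet> g x - f x \<bullet> zop g x) / norm (X x))" for x
  proof (cases "X x = 0")
    case False
    have pg: "pd (ax j) (G j) x = imul (sig (cross3 (X x) (ax j)) (f x)) \<bullet> pd (ax j) g x
        + imul (sig (cross3 (X x) (ax j)) (pd (ax j) f x) + sig (cross3 (pd (ax j) X x) (ax j)) (f x)) \<bullet> g x" for j
    proof -
      have "((\<lambda>x. cross3 (X x) (ax j)) has_derivative (\<lambda>v. cross3 (pd v X x) (ax j))) (at x)"
        using bounded_bilinear.FDERIV [OF bounded_bilinear_cross3 has_derivative_pd [OF diffs(1)] has_derivative_const]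
        by (simp add: cross_zero_right)
      then have "((\<lambda>x. imul (sig (cross3 (X x) (ax j)) (f x)) \<bullet> g x) has_derivative
         (\<lambda>v. imul (sig (cross3 (X x) (ax j)) (f x)) \<bullet> pd v g x
           + imul (sig (cross3 (X x) (ax j)) (pd v f x) + sig (cross3 (pd v X x) (ax j)) (f x)) \<bullet> g x)) (at x)"
        by (intro has_derivative_inner has_derivative_pd d bounded_linear.has_derivative [OF bounded_linear_imul] sigB.FDERIV)
      then show ?thesis unfolding G_def by (rule pd_eq)
    qed
    define S where "S = (\<Sum>j\<in>UNIV. imul (sig (cross3 (X x) (ax j)) (f x)) \<bullet> cov A (ax j) g x + imul (sig (cross3 (X x) (ax j)) (cov A (ax j) f x)) \<bullet> g x)"
    have "(\<Sum>j\<in>UNIV. sig (cross3 (pd (ax j) X x) (ax j)) (f x)) = - 2 *\<^sub>R sig (rot x) (f x)"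
      by (simp add: pd_X complex2_eq_iff sum_3 scaleR_complex algebra_simps)
    then have s1: "(\<Sum>j\<in>UNIV. imul (sig (cross3 (pd (ax j) X x) (ax j)) (f x)) \<bullet> g x) = - 2 * (imul (sig (rot x) (f x)) \<bullet> g x)"
      by (simp add: imul_scaleR imul_minus flip: inner_sum_left imul_sum)
    have cS: "imul (sig V (f x)) \<bullet> cov A (ax j) g x + imul (sig V (cov A (ax j) f x)) \<bullet> g x
        = imul (sig V (f x)) \<bullet> pd (ax j) g x + imul (sig V (pd (ax j) f x)) \<bullet> g x" for j V
      by (simp add: cov_def inner_add_left inner_diff_left inner_diff_right imul_inner sig_inner imul_diff imul_scaleR sigB.diff_right sigB.scaleR_right imul_minus)
    have D: "(\<Sum>j\<in>UNIV. pd (ax j) (G j) x) = S - 2 * (imul (sig (rot x) (f x)) \<bullet> g x)"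
      unfolding pg S_def cS using s1 by (simp add: imul_add inner_add_left sum.distrib)
    have V: "(\<Sum>j\<in>UNIV. (lam x * X x $ j + cross3 (X x) (rot x) $ j) *\<^sub>R cross3 (X x) (ax j)) = - (X x \<bullet> X x) *\<^sub>R rot x"
    proof -
      have "(\<Sum>j\<in>UNIV. (lam x * X x $ j + cross3 (X x) (rot x) $ j) *\<^sub>R cross3 (X x) (ax j)) = (X x \<bullet> rot x) *\<^sub>R X x - (X x \<bullet> X x) *\<^sub>R rot x"
        by (simp add: real3_eq_iff sum_3 real3_inner algebra_simps)
      then show ?thesis by (simp add: orth)
    qed
    have "(\<Sum>j\<in>UNIV. (lam x * X x $ j + cross3 (X x) (rot x) $ j) *\<^sub>R (imul (sig (cross3 (X x) (ax j)) (f x)) \<bullet> g x))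
        = - (X x \<bullet> X x) * (imul (sig (rot x) (f x)) \<bullet> g x)"
      using arg_cong [OF V, of "\<lambda>V. imul (sig V (f x)) \<bullet> g x"]
      by (simp add: sigB.sum_left sigB.scaleR_left sigB.minus_left imul_sum imul_scaleR imul_minus inner_sum_left)
    then have W: "(\<Sum>j\<in>UNIV. G j x * (lam x * X x $ j + cross3 (X x) (rot x) $ j)) = - ((norm (X x))\<^sup>2) * (imul (sig (rot x) (f x)) \<bullet> g x)"
      by (simp add: G_def power2_norm_eq_inner mult.commute)
    have Z: "zop f x \<bullet> g x - f x \<bullet> zop g x = imul (sig (rot x) (f x)) \<bullet> g x - S"
      unfolding zop_eq [OF d(1)] zop_eq [OF d(2)] S_def
      by (simp add: inner_add_left inner_add_right inner_diff_left inner_diff_right inner_sum_left inner_sum_right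
          imul_inner sig_inner sum.distrib sum_negf sum_subtractf algebra_simps)
    have "(\<Sum>j\<in>UNIV. pd (ax j) (\<lambda>x. G j x / norm (X x)) x)
       = (S - 2 * (imul (sig (rot x) (f x)) \<bullet> g x)) / norm (X x) + (norm (X x))\<^sup>2 * (imul (sig (rot x) (f x)) \<bullet> g x) / norm (X x) ^ 3"
      using sum_divergence_weight [where G = G, OF G K(1,2) G0] D W by simp
    also have "\<dots> = - ((zop f x \<bullet> g x - f x \<bullet> zop g x) / norm (X x))"
      unfolding Z using False by (simp add: field_simps power2_eq_square power3_eq_cube)
    finally show ?thesis .
  qed (simp add: sum_divergence_weight [where G = G, OF G K(1,2) G0])
  moreover have "(LINT x|lborel. (\<Sum>j\<in>UNIV. pd (ax j) (\<lambda>x. G j x / norm (X x)) x)) = 0"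
    by (rule integral_divergence_weight [OF G K(1,2)]) (rule G0)
  ultimately have "(LINT x|lborel. - ((zop f x \<bullet> g x - f x \<bullet> zop g x) / norm (X x))) = 0"
    by (simp only:)
  then show ?thesis by (simp only: Bochner_Integration.integral_minus neg_equal_0_iff_equal)
qed

lemma lie_C_upto: "C_upto (Suc k) f \<Longrightarrow> C_upto k A \<Longrightarrow> C_upto k (lie f)"
proof -
  assume f: "C_upto (Suc k) f" and A: "C_upto k A"
  have d: "f differentiable at x" for x using f by (simp add: C_upto_Suc_iff)
  have "lie f = (\<lambda>x. (\<Sum>j\<in>UNIV. (X x $ j) *\<^sub>R cov A (ax j) f x) + lam x *\<^sub>R f x + (1/2) *\<^sub>R imul (sig (rot x) (f x)))"
    unfolding lie_def [abs_def] using cov_ax_sum [OF d] by metis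
  moreover have "C_upto k (\<lambda>x. (\<Sum>j\<in>UNIV. (X x $ j) *\<^sub>R cov A (ax j) f x) + lam x *\<^sub>R f x + (1/2) *\<^sub>R imul (sig (rot x) (f x)))"
    by (rule C_upto_add [OF C_upto_add [OF C_upto_sum [OF C_upto_scaleR [OF C_upto_nth [OF X_C_upto] cov_C_upto [OF f A]]]
         C_upto_scaleR [OF lam_C_upto C_upto_Suc_lower [OF f]]] C_upto_scaleR [OF C_upto_const C_upto_linear [OF bounded_linear_imul
         C_upto_bilinear [OF bounded_bilinear_sig rot_C_upto C_upto_Suc_lower [OF f]]]]])
  ultimately show "C_upto k (lie f)" by simp
qed

lemma zop_C_upto: "C_upto (Suc k) f \<Longrightarrow> C_upto k A \<Longrightarrow> C_upto k (zop f)"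
  unfolding zop_def [abs_def]
  by (rule C_upto_diff [OF lie_C_upto C_upto_bilinear [OF bounded_bilinear_sig X_C_upto pdirac_C_upto]])

lemma lie_diff:
  assumes "f differentiable at x" "g differentiable at x"
  shows "lie (\<lambda>x. f x - g x) x = lie f x - lie g x"
proof -
  have "pd v (\<lambda>x. f x - g x) x = pd v f x - pd v g x" for v
    by (rule pd_eq [OF has_derivative_diff [OF has_derivative_pd [OF assms(1)] has_derivative_pd [OF assms(2)]]])
  then show ?thesis
    by (simp add: lie_def cov_def imul_diff sigB.diff_right scaleR_diff_right)
qed

lemma lie_zop_commute:
  assumes f: "C_upto 2 f"
  shows "lie (zop f) x = zop (lie f) x"
proof -
  have f2: "C_upto (Suc (Suc 0)) f" using f by (simp only: numeral_2_eq_2)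
  have dP: "pdirac A f differentiable at x" "lie f differentiable at x" for x
    using pdirac_C_upto [OF f2 A_C1] lie_C_upto [OF f2 A_C1] by (auto simp: C_upto_Suc_iff)
  have ds: "(\<lambda>x. sig (X x) (pdirac A f x)) differentiable at x" for x
    using sigB.FDERIV [OF has_derivative_pd [OF diffs(1)] has_derivative_pd [OF dP(1)]] by (auto simp: differentiable_def)
  have z: "zop f = (\<lambda>x. lie f x - sig (X x) (pdirac A f x))" by (simp add: zop_def fun_eq_iff)
  show ?thesis
    unfolding zop_def [of "lie f" x] pdirac_lie [OF f] z lie_diff [OF dP(2) ds] lie_sig [OF dP(1)]
    by (simp add: sigB.add_right sigB.scaleR_right)
qed

theorem lie_integral_le_dirac_integral:
  assumes f: "C_upto 2 f" and K: "compact K" "K \<subseteq> {x. X x \<noteq> 0}" "\<And>x. x \<notin> K \<Longrightarrow> f x = 0"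
  shows "integrable lborel (\<lambda>x. (norm (lie f x))\<^sup>2 / norm (X x))"
    "(LINT x|lborel. (norm (lie f x))\<^sup>2 / norm (X x)) \<le> (LINT x|lborel. norm (X x) * (norm (dirac A f x))\<^sup>2)"
proof -
  have f2: "C_upto (Suc (Suc 0)) f" using f by (simp only: numeral_2_eq_2)
  have f1: "C_upto (Suc 0) f" by (rule C_upto_Suc_lower [OF f2])
  have oK: "open (- K)" using K by (simp add: compact_imp_closed open_Compl)
  have L1: "C_upto (Suc 0) (lie f)" and Z1: "C_upto (Suc 0) (zop f)"
    by (rule lie_C_upto [OF f2 A_C1] zop_C_upto [OF f2 A_C1])+
  have P1: "C_upto (Suc 0) (pdirac A f)" by (rule pdirac_C_upto [OF f2 A_C1])
  note cont = C_upto_imp_continuous_on [OF L1] C_upto_imp_continuous_on [OF Z1] C_upto_imp_continuous_on [OF P1]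
    C_upto_imp_continuous_on [OF f1]
  have A0: "C_upto 0 A" by (rule C_upto_Suc_lower [OF A_C1])
  have cLL: "continuous_on UNIV (lie (lie f))" "continuous_on UNIV (lie (zop f))" "continuous_on UNIV (zop (lie f))"
    by (rule C_upto_imp_continuous_on, rule lie_C_upto [OF L1 A0] lie_C_upto [OF Z1 A0] zop_C_upto [OF L1 A0])+
  have cov0: "cov A v g x = 0" if "x \<notin> K" "\<And>x. x \<notin> K \<Longrightarrow> g x = 0" for v x g
    by (rule cov_eq_0 [OF oK]) (use that in auto)
  have P0: "pdirac A f x = 0" if "x \<notin> K" for x
    unfolding pdirac_def using cov0 [OF that] K(3) by simp
  have L0: "lie f x = 0" if "x \<notin> K" for x
    unfolding lie_def using cov0 [OF that] K(3) that by simp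
  have Z0: "zop f x = 0" if "x \<notin> K" for x
    using L0 P0 that by (simp add: zop_def)
  have i1: "integrable lborel (\<lambda>x. (lie f x \<bullet> zop f x) / norm (X x))"
    by (rule div_weight_integrable [OF _ K(1,2)]) (auto intro!: continuous_intros cont simp: L0)
  have i2: "integrable lborel (\<lambda>x. (f x \<bullet> lie (zop f) x) / norm (X x))"
    by (rule div_weight_integrable [OF _ K(1,2)]) (auto intro!: continuous_intros cont cLL simp: K(3))
  have "(LINT x|lborel. (lie f x \<bullet> zop f x + f x \<bullet> lie (zop f) x) / norm (X x)) = 0"
    by (rule lie_skew [OF f1 Z1 K])
  moreover have "(LINT x|lborel. (zop f x \<bullet> lie f x - f x \<bullet> zop (lie f) x) / norm (X x)) = 0"
    by (rule zop_symmetric [OF f1 L1 K])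
  ultimately have z: "(LINT x|lborel. (lie f x \<bullet> zop f x) / norm (X x)) = 0"
    using i1 i2 unfolding lie_zop_commute [OF f, symmetric]
    by (simp add: add_divide_distrib diff_divide_distrib inner_commute [of "zop f x" "lie f x" for x])
  have i3: "integrable lborel (\<lambda>x. (norm (lie f x))\<^sup>2 / norm (X x))"
    by (rule div_weight_integrable [OF _ K(1,2)]) (auto intro!: continuous_intros cont simp: L0)
  then show "integrable lborel (\<lambda>x. (norm (lie f x))\<^sup>2 / norm (X x))" .
  have i4: "integrable lborel (\<lambda>x. norm (X x) * (norm (pdirac A f x))\<^sup>2)"
  proof -
    obtain r where "supp_in (\<lambda>x. norm (X x) * (norm (pdirac A f x))\<^sup>2) r"
      using compact_supp_in [OF K(1), of "\<lambda>x. norm (X x) * (norm (pdirac A f x))\<^sup>2"] P0 by auto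
    then show ?thesis by (rule supp_in_integrable [rotated]) (auto intro!: continuous_intros cont X_continuous)
  qed
  have "(norm (lie f x))\<^sup>2 / norm (X x) \<le> 2 * ((lie f x \<bullet> zop f x) / norm (X x)) + norm (X x) * (norm (pdirac A f x))\<^sup>2" for x
  proof (cases "X x = 0")
    case False
    define w l p where "w = norm (X x)" "l = lie f x" "p = sig (X x) (pdirac A f x)"
    have w: "w > 0" using False by (simp add: w_l_p_def)
    have "2 * (l \<bullet> p) \<le> l \<bullet> l + p \<bullet> p"
      using inner_ge_zero [of "l - p"] by (simp add: inner_diff inner_commute)
    then have "l \<bullet> l \<le> 2 * (l \<bullet> (l - p)) + p \<bullet> p" by (simp add: inner_diff_right)
    then have "(norm l)\<^sup>2 / w \<le> (2 * (l \<bullet> (l - p)) + (norm p)\<^sup>2) / w"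
      using w by (intro divide_right_mono) (auto simp: power2_norm_eq_inner)
    also have "\<dots> = 2 * ((l \<bullet> (l - p)) / w) + (w * norm (pdirac A f x))\<^sup>2 / w"
      by (simp add: w_l_p_def norm_sig add_divide_distrib)
    also have "(w * norm (pdirac A f x))\<^sup>2 / w = w * (norm (pdirac A f x))\<^sup>2"
      using w by (simp add: power2_eq_square)
    finally show ?thesis by (simp add: w_l_p_def zop_def)
  qed (simp add: L0 K)
  then have "(LINT x|lborel. (norm (lie f x))\<^sup>2 / norm (X x))
      \<le> (LINT x|lborel. 2 * ((lie f x \<bullet> zop f x) / norm (X x)) + norm (X x) * (norm (pdirac A f x))\<^sup>2)"
    by (intro integral_mono i3 Bochner_Integration.integrable_add integrable_mult_right i1 i4)
  also have "\<dots> = (LINT x|lborel. norm (X x) * (norm (dirac A f x))\<^sup>2)"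
    using i1 i4 z by (simp add: norm_dirac del: times_divide_eq_right)
  finally show "(LINT x|lborel. (norm (lie f x))\<^sup>2 / norm (X x)) \<le> (LINT x|lborel. norm (X x) * (norm (dirac A f x))\<^sup>2)" .
qed

end



subsection \<open>transfer\<close>

lemma conv_supp_near:
  assumes "supp_in \<rho> e" "\<And>y. y \<notin> K \<Longrightarrow> f y = 0" "\<And>y. y \<in> K \<Longrightarrow> e < dist x y"
  shows "conv \<rho> f x = 0"
proof -
  have "\<rho> (x - y) *\<^sub>R f y = 0" for y
    using assms(2) [of y] assms(3) [of y] supp_inD [OF assms(1), of "x - y"] by (cases "y \<in> K") (auto simp: dist_norm)
  then show ?thesis by (simp only: conv_def integral_zero)
qed

lemma compact_neighbourhood:
  fixes K U :: "'a::euclidean_space set"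
  assumes K: "compact K" and U: "open U" "K \<subseteq> U"
  obtains e K' where "e > 0" "compact K'" "K \<subseteq> K'" "K' \<subseteq> U" "\<And>x y. y \<in> K \<Longrightarrow> x \<notin> K' \<Longrightarrow> e < dist x y"
proof -
  obtain d where d: "d > 0" "(\<Union>x\<in>K. cball x d) \<subseteq> U"
  proof -
    obtain e where e: "e > 0" "(\<Union>x\<in>K. ball x e) \<subseteq> U"
      using compact_subset_open_imp_ball_epsilon_subset [OF K U] .
    have "cball x (e / 2) \<subseteq> ball x e" for x using e(1) by (auto simp: dist_commute)
    then show ?thesis using that [of "e / 2"] e by fastforce
  qed
  define K' where "K' = {x + y | x y. x \<in> K \<and> y \<in> cball 0 d}"
  have c: "compact K'" unfolding K'_def by (rule compact_sums [OF K compact_cball])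
  have m: "z \<in> K' \<longleftrightarrow> (\<exists>x\<in>K. dist x z \<le> d)" for z
  proof
    assume "z \<in> K'"
    then obtain x y where "z = x + y" "x \<in> K" "norm y \<le> d" by (auto simp: K'_def)
    then show "\<exists>x\<in>K. dist x z \<le> d" by (intro bexI [of _ x]) (auto simp: dist_norm)
  next
    assume "\<exists>x\<in>K. dist x z \<le> d"
    then obtain x where "x \<in> K" "dist x z \<le> d" by blast
    then have "z = x + (z - x) \<and> x \<in> K \<and> z - x \<in> cball 0 d" by (simp add: dist_norm norm_minus_commute)
    then show "z \<in> K'" unfolding K'_def by blast
  qed
  show ?thesis
  proof (rule that [OF d(1) c])
    show "K \<subseteq> K'"
    proof
      fix x assume x: "x \<in> K"
      have "dist x x \<le> d" using d(1) by simp
      with x show "x \<in> K'" unfolding m by blast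
    qed
    show "K' \<subseteq> U"
    proof
      fix z assume "z \<in> K'"
      then obtain x where "x \<in> K" "z \<in> cball x d" unfolding m by auto
      then show "z \<in> U" using d(2) by blast
    qed
    show "d < dist x y" if "y \<in> K" "x \<notin> K'" for x y
    proof (rule ccontr)
      assume "\<not> d < dist x y"
      then have "dist y x \<le> d" by (simp add: dist_commute)
      with that show False unfolding m by blast
    qed
  qed
qed

lemma bounded_on_compact_extension:
  fixes W :: "'a::euclidean_space \<Rightarrow> real"
  assumes "compact K" "continuous_on K W"
  obtains V B where "V \<in> borel_measurable lborel" "\<And>x. \<bar>V x\<bar> \<le> B" "\<And>x. x \<in> K \<Longrightarrow> V x = W x"
proof -
  have Kb: "K \<in> sets borel" using assms(1) by (rule borel_compact)
  have "compact (W ` K)" by (rule compact_continuous_image [OF assms(2,1)])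
  then obtain B where B: "B > 0" "\<And>x. x \<in> K \<Longrightarrow> norm (W x) \<le> B"
    using compact_imp_bounded bounded_pos by (metis imageI)
  have "(\<lambda>x. indicator K x *\<^sub>R W x) \<in> borel_measurable borel"
    by (rule borel_measurable_continuous_on_indicator [OF Kb assms(2)])
  then show ?thesis
    using that [of "\<lambda>x. indicator K x *\<^sub>R W x" B] B by (auto simp: indicator_def)
qed

lemma weak_solution_inequality:
  assumes W: "weak_dirac A \<psi> (\<lambda>x. 0)" and A: "continuous_on UNIV A"
    and U: "open U" and w: "continuous_on U w" "continuous_on U w'"
    and ineq: "\<And>f K. C_upto 2 f \<Longrightarrow> compact K \<Longrightarrow> K \<subseteq> U \<Longrightarrow> (\<And>x. x \<notin> K \<Longrightarrow> f x = 0) \<Longrightarrow>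
        (LINT x|lborel. w' x * (norm (f x))\<^sup>2) \<le> (LINT x|lborel. w x * (norm (dirac A f x))\<^sup>2)"
    and h: "C_upto (Suc 0) h" and K: "compact K" "K \<subseteq> U" "\<And>x. x \<notin> K \<Longrightarrow> h x = 0"
  shows "(LINT x|lborel. w' x * ((h x)\<^sup>2 * (norm (\<psi> x))\<^sup>2)) \<le> (LINT x|lborel. w x * ((norm (grad h x))\<^sup>2 * (norm (\<psi> x))\<^sup>2))"
proof -
  obtain e K' where K': "e > 0" "compact K'" "K \<subseteq> K'" "K' \<subseteq> U" "\<And>x y. y \<in> K \<Longrightarrow> x \<notin> K' \<Longrightarrow> e < dist x y"
    using compact_neighbourhood [OF K(1) U K(2)] by metis
  have "\<exists>r. supp_in h r" by (rule compact_supp_in [OF K(1)]) (rule K(3))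
  then obtain r where r: "supp_in h r" ..
  define f where "f x = h x *\<^sub>R \<psi> x" for x
  define g where "g x = h x *\<^sub>R (0 :: complex^2) - imul (sig (grad h x) (\<psi> x))" for x
  have fg: "weak_dirac A f g" unfolding f_def g_def by (rule weak_dirac_localize [OF W A h r])
  have oK: "open (- K)" using K by (simp add: compact_imp_closed open_Compl)
  have f0: "f x = 0" if "x \<notin> K" for x using that K(3) by (simp add: f_def)
  have gr0: "grad h x = 0" if "x \<notin> K" for x
    unfolding grad_def using pd_eq_0 [OF oK, of x h] that K(3) by (simp add: vec_eq_iff)
  have g0: "g x = 0" if "x \<notin> K" for x using gr0 [OF that] by (simp add: g_def)
  have fs: "supp_in f r" and gs: "supp_in g r"
    using r supp_in_grad [OF r] by (auto simp: f_def g_def supp_in_def)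
  define F where "F n = conv (mseq n) f" for n
  have lim: "l2_lim F f" "l2_lim (\<lambda>n. dirac A (F n)) g"
    unfolding F_def by (rule l2_lim_dirac_mollify [OF fg A fs gs])+
  obtain v b where v: "v \<in> borel_measurable lborel" "\<And>x. \<bar>v x\<bar> \<le> b" "\<And>x. x \<in> K' \<Longrightarrow> v x = w x"
    using bounded_on_compact_extension [OF K'(2) continuous_on_subset [OF w(1) K'(4)]] by metis
  obtain v' b' where v': "v' \<in> borel_measurable lborel" "\<And>x. \<bar>v' x\<bar> \<le> b'" "\<And>x. x \<in> K' \<Longrightarrow> v' x = w' x"
    using bounded_on_compact_extension [OF K'(2) continuous_on_subset [OF w(2) K'(4)]] by metis
  have oK': "open (- K')" using K' by (simp add: compact_imp_closed open_Compl)
  have ev: "eventually (\<lambda>n. (LINT x|lborel. v' x * (norm (F n x))\<^sup>2) \<le> (LINT x|lborel. v x * (norm (dirac A (F n) x))\<^sup>2)) sequentially"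
    using order_tendstoD(2) [OF LIMSEQ_inverse_real_of_nat K'(1)]
  proof eventually_elim
    case (elim n)
    have F0: "F n x = 0" if "x \<notin> K'" for x
      unfolding F_def
    proof (rule conv_supp_near [OF mseq(3) f0])
      show "inverse (real (Suc n)) < dist x y" if "y \<in> K" for y
        using K'(5) [OF that \<open>x \<notin> K'\<close>] elim by linarith
    qed
    have D0: "dirac A (F n) x = 0" if "x \<notin> K'" for x
    proof -
      have "pd u (F n) x = 0" for u by (rule pd_eq_0 [OF oK']) (use that F0 in auto)
      then show ?thesis using F0 [OF that] by (simp add: dirac_def)
    qed
    have "sq_int f" using lim(1) by (simp add: l2_lim_def)
    then have fi: "integrable lborel f" by (rule sq_int_supp_in_integrable [OF _ fs])
    have "C_upto 2 (F n)"
      unfolding F_def numeral_2_eq_2 by (rule conv_C_upto [OF mseq(1,4) fi])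
    from ineq [OF this K'(2,4) F0]
    have "(LINT x|lborel. w' x * (norm (F n x))\<^sup>2) \<le> (LINT x|lborel. w x * (norm (dirac A (F n) x))\<^sup>2)" .
    moreover have "w' x * (norm (F n x))\<^sup>2 = v' x * (norm (F n x))\<^sup>2" for x
      using v'(3) F0 by (cases "x \<in> K'") auto
    moreover have "w x * (norm (dirac A (F n) x))\<^sup>2 = v x * (norm (dirac A (F n) x))\<^sup>2" for x
      using v(3) D0 by (cases "x \<in> K'") auto
    ultimately show ?case by simp
  qed
  have "(LINT x|lborel. v' x * (norm (f x))\<^sup>2) \<le> (LINT x|lborel. v x * (norm (g x))\<^sup>2)"
    by (rule tendsto_le [OF sequentially_bot l2_lim_weighted [OF lim(2) v(1,2)] l2_lim_weighted [OF lim(1) v'(1,2)] ev])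
  moreover have "v' x * (norm (f x))\<^sup>2 = w' x * ((h x)\<^sup>2 * (norm (\<psi> x))\<^sup>2)" for x
    using v'(3) K'(3) f0 K(3) by (cases "x \<in> K") (auto simp: f_def power_mult_distrib)
  moreover have "v x * (norm (g x))\<^sup>2 = w x * ((norm (grad h x))\<^sup>2 * (norm (\<psi> x))\<^sup>2)" for x
    using v(3) K'(3) g0 gr0 by (cases "x \<in> K") (auto simp: g_def power_mult_distrib norm_sig)
  ultimately show ?thesis by simp
qed

subsection \<open>constant field\<close>

lemma const_conformal_dirac:
  assumes "C_upto (Suc 0) A" "\<And>x. cross3 e (curl A x) = 0"
  shows "conformal_dirac (\<lambda>x. e) (\<lambda>x. 0) A (\<lambda>x. 0) 0"
  by unfold_locales (use assms in \<open>auto simp: cross_zero_left\<close>)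

lemma slab_poincare:
  fixes f :: spinor
  assumes f: "C_upto (Suc 0) f" "supp_in f r" and e: "norm e = 1" and r: "r \<ge> 0"
    and A: "continuous_on UNIV A"
  shows "(LINT x|lborel. (norm (f x))\<^sup>2) \<le> 4 * r\<^sup>2 * (LINT x|lborel. (norm (cov A e f x))\<^sup>2)"
  proof -
  have d: "f differentiable at x" for x using f by (simp add: C_upto_Suc_iff)
  define g where "g x = (x \<bullet> e) * (f x \<bullet> f x)" for x
  have g: "C_upto (Suc 0) g"
    unfolding g_def by (rule C_upto_mult [OF C_upto_inner [OF C_upto_id C_upto_const] C_upto_inner [OF f(1) f(1)]])
  have gs: "supp_in g r" using f(2) by (simp add: g_def supp_in_def)
  have pg: "pd e g x = (norm (f x))\<^sup>2 + 2 * (x \<bullet> e) * (f x \<bullet> cov A e f x)" for x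
  proof -
    have "(g has_derivative (\<lambda>v. (x \<bullet> e) * (f x \<bullet> pd v f x + pd v f x \<bullet> f x) + (v \<bullet> e) * (f x \<bullet> f x))) (at x)"
      unfolding g_def
      by (intro has_derivative_mult has_derivative_inner has_derivative_pd d has_derivative_inner_left has_derivative_ident)
    from pd_eq [OF this, of e] show ?thesis
      using e by (simp add: cov_def inner_diff_right inner_commute power2_norm_eq_inner norm_eq_1)
  qed
  have cc: "continuous_on UNIV (cov A e f)"
    unfolding cov_def [abs_def]
    by (intro continuous_intros imul_continuous_on C_upto_imp_continuous_on [OF f(1)] C_upto_imp_continuous_on [OF C_upto_pd [OF f(1)]] A)
  have cs: "supp_in (cov A e f) r"
    using f(2) supp_in_pd [OF f(2)] by (auto simp: supp_in_def cov_def)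
  have i: "integrable lborel (\<lambda>x. (norm (f x))\<^sup>2)" "integrable lborel (\<lambda>x. (norm (cov A e f x))\<^sup>2)"
    using sq_int_test(1) [OF f] sq_int_supp_in [OF cc cs] by (auto simp: sq_int_def)
  have pi: "integrable lborel (pd e g)"
    by (rule supp_in_integrable [OF C_upto_imp_continuous_on [OF C_upto_pd [OF g]] supp_in_pd [OF gs]])
  have "(norm (f x))\<^sup>2 \<le> 2 * pd e g x + 4 * r\<^sup>2 * (norm (cov A e f x))\<^sup>2" for x
  proof (cases "norm x \<le> r")
    case True
    define a b t where "a = norm (f x)" "b = norm (cov A e f x)" "t = x \<bullet> e"
    have "\<bar>t\<bar> \<le> r" using Cauchy_Schwarz_ineq2 [of x e] e True by (simp add: a_b_t_def)
    then have t: "t\<^sup>2 \<le> r\<^sup>2" by (simp add: abs_le_square_iff [symmetric])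
    define q p where "q = t * (f x \<bullet> cov A e f x)" "p = \<bar>t\<bar> * (a * b)"
    have "\<bar>q\<bar> \<le> p"
      unfolding q_p_def abs_mult using Cauchy_Schwarz_ineq2 [of "f x" "cov A e f x"]
      by (intro mult_left_mono) (auto simp: a_b_t_def)
    moreover have "pd e g x = a\<^sup>2 + 2 * q" unfolding pg by (simp add: a_b_t_def q_p_def)
    moreover have "0 \<le> (a - 2 * (\<bar>t\<bar> * b))\<^sup>2" by simp
    then have "4 * p \<le> a\<^sup>2 + 4 * (t\<^sup>2 * b\<^sup>2)"
      unfolding power2_diff by (simp add: power_mult_distrib q_p_def mult_ac)
    moreover have "t\<^sup>2 * b\<^sup>2 \<le> r\<^sup>2 * b\<^sup>2" using t by (intro mult_right_mono) auto
    ultimately have "a\<^sup>2 \<le> 2 * pd e g x + 4 * (r\<^sup>2 * b\<^sup>2)" by linarith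
    then show ?thesis by (simp add: a_b_t_def)
  next
    case False
    then show ?thesis using f(2) supp_in_pd [OF gs, of e] cs by (simp add: supp_in_def)
  qed
  then have "(LINT x|lborel. (norm (f x))\<^sup>2) \<le> (LINT x|lborel. 2 * pd e g x + 4 * r\<^sup>2 * (norm (cov A e f x))\<^sup>2)"
    by (intro integral_mono i Bochner_Integration.integrable_add integrable_mult_right pi)
  also have "\<dots> = 4 * r\<^sup>2 * (LINT x|lborel. (norm (cov A e f x))\<^sup>2)"
    using i pi integral_pd_eq_0 [OF g gs] by simp
  finally show ?thesis .
qed

lemma no_weak_solution_const:
  assumes W: "weak_dirac A \<psi> (\<lambda>x. 0)" and A: "C_upto (Suc 0) A"
    and e: "norm e = 1" and par: "\<And>x. cross3 e (curl A x) = 0"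
  shows "AE x in lborel. \<psi> x = 0"
proof -
  interpret conformal_dirac "\<lambda>x. e" "\<lambda>x. 0" A "\<lambda>x. 0" 0
    by (rule const_conformal_dirac [OF A par])
  have Ac: "continuous_on UNIV A" by (rule C_upto_imp_continuous_on [OF A])
  have e0: "e \<noteq> 0" using e by auto
  have sq: "sq_int \<psi>" by (rule weak_dirac_sq_int(1) [OF W])
  then have i2: "integrable lborel (\<lambda>x. (norm (\<psi> x))\<^sup>2)" and m: "\<psi> \<in> borel_measurable borel"
    by (auto simp: sq_int_def)
  have key: "(LINT x|lborel. indicator (cball 0 R) x * (norm (\<psi> x))\<^sup>2)
      \<le> 16384 * (LINT x|lborel. indicator {x. R \<le> norm x} x * (norm (\<psi> x))\<^sup>2)" if R: "R > 0" for R
  proof -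
    define r where "r = 4 * R"
    have r: "r > 0" using R by (simp add: r_def)
    have "(LINT x|lborel. 1 / (4 * r\<^sup>2) * ((cutoff R x)\<^sup>2 * (norm (\<psi> x))\<^sup>2))
        \<le> (LINT x|lborel. 1 * ((norm (grad (cutoff R) x))\<^sup>2 * (norm (\<psi> x))\<^sup>2))"
    proof (rule weak_solution_inequality [OF W Ac open_ball [of 0 r] _ _ _ cutoff(1) [OF R] compact_cball [of 0 "2 * R"]])
      fix f :: spinor and K :: "(real^3) set"
      assume f: "C_upto 2 f" and K: "compact K" "K \<subseteq> ball 0 r" "\<And>x. x \<notin> K \<Longrightarrow> f x = 0"
      have f1: "C_upto (Suc 0) f" by (rule C_upto_mono [OF f]) simp
      have fr: "supp_in f r" using K by (force simp: supp_in_def)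
      have lie: "lie f x = cov A e f x" for x by (simp add: lie_def sigB.zero_left)
      have Ke: "K \<subseteq> {x. e \<noteq> 0}" using e0 by simp
      have "(LINT x|lborel. (norm (cov A e f x))\<^sup>2) \<le> (LINT x|lborel. (norm (dirac A f x))\<^sup>2)"
        using lie_integral_le_dirac_integral(2) [OF f K(1) Ke K(3)] e by (simp add: lie)
      then have "4 * r\<^sup>2 * (LINT x|lborel. (norm (cov A e f x))\<^sup>2) \<le> 4 * r\<^sup>2 * (LINT x|lborel. (norm (dirac A f x))\<^sup>2)"
        by (intro mult_left_mono) auto
      then have "(LINT x|lborel. (norm (f x))\<^sup>2) \<le> 4 * r\<^sup>2 * (LINT x|lborel. (norm (dirac A f x))\<^sup>2)"
        using slab_poincare [OF f1 fr e less_imp_le [OF r] Ac] by linarith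
      then have "1 / (4 * r\<^sup>2) * (LINT x|lborel. (norm (f x))\<^sup>2) \<le> (LINT x|lborel. (norm (dirac A f x))\<^sup>2)"
        using r by (simp add: field_simps)
      then show "(LINT x|lborel. 1 / (4 * r\<^sup>2) * (norm (f x))\<^sup>2) \<le> (LINT x|lborel. 1 * (norm (dirac A f x))\<^sup>2)"
        by simp
    next
      show "cball 0 (2 * R) \<subseteq> ball (0 :: real^3) r" using R by (auto simp: r_def)
      show "cutoff R x = 0" if "x \<notin> cball 0 (2 * R)" for x
        using cutoff(3) [OF R] that by (simp add: supp_in_def)
    qed (auto intro: continuous_intros)
    then have 1: "(LINT x|lborel. (cutoff R x)\<^sup>2 * (norm (\<psi> x))\<^sup>2)
        \<le> 4 * r\<^sup>2 * (LINT x|lborel. (norm (grad (cutoff R) x))\<^sup>2 * (norm (\<psi> x))\<^sup>2)"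
      using r by (simp add: field_simps)
    have cm: "cutoff R \<in> borel_measurable borel" "grad (cutoff R) \<in> borel_measurable borel"
      using C_upto_imp_continuous_on [OF cutoff(1) [OF R]] grad_continuous [OF cutoff(1) [OF R]]
      by (auto intro: borel_measurable_continuous_onI)
    have "(LINT x|lborel. indicator (cball 0 R) x * (norm (\<psi> x))\<^sup>2) \<le> (LINT x|lborel. (cutoff R x)\<^sup>2 * (norm (\<psi> x))\<^sup>2)"
    proof (rule integral_mono)
      show "integrable lborel (\<lambda>x. indicator (cball 0 R) x * (norm (\<psi> x))\<^sup>2)"
        by (rule Bochner_Integration.integrable_bound [OF i2]) (use m in \<open>auto simp: indicator_def\<close>)
      show "integrable lborel (\<lambda>x. (cutoff R x)\<^sup>2 * (norm (\<psi> x))\<^sup>2)"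
        by (rule Bochner_Integration.integrable_bound [OF i2])
          (use m cm cutoff(4,5) [OF R] in \<open>auto intro!: mult_left_le_one_le power_le_one\<close>)
      show "indicator (cball 0 R) x * (norm (\<psi> x))\<^sup>2 \<le> (cutoff R x)\<^sup>2 * (norm (\<psi> x))\<^sup>2" for x
        using cutoff(2) [OF R, of x] by (auto simp: indicator_def)
    qed
    also note 1
    also have "4 * r\<^sup>2 * (LINT x|lborel. (norm (grad (cutoff R) x))\<^sup>2 * (norm (\<psi> x))\<^sup>2)
       \<le> 4 * r\<^sup>2 * (LINT x|lborel. (16 / R)\<^sup>2 * (indicator {x. R \<le> norm x} x * (norm (\<psi> x))\<^sup>2))"
    proof (rule mult_left_mono [OF integral_mono])
      have gb: "(norm (grad (cutoff R) x))\<^sup>2 * (norm (\<psi> x))\<^sup>2 \<le> (16 / R)\<^sup>2 * (norm (\<psi> x))\<^sup>2" for x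
        using power_mono [OF cutoff(6) [OF R] norm_ge_zero, of x 2] by (rule mult_right_mono) simp
      show "integrable lborel (\<lambda>x. (norm (grad (cutoff R) x))\<^sup>2 * (norm (\<psi> x))\<^sup>2)"
        by (rule Bochner_Integration.integrable_bound [OF integrable_mult_right [OF i2, of "(16 / R)\<^sup>2"]])
          (use m cm gb in \<open>auto simp: power_divide\<close>)
      show "integrable lborel (\<lambda>x. (16 / R)\<^sup>2 * (indicator {x. R \<le> norm x} x * (norm (\<psi> x))\<^sup>2))"
        by (intro integrable_mult_right Bochner_Integration.integrable_bound [OF i2]) (use m in \<open>auto simp: indicator_def\<close>)
      show "(norm (grad (cutoff R) x))\<^sup>2 * (norm (\<psi> x))\<^sup>2 \<le> (16 / R)\<^sup>2 * (indicator {x. R \<le> norm x} x * (norm (\<psi> x))\<^sup>2)" for x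
        using gb [of x] cutoff(7) [OF R, of x] by (cases "R \<le> norm x") auto
    qed simp
    also have "\<dots> = 16384 * (LINT x|lborel. indicator {x. R \<le> norm x} x * (norm (\<psi> x))\<^sup>2)"
      using R by (simp add: r_def power_divide power_mult_distrib)
    finally show ?thesis .
  qed
  have lim1: "(\<lambda>n. LINT x|lborel. indicator (cball 0 (real (Suc n))) x * (norm (\<psi> x))\<^sup>2) \<longlonglongrightarrow> (LINT x|lborel. (norm (\<psi> x))\<^sup>2)"
  proof (rule integral_dominated_convergence [where w = "\<lambda>x. (norm (\<psi> x))\<^sup>2"])
    show "AE x in lborel. (\<lambda>n. indicator (cball 0 (real (Suc n))) x * (norm (\<psi> x))\<^sup>2) \<longlonglongrightarrow> (norm (\<psi> x))\<^sup>2"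
    proof (intro AE_I2 tendsto_eventually)
      fix x
      show "eventually (\<lambda>n. indicator (cball 0 (real (Suc n))) x * (norm (\<psi> x))\<^sup>2 = (norm (\<psi> x))\<^sup>2) sequentially"
        using eventually_ge_at_top [of "nat \<lceil>norm x\<rceil>"]
      proof eventually_elim
        case (elim n)
        then have "norm x \<le> real (Suc n)" by linarith
        then show ?case by simp
      qed
    qed
  qed (use m i2 in \<open>auto simp: indicator_def\<close>)
  have lim2: "(\<lambda>n. LINT x|lborel. indicator {x. real (Suc n) \<le> norm x} x * (norm (\<psi> x))\<^sup>2) \<longlonglongrightarrow> (LINT x|(lborel::(real^3) measure). 0)"
  proof (rule integral_dominated_convergence [where w = "\<lambda>x. (norm (\<psi> x))\<^sup>2"])
    show "AE x in lborel. (\<lambda>n. indicator {x. real (Suc n) \<le> norm x} x * (norm (\<psi> x))\<^sup>2) \<longlonglongrightarrow> 0"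
    proof (intro AE_I2 tendsto_eventually)
      fix x
      show "eventually (\<lambda>n. indicator {x. real (Suc n) \<le> norm x} x * (norm (\<psi> x))\<^sup>2 = 0) sequentially"
        using eventually_ge_at_top [of "nat \<lceil>norm x\<rceil>"]
      proof eventually_elim
        case (elim n)
        then have "\<not> real (Suc n) \<le> norm x" by linarith
        then show ?case by simp
      qed
    qed
  qed (use m i2 in \<open>auto simp: indicator_def\<close>)
  have "(LINT x|lborel. (norm (\<psi> x))\<^sup>2) \<le> 16384 * (LINT x|(lborel::(real^3) measure). 0)"
    by (rule LIMSEQ_le [OF lim1 tendsto_mult_left [OF lim2]]) (use key in auto)
  then have "(LINT x|lborel. (norm (\<psi> x))\<^sup>2) = 0"
    by (intro antisym integral_nonneg_AE) auto
  then have "AE x in lborel. (norm (\<psi> x))\<^sup>2 = 0"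
    using integral_nonneg_eq_0_iff_AE [OF i2] by auto
  then show ?thesis by simp
qed



subsection \<open>Wirtinger\<close>

lemma cot_term_continuous:
  fixes \<phi> :: "real \<Rightarrow> real"
  assumes d: "(\<phi> has_real_derivative \<phi>') (at t)" and z: "sin ((t - z) / 2) = 0" "\<phi> t = 0"
  shows "isCont (\<lambda>t. cos ((t - z) / 2) / sin ((t - z) / 2) * (\<phi> t)\<^sup>2 / 2) t"
proof -
  have c: "cos ((t - z) / 2) \<noteq> 0"
    using sin_cos_squared_add [of "(t - z) / 2"] z(1) by auto
  have l1: "((\<lambda>r. \<phi> r / (r - t)) \<longlongrightarrow> \<phi>') (at t)"
    using d z(2) by (simp add: has_field_derivative_iff)
  have "((\<lambda>r. sin ((r - z) / 2)) has_real_derivative cos ((t - z) / 2) / 2) (at t)"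
    by (auto intro!: derivative_eq_intros)
  then have l2: "((\<lambda>r. sin ((r - z) / 2) / (r - t)) \<longlongrightarrow> cos ((t - z) / 2) / 2) (at t)"
    using z(1) by (simp add: has_field_derivative_iff)
  have l3: "(\<phi> \<longlongrightarrow> 0) (at t)" using DERIV_isCont [OF d] z(2) by (simp add: isCont_def)
  have "((\<lambda>r. cos ((r - z) / 2) * \<phi> r * (\<phi> r / (r - t)) / (sin ((r - z) / 2) / (r - t)) / 2) \<longlongrightarrow>
     cos ((t - z) / 2) * 0 * \<phi>' / (cos ((t - z) / 2) / 2) / 2) (at t)"
    by (intro tendsto_intros l1 l2 l3) (use c in auto)
  moreover have "eventually (\<lambda>r. cos ((r - z) / 2) * \<phi> r * (\<phi> r / (r - t)) / (sin ((r - z) / 2) / (r - t)) / 2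
      = cos ((r - z) / 2) / sin ((r - z) / 2) * (\<phi> r)\<^sup>2 / 2) (at t)"
    by (auto simp: eventually_at power2_eq_square intro!: exI [of _ 1])
  ultimately have "((\<lambda>r. cos ((r - z) / 2) / sin ((r - z) / 2) * (\<phi> r)\<^sup>2 / 2) \<longlongrightarrow> 0) (at t)"
    using Lim_transform_eventually by fastforce
  then show ?thesis using z by (simp add: isCont_def)
qed

lemma wirtinger_antiperiodic_real:
  fixes \<phi> :: "real \<Rightarrow> real"
  assumes d: "\<And>t. (\<phi> has_real_derivative \<phi>' t) (at t)" and c: "continuous_on UNIV \<phi>'"
    and anti: "\<phi> (2 * pi) = - \<phi> 0"
  shows "integral {0..2*pi} (\<lambda>t. (\<phi> t)\<^sup>2 / 4) \<le> integral {0..2*pi} (\<lambda>t. (\<phi>' t)\<^sup>2)"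
proof -
  have c\<phi>: "continuous_on S \<phi>" for S
    by (intro continuous_at_imp_continuous_on ballI DERIV_isCont [OF d])
  have c': "continuous_on S \<phi>'" for S using continuous_on_subset [OF c] by blast
  have "\<exists>z\<ge>0. z \<le> 2 * pi \<and> \<phi> z = 0"
  proof (cases "\<phi> 0 \<le> 0")
    case True
    then show ?thesis using anti c\<phi> by (intro IVT') auto
  next
    case False
    then show ?thesis using anti c\<phi> by (intro IVT2') auto
  qed
  then obtain z where z: "0 \<le> z" "z \<le> 2 * pi" "\<phi> z = 0" by blast
  define F where "F t = cos ((t - z) / 2) / sin ((t - z) / 2) * (\<phi> t)\<^sup>2 / 2" for t
  define F' where "F' t = - ((\<phi> t)\<^sup>2 / (4 * (sin ((t - z) / 2))\<^sup>2)) + cos ((t - z) / 2) / sin ((t - z) / 2) * \<phi> t * \<phi>' t" for t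
  have dF: "(F has_real_derivative F' t) (at t)" if s: "sin ((t - z) / 2) \<noteq> 0" for t
  proof -
    let ?s = "sin ((t - z) / 2)" and ?c = "cos ((t - z) / 2)"
    have q: "((\<lambda>t. cos ((t - z) / 2) / sin ((t - z) / 2)) has_real_derivative ((- ?s / 2) * ?s - ?c * (?c / 2)) / (?s * ?s)) (at t)"
      by (rule DERIV_divide) (use s in \<open>auto intro!: derivative_eq_intros\<close>)
    have "((\<lambda>t. (\<phi> t)\<^sup>2) has_real_derivative 2 * \<phi> t * \<phi>' t) (at t)"
      by (auto intro!: derivative_eq_intros d)
    from DERIV_cdivide [OF DERIV_mult [OF q this], of 2]
    have "(F has_real_derivative (((- ?s / 2) * ?s - ?c * (?c / 2)) / (?s * ?s) * (\<phi> t)\<^sup>2 + ?c / ?s * (2 * \<phi> t * \<phi>' t)) / 2) (at t)"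
      by (simp only: F_def [abs_def] mult.commute [of "2 * \<phi> t * \<phi>' t"])
    moreover have "(- ?s / 2) * ?s - ?c * (?c / 2) = - (1 / 2)"
      using sin_cos_squared_add [of "(t - z) / 2"] by (simp add: power2_eq_square field_simps)
    ultimately have "(F has_real_derivative (- (1 / 2) / (?s * ?s) * (\<phi> t)\<^sup>2 + ?c / ?s * (2 * \<phi> t * \<phi>' t)) / 2) (at t)"
      by simp
    moreover have "(- (1 / 2) / (?s * ?s) * (\<phi> t)\<^sup>2 + ?c / ?s * (2 * \<phi> t * \<phi>' t)) / 2 = F' t"
      using s by (simp add: F'_def field_simps power2_eq_square)
    ultimately show ?thesis by simp
  qed
  have sin0: "\<phi> t = 0" if t: "0 \<le> t" "t \<le> 2 * pi" and s: "sin ((t - z) / 2) = 0" for t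
  proof -
    have a: "- pi \<le> (t - z) / 2" "(t - z) / 2 \<le> pi" using t z by auto
    consider "(t - z) / 2 = - pi" | "(t - z) / 2 = pi" | "- pi < (t - z) / 2 \<and> (t - z) / 2 < pi"
      using a by linarith
    then show ?thesis
    proof cases
      case 1
      have "t = z - 2 * pi" using 1 by (simp add: field_simps)
      then have "t = 0" using t z by linarith
      moreover have "z = 2 * pi" using \<open>t = z - 2 * pi\<close> \<open>t = 0\<close> by simp
      ultimately show ?thesis using anti z(3) by simp
    next
      case 2
      have "t = z + 2 * pi" using 2 by (simp add: field_simps)
      then have "z = 0" using t z by linarith
      moreover have "t = 2 * pi" using \<open>t = z + 2 * pi\<close> \<open>z = 0\<close> by simp
      ultimately show ?thesis using anti z(3) by simp
    next
      case 3
      then have "(t - z) / 2 = 0" using s sin_eq_0_pi by blast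
      then show ?thesis using z(3) by simp
    qed
  qed
  have cF: "continuous_on {0..2*pi} F"
  proof (intro continuous_at_imp_continuous_on ballI)
    fix t assume t: "t \<in> {0..2*pi}"
    show "isCont F t"
    proof (cases "sin ((t - z) / 2) = 0")
      case True
      then show ?thesis unfolding F_def using cot_term_continuous [OF d] sin0 t by auto
    qed (rule DERIV_isCont [OF dF])
  qed
  have "(F' has_integral (F (2 * pi) - F 0)) {0..2*pi}"
  proof (rule fundamental_theorem_of_calculus_strong [of "{0, z, 2 * pi}"])
    fix t assume t: "t \<in> {0..2 * pi} - {0, z, 2 * pi}"
    then have "- pi < (t - z) / 2 \<and> (t - z) / 2 < pi" "(t - z) / 2 \<noteq> 0" using z by auto
    then have "sin ((t - z) / 2) \<noteq> 0" using sin_eq_0_pi by blast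
    from dF [OF this] show "(F has_vector_derivative F' t) (at t)"
      by (simp add: has_real_derivative_iff_has_vector_derivative)
  qed (use cF in auto)
  moreover have "F (2 * pi) = F 0"
  proof -
    have e: "(2 * pi - z) / 2 = pi - z / 2" by (simp add: field_simps)
    have "cos ((2 * pi - z) / 2) = - cos (z / 2)" "sin ((2 * pi - z) / 2) = sin (z / 2)"
      unfolding e by (simp_all add: cos_diff sin_diff)
    then show ?thesis using anti by (simp add: F_def)
  qed
  ultimately have "(F' has_integral 0) {0..2*pi}" by simp
  moreover have "((\<lambda>t. (\<phi>' t)\<^sup>2 - (\<phi> t)\<^sup>2 / 4) has_integral integral {0..2*pi} (\<lambda>t. (\<phi>' t)\<^sup>2 - (\<phi> t)\<^sup>2 / 4)) {0..2*pi}"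
    by (intro integrable_integral integrable_continuous_interval continuous_intros c\<phi> c') auto
  moreover have "F' t \<le> (\<phi>' t)\<^sup>2 - (\<phi> t)\<^sup>2 / 4" if t: "t \<in> {0..2*pi}" for t
  proof (cases "sin ((t - z) / 2) = 0")
    case True
    then show ?thesis using sin0 [of t] t by (simp add: F'_def)
  next
    case False
    let ?s = "sin ((t - z) / 2)" and ?c = "cos ((t - z) / 2)"
    have "(\<phi> t)\<^sup>2 / (4 * ?s\<^sup>2) = (\<phi> t)\<^sup>2 * (?s\<^sup>2 + ?c\<^sup>2) / (4 * ?s\<^sup>2)" by simp
    also have "\<dots> = (\<phi> t)\<^sup>2 / 4 + (?c / ?s * \<phi> t / 2)\<^sup>2"
      using False by (simp add: field_simps power2_eq_square del: sin_cos_squared_add sin_cos_squared_add2 sin_cos_squared_add3)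
    finally have "(\<phi>' t)\<^sup>2 - (\<phi> t)\<^sup>2 / 4 - F' t = (\<phi>' t - ?c / ?s * \<phi> t / 2)\<^sup>2"
      by (simp add: F'_def power2_diff)
    then show ?thesis using zero_le_power2 [of "\<phi>' t - ?c / ?s * \<phi> t / 2"] by linarith
  qed
  ultimately have "0 \<le> integral {0..2*pi} (\<lambda>t. (\<phi>' t)\<^sup>2 - (\<phi> t)\<^sup>2 / 4)"
    by (rule has_integral_le)
  also have "\<dots> = integral {0..2*pi} (\<lambda>t. (\<phi>' t)\<^sup>2) - integral {0..2*pi} (\<lambda>t. (\<phi> t)\<^sup>2 / 4)"
    by (intro integral_diff integrable_continuous_interval continuous_intros c\<phi> c') auto
  finally show ?thesis by simp
qed

lemma wirtinger_antiperiodic: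
  fixes u :: "real \<Rightarrow> 'b::euclidean_space"
  assumes d: "\<And>t. (u has_vector_derivative u' t) (at t)" and c: "continuous_on UNIV u'"
    and anti: "u (2 * pi) = - u 0"
  shows "0 \<le> integral {0..2*pi} (\<lambda>t. (norm (u' t))\<^sup>2 - (norm (u t))\<^sup>2 / 4)"
proof -
  have cu: "continuous_on S u" for S
    by (intro continuous_at_imp_continuous_on ballI has_vector_derivative_continuous [OF d])
  have cu': "continuous_on S u'" for S using continuous_on_subset [OF c] by blast
  have comp: "0 \<le> integral {0..2*pi} (\<lambda>t. (u' t \<bullet> b)\<^sup>2 - (u t \<bullet> b)\<^sup>2 / 4)" for b
  proof -
    have "integral {0..2*pi} (\<lambda>t. (u t \<bullet> b)\<^sup>2 / 4) \<le> integral {0..2*pi} (\<lambda>t. (u' t \<bullet> b)\<^sup>2)"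
    proof (rule wirtinger_antiperiodic_real)
      show "((\<lambda>t. u t \<bullet> b) has_real_derivative u' t \<bullet> b) (at t)" for t
        unfolding has_real_derivative_iff_has_vector_derivative
        by (rule bounded_linear.has_vector_derivative [OF bounded_linear_inner_left d])
    qed (use anti c in \<open>auto intro!: continuous_intros\<close>)
    moreover have "integral {0..2*pi} (\<lambda>t. (u' t \<bullet> b)\<^sup>2 - (u t \<bullet> b)\<^sup>2 / 4)
       = integral {0..2*pi} (\<lambda>t. (u' t \<bullet> b)\<^sup>2) - integral {0..2*pi} (\<lambda>t. (u t \<bullet> b)\<^sup>2 / 4)"
      by (intro integral_diff integrable_continuous_interval continuous_intros cu cu') auto
    ultimately show ?thesis by simp
  qed
  have n: "(norm v)\<^sup>2 = (\<Sum>b\<in>Basis. (v \<bullet> b)\<^sup>2)" for v :: 'b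
    unfolding power2_norm_eq_inner euclidean_inner [of v v] by (simp add: power2_eq_square)
  have "(\<lambda>t. (norm (u' t))\<^sup>2 - (norm (u t))\<^sup>2 / 4) = (\<lambda>t. \<Sum>b\<in>Basis. (u' t \<bullet> b)\<^sup>2 - (u t \<bullet> b)\<^sup>2 / 4)"
    by (simp add: n sum_subtractf sum_divide_distrib)
  moreover have "integral {0..2*pi} (\<lambda>t. \<Sum>b\<in>Basis. (u' t \<bullet> b)\<^sup>2 - (u t \<bullet> b)\<^sup>2 / 4)
      = (\<Sum>b\<in>Basis. integral {0..2*pi} (\<lambda>t. (u' t \<bullet> b)\<^sup>2 - (u t \<bullet> b)\<^sup>2 / 4))"
    by (intro integral_sum integrable_continuous_interval continuous_intros cu cu') auto
  ultimately show ?thesis using comp by (simp add: sum_nonneg)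
qed

subsection \<open>holonomy\<close>

lemma pd_continuous_compose:
  fixes A :: "real^3 \<Rightarrow> real^3"
  assumes A: "C_upto (Suc 0) A" and G: "continuous_on S G" "continuous_on S V"
  shows "continuous_on S (\<lambda>p. pd (V p) A (G p))"
proof -
  have d: "A differentiable at x" for x using A by (simp add: C_upto_Suc_iff)
  have c: "continuous_on UNIV (pd (ax j) A)" for j by (rule C_upto_imp_continuous_on [OF C_upto_pd [OF A]])
  have e: "(\<lambda>p. pd (V p) A (G p)) = (\<lambda>p. \<Sum>j\<in>UNIV. (V p $ j) *\<^sub>R pd (ax j) A (G p))"
    using pd_ax_sum [OF d] by blast
  show ?thesis
    unfolding e by (intro continuous_intros G continuous_on_compose2 [OF c G(1)]) auto
qed

lemma vector_derivative_compose:
  fixes A :: "real^3 \<Rightarrow> real^3"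
  assumes "A differentiable at (g t)" "(g has_vector_derivative g') (at t)"
  shows "((\<lambda>t. A (g t)) has_vector_derivative pd g' A (g t)) (at t)"
  using diff_chain_at [OF assms(2)[unfolded has_vector_derivative_def] has_derivative_pd [OF assms(1)]]
  by (simp add: has_vector_derivative_def o_def pd_add_dir(2) [OF assms(1)])

lemma holonomy_zero:
  fixes A :: "real^3 \<Rightarrow> real^3" and G Gs Gt Gst :: "real \<Rightarrow> real \<Rightarrow> real^3"
  assumes A: "C_upto (Suc 0) A"
    and Gs: "\<And>s t. ((\<lambda>s. G s t) has_vector_derivative Gs s t) (at s)"
    and Gt: "\<And>s t. ((\<lambda>t. G s t) has_vector_derivative Gt s t) (at t)"
    and Gts: "\<And>s t. ((\<lambda>s. Gt s t) has_vector_derivative Gst s t) (at s)"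
    and Gst: "\<And>s t. ((\<lambda>t. Gs s t) has_vector_derivative Gst s t) (at t)"
    and cont: "continuous_on UNIV (\<lambda>(s, t). G s t)" "continuous_on UNIV (\<lambda>(s, t). Gs s t)"
      "continuous_on UNIV (\<lambda>(s, t). Gt s t)" "continuous_on UNIV (\<lambda>(s, t). Gst s t)"
    and per: "\<And>s. G s b = G s a" "\<And>s. Gs s b = Gs s a" and ab: "a \<le> b"
    and curl0: "\<And>s t. curl A (G s t) \<bullet> cross3 (Gs s t) (Gt s t) = 0"
    and start: "\<And>t. Gt 0 t = 0"
  shows "integral {a..b} (\<lambda>t. A (G s t) \<bullet> Gt s t) = 0"
proof -
  have dA: "A differentiable at x" for x using A by (simp add: C_upto_Suc_iff)
  have Ac: "continuous_on UNIV A" by (rule C_upto_imp_continuous_on [OF A])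
  define fs where "fs s t = A (G s t) \<bullet> Gst s t + pd (Gs s t) A (G s t) \<bullet> Gt s t" for s t
  have ds: "((\<lambda>s. A (G s t) \<bullet> Gt s t) has_vector_derivative fs s t) (at s)" for s t
    unfolding fs_def
    by (rule bounded_bilinear.has_vector_derivative [OF bounded_bilinear_inner vector_derivative_compose [OF dA Gs] Gts])
  have dt: "((\<lambda>t. A (G s t) \<bullet> Gs s t) has_vector_derivative fs s t) (at t)" for s t
  proof -
    have "((\<lambda>t. A (G s t) \<bullet> Gs s t) has_vector_derivative A (G s t) \<bullet> Gst s t + pd (Gt s t) A (G s t) \<bullet> Gs s t) (at t)"
      by (rule bounded_bilinear.has_vector_derivative [OF bounded_bilinear_inner vector_derivative_compose [OF dA Gt] Gst])
    moreover have "pd (Gt s t) A (G s t) \<bullet> Gs s t = pd (Gs s t) A (G s t) \<bullet> Gt s t"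
      using curl_inner_cross3 [OF dA, of "Gs s t" "G s t" "Gt s t"] curl0 by simp
    ultimately show ?thesis by (simp add: fs_def)
  qed
  have c2: "continuous_on UNIV (\<lambda>p. G (fst p) (snd p))" "continuous_on UNIV (\<lambda>p. Gs (fst p) (snd p))"
    "continuous_on UNIV (\<lambda>p. Gt (fst p) (snd p))" "continuous_on UNIV (\<lambda>p. Gst (fst p) (snd p))"
    using cont by (simp_all add: case_prod_unfold)
  have cfs: "continuous_on UNIV (\<lambda>(s, t). fs s t)"
    unfolding fs_def case_prod_unfold
    by (intro continuous_intros continuous_on_compose2 [OF Ac] pd_continuous_compose [OF A] c2) auto
  have ct: "continuous_on S (\<lambda>t. A (G s t) \<bullet> Gt s t)" for s S
  proof -
    have "continuous_on UNIV (\<lambda>p. A (G (fst p) (snd p)) \<bullet> Gt (fst p) (snd p))"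
      by (intro continuous_intros continuous_on_compose2 [OF Ac] c2) auto
    moreover have "continuous_on S (\<lambda>t. (s, t))" by (intro continuous_intros)
    ultimately have "continuous_on S (\<lambda>t. A (G (fst (s, t)) (snd (s, t))) \<bullet> Gt (fst (s, t)) (snd (s, t)))"
      by (rule continuous_on_compose2) simp
    then show ?thesis by simp
  qed
  define H where "H s = integral (cbox a b) (\<lambda>t. A (G s t) \<bullet> Gt s t)" for s
  have "(H has_vector_derivative 0) (at s)" for s
  proof -
    have "(H has_vector_derivative integral (cbox a b) (fs s)) (at s within UNIV)"
      unfolding H_def
    proof (rule leibniz_rule_vector_derivative)
      show "((\<lambda>s. A (G s t) \<bullet> Gt s t) has_vector_derivative fs s t) (at s within UNIV)" for s t
        using ds by simp
      show "(\<lambda>t. A (G s t) \<bullet> Gt s t) integrable_on cbox a b" for s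
        by (rule integrable_continuous [OF ct])
      show "continuous_on (UNIV \<times> cbox a b) (\<lambda>(s, t). fs s t)"
        by (rule continuous_on_subset [OF cfs]) simp
    qed auto
    moreover have "(fs s has_integral (A (G s b) \<bullet> Gs s b - A (G s a) \<bullet> Gs s a)) {a..b}"
      by (rule fundamental_theorem_of_calculus [OF ab]) (rule has_vector_derivative_at_within [OF dt])
    then have "integral (cbox a b) (fs s) = 0"
      using per by (simp add: integral_unique)
    ultimately show ?thesis by simp
  qed
  then have "\<exists>k. \<forall>s\<in>UNIV. H s = k"
    by (intro has_derivative_zero_constant) (auto simp: has_vector_derivative_def)
  then have "H s = H 0" by auto
  also have "H 0 = 0" by (simp add: H_def start)
  finally show ?thesis by (simp add: H_def)
qed



definition ell :: "real^3 \<Rightarrow> real^3 \<Rightarrow> real^3 \<Rightarrow> real^3" where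
  "ell \<omega> e x = cross3 \<omega> x + (2 * (cross3 \<omega> e \<bullet> x)) *\<^sub>R x - (x \<bullet> x) *\<^sub>R cross3 \<omega> e"

lemma ell_has_derivative:
  "(ell \<omega> e has_derivative (\<lambda>u. (2 * (cross3 \<omega> e \<bullet> x)) *\<^sub>R u + cross3 (\<omega> + 2 *\<^sub>R cross3 (cross3 \<omega> e) x) u)) (at x)"
proof -
  have "(ell \<omega> e has_derivative (\<lambda>u. cross3 \<omega> u + ((2 * (cross3 \<omega> e \<bullet> x)) *\<^sub>R u + (2 * (cross3 \<omega> e \<bullet> u)) *\<^sub>R x) - (x \<bullet> u + u \<bullet> x) *\<^sub>R cross3 \<omega> e)) (at x)"
    unfolding ell_def [abs_def]
    by (intro has_derivative_diff has_derivative_add has_derivative_scaleR has_derivative_scaleR_left has_derivative_inner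
        has_derivative_mult_right has_derivative_inner_right has_derivative_ident
        bounded_linear.has_derivative [OF bounded_bilinear.bounded_linear_right [OF bounded_bilinear_cross3]])
  then show ?thesis
    by (rule has_derivative_eq_rhs) (auto simp: fun_eq_iff real3_eq_iff real3_inner algebra_simps)
qed

definition inv3 :: "real^3 \<Rightarrow> real^3" where "inv3 x = (1 / (x \<bullet> x)) *\<^sub>R x"

lemma inv3_derivative:
  assumes k: "(k has_vector_derivative k') (at t)" and n: "k t \<noteq> 0"
  shows "((\<lambda>t. inv3 (k t)) has_vector_derivative (1 / (k t \<bullet> k t)) *\<^sub>R k' - (2 * (k t \<bullet> k') / (k t \<bullet> k t)\<^sup>2) *\<^sub>R k t) (at t)"
proof -
  have n2: "k t \<bullet> k t \<noteq> 0" using n by simp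
  have "((\<lambda>t. k t \<bullet> k t) has_vector_derivative k t \<bullet> k' + k' \<bullet> k t) (at t)"
    by (rule bounded_bilinear.has_vector_derivative [OF bounded_bilinear_inner k k])
  then have "((\<lambda>t. k t \<bullet> k t) has_real_derivative 2 * (k t \<bullet> k')) (at t)"
    by (simp add: has_real_derivative_iff_has_vector_derivative inner_commute)
  from DERIV_divide [OF DERIV_const this n2, of 1]
  have "((\<lambda>t. 1 / (k t \<bullet> k t)) has_real_derivative - (2 * (k t \<bullet> k') / (k t \<bullet> k t)\<^sup>2)) (at t)"
    by (simp add: power2_eq_square)
  from has_vector_derivative_scaleR [OF this k]
  show ?thesis by (simp add: inv3_def)
qed

locale elliptic_dirac =
  fixes \<omega> e :: "real^3" and A :: "real^3 \<Rightarrow> real^3"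
  assumes unit: "norm \<omega> = 1" and perp: "\<omega> \<bullet> e = 0"
    and A1: "C_upto (Suc 0) A"
    and parallel: "\<And>x. cross3 (ell \<omega> e x) (curl A x) = 0"
begin

definition ax_c :: "real^3" where "ax_c = cross3 \<omega> e"

lemma unit_inner: "\<omega> \<bullet> \<omega> = 1" using unit by (simp add: norm_eq_1)

lemma ell_orth: "ell \<omega> e x \<bullet> (\<omega> + 2 *\<^sub>R cross3 (cross3 \<omega> e) x) = 0"
  by (simp add: ell_def real3_inner algebra_simps)

end

sublocale elliptic_dirac \<subseteq> conformal_dirac "ell \<omega> e" "\<lambda>x. \<omega> + 2 *\<^sub>R cross3 (cross3 \<omega> e) x" A "\<lambda>x. 2 * (cross3 \<omega> e \<bullet> x)" "cross3 \<omega> e"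
proof
  show "(ell \<omega> e has_derivative (\<lambda>u. (2 * (cross3 \<omega> e \<bullet> x)) *\<^sub>R u + cross3 (\<omega> + 2 *\<^sub>R cross3 (cross3 \<omega> e) x) u)) (at x)" for x
    by (rule ell_has_derivative)
  show "((\<lambda>x. 2 * (cross3 \<omega> e \<bullet> x)) has_derivative (\<lambda>u. 2 * (cross3 \<omega> e \<bullet> u))) (at x)" for x
    by (intro has_derivative_mult_right has_derivative_inner_right has_derivative_ident)
  have "((\<lambda>x. cross3 c x) has_derivative (\<lambda>u. cross3 c u)) (at x)" for x c :: "real^3"
    by (rule bounded_linear_imp_has_derivative [OF bounded_bilinear.bounded_linear_right [OF bounded_bilinear_cross3]])
  from has_derivative_add [OF has_derivative_const has_derivative_scaleR_right [OF this]]
  show "((\<lambda>x. \<omega> + 2 *\<^sub>R cross3 (cross3 \<omega> e) x) has_derivative (\<lambda>u. 2 *\<^sub>R cross3 (cross3 \<omega> e) u)) (at x)" for x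
    by simp
qed (use ell_orth A1 parallel in auto)

context elliptic_dirac
begin

lemma ell_inv3:
  assumes "k \<noteq> 0"
  shows "ell \<omega> e (inv3 k) = (1 / (k \<bullet> k)) *\<^sub>R cross3 \<omega> (k - e) - (2 * (k \<bullet> cross3 \<omega> (k - e)) / (k \<bullet> k)\<^sup>2) *\<^sub>R k"
proof -
  have n: "k \<bullet> k \<noteq> 0" using assms by simp
  have 1: "cross3 \<omega> (k - e) = cross3 \<omega> k - cross3 \<omega> e" by (simp add: real3_eq_iff algebra_simps)
  have 2: "k \<bullet> (cross3 \<omega> k - cross3 \<omega> e) = - (cross3 \<omega> e \<bullet> k)" by (simp add: real3_inner algebra_simps)
  have 3: "inv3 k \<bullet> inv3 k = 1 / (k \<bullet> k)" using n by (simp add: inv3_def power2_eq_square)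
  have 4: "cross3 \<omega> (inv3 k) = (1 / (k \<bullet> k)) *\<^sub>R cross3 \<omega> k" by (simp add: inv3_def real3_eq_iff algebra_simps)
  show ?thesis
    unfolding ell_def 3 4 1 2
    by (simp add: inv3_def scaleR_diff_right power2_eq_square)
qed

subsection \<open>rot\<close>

definition Rt :: "real \<Rightarrow> real^3 \<Rightarrow> real^3" where
  "Rt t v = cos t *\<^sub>R v + sin t *\<^sub>R cross3 \<omega> v + ((1 - cos t) * (\<omega> \<bullet> v)) *\<^sub>R \<omega>"

lemma cross_cross_unit: "cross3 \<omega> (cross3 \<omega> v) = (\<omega> \<bullet> v) *\<^sub>R \<omega> - v"
proof -
  have "cross3 \<omega> (cross3 \<omega> v) = (\<omega> \<bullet> v) *\<^sub>R \<omega> - (\<omega> \<bullet> \<omega>) *\<^sub>R v"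
    by (simp add: real3_eq_iff real3_inner algebra_simps)
  then show ?thesis by (simp add: unit_inner)
qed

lemma Rt_derivative: "((\<lambda>t. Rt t v) has_vector_derivative cross3 \<omega> (Rt t v)) (at t)"
proof -
  have "((\<lambda>t. Rt t v) has_vector_derivative (- sin t) *\<^sub>R v + cos t *\<^sub>R cross3 \<omega> v + (sin t * (\<omega> \<bullet> v)) *\<^sub>R \<omega>) (at t)"
    unfolding Rt_def has_vector_derivative_def
    by (auto intro!: derivative_eq_intros simp: fun_eq_iff algebra_simps)
  moreover have "cross3 \<omega> (Rt t v) = cos t *\<^sub>R cross3 \<omega> v + sin t *\<^sub>R cross3 \<omega> (cross3 \<omega> v)"
    by (simp add: Rt_def real3_eq_iff algebra_simps)
  moreover have "cos t *\<^sub>R cross3 \<omega> v + sin t *\<^sub>R cross3 \<omega> (cross3 \<omega> v)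
      = (- sin t) *\<^sub>R v + cos t *\<^sub>R cross3 \<omega> v + (sin t * (\<omega> \<bullet> v)) *\<^sub>R \<omega>"
    unfolding cross_cross_unit by (simp add: scaleR_diff_right)
  ultimately show ?thesis by simp
qed

lemma Rt_axis: "\<omega> \<bullet> Rt t v = \<omega> \<bullet> v"
proof -
  have "\<omega> \<bullet> Rt t v = cos t * (\<omega> \<bullet> v) + (1 - cos t) * (\<omega> \<bullet> v) * (\<omega> \<bullet> \<omega>)"
    by (simp add: Rt_def inner_add_right real3_inner algebra_simps)
  then show ?thesis by (simp add: unit_inner algebra_simps)
qed

lemma norm_Rt: "norm (Rt t v) = norm v"
proof -
  have c1: "cross3 \<omega> v \<bullet> cross3 \<omega> v = v \<bullet> v - (\<omega> \<bullet> v)\<^sup>2"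
  proof -
    have "cross3 \<omega> v \<bullet> cross3 \<omega> v = (\<omega> \<bullet> \<omega>) * (v \<bullet> v) - (\<omega> \<bullet> v)\<^sup>2"
      by (simp add: real3_inner power2_eq_square algebra_simps)
    then show ?thesis by (simp add: unit_inner)
  qed
  have c2: "v \<bullet> cross3 \<omega> v = 0" "\<omega> \<bullet> cross3 \<omega> v = 0" "cross3 \<omega> v \<bullet> v = 0" "cross3 \<omega> v \<bullet> \<omega> = 0" "v \<bullet> \<omega> = \<omega> \<bullet> v"
    by (simp_all add: real3_inner algebra_simps)
  have "Rt t v \<bullet> Rt t v = (cos t)\<^sup>2 * (v \<bullet> v) + (sin t)\<^sup>2 * (v \<bullet> v - (\<omega> \<bullet> v)\<^sup>2) + ((1 - cos t) * (\<omega> \<bullet> v))\<^sup>2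
      + 2 * cos t * ((1 - cos t) * (\<omega> \<bullet> v)) * (\<omega> \<bullet> v)"
    unfolding Rt_def
    by (simp add: inner_add_left inner_add_right c1 c2 unit_inner power2_eq_square algebra_simps)
  also have "\<dots> = ((sin t)\<^sup>2 + (cos t)\<^sup>2) * (v \<bullet> v) + (\<omega> \<bullet> v)\<^sup>2 * (1 - ((sin t)\<^sup>2 + (cos t)\<^sup>2))"
    by (simp add: power2_eq_square algebra_simps del: sin_cos_squared_add sin_cos_squared_add2 sin_cos_squared_add3)
  finally show ?thesis by (simp add: norm_eq_sqrt_inner)
qed

lemma Rt_linear: "linear (Rt t)"
  by (intro linearI) (simp_all add: Rt_def real3_eq_iff inner_add_right algebra_simps)

lemma Rt_orthogonal: "orthogonal_transformation (Rt t)"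
  using Rt_linear norm_Rt by (simp add: orthogonal_transformation)

definition orb :: "real^3 \<Rightarrow> real \<Rightarrow> real^3" where
  "orb x t = e + Rt t (x - e)"

lemma orb_derivative: "((\<lambda>t. orb x t) has_vector_derivative cross3 \<omega> (orb x t - e)) (at t)"
  using has_vector_derivative_add [OF has_vector_derivative_const Rt_derivative]
  by (simp add: orb_def)

lemma orb_axis: "\<omega> \<bullet> orb x t = \<omega> \<bullet> x"
  by (simp add: orb_def inner_add_right inner_diff_right Rt_axis perp)

lemma orb_nonzero: "\<omega> \<bullet> x \<noteq> 0 \<Longrightarrow> orb x t \<noteq> 0"
  using orb_axis [of x t] by auto

lemma orb_period: "orb x (2 * pi) = orb x 0"
  by (simp add: orb_def Rt_def)

lemma orb_0: "orb x 0 = x"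
  by (simp add: orb_def Rt_def)

lemma orb_continuous: "continuous_on S (orb x)"
  by (intro continuous_at_imp_continuous_on ballI has_vector_derivative_continuous [OF orb_derivative])

lemma inv3_orb_derivative:
  assumes "\<omega> \<bullet> x \<noteq> 0"
  shows "((\<lambda>t. inv3 (orb x t)) has_vector_derivative ell \<omega> e (inv3 (orb x t))) (at t)"
  unfolding ell_inv3 [OF orb_nonzero [OF assms]]
  by (rule inv3_derivative [OF orb_derivative orb_nonzero [OF assms]])

lemma inv3_continuous:
  assumes "continuous_on S k" "\<And>p. p \<in> S \<Longrightarrow> k p \<noteq> 0"
  shows "continuous_on S (\<lambda>p. inv3 (k p))"
  unfolding inv3_def by (intro continuous_intros assms(1)) (use assms(2) in auto)

lemma orbit_holonomy:
  assumes x: "\<omega> \<bullet> x \<noteq> 0"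
  shows "integral {0..2*pi} (\<lambda>t. A (inv3 (orb x t)) \<bullet> ell \<omega> e (inv3 (orb x t))) = 0"
proof -
  define \<rho> where "\<rho> = x - e - (\<omega> \<bullet> x) *\<^sub>R \<omega>"
  have \<omega>\<rho>: "\<omega> \<bullet> \<rho> = 0" by (simp add: \<rho>_def inner_diff_right perp unit_inner)
  define r where "r t = cos t *\<^sub>R \<rho> + sin t *\<^sub>R cross3 \<omega> \<rho>" for t
  define r1 where "r1 t = cos t *\<^sub>R cross3 \<omega> \<rho> - sin t *\<^sub>R \<rho>" for t
  define k where "k s t = e + (\<omega> \<bullet> x) *\<^sub>R \<omega> + s *\<^sub>R r t" for s t
  have dr: "(r has_vector_derivative r1 t) (at t)" for t
    unfolding r_def r1_def has_vector_derivative_def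
    by (auto intro!: derivative_eq_intros simp: fun_eq_iff algebra_simps)
  have dr1: "(r1 has_vector_derivative - r t) (at t)" for t
    unfolding r_def r1_def has_vector_derivative_def
    by (auto intro!: derivative_eq_intros simp: fun_eq_iff algebra_simps)
  have \<omega>r: "cross3 \<omega> (r t) = r1 t" for t
  proof -
    have "cross3 \<omega> (r t) = cos t *\<^sub>R cross3 \<omega> \<rho> + sin t *\<^sub>R cross3 \<omega> (cross3 \<omega> \<rho>)"
      by (simp add: r_def real3_eq_iff algebra_simps)
    then show ?thesis by (simp add: cross_cross_unit \<omega>\<rho> r1_def)
  qed
  have ks: "((\<lambda>s. k s t) has_vector_derivative r t) (at s)" for s t
    unfolding k_def has_vector_derivative_def by (auto intro!: derivative_eq_intros)
  have kt: "((\<lambda>t. k s t) has_vector_derivative s *\<^sub>R r1 t) (at t)" for s t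
    unfolding k_def
    using has_vector_derivative_add [OF has_vector_derivative_const bounded_linear.has_vector_derivative [OF bounded_linear_scaleR_right dr]]
    by simp
  have ke: "cross3 \<omega> (k s t - e) = s *\<^sub>R r1 t" for s t
  proof -
    have "cross3 \<omega> (k s t - e) = s *\<^sub>R cross3 \<omega> (r t)"
      by (simp add: k_def real3_eq_iff algebra_simps)
    then show ?thesis by (simp add: \<omega>r)
  qed
  have k0: "k s t \<noteq> 0" for s t
  proof -
    have "\<omega> \<bullet> cross3 \<omega> \<rho> = 0" by (simp add: real3_inner algebra_simps)
    then have "\<omega> \<bullet> k s t = \<omega> \<bullet> x" by (simp add: k_def r_def inner_add_right perp unit_inner \<omega>\<rho>)
    then show ?thesis using x by auto
  qed
  have n0: "k s t \<bullet> k s t \<noteq> 0" for s t using k0 by simp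
  define G where "G s t = inv3 (k s t)" for s t
  define n where "n s t = k s t \<bullet> k s t" for s t
  define p where "p s t = k s t \<bullet> r t" for s t
  define q where "q s t = k s t \<bullet> r1 t" for s t
  define Gs where "Gs s t = (1 / n s t) *\<^sub>R r t - (2 * p s t / (n s t)\<^sup>2) *\<^sub>R k s t" for s t
  define Gt where "Gt s t = (s / n s t) *\<^sub>R r1 t - (2 * (s * q s t) / (n s t)\<^sup>2) *\<^sub>R k s t" for s t
  define m where "m s t = q s t + s * (r t \<bullet> r1 t)" for s t
  define Gst where "Gst s t = (1 / n s t - 2 * s * p s t / (n s t)\<^sup>2) *\<^sub>R r1 t
     - (2 * m s t / (n s t)\<^sup>2 - 8 * s * p s t * q s t / (n s t) ^ 3) *\<^sub>R k s t
     - (2 * (s * q s t) / (n s t)\<^sup>2) *\<^sub>R r t" for s t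
  have nn: "n s t \<noteq> 0" for s t using n0 by (simp add: n_def)
  have dG: "((\<lambda>s. G s t) has_vector_derivative Gs s t) (at s)" "((\<lambda>t. G s t) has_vector_derivative Gt s t) (at t)" for s t
  proof -
    show "((\<lambda>s. G s t) has_vector_derivative Gs s t) (at s)"
      unfolding G_def Gs_def n_def p_def by (rule inv3_derivative [OF ks k0])
    have "((\<lambda>t. G s t) has_vector_derivative (1 / (k s t \<bullet> k s t)) *\<^sub>R (s *\<^sub>R r1 t) - (2 * (k s t \<bullet> (s *\<^sub>R r1 t)) / (k s t \<bullet> k s t)\<^sup>2) *\<^sub>R k s t) (at t)"
      unfolding G_def by (rule inv3_derivative [OF kt k0])
    then show "((\<lambda>t. G s t) has_vector_derivative Gt s t) (at t)"
      by (simp add: Gt_def n_def q_def)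
  qed
  have inner_real: "((\<lambda>t. f t \<bullet> g t) has_real_derivative f t \<bullet> g' + f' \<bullet> g t) (at t)"
    if "(f has_vector_derivative f') (at t)" "(g has_vector_derivative g') (at t)" for f g :: "real \<Rightarrow> real^3" and f' g' t
    unfolding has_real_derivative_iff_has_vector_derivative
    by (rule bounded_bilinear.has_vector_derivative [OF bounded_bilinear_inner that])
  have n_s: "((\<lambda>s. n s t) has_real_derivative 2 * p s t) (at s)" for s t
    unfolding n_def using inner_real [OF ks [where s = s and t = t] ks [where s = s and t = t]] by (simp add: p_def inner_commute)
  have n_t: "((\<lambda>t. n s t) has_real_derivative 2 * (s * q s t)) (at t)" for s t
    unfolding n_def using inner_real [OF kt [where s = s and t = t] kt [where s = s and t = t]] by (simp add: q_def inner_commute)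
  have q_s: "((\<lambda>s. q s t) has_real_derivative r t \<bullet> r1 t) (at s)" for s t
    unfolding q_def using inner_real [OF ks has_vector_derivative_const] by simp
  have p_t: "((\<lambda>t. p s t) has_real_derivative m s t) (at t)" for s t
    unfolding p_def using inner_real [OF kt [where s = s and t = t] dr] by (simp add: q_def m_def inner_commute)
  have dGt: "((\<lambda>s. Gt s t) has_vector_derivative Gst s t) (at s)" for s t
  proof -
    have a: "((\<lambda>s. s / n s t) has_real_derivative 1 / n s t - 2 * s * p s t / (n s t)\<^sup>2) (at s)"
      by (rule DERIV_cong [OF DERIV_divide [OF DERIV_ident n_s nn]]) (use nn [of s t] in \<open>simp add: field_simps power2_eq_square\<close>)
    have b: "((\<lambda>s. 2 * (s * q s t) / (n s t)\<^sup>2) has_real_derivative 2 * m s t / (n s t)\<^sup>2 - 8 * s * p s t * q s t / (n s t) ^ 3) (at s)"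
      by (rule DERIV_cong [OF DERIV_divide [OF DERIV_cmult [OF DERIV_mult [OF DERIV_ident q_s]] DERIV_power [OF n_s]]])
        (use nn [of s t] in \<open>simp_all add: field_simps power2_eq_square power3_eq_cube m_def\<close>)
    show ?thesis
      unfolding Gt_def Gst_def
      by (rule has_vector_derivative_eq_rhs [OF has_vector_derivative_diff [OF has_vector_derivative_scaleR [OF a has_vector_derivative_const]
           has_vector_derivative_scaleR [OF b ks]]]) (simp add: algebra_simps)
  qed
  have dGs: "((\<lambda>t. Gs s t) has_vector_derivative Gst s t) (at t)" for s t
  proof -
    have a: "((\<lambda>t. 1 / n s t) has_real_derivative - (2 * (s * q s t) / (n s t)\<^sup>2)) (at t)"
      by (rule DERIV_cong [OF DERIV_divide [OF DERIV_const n_t nn]]) (simp add: power2_eq_square)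
    have b: "((\<lambda>t. 2 * p s t / (n s t)\<^sup>2) has_real_derivative 2 * m s t / (n s t)\<^sup>2 - 8 * s * p s t * q s t / (n s t) ^ 3) (at t)"
      by (rule DERIV_cong [OF DERIV_divide [OF DERIV_cmult [OF p_t] DERIV_power [OF n_t]]])
        (use nn [of s t] in \<open>simp_all add: field_simps power2_eq_square power3_eq_cube\<close>)
    show ?thesis
      unfolding Gs_def Gst_def
      by (rule has_vector_derivative_eq_rhs [OF has_vector_derivative_diff [OF has_vector_derivative_scaleR [OF a dr]
           has_vector_derivative_scaleR [OF b kt]]]) (simp add: algebra_simps)
  qed
  have cr: "continuous_on S (\<lambda>p. r (f p))" "continuous_on S (\<lambda>p. r1 (f p))" if "continuous_on S f" for S :: "(real \<times> real) set" and f
    unfolding r_def r1_def by (intro continuous_intros that)+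
  have ck: "continuous_on UNIV (\<lambda>p. k (fst p) (snd p))"
    unfolding k_def by (intro continuous_intros cr)
  have cn: "continuous_on UNIV (\<lambda>w. n (fst w) (snd w))" "continuous_on UNIV (\<lambda>w. p (fst w) (snd w))"
      "continuous_on UNIV (\<lambda>w. q (fst w) (snd w))" "continuous_on UNIV (\<lambda>w. m (fst w) (snd w))"
    unfolding m_def n_def p_def q_def by (intro continuous_intros ck cr)+
  have per: "r (2 * pi) = r 0" by (simp add: r_def)
  have "integral {0..2*pi} (\<lambda>t. A (G 1 t) \<bullet> Gt 1 t) = 0"
  proof (rule holonomy_zero [OF A1 dG dGt dGs])
    show "continuous_on UNIV (\<lambda>(s, t). G s t)"
      unfolding G_def case_prod_unfold by (intro inv3_continuous ck k0)
    show "continuous_on UNIV (\<lambda>(s, t). Gs s t)" "continuous_on UNIV (\<lambda>(s, t). Gt s t)" "continuous_on UNIV (\<lambda>(s, t). Gst s t)"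
      unfolding Gs_def Gt_def Gst_def case_prod_unfold
      by (intro continuous_intros ck cn cr; simp add: nn)+
    show "G s (2 * pi) = G s 0" "Gs s (2 * pi) = Gs s 0" for s
      by (simp_all add: G_def Gs_def n_def p_def k_def per)
    show "curl A (G s t) \<bullet> cross3 (Gs s t) (Gt s t) = 0" for s t
    proof -
      have "Gt s t = ell \<omega> e (G s t)"
        unfolding G_def ell_inv3 [OF k0] ke by (simp add: Gt_def n_def q_def)
      then have "cross3 (Gt s t) (curl A (G s t)) = 0" using parallel by simp
      moreover have "curl A (G s t) \<bullet> cross3 (Gs s t) (Gt s t) = Gs s t \<bullet> cross3 (Gt s t) (curl A (G s t))"
        by (simp add: real3_inner algebra_simps)
      ultimately show ?thesis by simp
    qed
    show "Gt 0 t = 0" for t by (simp add: Gt_def)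
  qed simp
  moreover have "k 1 t = orb x t" for t
    by (simp add: k_def r_def orb_def Rt_def \<rho>_def real3_eq_iff inner_diff_right perp algebra_simps)
      (simp add: real3_inner algebra_simps)?
  then have "G 1 t = inv3 (orb x t)" "Gt 1 t = ell \<omega> e (inv3 (orb x t))" for t
    using ell_inv3 [OF k0, of 1 t] ke [of 1 t] by (simp_all add: G_def Gt_def n_def q_def)
  ultimately show ?thesis by simp
qed

end



lemma inv3_simps:
  assumes "k \<noteq> 0"
  shows "inv3 k \<bullet> inv3 k = 1 / (k \<bullet> k)" "inv3 (inv3 k) = k" "inv3 k \<noteq> 0"
proof -
  have n: "k \<bullet> k \<noteq> 0" using assms by simp
  show 1: "inv3 k \<bullet> inv3 k = 1 / (k \<bullet> k)" using n by (simp add: inv3_def)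
  show "inv3 (inv3 k) = k" unfolding inv3_def [of "inv3 k"] 1 using n by (simp add: inv3_def)
  show "inv3 k \<noteq> 0" using n assms by (simp add: inv3_def)
qed

context elliptic_dirac
begin

definition gen :: "complex^2 \<Rightarrow> complex^2" where "gen v = imul (sig \<omega> v)"

lemma bounded_linear_gen: "bounded_linear gen"
  unfolding gen_def [abs_def] by (rule bounded_linear_compose [OF bounded_linear_imul sigB.bounded_linear_right])

lemma gen_gen: "gen (gen v) = - v"
  by (simp add: gen_def sig_sig unit_inner imul_minus)

lemma inner_gen: "v \<bullet> gen v = 0"
proof -
  have "v \<bullet> gen v = - (v \<bullet> gen v)"
    unfolding gen_def by (metis imul_inner inner_commute sig_imul sig_inner)
  then show ?thesis by simp
qed

lemma norm_gen: "norm (gen v) = norm v"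
  by (simp add: gen_def norm_sig unit)

lemma norm_rotate:
  assumes "v \<bullet> w = 0" "norm w = norm v"
  shows "norm (cos a *\<^sub>R v + sin a *\<^sub>R w) = norm (v :: 'v::real_inner)"
proof -
  have "v \<bullet> v = w \<bullet> w" using assms(2) by (simp add: norm_eq)
  then have "(cos a *\<^sub>R v + sin a *\<^sub>R w) \<bullet> (cos a *\<^sub>R v + sin a *\<^sub>R w) = ((sin a)\<^sup>2 + (cos a)\<^sup>2) * (v \<bullet> v)"
    using assms(1) by (simp add: inner_add_left inner_add_right inner_commute power2_eq_square algebra_simps
      del: sin_cos_squared_add sin_cos_squared_add2 sin_cos_squared_add3)
  then show ?thesis by (simp add: norm_eq_sqrt_inner)
qed

lemma conjugated_lie:
  assumes k: "k \<noteq> 0"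
  shows "sig k P + sig (cross3 \<omega> (k - e)) F + (3 * (cross3 \<omega> e \<bullet> k) / (k \<bullet> k)) *\<^sub>R sig k F
    = sig k (P + (2 * (cross3 \<omega> e \<bullet> inv3 k)) *\<^sub>R F + (1/2) *\<^sub>R imul (sig (\<omega> + 2 *\<^sub>R cross3 (cross3 \<omega> e) (inv3 k)) F))
      - (1/2) *\<^sub>R gen (sig k F)"
proof -
  define c where "c = cross3 \<omega> e"
  have n: "k \<bullet> k \<noteq> 0" using k by simp
  have 1: "sig k (sig \<omega> F) - sig \<omega> (sig k F) = - 2 *\<^sub>R imul (sig (cross3 \<omega> k) F)"
    by (simp add: sig_sig inner_commute [of k \<omega>] cross_skew [of k \<omega>] sigB.minus_left imul_minus scaleR_2)
  have ck: "cross3 k (cross3 c k) = (k \<bullet> k) *\<^sub>R c - (c \<bullet> k) *\<^sub>R k"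
    by (simp add: real3_eq_iff real3_inner algebra_simps)
  have k0: "k \<bullet> cross3 c k = 0" by (simp add: real3_inner algebra_simps)
  have 2: "sig k (sig (cross3 c k) F) = imul ((k \<bullet> k) *\<^sub>R sig c F - (c \<bullet> k) *\<^sub>R sig k F)"
    by (simp add: sig_sig k0 ck sigB.diff_left sigB.scaleR_left)
  have i: "cross3 c (inv3 k) = (1 / (k \<bullet> k)) *\<^sub>R cross3 c k" by (simp add: inv3_def real3_eq_iff algebra_simps)
  have ci: "c \<bullet> inv3 k = (c \<bullet> k) / (k \<bullet> k)" by (simp add: inv3_def)
  have w: "cross3 \<omega> (k - e) = cross3 \<omega> k - c" by (simp add: c_def real3_eq_iff algebra_simps)
  have "sig k ((1/2) *\<^sub>R imul (sig (\<omega> + 2 *\<^sub>R cross3 c (inv3 k)) F)) - (1/2) *\<^sub>R gen (sig k F)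
      = (1/2) *\<^sub>R imul (sig k (sig \<omega> F) - sig \<omega> (sig k F)) + (1 / (k \<bullet> k)) *\<^sub>R imul (sig k (sig (cross3 c k) F))"
    by (simp add: i gen_def sigB.add_left sigB.add_right sigB.scaleR_left sigB.scaleR_right imul_add imul_diff imul_scaleR scaleR_add_right scaleR_diff_right)
  also have "\<dots> = sig (cross3 \<omega> k) F - sig c F + ((c \<bullet> k) / (k \<bullet> k)) *\<^sub>R sig k F"
    unfolding 1 2 using n by (simp add: imul_diff imul_scaleR imul_minus scaleR_diff_right)
  finally have "sig k ((1/2) *\<^sub>R imul (sig (\<omega> + 2 *\<^sub>R cross3 c (inv3 k)) F)) - (1/2) *\<^sub>R gen (sig k F)
      = sig (cross3 \<omega> k) F - sig c F + ((c \<bullet> k) / (k \<bullet> k)) *\<^sub>R sig k F" .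
  then have "sig k (P + (2 * (c \<bullet> inv3 k)) *\<^sub>R F + (1/2) *\<^sub>R imul (sig (\<omega> + 2 *\<^sub>R cross3 c (inv3 k)) F)) - (1/2) *\<^sub>R gen (sig k F)
      = sig k P + (2 * (c \<bullet> k) / (k \<bullet> k)) *\<^sub>R sig k F + (sig (cross3 \<omega> k) F - sig c F + ((c \<bullet> k) / (k \<bullet> k)) *\<^sub>R sig k F)"
    by (simp add: sigB.add_right sigB.scaleR_right ci)
  also have "\<dots> = sig k P + sig (cross3 \<omega> (k - e)) F + (3 * (c \<bullet> k) / (k \<bullet> k)) *\<^sub>R sig k F"
  proof -
    have 3: "3 * (c \<bullet> k) / (k \<bullet> k) = 2 * (c \<bullet> k) / (k \<bullet> k) + (c \<bullet> k) / (k \<bullet> k)" by (simp add: add_divide_distrib [symmetric])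
    show ?thesis by (simp only: w 3 sigB.diff_left scaleR_add_left add_ac)
  qed
  finally show ?thesis by (simp add: c_def)
qed

lemma inverse_cube_derivative:
  assumes k: "(k has_vector_derivative k') (at t)" and n: "k t \<noteq> 0"
  shows "((\<lambda>t. 1 / norm (k t) ^ 3) has_real_derivative - 3 * (k t \<bullet> k') / norm (k t) ^ 5) (at t)"
proof -
  have pos: "norm (k t) > 0" using n by simp
  have "((\<lambda>t. norm (k t)) has_derivative (\<lambda>h. (h *\<^sub>R k') \<bullet> sgn (k t))) (at t)"
    using diff_chain_at [OF k [unfolded has_vector_derivative_def] has_derivative_norm [OF n]] by (simp add: o_def)
  then have d: "((\<lambda>t. norm (k t)) has_real_derivative (k t \<bullet> k') / norm (k t)) (at t)"
    unfolding has_field_derivative_def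
    by (rule has_derivative_eq_rhs) (simp add: fun_eq_iff sgn_div_norm inner_commute field_simps)
  show ?thesis
    by (rule DERIV_cong [OF DERIV_divide [OF DERIV_const DERIV_power [OF d]]])
      (use pos in \<open>simp_all add: field_simps eval_nat_numeral\<close>)
qed

lemma orbit_inequality:
  fixes f :: spinor
  assumes f: "C_upto (Suc 0) f" and x: "\<omega> \<bullet> x \<noteq> 0"
  shows "0 \<le> integral {0..2*pi} (\<lambda>t. ((norm (lie f (inv3 (orb x t))))\<^sup>2 - (norm (f (inv3 (orb x t))))\<^sup>2 / 4) / norm (orb x t) ^ 4)"
proof -
  have df: "f differentiable at z" for z using f by (simp add: C_upto_Suc_iff)
  have fc: "continuous_on UNIV f" by (rule C_upto_imp_continuous_on [OF f])
  have Ac: "continuous_on UNIV A" by (rule C_upto_imp_continuous_on [OF A1])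
  have "C_upto 0 A" by (rule C_upto_Suc_lower [OF A1])
  then have lc: "continuous_on UNIV (lie f)" using lie_C_upto [OF f] by simp
  define k where "k = orb x"
  define y where "y t = inv3 (k t)" for t
  have k0: "k t \<noteq> 0" for t unfolding k_def by (rule orb_nonzero [OF x])
  have dk: "(k has_vector_derivative cross3 \<omega> (k t - e)) (at t)" for t
    unfolding k_def by (rule orb_derivative)
  have dy: "(y has_vector_derivative ell \<omega> e (y t)) (at t)" for t
    unfolding y_def [abs_def] k_def by (rule inv3_orb_derivative [OF x])
  have kc: "continuous_on S k" for S unfolding k_def by (rule orb_continuous)
  have yc: "continuous_on S y" for S
    unfolding y_def [abs_def] by (rule inv3_continuous [OF kc k0])
  define h where "h t = A (y t) \<bullet> ell \<omega> e (y t)" for t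
  have hc: "continuous_on UNIV h"
    unfolding h_def by (intro continuous_intros continuous_on_compose2 [OF Ac yc] continuous_on_compose2 [OF X_continuous yc]) auto
  have "\<exists>g. \<forall>t. (-\<infinity>::ereal) < ereal t \<longrightarrow> ereal t < \<infinity> \<longrightarrow> (g has_vector_derivative h t) (at t)"
    by (rule einterval_antiderivative) (use hc in \<open>auto simp: continuous_on_eq_continuous_at\<close>)
  then obtain g where g: "\<And>t. (g has_vector_derivative h t) (at t)" by auto
  have "(h has_integral (g (2 * pi) - g 0)) {0..2*pi}"
    by (rule fundamental_theorem_of_calculus) (auto intro: has_vector_derivative_at_within [OF g])
  moreover have "integral {0..2*pi} h = 0"
    unfolding h_def y_def k_def by (rule orbit_holonomy [OF x])
  ultimately have gper: "g (2 * pi) = g 0" by (auto dest: integral_unique)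
  define F where "F t = f (y t)" for t
  define s where "s t = (1 / norm (k t) ^ 3) *\<^sub>R sig (k t) (F t)" for t
  define Q where "Q t = (1 / norm (k t) ^ 3) *\<^sub>R sig (k t) (lie f (y t))" for t
  have dF: "(F has_vector_derivative pd (ell \<omega> e (y t)) f (y t)) (at t)" for t
    unfolding F_def [abs_def] has_vector_derivative_def
    using diff_chain_at [OF dy [unfolded has_vector_derivative_def] has_derivative_pd [OF df]] pd_add_dir(2) [OF df]
    by (simp add: o_def)
  have ds: "(s has_vector_derivative Q t + h t *\<^sub>R imul (s t) - (1/2) *\<^sub>R gen (s t)) (at t)" for t
  proof -
    let ?P = "pd (ell \<omega> e (y t)) f (y t)"
    have n: "norm (k t) > 0" using k0 by simp
    have kk: "k t \<bullet> cross3 \<omega> (k t - e) = - (cross3 \<omega> e \<bullet> k t)"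
      by (simp add: real3_inner algebra_simps)
    have 0: "(s has_vector_derivative (1 / norm (k t) ^ 3) *\<^sub>R (sig (k t) ?P + sig (cross3 \<omega> (k t - e)) (F t))
        + (- 3 * (k t \<bullet> cross3 \<omega> (k t - e)) / norm (k t) ^ 5) *\<^sub>R sig (k t) (F t)) (at t)"
      unfolding s_def
      by (rule has_vector_derivative_scaleR [OF inverse_cube_derivative [OF dk k0] sigB.has_vector_derivative [OF dk dF]])
    have e3: "- 3 * (k t \<bullet> cross3 \<omega> (k t - e)) / norm (k t) ^ 5 = (1 / norm (k t) ^ 3) * (3 * (cross3 \<omega> e \<bullet> k t) / (k t \<bullet> k t))"
      unfolding kk dot_square_norm using n by (simp add: field_simps eval_nat_numeral)
    have "(s has_vector_derivative (1 / norm (k t) ^ 3) *\<^sub>R (sig (k t) ?P + sig (cross3 \<omega> (k t - e)) (F t)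
        + (3 * (cross3 \<omega> e \<bullet> k t) / (k t \<bullet> k t)) *\<^sub>R sig (k t) (F t))) (at t)"
      using 0 unfolding e3 by (simp add: scaleR_add_right)
    then have 1: "(s has_vector_derivative (1 / norm (k t) ^ 3) *\<^sub>R (sig (k t) (?P + (2 * (cross3 \<omega> e \<bullet> y t)) *\<^sub>R F t + (1/2) *\<^sub>R imul (sig (\<omega> + 2 *\<^sub>R cross3 (cross3 \<omega> e) (y t)) (F t)))
      - (1/2) *\<^sub>R gen (sig (k t) (F t)))) (at t)"
      unfolding conjugated_lie [OF k0] y_def [symmetric] .
    have 2: "?P + (2 * (cross3 \<omega> e \<bullet> y t)) *\<^sub>R F t + (1/2) *\<^sub>R imul (sig (\<omega> + 2 *\<^sub>R cross3 (cross3 \<omega> e) (y t)) (F t))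
       = lie f (y t) + h t *\<^sub>R imul (F t)"
      by (simp add: lie_def cov_def h_def F_def)
    show ?thesis
      using 1 unfolding 2
      by (rule has_vector_derivative_eq_rhs)
        (simp add: Q_def s_def gen_def sigB.add_right sigB.scaleR_right imul_scaleR scaleR_add_right scaleR_diff_right)
  qed
  define T where "T a v = cos (a / 2) *\<^sub>R v + sin (a / 2) *\<^sub>R gen v" for a v
  define v where "v t = T t (s t)" for t
  have T_lin: "T a (w + z) = T a w + T a z" "T a (r *\<^sub>R w) = r *\<^sub>R T a w" "T a (imul w) = imul (T a w)" for a w z r
    by (simp_all add: T_def gen_def sigB.add_right sigB.scaleR_right imul_add imul_scaleR scaleR_add_right mult.commute)
  have dv: "(v has_vector_derivative T t (Q t) + h t *\<^sub>R imul (v t)) (at t)" for t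
  proof -
    let ?s' = "Q t + h t *\<^sub>R imul (s t) - (1/2) *\<^sub>R gen (s t)"
    have c: "((\<lambda>t. cos (t / 2)) has_real_derivative - sin (t / 2) / 2) (at t)"
        "((\<lambda>t. sin (t / 2)) has_real_derivative cos (t / 2) / 2) (at t)"
      by (auto intro!: derivative_eq_intros)
    have "(v has_vector_derivative (cos (t/2) *\<^sub>R ?s' + (- sin (t / 2) / 2) *\<^sub>R s t) + (sin (t/2) *\<^sub>R gen ?s' + (cos (t/2) / 2) *\<^sub>R gen (s t))) (at t)"
      unfolding v_def T_def
      by (rule has_vector_derivative_add [OF has_vector_derivative_scaleR [OF c(1) ds] has_vector_derivative_scaleR [OF c(2)
            bounded_linear.has_vector_derivative [OF bounded_linear_gen ds]]])
    moreover have "gen ?s' = gen (Q t + h t *\<^sub>R imul (s t)) + (1/2) *\<^sub>R s t"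
      using linear_diff [OF bounded_linear.linear [OF bounded_linear_gen]] linear_scale [OF bounded_linear.linear [OF bounded_linear_gen]]
      by (simp add: gen_gen)
    ultimately have "(v has_vector_derivative T t (Q t + h t *\<^sub>R imul (s t))) (at t)"
      by (simp add: T_def scaleR_diff_right scaleR_add_right algebra_simps)
    then show ?thesis by (simp add: T_lin v_def)
  qed
  define u where "u t = cos (g t) *\<^sub>R v t - sin (g t) *\<^sub>R imul (v t)" for t
  define u' where "u' t = cos (g t) *\<^sub>R T t (Q t) - sin (g t) *\<^sub>R imul (T t (Q t))" for t
  have du: "(u has_vector_derivative u' t) (at t)" for t
  proof -
    have g': "(g has_real_derivative h t) (at t)"
      using g by (simp add: has_real_derivative_iff_has_vector_derivative)
    have c: "((\<lambda>t. cos (g t)) has_real_derivative - sin (g t) * h t) (at t)"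
        "((\<lambda>t. sin (g t)) has_real_derivative cos (g t) * h t) (at t)"
      by (auto intro!: derivative_eq_intros g')
    let ?v' = "T t (Q t) + h t *\<^sub>R imul (v t)"
    have "(u has_vector_derivative (cos (g t) *\<^sub>R ?v' + (- sin (g t) * h t) *\<^sub>R v t) - (sin (g t) *\<^sub>R imul ?v' + (cos (g t) * h t) *\<^sub>R imul (v t))) (at t)"
      unfolding u_def
      by (rule has_vector_derivative_diff [OF has_vector_derivative_scaleR [OF c(1) dv] has_vector_derivative_scaleR [OF c(2)
            bounded_linear.has_vector_derivative [OF bounded_linear_imul dv]]])
    then show ?thesis
      by (rule has_vector_derivative_eq_rhs) (simp add: u'_def imul_add imul_scaleR scaleR_add_right algebra_simps)
  qed
  have Qc: "continuous_on UNIV Q"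
    unfolding Q_def by (intro continuous_intros kc continuous_on_sig continuous_on_compose2 [OF lc yc]) (use k0 in auto)
  have gc: "continuous_on UNIV g"
    by (intro continuous_at_imp_continuous_on ballI has_vector_derivative_continuous [OF g])
  have TQc: "continuous_on UNIV (\<lambda>t. T t (Q t))"
    unfolding T_def by (intro continuous_intros Qc bounded_linear.continuous_on [OF bounded_linear_gen]) auto
  have u'c: "continuous_on UNIV u'"
    unfolding u'_def by (intro continuous_intros gc TQc imul_continuous_on) 
  have anti: "u (2 * pi) = - u 0"
  proof -
    have "k (2 * pi) = k 0" unfolding k_def by (rule orb_period)
    then have "s (2 * pi) = s 0" by (simp add: s_def F_def y_def)
    then have "v (2 * pi) = - v 0" by (simp add: v_def T_def)
    then show ?thesis by (simp add: u_def gper imul_minus)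
  qed
  have nT: "norm (T a w) = norm w" for a w
    unfolding T_def by (rule norm_rotate) (simp_all add: inner_gen norm_gen)
  have nE: "norm (cos a *\<^sub>R w - sin a *\<^sub>R imul w) = norm w" for a w
    using norm_rotate [of w "- imul w" a] by simp
  have nk: "norm (k t) > 0" for t using k0 by simp
  have nu: "norm (u t) = norm (F t) / norm (k t) ^ 2" for t
    using nk [of t] unfolding u_def nE v_def nT s_def by (simp add: norm_sig eval_nat_numeral field_simps)
  have nu': "norm (u' t) = norm (lie f (y t)) / norm (k t) ^ 2" for t
    using nk [of t] unfolding u'_def nE nT Q_def by (simp add: norm_sig eval_nat_numeral field_simps)
  have "0 \<le> integral {0..2*pi} (\<lambda>t. (norm (u' t))\<^sup>2 - (norm (u t))\<^sup>2 / 4)"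
    by (rule wirtinger_antiperiodic [OF du u'c anti])
  moreover have "(norm (u' t))\<^sup>2 - (norm (u t))\<^sup>2 / 4 = ((norm (lie f (y t)))\<^sup>2 - (norm (F t))\<^sup>2 / 4) / norm (k t) ^ 4" for t
    unfolding nu nu' power_divide by (simp add: diff_divide_distrib flip: power_mult)
  ultimately show ?thesis by (simp add: y_def k_def F_def)
qed

end



lemma AE_not_negligible: "negligible N \<Longrightarrow> AE x in lborel. x \<notin> N"
  unfolding negligible_iff_null_sets null_sets_completion_iff2 by (auto intro: AE_I')

lemma borel_integrable_iff_absolutely_integrable:
  fixes F :: "'a::euclidean_space \<Rightarrow> real"
  assumes "F \<in> borel_measurable borel"
  shows "integrable lborel F \<longleftrightarrow> F absolutely_integrable_on UNIV"
  using integrable_completion [of F lborel] assms by (simp add: set_integrable_def)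

lemma change_of_variables_real:
  fixes g :: "real^3 \<Rightarrow> real^3" and F :: "real^3 \<Rightarrow> real"
  assumes S: "S \<in> sets lebesgue" and g: "\<And>x. x \<in> S \<Longrightarrow> (g has_derivative g' x) (at x)" and inj: "inj_on g S"
    and F: "F absolutely_integrable_on (g ` S)"
  shows "(\<lambda>x. \<bar>det (matrix (g' x))\<bar> * F (g x)) absolutely_integrable_on S"
    "integral S (\<lambda>x. \<bar>det (matrix (g' x))\<bar> * F (g x)) = integral (g ` S) F"
proof -
  have der: "(g has_derivative g' x) (at x within S)" if "x \<in> S" for x
    by (rule has_derivative_at_withinI [OF g [OF that]])
  have F1: "(\<lambda>x. vec (F x) :: real^1) absolutely_integrable_on (g ` S)"
    using F by (simp add: absolutely_integrable_on_1_iff)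
  note cov = has_absolute_integral_change_of_variables [OF S der inj, of "\<lambda>x. vec (F x) :: real^1" "integral (g ` S) (\<lambda>x. vec (F x) :: real^1)"]
  have 1: "(\<lambda>x. \<bar>det (matrix (g' x))\<bar> *\<^sub>R (vec (F (g x)) :: real^1)) absolutely_integrable_on S"
    and 2: "integral S (\<lambda>x. \<bar>det (matrix (g' x))\<bar> *\<^sub>R (vec (F (g x)) :: real^1)) = integral (g ` S) (\<lambda>x. vec (F x) :: real^1)"
    using cov F1 by auto
  show "(\<lambda>x. \<bar>det (matrix (g' x))\<bar> * F (g x)) absolutely_integrable_on S"
    using 1 by (simp add: absolutely_integrable_on_1_iff)
  show "integral S (\<lambda>x. \<bar>det (matrix (g' x))\<bar> * F (g x)) = integral (g ` S) F"
    using 2 by (simp add: integral_on_1_eq)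
qed

lemma inv3_has_derivative:
  assumes "x \<noteq> 0"
  shows "(inv3 has_derivative (\<lambda>u. (1 / (x \<bullet> x)) *\<^sub>R u - (2 * (x \<bullet> u) / (x \<bullet> x)\<^sup>2) *\<^sub>R x)) (at x)"
proof -
  have n: "x \<bullet> x \<noteq> 0" using assms by simp
  have "((\<lambda>x. 1 / (x \<bullet> x)) has_derivative (\<lambda>u. - (2 * (x \<bullet> u) / (x \<bullet> x)\<^sup>2))) (at x)"
    by (rule has_derivative_eq_rhs [OF has_derivative_divide [OF has_derivative_const has_derivative_inner [OF has_derivative_ident has_derivative_ident] n]])
      (use n in \<open>auto simp: fun_eq_iff power2_eq_square inner_commute field_simps\<close>)
  from has_derivative_scaleR [OF this has_derivative_ident]
  show ?thesis unfolding inv3_def [abs_def] by (rule has_derivative_eq_rhs) (simp add: fun_eq_iff)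
qed

lemma det_inv3_derivative:
  fixes x :: "real^3"
  assumes "x \<noteq> 0"
  shows "\<bar>det (matrix (\<lambda>u. (1 / (x \<bullet> x)) *\<^sub>R u - (2 * (x \<bullet> u) / (x \<bullet> x)\<^sup>2) *\<^sub>R x))\<bar> = 1 / norm x ^ 6"
proof -
  define n where "n = x \<bullet> x"
  have n: "n > 0" using assms by (simp add: n_def)
  have ne: "n = x$1 * x$1 + x$2 * x$2 + x$3 * x$3" by (simp add: n_def real3_inner)
  define p where "p = 1 / n"
  define q where "q = 2 / n\<^sup>2"
  have m: "matrix (\<lambda>u. (1 / n) *\<^sub>R u - (2 * (x \<bullet> u) / n\<^sup>2) *\<^sub>R x) $ i $ j = p * (if i = j then 1 else 0) - q * x $ j * x $ i" for i j
    by (simp add: matrix_def p_def q_def inner_axis) (simp add: axis_def)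
  have "det (matrix (\<lambda>u. (1 / n) *\<^sub>R u - (2 * (x \<bullet> u) / n\<^sup>2) *\<^sub>R x)) = p^3 - p\<^sup>2 * q * (x$1 * x$1 + x$2 * x$2 + x$3 * x$3)"
    unfolding det_3 m by (simp add: power2_eq_square power3_eq_cube algebra_simps)
  also have "\<dots> = p^3 - p\<^sup>2 * q * n" by (simp only: ne)
  also have "\<dots> = - (1 / n ^ 3)"
    using n by (simp add: p_def q_def power2_eq_square power3_eq_cube field_simps)
  finally have "\<bar>det (matrix (\<lambda>u. (1 / n) *\<^sub>R u - (2 * (x \<bullet> u) / n\<^sup>2) *\<^sub>R x))\<bar> = 1 / n ^ 3"
    using n by simp
  also have "n ^ 3 = norm x ^ 6" by (simp add: n_def dot_square_norm flip: power_mult)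
  finally show ?thesis by (simp add: n_def)
qed

lemma inv3_measurable: "inv3 \<in> borel_measurable borel"
proof -
  have [measurable]: "(\<lambda>x::real^3. x \<bullet> x) \<in> borel_measurable borel" "(\<lambda>x::real^3. x) \<in> borel_measurable borel"
    by (auto intro!: borel_measurable_continuous_onI continuous_intros)
  show ?thesis unfolding inv3_def [abs_def] by measurable
qed

lemma integral_inversion:
  fixes F :: "real^3 \<Rightarrow> real"
  assumes F: "integrable lborel F"
  shows "integrable lborel (\<lambda>x. F (inv3 x) / norm x ^ 6)"
    "(LINT x|lborel. F (inv3 x) / norm x ^ 6) = (LINT x|lborel. F x)"
proof -
  let ?S = "- {0 :: real^3}"
  have Fm: "F \<in> borel_measurable borel" using F by simp
  have img: "inv3 ` ?S = ?S"
  proof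
    show "inv3 ` ?S \<subseteq> ?S" by (rule image_subsetI) (simp add: inv3_simps(3))
    show "?S \<subseteq> inv3 ` ?S"
    proof
      fix x assume "x \<in> ?S"
      then have "inv3 x \<in> ?S" using inv3_simps(3) [of x] by simp
      then have "inv3 (inv3 x) \<in> inv3 ` ?S" by (rule imageI)
      then show "x \<in> inv3 ` ?S" using \<open>x \<in> ?S\<close> by (simp add: inv3_simps(2))
    qed
  qed
  have inj: "inj_on inv3 ?S" by (rule inj_on_inverseI [where g = inv3]) (simp add: inv3_simps)
  have Fa: "F absolutely_integrable_on UNIV" using F borel_integrable_iff_absolutely_integrable [OF Fm] by simp
  have Fa': "F absolutely_integrable_on (inv3 ` ?S)"
    unfolding img by (rule set_integrable_subset [OF Fa]) auto
  define D where "D x = (\<lambda>u. (1 / (x \<bullet> x)) *\<^sub>R u - (2 * (x \<bullet> u) / (x \<bullet> x)\<^sup>2) *\<^sub>R x)" for x :: "real^3"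
  have d: "(inv3 has_derivative D x) (at x)" if "x \<in> ?S" for x
    unfolding D_def by (rule inv3_has_derivative) (use that in simp)
  have S: "?S \<in> sets lebesgue" by auto
  have eq: "\<bar>det (matrix (D x))\<bar> * F (inv3 x) = F (inv3 x) / norm x ^ 6" if "x \<noteq> 0" for x
    using det_inv3_derivative [of x] that by (simp add: D_def)
  note cov = change_of_variables_real [where g' = D, OF S d inj Fa']
  define G where "G x = F (inv3 x) / norm x ^ 6" for x
  have Gm: "G \<in> borel_measurable borel"
    unfolding G_def using measurable_compose [OF inv3_measurable Fm] by measurable
  have G1: "G absolutely_integrable_on ?S"
    using cov(1) by (rule absolutely_integrable_spike [OF _ negligible_empty]) (auto simp: eq G_def)
  have "(\<lambda>x. if x \<in> ?S then G x else 0) absolutely_integrable_on UNIV"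
    by (rule iffD2 [OF absolutely_integrable_restrict_UNIV G1])
  moreover have "(\<lambda>x. if x \<in> ?S then G x else 0) = G" by (auto simp: G_def)
  ultimately have Ga: "G absolutely_integrable_on UNIV" by simp
  show Gi: "integrable lborel (\<lambda>x. F (inv3 x) / norm x ^ 6)"
    using Ga borel_integrable_iff_absolutely_integrable [OF Gm] by (simp add: G_def [abs_def])
  have "(LINT x|lborel. G x) = integral UNIV G"
    using integral_lborel [OF Gi] by (simp add: G_def [abs_def])
  also have "\<dots> = integral ?S G"
    by (rule integral_spike_set) (auto intro: negligible_subset [of "{0}"])
  also have "\<dots> = integral ?S (\<lambda>x. \<bar>det (matrix (D x))\<bar> * F (inv3 x))"
    by (rule integral_cong) (auto simp: eq G_def)
  also have "\<dots> = integral ?S F" using cov(2) by (simp add: img)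
  also have "\<dots> = integral UNIV F"
    by (rule integral_spike_set) (auto intro: negligible_subset [of "{0}"])
  also have "\<dots> = (LINT x|lborel. F x)" using integral_lborel [OF F] by simp
  finally show "(LINT x|lborel. F (inv3 x) / norm x ^ 6) = (LINT x|lborel. F x)" by (simp add: G_def)
qed

context elliptic_dirac
begin

lemma orb_joint_continuous: "continuous_on UNIV (\<lambda>p. orb (snd p) (fst p))"
  unfolding orb_def Rt_def
  by (intro continuous_intros bounded_bilinear.continuous_on [OF bounded_bilinear_cross3])

lemma integral_orb:
  fixes G :: "real^3 \<Rightarrow> real"
  assumes G: "integrable lborel G"
  shows "integrable lborel (\<lambda>x. G (orb x t))" "(LINT x|lborel. G (orb x t)) = (LINT x|lborel. G x)"
proof -
  have Gm: "G \<in> borel_measurable borel" using G by simp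
  have "continuous_on UNIV (\<lambda>x. orb x t)"
    unfolding orb_def Rt_def
    by (intro continuous_intros bounded_bilinear.continuous_on [OF bounded_bilinear_cross3])
  then have om: "(\<lambda>x. orb x t) \<in> borel_measurable borel" by (rule borel_measurable_continuous_onI)
  have blR: "bounded_linear (Rt t)" using Rt_linear by (simp add: linear_conv_bounded_linear)
  have d: "((\<lambda>x. orb x t) has_derivative Rt t) (at x)" for x
  proof -
    have "((\<lambda>x. x - e) has_derivative (\<lambda>u. u)) (at x)" by (auto intro!: derivative_eq_intros)
    from has_derivative_add [OF has_derivative_const bounded_linear.has_derivative [OF blR this]]
    show ?thesis by (simp add: orb_def)
  qed
  have inj: "inj (\<lambda>x. orb x t)"
    using injD [OF orthogonal_transformation_inj [OF Rt_orthogonal, of t]] by (fastforce intro: injI simp: orb_def)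
  have "surj (Rt t)" by (rule orthogonal_transformation_surj [OF Rt_orthogonal])
  then have img: "(\<lambda>x. orb x t) ` UNIV = UNIV"
  proof -
    assume s: "surj (Rt t)"
    have "\<exists>x. z = orb x t" for z
    proof -
      obtain v where "z - e = Rt t v" using s by (meson surjD)
      then have "z = orb (v + e) t" by (simp add: orb_def algebra_simps)
      then show ?thesis ..
    qed
    then show ?thesis by blast
  qed
  have det1: "\<bar>det (matrix (Rt t))\<bar> = 1"
    by (rule orthogonal_transformation_det [OF Rt_orthogonal])
  have Ga: "G absolutely_integrable_on ((\<lambda>x. orb x t) ` UNIV)"
    unfolding img using G borel_integrable_iff_absolutely_integrable [OF Gm] by simp
  note cov = change_of_variables_real [where g' = "\<lambda>x. Rt t", OF _ d inj Ga]
  have "(\<lambda>x. G (orb x t)) absolutely_integrable_on UNIV" using cov(1) by (simp add: det1)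
  then show i: "integrable lborel (\<lambda>x. G (orb x t))"
    using borel_integrable_iff_absolutely_integrable [OF measurable_compose [OF om Gm]] by simp
  have "(LINT x|lborel. G (orb x t)) = integral UNIV (\<lambda>x. G (orb x t))" using integral_lborel [OF i] by simp
  also have "\<dots> = integral UNIV G" using cov(2) by (simp add: det1 img)
  also have "\<dots> = (LINT x|lborel. G x)" using integral_lborel [OF G] by simp
  finally show "(LINT x|lborel. G (orb x t)) = (LINT x|lborel. G x)" .
qed

lemma orbit_average_nonneg:
  fixes G :: "real^3 \<Rightarrow> real"
  assumes G: "integrable lborel G"
    and nn: "AE x in lborel. 0 \<le> (LINT t|lborel. indicator {0..2*pi} t * G (orb x t))"
  shows "0 \<le> (LINT x|lborel. G x)"
proof -
  have Gm: "G \<in> borel_measurable borel" using G by simp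
  have m: "(\<lambda>p. orb (snd p) (fst p)) \<in> borel_measurable (lborel \<Otimes>\<^sub>M lborel :: (real \<times> (real^3)) measure)"
    using borel_measurable_continuous_onI [OF orb_joint_continuous] by (simp add: lborel_prod)
  have i: "integrable (lborel \<Otimes>\<^sub>M lborel) (\<lambda>(t, x). indicator {0..2*pi} t * G (orb x t))"
  proof (rule lborel_pair.Fubini_integrable)
    have "(\<lambda>p. indicat_real {0..2*pi} (fst p)) \<in> borel_measurable (lborel \<Otimes>\<^sub>M lborel :: (real \<times> (real^3)) measure)"
      by measurable
    then show "(\<lambda>(t, x). indicator {0..2*pi} t * G (orb x t)) \<in> borel_measurable (lborel \<Otimes>\<^sub>M (lborel :: (real^3) measure))"
      using measurable_compose [OF m Gm] unfolding case_prod_unfold by (intro borel_measurable_times)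
    have e: "(LINT x|lborel. norm (case (t, x) of (t, x) \<Rightarrow> indicator {0..2*pi} t * G (orb x t))) = indicator {0..2*pi} t * (LINT x|lborel. \<bar>G x\<bar>)" for t :: real
      using integral_orb(2) [of "\<lambda>x. \<bar>G x\<bar>" t] G by (simp add: abs_mult)
    show "integrable lborel (\<lambda>t. LINT x|lborel. norm (case (t, x) of (t, x) \<Rightarrow> indicator {0..2*pi} t * G (orb x t)))"
      unfolding e by (intro integrable_mult_left integrable_real_indicator) auto
    show "AE t in lborel. integrable lborel (\<lambda>x. case (t, x) of (t, x) \<Rightarrow> indicator {0..2*pi} t * G (orb x t))"
      using integral_orb(1) [OF G] by auto
  qed
  have "0 \<le> (LINT x|lborel. LINT t|lborel. indicator {0..2*pi} t * G (orb x t))"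
    by (rule integral_nonneg_AE [OF nn])
  also have "\<dots> = (LINT t|lborel. LINT x|lborel. indicator {0..2*pi} t * G (orb x t))"
    by (rule lborel_pair.Fubini_integral [OF i])
  also have "\<dots> = (LINT t|lborel. indicator {0..2*pi} t * (LINT x|lborel. G x))"
    by (simp add: integral_orb(2) [OF G])
  also have "\<dots> = 2 * pi * (LINT x|lborel. G x)" by simp
  finally show ?thesis using pi_gt_zero by (simp add: zero_le_mult_iff not_le)
qed

lemma norm_cross_Rt: "norm (cross3 \<omega> (Rt t v)) = norm (cross3 \<omega> v)"
proof -
  have c: "cross3 \<omega> z \<bullet> cross3 \<omega> z = z \<bullet> z - (\<omega> \<bullet> z)\<^sup>2" for z
  proof -
    have "cross3 \<omega> z \<bullet> cross3 \<omega> z = (\<omega> \<bullet> \<omega>) * (z \<bullet> z) - (\<omega> \<bullet> z)\<^sup>2"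
      by (simp add: real3_inner power2_eq_square algebra_simps)
    then show ?thesis by (simp add: unit_inner)
  qed
  have "Rt t v \<bullet> Rt t v = v \<bullet> v" using norm_Rt [of t v] by (simp add: norm_eq)
  then show ?thesis unfolding norm_eq c Rt_axis by simp
qed

lemma norm_ell_inv3:
  assumes "k \<noteq> 0"
  shows "norm (ell \<omega> e (inv3 k)) = norm (cross3 \<omega> (k - e)) / (norm k)\<^sup>2"
proof -
  define n where "n = k \<bullet> k"
  define u where "u = cross3 \<omega> (k - e)"
  have n: "n > 0" using assms by (simp add: n_def)
  have "ell \<omega> e (inv3 k) \<bullet> ell \<omega> e (inv3 k) = (u \<bullet> u) / n\<^sup>2"
    unfolding ell_inv3 [OF assms] n_def [symmetric] u_def [symmetric]
    using n by (simp add: inner_diff_left inner_diff_right inner_commute [of u k] n_def [symmetric] field_simps power2_eq_square)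
  then have "(norm (ell \<omega> e (inv3 k)))\<^sup>2 = (norm u / n)\<^sup>2"
    by (simp add: power2_norm_eq_inner power_divide)
  then have "norm (ell \<omega> e (inv3 k)) = norm u / n"
    by (rule power2_eq_imp_eq) (use n in simp_all)
  then show ?thesis by (simp add: n_def u_def dot_square_norm)
qed

theorem orbit_poincare:
  fixes f :: spinor
  assumes f: "C_upto 2 f" and K: "compact K" "K \<subseteq> {x. ell \<omega> e x \<noteq> 0}" "\<And>x. x \<notin> K \<Longrightarrow> f x = 0"
  shows "(LINT x|lborel. 1 / (4 * norm (ell \<omega> e x)) * (norm (f x))\<^sup>2) \<le> (LINT x|lborel. norm (ell \<omega> e x) * (norm (dirac A f x))\<^sup>2)"
proof -
  have f1: "C_upto (Suc 0) f" by (rule C_upto_mono [OF f]) simp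
  have fc: "continuous_on UNIV f" by (rule C_upto_imp_continuous_on [OF f1])
  have "C_upto 0 A" by (rule C_upto_Suc_lower [OF A1])
  then have lc: "continuous_on UNIV (lie f)" using lie_C_upto [OF f1] by simp
  define F where "F x = ((norm (lie f x))\<^sup>2 - (norm (f x))\<^sup>2 / 4) / norm (ell \<omega> e x)" for x
  note star = lie_integral_le_dirac_integral [OF f K]
  have i2: "integrable lborel (\<lambda>x. (norm (f x))\<^sup>2 / 4 / norm (ell \<omega> e x))"
    by (rule div_weight_integrable [OF _ K(1,2)]) (auto intro!: continuous_intros fc simp: K(3))
  have Fe: "F x = (norm (lie f x))\<^sup>2 / norm (ell \<omega> e x) - (norm (f x))\<^sup>2 / 4 / norm (ell \<omega> e x)" for x
    by (simp add: F_def diff_divide_distrib)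
  have Fi: "integrable lborel F" unfolding Fe [abs_def] using star(1) i2 by simp
  define G where "G x = F (inv3 x) / norm x ^ 6" for x
  note inv = integral_inversion [OF Fi]
  have Gi: "integrable lborel G" unfolding G_def using inv(1) .
  have hyp: "negligible {x. \<omega> \<bullet> x = 0}"
    by (rule negligible_hyperplane) (use unit in auto)
  have "0 \<le> (LINT x|lborel. G x)"
  proof (rule orbit_average_nonneg [OF Gi])
    show "AE x in lborel. 0 \<le> (LINT t|lborel. indicator {0..2*pi} t * G (orb x t))"
      using AE_not_negligible [OF hyp]
    proof eventually_elim
      case (elim x)
      then have x: "\<omega> \<bullet> x \<noteq> 0" by simp
      define w where "w = norm (cross3 \<omega> (x - e))"
      define H where "H t = ((norm (lie f (inv3 (orb x t))))\<^sup>2 - (norm (f (inv3 (orb x t))))\<^sup>2 / 4) / norm (orb x t) ^ 4" for t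
      have k0: "orb x t \<noteq> 0" for t by (rule orb_nonzero [OF x])
      have GH: "G (orb x t) = H t / w" for t
      proof -
        have "norm (orb x t) > 0" using k0 by simp
        moreover have "norm (ell \<omega> e (inv3 (orb x t))) = w / (norm (orb x t))\<^sup>2"
          unfolding norm_ell_inv3 [OF k0] w_def by (simp add: orb_def norm_cross_Rt)
        ultimately show ?thesis
          by (simp add: G_def F_def H_def eval_nat_numeral)
      qed
      have yc: "continuous_on {0..2*pi} (\<lambda>t. inv3 (orb x t))" by (rule inv3_continuous [OF orb_continuous k0])
      have Hc: "continuous_on {0..2*pi} H"
        unfolding H_def
        by (intro continuous_intros orb_continuous continuous_on_compose2 [OF lc yc] continuous_on_compose2 [OF fc yc]) (auto simp: k0)
      have si: "set_integrable lborel {0..2*pi} H"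
        unfolding set_integrable_def using borel_integrable_compact [OF compact_Icc Hc] .
      have "(LINT t|lborel. indicator {0..2*pi} t * G (orb x t)) = (LINT t|lborel. indicator {0..2*pi} t * H t) / w"
        unfolding GH by simp
      also have "(LINT t|lborel. indicator {0..2*pi} t * H t) = integral {0..2*pi} H"
        using set_borel_integral_eq_integral(2) [OF si] by (simp add: set_lebesgue_integral_def)
      finally show ?case
        using orbit_inequality [OF f1 x, folded H_def] by (simp add: w_def)
    qed
  qed
  also have "\<dots> = (LINT x|lborel. F x)" unfolding G_def by (rule inv(2))
  also have "\<dots> = (LINT x|lborel. (norm (lie f x))\<^sup>2 / norm (ell \<omega> e x)) - (LINT x|lborel. (norm (f x))\<^sup>2 / 4 / norm (ell \<omega> e x))"
    unfolding Fe using star(1) i2 by simp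
  finally have "(LINT x|lborel. (norm (f x))\<^sup>2 / 4 / norm (ell \<omega> e x)) \<le> (LINT x|lborel. norm (ell \<omega> e x) * (norm (dirac A f x))\<^sup>2)"
    using star(2) by linarith
  then show ?thesis by simp
qed

end



context elliptic_dirac
begin

definition Q :: "real^3 \<Rightarrow> real" where
  "Q x = 1 - 2 * (e \<bullet> x) + (1 + e \<bullet> e) * (x \<bullet> x)"

definition gQ :: "real^3 \<Rightarrow> real^3" where
  "gQ x = (2 * (1 + e \<bullet> e)) *\<^sub>R x - 2 *\<^sub>R e"

definition N :: "real^3 \<Rightarrow> real" where
  "N x = (x \<bullet> x) * (Q x - x \<bullet> x) - (\<omega> \<bullet> x)\<^sup>2"

definition gN :: "real^3 \<Rightarrow> real^3" where
  "gN x = (2 * Q x - 4 * (x \<bullet> x)) *\<^sub>R x + (x \<bullet> x) *\<^sub>R gQ x - (2 * (\<omega> \<bullet> x)) *\<^sub>R \<omega>"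

definition D :: "real^3 \<Rightarrow> real" where
  "D x = 1 - 4 * (e \<bullet> x) + 4 * (e \<bullet> e) * (x \<bullet> x)"

definition Y :: "real^3 \<Rightarrow> real^3" where
  "Y x = (1/4) *\<^sub>R gN x - (N x / (2 * Q x)) *\<^sub>R gQ x"

lemma N_eq: "N x = (norm (ell \<omega> e x))\<^sup>2"
proof -
  define c where "c = cross3 \<omega> e"
  define v where "v = cross3 \<omega> x"
  have c: "c \<bullet> c = e \<bullet> e"
  proof -
    have "c \<bullet> c = (\<omega> \<bullet> \<omega>) * (e \<bullet> e) - (\<omega> \<bullet> e)\<^sup>2" by (simp add: c_def real3_inner power2_eq_square algebra_simps)
    then show ?thesis by (simp add: unit_inner perp)
  qed
  have v: "v \<bullet> v = x \<bullet> x - (\<omega> \<bullet> x)\<^sup>2"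
  proof -
    have "v \<bullet> v = (\<omega> \<bullet> \<omega>) * (x \<bullet> x) - (\<omega> \<bullet> x)\<^sup>2" by (simp add: v_def real3_inner power2_eq_square algebra_simps)
    then show ?thesis by (simp add: unit_inner)
  qed
  have cv: "c \<bullet> v = e \<bullet> x"
  proof -
    have "c \<bullet> v = (\<omega> \<bullet> \<omega>) * (e \<bullet> x) - (\<omega> \<bullet> e) * (\<omega> \<bullet> x)" by (simp add: c_def v_def real3_inner algebra_simps)
    then show ?thesis by (simp add: unit_inner perp)
  qed
  have vx: "v \<bullet> x = 0" by (simp add: v_def real3_inner algebra_simps)
  have "(norm (ell \<omega> e x))\<^sup>2 = (v + (2 * (c \<bullet> x)) *\<^sub>R x - (x \<bullet> x) *\<^sub>R c) \<bullet> (v + (2 * (c \<bullet> x)) *\<^sub>R x - (x \<bullet> x) *\<^sub>R c)"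
    by (simp add: power2_norm_eq_inner ell_def c_def v_def)
  also have "\<dots> = v \<bullet> v - 2 * (x \<bullet> x) * (c \<bullet> v) + (x \<bullet> x)\<^sup>2 * (c \<bullet> c)"
    using vx by (simp add: inner_add_left inner_add_right inner_diff_left inner_diff_right inner_commute power2_eq_square algebra_simps)
  also have "\<dots> = N x"
    by (simp add: c v cv N_def Q_def power2_eq_square algebra_simps)
  finally show ?thesis by simp
qed

lemma Q_has_derivative: "(Q has_derivative (\<lambda>v. v \<bullet> gQ x)) (at x)"
  unfolding Q_def [abs_def]
  by (rule has_derivative_eq_rhs, (rule derivative_intros)+)
    (simp add: fun_eq_iff gQ_def inner_diff_right inner_commute algebra_simps)

lemma N_has_derivative: "(N has_derivative (\<lambda>v. v \<bullet> gN x)) (at x)"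
  unfolding N_def [abs_def]
  by (rule has_derivative_eq_rhs, (rule derivative_intros Q_has_derivative)+)
    (simp add: fun_eq_iff gN_def inner_diff_right inner_add_right inner_commute algebra_simps)

lemma C_upto_Q: "C_upto k Q"
  unfolding Q_def [abs_def] by (intro C_upto_add C_upto_diff C_upto_mult C_upto_inner C_upto_const C_upto_id)

lemma C_upto_N: "C_upto k N"
  unfolding N_def [abs_def] power2_eq_square
  by (intro C_upto_diff C_upto_mult C_upto_inner C_upto_const C_upto_id C_upto_Q)

lemma gQ_C_upto: "C_upto k gQ"
  unfolding gQ_def [abs_def]
  by (intro C_upto_add C_upto_diff C_upto_scaleR C_upto_const C_upto_id)

lemma gN_C_upto: "C_upto k gN"
  unfolding gN_def [abs_def]
  by (intro C_upto_add C_upto_diff C_upto_scaleR C_upto_mult C_upto_inner C_upto_const C_upto_id C_upto_Q gQ_C_upto)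

lemma Q_lower: "1 + x \<bullet> x \<le> 2 * (1 + e \<bullet> e)\<^sup>2 * Q x" "Q x > 0"
proof -
  define E r t M where "E = e \<bullet> e" "r = x \<bullet> x" "t = (1 + E) * (e \<bullet> x)" "M = (1 + E)\<^sup>2 * r"
  note d = E_r_t_M_def
  have E: "E \<ge> 0" and r: "r \<ge> 0" by (simp_all add: d)
  have "0 \<le> ((1 + E) *\<^sub>R x - e) \<bullet> ((1 + E) *\<^sub>R x - e)" by simp
  also have "\<dots> = M - 2 * t + E"
    by (simp add: d inner_diff_left inner_diff_right inner_commute power2_eq_square algebra_simps)
  finally have 1: "0 \<le> M - 2 * t + E" .
  have "0 \<le> ((1 + E) *\<^sub>R x - 2 *\<^sub>R e) \<bullet> ((1 + E) *\<^sub>R x - 2 *\<^sub>R e)" by simp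
  also have "\<dots> = M - 4 * t + 4 * E"
    by (simp add: d inner_diff_left inner_diff_right inner_commute power2_eq_square algebra_simps)
  finally have 2: "0 \<le> M - 4 * t + 4 * E" .
  define q where "q = (1 + E) * Q x"
  have q: "q = 1 + E - 2 * t + M"
    by (simp add: Q_def q_def d power2_eq_square algebra_simps)
  have q1: "1 \<le> q" using 1 q by linarith
  then show "Q x > 0" using E unfolding q_def by (smt (verit) mult_nonneg_nonpos)
  have "r \<le> M" using E r by (simp add: d(4) mult_le_cancel_right1 one_le_power)
  moreover have "E * 1 \<le> E * q" by (rule mult_left_mono [OF q1 E])
  ultimately have "1 + r \<le> 2 * (q + E * q)" using 2 q by argo
  also have "\<dots> = 2 * (1 + E)\<^sup>2 * Q x" by (simp add: q_def power2_eq_square algebra_simps)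
  finally show "1 + x \<bullet> x \<le> 2 * (1 + e \<bullet> e)\<^sup>2 * Q x" by (simp add: d)
qed

lemma gN_norm: "gN x \<bullet> gN x = 4 * N x * D x"
  and gN_gQ: "Q x * (gN x \<bullet> gQ x) = N x * (gQ x \<bullet> gQ x) + 4 * N x + (Q x)\<^sup>2 * (D x - 1)"
proof -
  define E r z a where "E = e \<bullet> e" "r = x \<bullet> x" "z = \<omega> \<bullet> x" "a = e \<bullet> x"
  note d = E_r_z_a_def
  have i: "x \<bullet> x = r" "e \<bullet> e = E" "\<omega> \<bullet> x = z" "x \<bullet> \<omega> = z" "e \<bullet> x = a" "x \<bullet> e = a" "\<omega> \<bullet> e = 0" "e \<bullet> \<omega> = 0" "\<omega> \<bullet> \<omega> = 1"
    using perp unit_inner by (simp_all add: d inner_commute)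
  define p s u where "p = 2 * Q x - 4 * r + r * (2 * (1 + E))" "s = 2 * r" "u = 2 * z"
  have gN: "gN x = p *\<^sub>R x - s *\<^sub>R e - u *\<^sub>R \<omega>"
    by (simp add: gN_def gQ_def i p_s_u_def vec_eq_iff algebra_simps)
  define b where "b = 2 * (1 + E)"
  have gQ: "gQ x = b *\<^sub>R x - 2 *\<^sub>R e" by (simp add: gQ_def i b_def)
  have 1: "gN x \<bullet> gN x = p\<^sup>2 * r + s\<^sup>2 * E + u\<^sup>2 - 2 * p * s * a - 2 * p * u * z"
    unfolding gN by (simp add: inner_diff_left inner_diff_right i power2_eq_square algebra_simps)
  have 2: "gN x \<bullet> gQ x = p * b * r - 2 * p * a - s * b * a + 2 * s * E - u * b * z"
    unfolding gN gQ by (simp add: inner_diff_left inner_diff_right i power2_eq_square algebra_simps)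
  have 3: "gQ x \<bullet> gQ x = b\<^sup>2 * r - 4 * b * a + 4 * E"
    unfolding gQ by (simp add: inner_diff_left inner_diff_right i power2_eq_square algebra_simps)
  have q: "Q x = 1 - 2 * a + (1 + E) * r" and n: "N x = r * (Q x - r) - z\<^sup>2" and dd: "D x = 1 - 4 * a + 4 * E * r"
    by (simp_all add: Q_def N_def D_def i)
  show "gN x \<bullet> gN x = 4 * N x * D x"
    unfolding 1 p_s_u_def n q dd by algebra
  show "Q x * (gN x \<bullet> gQ x) = N x * (gQ x \<bullet> gQ x) + 4 * N x + (Q x)\<^sup>2 * (D x - 1)"
    unfolding 2 3 p_s_u_def b_def n q dd by algebra
qed

lemma Y_norm: "Y x \<bullet> Y x = N x * (1/4 - N x / (Q x)\<^sup>2)"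
proof -
  define n q d A B C where "n = N x" "q = Q x" "d = D x" "A = gN x \<bullet> gN x" "B = gN x \<bullet> gQ x" "C = gQ x \<bullet> gQ x"
  note defs = n_q_d_A_B_C_def
  have q: "q \<noteq> 0" using Q_lower(2) [of x] by (simp add: defs)
  have A: "A = 4 * n * d" unfolding defs by (rule gN_norm)
  have "q * B = n * C + 4 * n + q\<^sup>2 * (d - 1)" unfolding defs by (rule gN_gQ)
  then have B: "B = (n * C + 4 * n + q\<^sup>2 * (d - 1)) / q" using q by (simp add: eq_divide_eq mult.commute)
  have "Y x \<bullet> Y x = A / 16 - n / (4 * q) * B + n\<^sup>2 / (4 * q\<^sup>2) * C"
    using q unfolding defs
    by (simp add: Y_def inner_diff_left inner_diff_right inner_commute [of "gQ x" "gN x"] power2_eq_square field_simps)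
  also have "\<dots> = n * (1/4 - n / q\<^sup>2)"
  proof -
    have "n / (4 * q) * B = n\<^sup>2 / (4 * q\<^sup>2) * C + n\<^sup>2 / q\<^sup>2 + n * (d - 1) / 4"
      unfolding B using q by (simp add: power2_eq_square add_divide_distrib distrib_left)
    moreover have "n * (1/4 - n / q\<^sup>2) = n / 4 - n\<^sup>2 / q\<^sup>2" "n * (d - 1) / 4 = n * d / 4 - n / 4"
      by (simp_all add: power2_eq_square right_diff_distrib diff_divide_distrib)
    ultimately show ?thesis unfolding A by linarith
  qed
  finally show ?thesis by (simp add: defs)
qed

lemma N_upper: "N x \<le> (1 + e \<bullet> e) * (1 + x \<bullet> x)\<^sup>2"
  and D_upper: "D x \<le> 4 * (1 + e \<bullet> e) * (1 + x \<bullet> x)"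
proof -
  have "0 \<le> (x - e) \<bullet> (x - e)" by simp
  then have "2 * (e \<bullet> x) \<le> e \<bullet> e + x \<bullet> x" by (simp add: inner_diff_left inner_diff_right inner_commute)
  have "0 \<le> (x + e) \<bullet> (x + e)" by simp
  then have a: "- 2 * (e \<bullet> x) \<le> e \<bullet> e + x \<bullet> x" by (simp add: inner_add_left inner_add_right inner_commute)
  have E: "e \<bullet> e \<ge> 0" and r: "x \<bullet> x \<ge> 0" by simp_all
  have Er: "0 \<le> (e \<bullet> e) * (x \<bullet> x)" using E r by simp
  show "D x \<le> 4 * (1 + e \<bullet> e) * (1 + x \<bullet> x)"
  proof -
    have "4 * (1 + e \<bullet> e) * (1 + x \<bullet> x) = 4 + 4 * (e \<bullet> e) + 4 * (x \<bullet> x) + 4 * ((e \<bullet> e) * (x \<bullet> x))"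
      by (simp add: algebra_simps)
    then show ?thesis using a Er E r unfolding D_def mult.assoc by linarith
  qed
  have "- 2 * (e \<bullet> x) * (x \<bullet> x) \<le> (e \<bullet> e + x \<bullet> x) * (x \<bullet> x)" by (rule mult_right_mono [OF a r])
  moreover have "0 \<le> (\<omega> \<bullet> x)\<^sup>2" by simp
  moreover have "N x = x \<bullet> x + - 2 * (e \<bullet> x) * (x \<bullet> x) + (e \<bullet> e) * (x \<bullet> x) * (x \<bullet> x) - (\<omega> \<bullet> x)\<^sup>2"
    by (simp add: N_def Q_def power2_eq_square algebra_simps)
  moreover have "(1 + e \<bullet> e) * (1 + x \<bullet> x)\<^sup>2 - (x \<bullet> x + (e \<bullet> e + x \<bullet> x) * (x \<bullet> x) + (e \<bullet> e) * (x \<bullet> x) * (x \<bullet> x))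
      = 1 + e \<bullet> e + x \<bullet> x + (e \<bullet> e) * (x \<bullet> x)"
    by (simp add: power2_eq_square algebra_simps)
  ultimately show "N x \<le> (1 + e \<bullet> e) * (1 + x \<bullet> x)\<^sup>2"
    using Er E r by linarith
qed


definition zeta :: "real \<Rightarrow> real^3 \<Rightarrow> real" where
  "zeta R x = step (R\<^sup>2 * N x) * cutoff R x"

definition gz :: "real \<Rightarrow> real^3 \<Rightarrow> real^3" where
  "gz R x = (step' (R\<^sup>2 * N x) * R\<^sup>2 * cutoff R x) *\<^sub>R gN x + step (R\<^sup>2 * N x) *\<^sub>R grad (cutoff R) x"

definition m :: "real^3 \<Rightarrow> real" where
  "m x = exp (ln (N x) / 4 - ln (Q x) / 2)"

lemma zeta_derivative:
  assumes R: "R > 0"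
  shows "(zeta R has_derivative (\<lambda>v. v \<bullet> gz R x)) (at x)"
proof -
  have c: "(cutoff R has_derivative (\<lambda>v. v \<bullet> grad (cutoff R) x)) (at x)"
    using C_upto_has_derivative [OF cutoff(1) [OF R], of x] pd_eq_grad [of "cutoff R" x] cutoff(1) [OF R]
    by (simp add: C_upto_Suc_iff)
  have n: "((\<lambda>x. R\<^sup>2 * N x) has_derivative (\<lambda>v. R\<^sup>2 * (v \<bullet> gN x))) (at x)"
    by (rule has_derivative_mult_right [OF N_has_derivative])
  have "((\<lambda>x. step (R\<^sup>2 * N x)) has_derivative (\<lambda>v. step' (R\<^sup>2 * N x) * (R\<^sup>2 * (v \<bullet> gN x)))) (at x)"
    using diff_chain_at [OF n step_deriv [unfolded has_field_derivative_def]] by (simp add: o_def)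
  from has_derivative_mult [OF this c] show ?thesis
    unfolding zeta_def [abs_def]
    by (rule has_derivative_eq_rhs) (simp add: fun_eq_iff gz_def inner_add_right algebra_simps)
qed

lemma gz_continuous: "R > 0 \<Longrightarrow> continuous_on UNIV (gz R)"
  unfolding gz_def [abs_def]
  by (intro continuous_intros continuous_on_compose2 [OF step'_continuous] continuous_on_compose2 [OF DERIV_continuous_on [OF DERIV_subset [OF step_deriv]]]
     C_upto_imp_continuous_on [OF C_upto_N] C_upto_imp_continuous_on [OF gN_C_upto] C_upto_imp_continuous_on [OF cutoff(1)] grad_continuous cutoff(1)) auto

lemma zeta_continuous: "R > 0 \<Longrightarrow> continuous_on UNIV (zeta R)"
  by (intro continuous_at_imp_continuous_on ballI has_derivative_continuous [OF zeta_derivative])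

lemma m_derivative:
  assumes "N x > 0"
  shows "(m has_derivative (\<lambda>v. v \<bullet> ((m x / N x) *\<^sub>R Y x))) (at x)"
proof -
  have q: "Q x > 0" by (rule Q_lower)
  have n: "((\<lambda>x. ln (N x)) has_derivative (\<lambda>v. (v \<bullet> gN x) * inverse (N x))) (at x)"
    using diff_chain_at [OF N_has_derivative DERIV_ln [OF assms, unfolded has_field_derivative_def]] by (simp add: o_def mult.commute)
  have l: "((\<lambda>x. ln (Q x)) has_derivative (\<lambda>v. (v \<bullet> gQ x) * inverse (Q x))) (at x)"
    using diff_chain_at [OF Q_has_derivative DERIV_ln [OF q, unfolded has_field_derivative_def]] by (simp add: o_def mult.commute)
  have "((\<lambda>x. (1/4) * ln (N x) - (1/2) * ln (Q x)) has_derivative (\<lambda>v. (1/4) * ((v \<bullet> gN x) * inverse (N x)) - (1/2) * ((v \<bullet> gQ x) * inverse (Q x)))) (at x)"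
    by (intro has_derivative_diff has_derivative_mult_right n l)
  from diff_chain_at [OF this DERIV_exp [unfolded has_field_derivative_def]]
  have d: "(m has_derivative (\<lambda>v. m x * ((1/4) * ((v \<bullet> gN x) * inverse (N x)) - (1/2) * ((v \<bullet> gQ x) * inverse (Q x))))) (at x)"
    by (simp add: m_def [abs_def] o_def)
  show ?thesis
    by (rule has_derivative_eq_rhs [OF d])
      (use assms q in \<open>simp add: fun_eq_iff Y_def inner_diff_right field_simps\<close>)
qed

lemma m_square:
  assumes "N x > 0"
  shows "(m x)\<^sup>2 = norm (ell \<omega> e x) / Q x"
proof -
  have q: "Q x > 0" by (rule Q_lower)
  have w: "norm (ell \<omega> e x) > 0" using assms unfolding N_eq by simp
  have "ln (N x) = 2 * ln (norm (ell \<omega> e x))" unfolding N_eq by (simp add: ln_realpow)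
  then have "(m x)\<^sup>2 = exp (ln (norm (ell \<omega> e x)) - ln (Q x))"
    by (simp add: m_def flip: exp_double) 
  also have "\<dots> = norm (ell \<omega> e x) / Q x" using q w by (simp add: exp_diff)
  finally show ?thesis .
qed

lemma N_nonneg: "N x \<ge> 0" unfolding N_eq by simp

lemma ell_nonzero_iff: "ell \<omega> e x \<noteq> 0 \<longleftrightarrow> N x > 0" unfolding N_eq by simp

definition P :: "real \<Rightarrow> real^3 \<Rightarrow> real" where
  "P R x = (2 * zeta R x * (Y x \<bullet> gz R x) + N x * (gz R x \<bullet> gz R x)) / Q x"

lemma weighted_inequality:
  assumes W: "weak_dirac A \<psi> (\<lambda>x. 0)" and R: "R > 0"
  shows "(LINT x|lborel. (zeta R x)\<^sup>2 / (4 * Q x) * (norm (\<psi> x))\<^sup>2)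
    \<le> (LINT x|lborel. ((zeta R x)\<^sup>2 * (1/4 - N x / (Q x)\<^sup>2) / Q x + P R x) * (norm (\<psi> x))\<^sup>2)"
proof -
  define h where "h x = m x * zeta R x" for x
  define K where "K = {x. 1 \<le> R\<^sup>2 * N x} \<inter> cball 0 (2 * R)"
  have Nc: "continuous_on UNIV N" by (rule C_upto_imp_continuous_on [OF C_upto_N])
  have K: "compact K"
    unfolding K_def by (rule closed_Int_compact [OF closed_Collect_le compact_cball]) (intro continuous_intros Nc)+
  have KU: "K \<subseteq> {x. ell \<omega> e x \<noteq> 0}"
    unfolding ell_nonzero_iff K_def using R N_nonneg by (auto simp: less_le)
  have z0: "zeta R x = 0" if "x \<notin> K" for x
    using that step_vals(1) [of "R\<^sup>2 * N x"] cutoff(3) [OF R] by (auto simp: K_def zeta_def supp_in_def)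
  have U: "open {x. ell \<omega> e x \<noteq> 0}" by (rule U_open)
  have dh: "(h has_derivative (\<lambda>v. v \<bullet> (m x *\<^sub>R ((zeta R x / N x) *\<^sub>R Y x + gz R x)))) (at x)" if "x \<in> {x. ell \<omega> e x \<noteq> 0}" for x
  proof -
    have "N x > 0" using that ell_nonzero_iff by simp
    from has_derivative_mult [OF m_derivative [OF this] zeta_derivative [OF R]] show ?thesis
      unfolding h_def [abs_def]
      by (rule has_derivative_eq_rhs) (simp add: fun_eq_iff inner_add_right algebra_simps)
  qed
  have mc: "continuous_on {x. ell \<omega> e x \<noteq> 0} m"
    by (intro continuous_at_imp_continuous_on ballI has_derivative_continuous [OF m_derivative]) (simp add: ell_nonzero_iff)
  have Yc: "continuous_on S Y" for S
    unfolding Y_def [abs_def]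
    by (intro continuous_intros C_upto_imp_continuous_on [OF gN_C_upto] C_upto_imp_continuous_on [OF gQ_C_upto]
      C_upto_imp_continuous_on [OF C_upto_N] C_upto_imp_continuous_on [OF C_upto_Q]) (use Q_lower(2) in \<open>auto simp: less_imp_neq [symmetric]\<close>)
  have h1: "C_upto (Suc 0) h"
  proof (rule C1_zero_extension [OF U K KU _ dh])
    show "h x = 0" if "x \<notin> K" for x using z0 [OF that] by (simp add: h_def)
    show "continuous_on {x. ell \<omega> e x \<noteq> 0} (\<lambda>x. v \<bullet> (m x *\<^sub>R ((zeta R x / N x) *\<^sub>R Y x + gz R x)))" for v
      by (intro continuous_intros mc Yc continuous_on_subset [OF zeta_continuous [OF R]] continuous_on_subset [OF gz_continuous [OF R]] continuous_on_subset [OF Nc])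
        (auto simp: ell_nonzero_iff)
  qed
  have gh: "grad h x = m x *\<^sub>R ((zeta R x / N x) *\<^sub>R Y x + gz R x)" if "N x > 0" for x
    by (rule grad_eqI [OF dh]) (use that ell_nonzero_iff in simp)
  have "(LINT x|lborel. 1 / (4 * norm (ell \<omega> e x)) * ((h x)\<^sup>2 * (norm (\<psi> x))\<^sup>2))
      \<le> (LINT x|lborel. norm (ell \<omega> e x) * ((norm (grad h x))\<^sup>2 * (norm (\<psi> x))\<^sup>2))"
  proof (rule weak_solution_inequality [OF W C_upto_imp_continuous_on [OF A1] U _ _ _ h1 K KU])
    show "continuous_on {x. ell \<omega> e x \<noteq> 0} (\<lambda>x. norm (ell \<omega> e x))" by (intro continuous_intros X_continuous)
    show "continuous_on {x. ell \<omega> e x \<noteq> 0} (\<lambda>x. 1 / (4 * norm (ell \<omega> e x)))" by (intro continuous_intros X_continuous) auto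
    show "h x = 0" if "x \<notin> K" for x using z0 [OF that] by (simp add: h_def)
  qed (rule orbit_poincare)
  moreover have "1 / (4 * norm (ell \<omega> e x)) * ((h x)\<^sup>2 * (norm (\<psi> x))\<^sup>2) = (zeta R x)\<^sup>2 / (4 * Q x) * (norm (\<psi> x))\<^sup>2" for x
  proof (cases "N x > 0")
    case True
    then have "norm (ell \<omega> e x) > 0" using ell_nonzero_iff by simp
    then show ?thesis using Q_lower(2) [of x] by (simp add: h_def power_mult_distrib m_square [OF True])
  next
    case False
    then have "x \<notin> K" using KU ell_nonzero_iff by auto
    then show ?thesis by (simp add: z0 h_def)
  qed
  moreover have "norm (ell \<omega> e x) * ((norm (grad h x))\<^sup>2 * (norm (\<psi> x))\<^sup>2)
     = ((zeta R x)\<^sup>2 * (1/4 - N x / (Q x)\<^sup>2) / Q x + P R x) * (norm (\<psi> x))\<^sup>2" for x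
  proof (cases "N x > 0")
    case True
    define z y g where "z = zeta R x" "y = Y x" "g = gz R x"
    have q: "Q x > 0" by (rule Q_lower)
    have "norm (ell \<omega> e x) * (norm (grad h x))\<^sup>2 = (norm (ell \<omega> e x) * (m x)\<^sup>2) * (((z / N x) *\<^sub>R y + g) \<bullet> ((z / N x) *\<^sub>R y + g))"
      by (simp add: gh [OF True] power_mult_distrib z_y_g_def flip: power2_norm_eq_inner)
    also have "norm (ell \<omega> e x) * (m x)\<^sup>2 = N x / Q x"
      unfolding m_square [OF True] N_eq by (simp add: power2_eq_square)
    also have "((z / N x) *\<^sub>R y + g) \<bullet> ((z / N x) *\<^sub>R y + g) = (z / N x)\<^sup>2 * (y \<bullet> y) + 2 * (z / N x) * (y \<bullet> g) + g \<bullet> g"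
      using True by (simp add: inner_add_left inner_add_right inner_commute [of g y] power2_eq_square field_simps)
    also have "y \<bullet> y = N x * (1/4 - N x / (Q x)\<^sup>2)" unfolding z_y_g_def by (rule Y_norm)
    also have "N x / Q x * ((z / N x)\<^sup>2 * (N x * (1/4 - N x / (Q x)\<^sup>2)) + 2 * (z / N x) * (y \<bullet> g) + g \<bullet> g)
       = z\<^sup>2 * (1/4 - N x / (Q x)\<^sup>2) / Q x + (2 * z * (y \<bullet> g) + N x * (g \<bullet> g)) / Q x"
    proof -
      define n B C where "n = N x" "B = 1/4 - N x / (Q x)\<^sup>2" "C = y \<bullet> g"
      show ?thesis using True q unfolding n_B_C_def [symmetric] by (simp add: power2_eq_square field_simps)
    qed
    finally have "norm (ell \<omega> e x) * (norm (grad h x))\<^sup>2 = z\<^sup>2 * (1/4 - N x / (Q x)\<^sup>2) / Q x + (2 * z * (y \<bullet> g) + N x * (g \<bullet> g)) / Q x" .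
    then show ?thesis by (simp add: P_def z_y_g_def flip: mult.assoc)
  next
    case False
    then have n: "N x = 0" using N_nonneg [of x] by simp
    then have "ell \<omega> e x = 0" unfolding N_eq by simp
    moreover have "zeta R x = 0" by (simp add: zeta_def n step_vals)
    ultimately show ?thesis by (simp add: P_def n)
  qed
  ultimately show ?thesis by simp
qed


lemma gz_bound:
  assumes R: "R \<ge> 1"
  shows "N x * (gz R x \<bullet> gz R x) \<le> 4608 * (1 + e \<bullet> e) * (1 + x \<bullet> x)"
proof -
  define E r where "E = e \<bullet> e" "r = x \<bullet> x"
  have E: "E \<ge> 0" and r: "r \<ge> 0" by (simp_all add: E_r_def)
  define a where "a = (step' (R\<^sup>2 * N x) * R\<^sup>2 * cutoff R x) *\<^sub>R gN x"
  define b where "b = step (R\<^sup>2 * N x) *\<^sub>R grad (cutoff R) x"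
  have n: "N x \<ge> 0" by (rule N_nonneg)
  have R0: "R > 0" using R by simp
  have "0 \<le> (a - b) \<bullet> (a - b)" by simp
  then have ab: "(a + b) \<bullet> (a + b) \<le> 2 * (a \<bullet> a) + 2 * (b \<bullet> b)"
    by (simp add: inner_diff_left inner_diff_right inner_add_left inner_add_right inner_commute)
  have 1: "N x * (gz R x \<bullet> gz R x) \<le> 2 * (N x * (a \<bullet> a)) + 2 * (N x * (b \<bullet> b))"
    using mult_left_mono [OF ab n] by (simp add: gz_def distrib_left mult.left_commute flip: a_def b_def)
  have c2: "(cutoff R x)\<^sup>2 \<le> 1" using cutoff(4,5) [OF R0, of x] by (simp add: power_le_one)
  have 2: "N x * (a \<bullet> a) \<le> 1024 * (1 + E) * (1 + r)"
  proof (cases "R\<^sup>2 * N x < 2")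
    case True
    define t where "t = R\<^sup>2 * N x"
    have t: "0 \<le> t" "t \<le> 2" using True n by (simp_all add: t_def)
    have D: "D x \<le> 4 * (1 + E) * (1 + r)" unfolding E_r_def by (rule D_upper)
    have "N x * (a \<bullet> a) = ((step' t)\<^sup>2 * (t\<^sup>2 * (cutoff R x)\<^sup>2)) * (4 * D x)"
      unfolding a_def inner_scaleR_left inner_scaleR_right gN_norm t_def by (simp add: power2_eq_square)
    also have "\<dots> \<le> (4\<^sup>2 * (2\<^sup>2 * 1)) * (4 * (4 * (1 + E) * (1 + r)))"
    proof -
      have "(step' t)\<^sup>2 \<le> 4\<^sup>2" "t\<^sup>2 \<le> 2\<^sup>2" using t step_vals(5,6) [of t] by (intro power_mono; simp)+
      then have "(step' t)\<^sup>2 * (t\<^sup>2 * (cutoff R x)\<^sup>2) \<le> 4\<^sup>2 * (2\<^sup>2 * 1)"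
        using c2 by (intro mult_mono) auto
      then have "((step' t)\<^sup>2 * (t\<^sup>2 * (cutoff R x)\<^sup>2)) * (4 * (4 * (1 + E) * (1 + r))) \<le> (4\<^sup>2 * (2\<^sup>2 * 1)) * (4 * (4 * (1 + E) * (1 + r)))"
        by (rule mult_right_mono) (use E r in simp)
      moreover have "((step' t)\<^sup>2 * (t\<^sup>2 * (cutoff R x)\<^sup>2)) * (4 * D x) \<le> ((step' t)\<^sup>2 * (t\<^sup>2 * (cutoff R x)\<^sup>2)) * (4 * (4 * (1 + E) * (1 + r)))"
        using D by (intro mult_left_mono) auto
      ultimately show ?thesis by linarith
    qed
    also have "\<dots> = 1024 * (1 + E) * (1 + r)" by simp
    finally show ?thesis .
  next
    case False
    then have "a = 0" by (simp add: a_def step_vals)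
    then show ?thesis using E r by simp
  qed
  have 3: "N x * (b \<bullet> b) \<le> 1280 * (1 + E) * (1 + r)"
  proof (cases "R \<le> norm x \<and> norm x \<le> 2 * R")
    case True
    have "r = (norm x)\<^sup>2" by (simp add: E_r_def power2_norm_eq_inner)
    moreover have "(norm x)\<^sup>2 \<le> (2 * R)\<^sup>2" using True by (intro power_mono) auto
    moreover have "1 \<le> R\<^sup>2" using R by (simp add: one_le_power)
    ultimately have r5: "1 + r \<le> 5 * R\<^sup>2" by simp
    have "b \<bullet> b = (step (R\<^sup>2 * N x))\<^sup>2 * (norm (grad (cutoff R) x))\<^sup>2"
      by (simp add: b_def power2_eq_square power2_norm_eq_inner flip: power2_norm_eq_inner) 
    also have "\<dots> \<le> 1 * (16 / R)\<^sup>2"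
      using cutoff(6) [OF R0, of x] step_vals(3,4) [of "R\<^sup>2 * N x"]
      by (intro mult_mono power_mono power_le_one) auto
    finally have "N x * (b \<bullet> b) \<le> ((1 + E) * (1 + r)\<^sup>2) * (256 / R\<^sup>2)"
      using N_upper [of x] E by (intro mult_mono) (auto simp: E_r_def power_divide)
    also have "\<dots> = (1 + E) * (1 + r) * ((1 + r) * (256 / R\<^sup>2))" by (simp add: power2_eq_square)
    also have "\<dots> \<le> (1 + E) * (1 + r) * (5 * R\<^sup>2 * (256 / R\<^sup>2))"
      using r5 E r by (intro mult_left_mono mult_right_mono) auto
    also have "\<dots> = 1280 * (1 + E) * (1 + r)" using R0 by simp
    finally show ?thesis .
  next
    case False
    then have "grad (cutoff R) x = 0"
      using cutoff(7) [OF R0, of x] supp_in_grad [OF cutoff(3) [OF R0]] by (auto simp: supp_in_def)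
    then show ?thesis using E r by (simp add: b_def)
  qed
  have "N x * (gz R x \<bullet> gz R x) \<le> 4608 * ((1 + E) * (1 + r))" using 1 2 3 unfolding mult.assoc by linarith
  then show ?thesis by (simp only: E_r_def mult.assoc)
qed

lemma P_bound:
  assumes R: "R \<ge> 1"
  shows "\<bar>P R x\<bar> \<le> 2 * (1 + 2 * 4608 * (1 + e \<bullet> e)) * (1 + e \<bullet> e)\<^sup>2"
proof -
  define S where "S = N x * (gz R x \<bullet> gz R x)"
  have n: "N x \<ge> 0" by (rule N_nonneg)
  have q: "Q x > 0" by (rule Q_lower)
  have S0: "S \<ge> 0" using n by (simp add: S_def)
  have z: "\<bar>zeta R x\<bar> \<le> 1"
    using cutoff(4,5) [of R x] step_vals(3,4) [of "R\<^sup>2 * N x"] R by (simp add: zeta_def abs_mult mult_le_one)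
  have "Y x \<bullet> Y x \<le> N x * (1/4)"
    unfolding Y_norm using n by (intro mult_left_mono) auto
  then have "(Y x \<bullet> Y x) * (gz R x \<bullet> gz R x) \<le> S / 4"
    unfolding S_def using mult_right_mono [of "Y x \<bullet> Y x" "N x * (1/4)" "gz R x \<bullet> gz R x"] by simp
  then have "(Y x \<bullet> gz R x)\<^sup>2 \<le> S / 4" using Cauchy_Schwarz_ineq [of "Y x" "gz R x"] by linarith
  moreover have "S / 4 \<le> ((1 + S) / 2)\<^sup>2" using S0 by (simp add: power2_eq_square field_simps)
  ultimately have "\<bar>Y x \<bullet> gz R x\<bar>\<^sup>2 \<le> ((1 + S) / 2)\<^sup>2" by simp
  then have y: "\<bar>Y x \<bullet> gz R x\<bar> \<le> (1 + S) / 2" by (rule power2_le_imp_le) (use S0 in simp)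
  have "\<bar>2 * zeta R x * (Y x \<bullet> gz R x)\<bar> \<le> 2 * 1 * ((1 + S) / 2)"
    unfolding abs_mult using z y by (intro mult_mono) auto
  then have "\<bar>2 * zeta R x * (Y x \<bullet> gz R x)\<bar> \<le> 1 + S" by simp
  then have "\<bar>2 * zeta R x * (Y x \<bullet> gz R x) + S\<bar> \<le> 1 + 2 * S" using S0 by linarith
  also have "\<dots> \<le> 1 + 2 * (4608 * (1 + e \<bullet> e) * (1 + x \<bullet> x))" using gz_bound [OF R, of x] by (simp add: S_def)
  also have "\<dots> \<le> (1 + 2 * 4608 * (1 + e \<bullet> e)) * (1 + x \<bullet> x)" by (simp add: algebra_simps)
  also have "\<dots> \<le> (1 + 2 * 4608 * (1 + e \<bullet> e)) * (2 * (1 + e \<bullet> e)\<^sup>2 * Q x)"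
    by (rule mult_left_mono [OF Q_lower(1)]) simp
  also have "\<dots> = 2 * (1 + 2 * 4608 * (1 + e \<bullet> e)) * (1 + e \<bullet> e)\<^sup>2 * Q x" by (simp only: mult_ac)
  finally show ?thesis unfolding P_def S_def using q by (simp add: abs_divide divide_le_eq)
qed

lemma P_eventually_0: "eventually (\<lambda>n. P (real (Suc n)) x = 0) sequentially"
proof (cases "N x > 0")
  case True
  have "eventually (\<lambda>n. 2 / N x \<le> real n \<and> norm x \<le> real n) sequentially"
    using eventually_ge_at_top [of "nat \<lceil>2 / N x\<rceil>"] eventually_ge_at_top [of "nat \<lceil>norm x\<rceil>"]
    by eventually_elim linarith
  then show ?thesis
  proof eventually_elim
    case (elim n)
    define R where "R = real (Suc n)"
    have R: "R \<ge> 1" "2 / N x \<le> R" "norm x < R" using elim by (simp_all add: R_def)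
    have "2 \<le> R * N x" using R(2) True by (simp add: divide_le_eq)
    also have "\<dots> \<le> R\<^sup>2 * N x" using R(1) True by (simp add: power2_eq_square)
    finally have "step' (R\<^sup>2 * N x) = 0" by (rule step_vals)
    moreover have "grad (cutoff R) x = 0" by (rule cutoff) (use R in simp_all)
    ultimately have "gz R x = 0" by (simp add: gz_def)
    then show ?case unfolding R_def [symmetric] by (simp add: P_def)
  qed
next
  case False
  then have n: "N x = 0" using N_nonneg [of x] by simp
  then have "zeta R x = 0" for R by (simp add: zeta_def step_vals)
  then show ?thesis by (simp add: P_def n)
qed

lemma zeta_eventually_1:
  assumes "N x > 0"
  shows "eventually (\<lambda>n. zeta (real (Suc n)) x = 1) sequentially"
proof -
  have "eventually (\<lambda>n. 2 / N x \<le> real n \<and> norm x \<le> real n) sequentially"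
    using eventually_ge_at_top [of "nat \<lceil>2 / N x\<rceil>"] eventually_ge_at_top [of "nat \<lceil>norm x\<rceil>"]
    by eventually_elim linarith
  then show ?thesis
  proof eventually_elim
    case (elim n)
    define R where "R = real (Suc n)"
    have R: "R \<ge> 1" "2 / N x \<le> R" "norm x \<le> R" using elim by (simp_all add: R_def)
    have "2 \<le> R * N x" using R(2) assms by (simp add: divide_le_eq)
    also have "\<dots> \<le> R\<^sup>2 * N x" using R(1) assms by (simp add: power2_eq_square)
    finally have "step (R\<^sup>2 * N x) = 1" by (rule step_vals)
    moreover have "cutoff R x = 1" by (rule cutoff) (use R in simp_all)
    ultimately show ?case unfolding R_def [symmetric] by (simp add: zeta_def)
  qed
qed


lemma Y_continuous: "continuous_on S Y"
  unfolding Y_def [abs_def]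
  by (intro continuous_intros C_upto_imp_continuous_on [OF gN_C_upto] C_upto_imp_continuous_on [OF gQ_C_upto]
    C_upto_imp_continuous_on [OF C_upto_N] C_upto_imp_continuous_on [OF C_upto_Q]) (use Q_lower(2) in \<open>auto simp: less_imp_neq [symmetric]\<close>)

lemma ell_zero_negligible: "negligible {x. ell \<omega> e x = 0}"
proof -
  define c where "c = cross3 \<omega> e"
  have cc: "c \<bullet> c = e \<bullet> e"
  proof -
    have "c \<bullet> c = (\<omega> \<bullet> \<omega>) * (e \<bullet> e) - (\<omega> \<bullet> e)\<^sup>2" by (simp add: c_def real3_inner power2_eq_square algebra_simps)
    then show ?thesis by (simp add: unit_inner perp)
  qed
  have cx: "(c \<bullet> x) * (x \<bullet> x) = 0" if "ell \<omega> e x = 0" for x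
  proof -
    have "x \<bullet> ell \<omega> e x = (c \<bullet> x) * (x \<bullet> x)"
      by (simp add: ell_def c_def real3_inner algebra_simps)
    then show ?thesis using that by simp
  qed
  show ?thesis
  proof (cases "e = 0")
    case True
    obtain d where d: "d \<noteq> 0" "\<omega> \<bullet> d = 0"
    proof -
      have "\<exists>d. d \<noteq> 0 \<and> \<omega> \<bullet> d = 0"
        using orthogonal_to_vector_exists [of \<omega>] by (auto simp: orthogonal_def)
      then show ?thesis using that by blast
    qed
    have "{x. ell \<omega> e x = 0} \<subseteq> {x. d \<bullet> x = 0}"
    proof clarify
      fix x assume "ell \<omega> e x = 0"
      then have "cross3 \<omega> x = 0" using True by (simp add: ell_def)
      then have "cross3 \<omega> (cross3 \<omega> x) = 0" by simp
      then have "x = (\<omega> \<bullet> x) *\<^sub>R \<omega>" by (simp add: cross_cross_unit)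
      then have "d \<bullet> x = (\<omega> \<bullet> x) * (d \<bullet> \<omega>)" by (metis inner_scaleR_right)
      then show "d \<bullet> x = 0" using d(2) by (simp add: inner_commute)
    qed
    with negligible_hyperplane [of d 0] d(1) show ?thesis by (auto intro: negligible_subset)
  next
    case False
    then have "c \<noteq> 0" using cc by auto
    moreover have "{x. ell \<omega> e x = 0} \<subseteq> {x. c \<bullet> x = 0}"
    proof clarify
      fix x assume "ell \<omega> e x = 0"
      from cx [OF this] show "c \<bullet> x = 0" by auto
    qed
    ultimately show ?thesis using negligible_hyperplane [of c 0] by (auto intro: negligible_subset)
  qed
qed

theorem no_weak_solution:
  assumes W: "weak_dirac A \<psi> (\<lambda>x. 0)"
  shows "AE x in lborel. \<psi> x = 0"
proof -
  have sq: "sq_int \<psi>" by (rule weak_dirac_sq_int(1) [OF W])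
  then have i2: "integrable lborel (\<lambda>x. (norm (\<psi> x))\<^sup>2)" and m\<psi>: "\<psi> \<in> borel_measurable borel"
    by (auto simp: sq_int_def)
  define \<kappa> where "\<kappa> = 2 * (1 + e \<bullet> e)\<^sup>2"
  have bi: "integrable lborel (\<lambda>x. F x * (norm (\<psi> x))\<^sup>2)"
    if "continuous_on UNIV F" "\<And>x. \<bar>F x\<bar> \<le> C" for F :: "real^3 \<Rightarrow> real" and C
  proof (rule Bochner_Integration.integrable_bound [OF integrable_mult_right [OF i2, of C]])
    have "F \<in> borel_measurable borel" by (rule borel_measurable_continuous_onI [OF that(1)])
    then show "(\<lambda>x. F x * (norm (\<psi> x))\<^sup>2) \<in> borel_measurable lborel" using m\<psi> by simp
    have "\<bar>F x\<bar> * (norm (\<psi> x))\<^sup>2 \<le> \<bar>C\<bar> * (norm (\<psi> x))\<^sup>2" for x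
      by (rule mult_right_mono [OF order_trans [OF that(2)]]) auto
    then show "AE x in lborel. norm (F x * (norm (\<psi> x))\<^sup>2) \<le> norm (C * (norm (\<psi> x))\<^sup>2)"
      by (simp add: abs_mult)
  qed
  have Qc: "continuous_on UNIV Q" and Nc: "continuous_on UNIV N"
    by (rule C_upto_imp_continuous_on [OF C_upto_Q], rule C_upto_imp_continuous_on [OF C_upto_N])
  have Q0: "Q x \<noteq> 0" for x using Q_lower(2) [of x] by simp
  have Qb: "1 / Q x \<le> \<kappa>" "0 \<le> 1 / Q x" for x
  proof -
    have "1 \<le> 1 + x \<bullet> x" by simp
    also have "\<dots> \<le> \<kappa> * Q x" unfolding \<kappa>_def by (rule Q_lower)
    finally show "1 / Q x \<le> \<kappa>" using Q_lower(2) [of x] by (simp add: divide_le_eq)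
    show "0 \<le> 1 / Q x" using Q_lower(2) [of x] by simp
  qed
  have B: "0 \<le> N x / (Q x)\<^sup>2" "N x / (Q x)\<^sup>2 \<le> 1/4" for x
  proof -
    show "0 \<le> N x / (Q x)\<^sup>2" using N_nonneg [of x] by simp
    have "0 \<le> Y x \<bullet> Y x" by simp
    then show "N x / (Q x)\<^sup>2 \<le> 1/4"
      unfolding Y_norm using N_nonneg [of x] by (cases "N x = 0") (auto simp: zero_le_mult_iff)
  qed
  define R where "R n = real (Suc n)" for n
  have R: "R n > 0" "R n \<ge> 1" for n by (simp_all add: R_def)
  have zb: "(zeta (R n) x)\<^sup>2 \<le> 1" for n x
    using cutoff(4,5) [OF R(1) [of n], of x] step_vals(3,4) [of "(R n)\<^sup>2 * N x"]
    by (intro power_le_one) (auto simp: zeta_def intro: mult_le_one)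
  define L where "L n x = (zeta (R n) x)\<^sup>2 * (N x / (Q x)\<^sup>2 / Q x)" for n x
  define C where "C = 2 * (1 + 2 * 4608 * (1 + e \<bullet> e)) * (1 + e \<bullet> e)\<^sup>2"
  have Pb: "\<bar>P (R n) x\<bar> \<le> C" for n x unfolding C_def by (rule P_bound [OF R(2)])
  have Pc: "continuous_on UNIV (P (R n))" for n
    unfolding P_def [abs_def]
    by (intro continuous_intros Y_continuous Qc Nc zeta_continuous gz_continuous R) (auto simp: Q0)
  have Lc: "continuous_on UNIV (L n)" for n
    unfolding L_def [abs_def]
    by (intro continuous_intros Qc Nc zeta_continuous R) (auto simp: Q0)
  have Bq: "0 \<le> N x / (Q x)\<^sup>2 / Q x" "N x / (Q x)\<^sup>2 / Q x \<le> \<kappa>" for x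
  proof -
    have "(N x / (Q x)\<^sup>2) * (1 / Q x) \<le> 1 * \<kappa>"
      using order_trans [OF B(2) [of x], of 1] Qb [of x] by (intro mult_mono) auto
    then show "N x / (Q x)\<^sup>2 / Q x \<le> \<kappa>" by simp
    show "0 \<le> N x / (Q x)\<^sup>2 / Q x" by (rule divide_nonneg_pos [OF B(1) Q_lower(2)])
  qed
  have Lb: "0 \<le> L n x" "L n x \<le> \<kappa>" for n x
  proof -
    show "0 \<le> L n x" unfolding L_def using Bq(1) by (intro mult_nonneg_nonneg) auto
    have "L n x \<le> 1 * \<kappa>" unfolding L_def using Bq [of x] zb [of n x] by (intro mult_mono) auto
    then show "L n x \<le> \<kappa>" by simp
  qed
  have iL: "integrable lborel (\<lambda>x. L n x * (norm (\<psi> x))\<^sup>2)" for n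
    by (rule bi [OF Lc, of _ \<kappa>]) (use Lb in \<open>simp add: abs_le_iff\<close>)
  have iP: "integrable lborel (\<lambda>x. P (R n) x * (norm (\<psi> x))\<^sup>2)" for n
    by (rule bi [OF Pc Pb])
  have LP: "(LINT x|lborel. L n x * (norm (\<psi> x))\<^sup>2) \<le> (LINT x|lborel. P (R n) x * (norm (\<psi> x))\<^sup>2)" for n
  proof -
    have iZ: "integrable lborel (\<lambda>x. (zeta (R n) x)\<^sup>2 / (4 * Q x) * (norm (\<psi> x))\<^sup>2)"
    proof (rule bi [of _ \<kappa>])
      show "continuous_on UNIV (\<lambda>x. (zeta (R n) x)\<^sup>2 / (4 * Q x))"
        by (intro continuous_intros Qc zeta_continuous R) (auto simp: Q0)
      show "\<bar>(zeta (R n) x)\<^sup>2 / (4 * Q x)\<bar> \<le> \<kappa>" for x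
      proof -
        have "(zeta (R n) x)\<^sup>2 * (1 / Q x) \<le> 1 * \<kappa>" using zb [of n x] Qb [of x] by (intro mult_mono) auto
        moreover have "0 \<le> (zeta (R n) x)\<^sup>2 * (1 / Q x)" using Qb(2) [of x] by (intro mult_nonneg_nonneg) auto
        ultimately show ?thesis by simp
      qed
    qed
    have e: "((zeta (R n) x)\<^sup>2 * (1/4 - N x / (Q x)\<^sup>2) / Q x + P (R n) x) * (norm (\<psi> x))\<^sup>2
       = (zeta (R n) x)\<^sup>2 / (4 * Q x) * (norm (\<psi> x))\<^sup>2 - L n x * (norm (\<psi> x))\<^sup>2 + P (R n) x * (norm (\<psi> x))\<^sup>2" for x
      by (simp add: L_def right_diff_distrib diff_divide_distrib distrib_right left_diff_distrib)
    show ?thesis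
      using weighted_inequality [OF W R(1) [of n]] unfolding e using iZ iL [of n] iP [of n] by simp
  qed
  have limP: "(\<lambda>n. LINT x|lborel. P (R n) x * (norm (\<psi> x))\<^sup>2) \<longlonglongrightarrow> (LINT x|(lborel::(real^3) measure). 0)"
  proof (rule integral_dominated_convergence [where w = "\<lambda>x. C * (norm (\<psi> x))\<^sup>2"])
    show "integrable lborel (\<lambda>x. C * (norm (\<psi> x))\<^sup>2)" using i2 by simp
    show "AE x in lborel. (\<lambda>n. P (R n) x * (norm (\<psi> x))\<^sup>2) \<longlonglongrightarrow> 0"
    proof (intro AE_I2 tendsto_eventually)
      fix x
      show "eventually (\<lambda>n. P (R n) x * (norm (\<psi> x))\<^sup>2 = 0) sequentially"
        using P_eventually_0 [of x] by eventually_elim (simp add: R_def)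
    qed
    show "AE x in lborel. norm (P (R n) x * (norm (\<psi> x))\<^sup>2) \<le> C * (norm (\<psi> x))\<^sup>2" for n
    proof (rule AE_I2)
      fix x
      show "norm (P (R n) x * (norm (\<psi> x))\<^sup>2) \<le> C * (norm (\<psi> x))\<^sup>2"
        using mult_right_mono [OF Pb [of n x], of "(norm (\<psi> x))\<^sup>2"] by (simp add: abs_mult)
    qed
  qed (use iP in auto)
  define w where "w x = N x / (Q x)\<^sup>2 / Q x" for x
  have iw: "integrable lborel (\<lambda>x. w x * (norm (\<psi> x))\<^sup>2)"
  proof (rule bi [of _ \<kappa>])
    show "continuous_on UNIV w" unfolding w_def by (intro continuous_intros Qc Nc) (auto simp: Q0)
    show "\<bar>w x\<bar> \<le> \<kappa>" for x using Bq [of x] by (simp add: w_def)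
  qed
  have limL: "(\<lambda>n. LINT x|lborel. L n x * (norm (\<psi> x))\<^sup>2) \<longlonglongrightarrow> (LINT x|lborel. w x * (norm (\<psi> x))\<^sup>2)"
  proof (rule integral_dominated_convergence [where w = "\<lambda>x. \<kappa> * (norm (\<psi> x))\<^sup>2"])
    show "integrable lborel (\<lambda>x. \<kappa> * (norm (\<psi> x))\<^sup>2)" using i2 by simp
    show "AE x in lborel. (\<lambda>n. L n x * (norm (\<psi> x))\<^sup>2) \<longlonglongrightarrow> w x * (norm (\<psi> x))\<^sup>2"
    proof (intro AE_I2 tendsto_eventually)
      fix x
      show "eventually (\<lambda>n. L n x * (norm (\<psi> x))\<^sup>2 = w x * (norm (\<psi> x))\<^sup>2) sequentially"
      proof (cases "N x > 0")
        case True
        show ?thesis using zeta_eventually_1 [OF True] by eventually_elim (simp add: R_def L_def w_def)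
      next
        case False
        then have "N x = 0" using N_nonneg [of x] by simp
        then show ?thesis by (simp add: L_def w_def)
      qed
    qed
    show "AE x in lborel. norm (L n x * (norm (\<psi> x))\<^sup>2) \<le> \<kappa> * (norm (\<psi> x))\<^sup>2" for n
    proof (rule AE_I2)
      fix x
      show "norm (L n x * (norm (\<psi> x))\<^sup>2) \<le> \<kappa> * (norm (\<psi> x))\<^sup>2"
        using mult_right_mono [OF Lb(2) [of n x], of "(norm (\<psi> x))\<^sup>2"] Lb(1) [of n x] by (simp add: abs_mult)
    qed
  qed (use iL iw in auto)
  have w0: "0 \<le> w x * (norm (\<psi> x))\<^sup>2" for x
    unfolding w_def by (rule mult_nonneg_nonneg [OF Bq(1)]) simp
  have "(LINT x|lborel. w x * (norm (\<psi> x))\<^sup>2) \<le> (LINT x|(lborel::(real^3) measure). 0)"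
    by (rule LIMSEQ_le [OF limL limP]) (use LP in auto)
  then have "(LINT x|lborel. w x * (norm (\<psi> x))\<^sup>2) = 0"
    by (intro antisym Bochner_Integration.integral_nonneg w0) simp
  then have "AE x in lborel. w x * (norm (\<psi> x))\<^sup>2 = 0"
    using integral_nonneg_eq_0_iff_AE [OF iw] w0 by auto
  then show ?thesis
    using AE_not_negligible [OF ell_zero_negligible]
  proof eventually_elim
    case (elim x)
    then have "N x \<noteq> 0" using ell_nonzero_iff [of x] by auto
    then have "w x \<noteq> 0" using Q0 [of x] by (simp add: w_def)
    then show ?case using elim(1) by simp
  qed
qed

end



definition ckf :: "real^3 \<Rightarrow> real \<Rightarrow> real^3 \<Rightarrow> real^3 \<Rightarrow> real^3 \<Rightarrow> real^3" where
  "ckf a b w c x = a + b *\<^sub>R x + cross3 w x + (2 * (c \<bullet> x)) *\<^sub>R x - (x \<bullet> x) *\<^sub>R c"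

lemma ckf_has_derivative:
  "(ckf a b w c has_derivative (\<lambda>u. (b + 2 * (c \<bullet> x)) *\<^sub>R u + cross3 (w + 2 *\<^sub>R cross3 c x) u)) (at x)"
proof -
  have "(ckf a b w c has_derivative (\<lambda>u. 0 + b *\<^sub>R u + cross3 w u + ((2 * (c \<bullet> x)) *\<^sub>R u + (2 * (c \<bullet> u)) *\<^sub>R x) - (x \<bullet> u + u \<bullet> x) *\<^sub>R c)) (at x)"
    unfolding ckf_def [abs_def]
    by (intro has_derivative_diff has_derivative_add has_derivative_scaleR has_derivative_scaleR_left has_derivative_inner
        has_derivative_mult_right has_derivative_inner_right has_derivative_ident has_derivative_const has_derivative_scaleR_right
        bounded_linear.has_derivative [OF bounded_bilinear.bounded_linear_right [OF bounded_bilinear_cross3]])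
  then show ?thesis
    by (rule has_derivative_eq_rhs) (auto simp: fun_eq_iff real3_eq_iff real3_inner algebra_simps)
qed

lemma ckf_translate:
  "ckf a b w c (p + y) = ckf (ckf a b w c p) (b + 2 * (c \<bullet> p)) (w + 2 *\<^sub>R cross3 c p) c y"
  by (simp add: ckf_def real3_eq_iff real3_inner algebra_simps)

lemma pd_zero_const:
  fixes f :: "'a::euclidean_space \<Rightarrow> 'b::real_normed_vector"
  assumes d: "\<And>x. f differentiable at x" and z: "\<And>v x. pd v f x = 0"
  shows "f x = f 0"
proof -
  have "(f has_derivative (\<lambda>v. 0)) (at x)" for x
    using has_derivative_pd [OF d, of x] z by simp
  then have "\<exists>c. \<forall>x\<in>UNIV. f x = c"
    by (intro has_derivative_zero_constant [OF convex_UNIV]) (simp add: has_derivative_at_withinI)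
  then show ?thesis by auto
qed

lemma pd_inner_const: "g differentiable at x \<Longrightarrow> pd w (\<lambda>x. u \<bullet> g x) x = u \<bullet> pd w g x"
  by (rule pd_linear_comp [OF bounded_linear_inner_right])

lemma conformal_killing_ckf:
  assumes ck: "conformal_killing X"
  obtains a b w c where "X = ckf a b w c"
proof -
  have sm: "C_upto k X" for k using ck by (simp add: conformal_killing_def smooth_def)
  have dX: "X differentiable at x" for x using sm [of "Suc 0"] by (simp add: C_upto_Suc_iff)
  define \<mu> where "\<mu> x = pd (ax 1) X x $ 1" for x
  have s1: "C_upto k (pd v X)" for k v by (rule C_upto_pd [OF sm])
  have \<mu>s: "C_upto k \<mu>" for k unfolding \<mu>_def by (rule C_upto_nth [OF s1])
  have eqn: "pd (ax i) X x $ j + pd (ax j) X x $ i = 2 / 3 * divergence X x * (if i = j then 1 else 0)" for i j x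
    using ck unfolding conformal_killing_def by (simp add: partial_nth [OF dX])
  have "2 / 3 * divergence X x = 2 * \<mu> x" for x
    using eqn [of 1 x 1] by (simp add: \<mu>_def)
  then have eq\<mu>: "pd (ax i) X x $ j + pd (ax j) X x $ i = 2 * \<mu> x * (if i = j then 1 else 0)" for i j x
    using eqn by simp
  have bas: "pd v X x = v$1 *\<^sub>R pd (ax 1) X x + v$2 *\<^sub>R pd (ax 2) X x + v$3 *\<^sub>R pd (ax 3) X x" for v x
    by (subst pd_ax_sum [OF dX]) (simp add: sum_3)
  have main: "u \<bullet> pd v X x + v \<bullet> pd u X x = 2 * \<mu> x * (u \<bullet> v)" for u v x
  proof -
    define d where "d i j = pd (ax i) X x $ j" for i j
    have e: "d 1 1 = \<mu> x" "d 2 2 = \<mu> x" "d 3 3 = \<mu> x" "d 2 1 = - d 1 2" "d 3 1 = - d 1 3" "d 3 2 = - d 2 3"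
      using eq\<mu> [of 1 x 1] eq\<mu> [of 2 x 2] eq\<mu> [of 3 x 3] eq\<mu> [of 1 x 2] eq\<mu> [of 1 x 3] eq\<mu> [of 2 x 3] by (simp_all add: d_def)
    show ?thesis
      unfolding bas [of u] bas [of v] using e by (simp add: real3_inner flip: d_def) (simp add: algebra_simps)
  qed
  have dpd: "pd v X differentiable at x" for v x using s1 [of "Suc 0" v] by (simp add: C_upto_Suc_iff)
  have d\<mu>: "\<mu> differentiable at x" for x using \<mu>s [of "Suc 0"] by (simp add: C_upto_Suc_iff)
  have comm: "pd u (pd v X) x = pd v (pd u X) x" for u v x by (rule pd_commute [OF sm])
  have T1: "u \<bullet> pd w (pd v X) x + v \<bullet> pd w (pd u X) x = 2 * pd w \<mu> x * (u \<bullet> v)" for u v w x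
  proof -
    have l: "((\<lambda>x. u \<bullet> pd v X x + v \<bullet> pd u X x) has_derivative (\<lambda>w. u \<bullet> pd w (pd v X) x + v \<bullet> pd w (pd u X) x)) (at x)"
      by (intro has_derivative_add has_derivative_inner_right has_derivative_pd dpd)
    have r: "((\<lambda>x. 2 * \<mu> x * (u \<bullet> v)) has_derivative (\<lambda>w. 2 * pd w \<mu> x * (u \<bullet> v))) (at x)"
      by (intro has_derivative_mult_left has_derivative_mult_right has_derivative_pd d\<mu>)
    from pd_eq [OF l, of w] pd_eq [OF r, of w] show ?thesis unfolding main by simp
  qed
  have T2: "w \<bullet> pd u (pd v X) x = pd u \<mu> x * (w \<bullet> v) + pd v \<mu> x * (w \<bullet> u) - pd w \<mu> x * (u \<bullet> v)" for u v w x
    using T1 [of u w v x] T1 [of v u w x] T1 [of w v u x] comm [of v u x] comm [of w v x] comm [of w u x]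
    by (simp add: inner_commute)
  have d\<mu>': "pd v \<mu> differentiable at x" for v x
  proof -
    have "C_upto (Suc 0) (pd v \<mu>)" by (rule C_upto_pd [OF \<mu>s])
    then show ?thesis by (simp add: C_upto_Suc_iff)
  qed
  have T3: "w \<bullet> pd z (pd u (pd v X)) x = pd z (pd u \<mu>) x * (w \<bullet> v) + pd z (pd v \<mu>) x * (w \<bullet> u) - pd z (pd w \<mu>) x * (u \<bullet> v)" for u v w z x
  proof -
    have "pd u (pd v X) differentiable at x"
      using C_upto_pd [OF s1, of "Suc 0" u v] by (simp add: C_upto_Suc_iff)
    then have "pd z (\<lambda>x. w \<bullet> pd u (pd v X) x) x = w \<bullet> pd z (pd u (pd v X)) x" by (rule pd_inner_const)
    moreover
    have "((\<lambda>x. pd u \<mu> x * (w \<bullet> v) + pd v \<mu> x * (w \<bullet> u) - pd w \<mu> x * (u \<bullet> v)) has_derivative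
        (\<lambda>z. pd z (pd u \<mu>) x * (w \<bullet> v) + pd z (pd v \<mu>) x * (w \<bullet> u) - pd z (pd w \<mu>) x * (u \<bullet> v))) (at x)"
      by (intro has_derivative_diff has_derivative_add has_derivative_mult_left has_derivative_pd d\<mu>')
    from pd_eq [OF this, where v = z] have "pd z (\<lambda>x. pd u \<mu> x * (w \<bullet> v) + pd v \<mu> x * (w \<bullet> u) - pd w \<mu> x * (u \<bullet> v)) x
        = pd z (pd u \<mu>) x * (w \<bullet> v) + pd z (pd v \<mu>) x * (w \<bullet> u) - pd z (pd w \<mu>) x * (u \<bullet> v)" .
    ultimately show ?thesis unfolding T2 by (rule trans [OF sym])
  qed
  have comm3: "pd z (pd u (pd v X)) x = pd u (pd z (pd v X)) x" for u v z x
    by (rule pd_commute [OF s1])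
  have T4: "pd z (pd v \<mu>) x * (w \<bullet> u) - pd z (pd w \<mu>) x * (u \<bullet> v) = pd u (pd v \<mu>) x * (w \<bullet> z) - pd u (pd w \<mu>) x * (z \<bullet> v)" for u v w z x
    using T3 [of w z u v x] T3 [of w u z v x] comm3 [of z u v x] pd_commute [OF \<mu>s, of z u x] by simp
  define h where "h x i j = pd (ax i) (pd (ax j) \<mu>) x" for x i j
  have hs: "h x i j = h x j i" for x i j unfolding h_def by (rule pd_commute [OF \<mu>s])
  have axd: "ax i \<bullet> ax j = (if i = j then 1 else 0)" for i j by (simp add: inner_axis_axis)
  have h0: "h x i j = 0" for x i j
  proof -
    have k: "h x l j * (ax k \<bullet> ax i) - h x l k * (ax i \<bullet> ax j) = h x i j * (ax k \<bullet> ax l) - h x i k * (ax l \<bullet> ax j)" for i j k l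
      unfolding h_def by (rule T4)
    have off: "h x 2 3 = 0" "h x 1 3 = 0" "h x 1 2 = 0"
      using k [of 2 3 1 1] k [of 1 3 2 2] k [of 1 2 3 3] by (simp_all add: axd)
    have "h x 2 2 = - h x 1 1" "h x 3 3 = - h x 1 1" "h x 3 3 = - h x 2 2"
      using k [of 2 2 1 1] k [of 3 3 1 1] k [of 3 3 2 2] by (simp_all add: axd)
    then have "h x 1 1 = 0" "h x 2 2 = 0" "h x 3 3 = 0" by linarith+
    with off hs [of x] show ?thesis using exhaust_3 [of i] exhaust_3 [of j] by auto
  qed
  have \<mu>2: "pd u (pd v \<mu>) x = 0" for u v x
  proof -
    have a: "pd u (pd (ax j) \<mu>) x = 0" for u j x
      using h0 by (subst pd_ax_sum [OF d\<mu>']) (simp add: h_def)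
    have "pd v \<mu> = (\<lambda>x. \<Sum>j\<in>UNIV. v $ j *\<^sub>R pd (ax j) \<mu> x)"
      by (rule ext) (rule pd_ax_sum [OF d\<mu>])
    moreover have "((\<lambda>x. \<Sum>j\<in>UNIV. v $ j *\<^sub>R pd (ax j) \<mu> x) has_derivative (\<lambda>u. \<Sum>j\<in>UNIV. v $ j *\<^sub>R pd u (pd (ax j) \<mu>) x)) (at x)"
      by (intro has_derivative_sum has_derivative_scaleR_right has_derivative_pd d\<mu>')
    ultimately show ?thesis using pd_eq [of "pd v \<mu>"] by (simp add: a)
  qed
  define c where "c = (1/2) *\<^sub>R grad \<mu> 0"
  have \<mu>c: "pd v \<mu> x = 2 * (c \<bullet> v)" for v x
  proof -
    have "pd v \<mu> x = pd v \<mu> 0" by (rule pd_zero_const [OF d\<mu>' \<mu>2])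
    then show ?thesis by (simp add: pd_eq_grad [OF d\<mu>] c_def inner_commute)
  qed
  define w :: "real^3" where "w = vector [pd (ax 2) X 0 $ 3, pd (ax 3) X 0 $ 1, pd (ax 1) X 0 $ 2]"
  define p where "p = ckf (X 0) (\<mu> 0) w c"
  have dp: "p differentiable at x" for x
    unfolding p_def using ckf_has_derivative differentiableI by blast
  have pp: "pd u p x = (\<mu> 0 + 2 * (c \<bullet> x)) *\<^sub>R u + cross3 (w + 2 *\<^sub>R cross3 c x) u" for u x
    unfolding p_def by (rule pd_eq [OF ckf_has_derivative])
  have p2: "((pd v p) has_derivative (\<lambda>u. (2 * (c \<bullet> u)) *\<^sub>R v + cross3 (2 *\<^sub>R cross3 c u) v)) (at x)" for v x
  proof -
    have 1: "((\<lambda>x. cross3 c x) has_derivative (\<lambda>u. cross3 c u)) (at x)"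
      by (rule bounded_linear_imp_has_derivative [OF bounded_bilinear.bounded_linear_right [OF bounded_bilinear_cross3]])
    have 2: "((\<lambda>x. w + 2 *\<^sub>R cross3 c x) has_derivative (\<lambda>u. 0 + 2 *\<^sub>R cross3 c u)) (at x)"
      by (intro has_derivative_add has_derivative_const has_derivative_scaleR_right 1)
    have 3: "((\<lambda>x. cross3 (w + 2 *\<^sub>R cross3 c x) v) has_derivative (\<lambda>u. cross3 (0 + 2 *\<^sub>R cross3 c u) v)) (at x)"
      by (rule bounded_linear.has_derivative [OF bounded_bilinear.bounded_linear_left [OF bounded_bilinear_cross3] 2])
    have "((\<lambda>x. (\<mu> 0 + 2 * (c \<bullet> x)) *\<^sub>R v + cross3 (w + 2 *\<^sub>R cross3 c x) v) has_derivative (\<lambda>u. (0 + 2 * (c \<bullet> u)) *\<^sub>R v + cross3 (0 + 2 *\<^sub>R cross3 c u) v)) (at x)"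
      by (intro has_derivative_add has_derivative_const has_derivative_scaleR_left has_derivative_mult_right has_derivative_inner_right has_derivative_ident 3)
    moreover have "pd v p = (\<lambda>x. (\<mu> 0 + 2 * (c \<bullet> x)) *\<^sub>R v + cross3 (w + 2 *\<^sub>R cross3 c x) v)"
      by (rule ext) (rule pp)
    ultimately show ?thesis by simp
  qed
  have X2: "pd u (pd v X) x = (2 * (c \<bullet> u)) *\<^sub>R v + cross3 (2 *\<^sub>R cross3 c u) v" for u v x
  proof -
    have "z \<bullet> pd u (pd v X) x = z \<bullet> ((2 * (c \<bullet> u)) *\<^sub>R v + cross3 (2 *\<^sub>R cross3 c u) v)" for z
      unfolding T2 \<mu>c by (simp add: real3_inner algebra_simps)
    then have "\<forall>z. z \<bullet> pd u (pd v X) x = z \<bullet> ((2 * (c \<bullet> u)) *\<^sub>R v + cross3 (2 *\<^sub>R cross3 c u) v)" by (rule allI)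
    then show ?thesis by (rule iffD1 [OF vector_eq_ldot])
  qed
  have first: "pd v X x = pd v p x" for v x
  proof -
    have d: "((\<lambda>x. pd v X x - pd v p x) has_derivative (\<lambda>u. 0)) (at x)" for x
      using has_derivative_diff [OF has_derivative_pd [OF dpd [of v x]] p2 [of v x]] by (simp add: X2)
    have "(\<lambda>x. pd v X x - pd v p x) x = (\<lambda>x. pd v X x - pd v p x) 0"
      by (rule pd_zero_const [OF differentiableI [OF d] pd_eq [OF d]])
    moreover have "pd v X 0 = pd v p 0"
    proof -
      define d where "d i j = pd (ax i) X 0 $ j" for i j
      have e: "d 1 1 = \<mu> 0" "d 2 2 = \<mu> 0" "d 3 3 = \<mu> 0" "d 2 1 = - d 1 2" "d 3 1 = - d 1 3" "d 3 2 = - d 2 3"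
        using eq\<mu> [of 1 0 1] eq\<mu> [of 2 0 2] eq\<mu> [of 3 0 3] eq\<mu> [of 1 0 2] eq\<mu> [of 1 0 3] eq\<mu> [of 2 0 3] by (simp_all add: d_def)
      show ?thesis
        unfolding bas [of v] pp w_def using e by (simp add: real3_eq_iff flip: d_def)
    qed
    ultimately show ?thesis by simp
  qed
  have "X x = p x" for x
  proof -
    have d: "((\<lambda>x. X x - p x) has_derivative (\<lambda>u. 0)) (at x)" for x
      using has_derivative_diff [OF has_derivative_pd [OF dX [of x]] has_derivative_pd [OF dp [of x]]] by (simp add: first)
    have "(\<lambda>x. X x - p x) x = (\<lambda>x. X x - p x) 0"
      by (rule pd_zero_const [OF differentiableI [OF d] pd_eq [OF d]])
    then show ?thesis by (simp add: p_def ckf_def)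
  qed
  then have "X = p" by (rule ext)
  then show thesis using that p_def by blast
qed


lemma ckf_differentiable: "ckf a b w c differentiable at x"
  using ckf_has_derivative differentiableI by blast

lemma pd_ckf: "pd u (ckf a b w c) x = (b + 2 * (c \<bullet> x)) *\<^sub>R u + cross3 (w + 2 *\<^sub>R cross3 c x) u"
  by (rule pd_eq [OF ckf_has_derivative])

lemma curl_eq:
  assumes "A differentiable at x"
  shows "curl A x = (\<Sum>j\<in>UNIV. cross3 (ax j) (pd (ax j) A x))"
  by (simp add: curl_def partial_nth [OF assms] real3_eq_iff sum_3)

lemma curl_ckf: "curl (ckf a b w c) x = 2 *\<^sub>R (w + 2 *\<^sub>R cross3 c x)"
  by (simp add: curl_eq [OF ckf_differentiable] pd_ckf sum_3 real3_eq_iff)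

definition twist_free :: "real^3 \<Rightarrow> real \<Rightarrow> real^3 \<Rightarrow> real^3 \<Rightarrow> bool" where
  "twist_free a b w c \<longleftrightarrow> (\<forall>x. ckf a b w c x \<bullet> (w + 2 *\<^sub>R cross3 c x) = 0)"

lemma twist_free_translate:
  assumes "twist_free a b w c"
  shows "twist_free (ckf a b w c p) (b + 2 * (c \<bullet> p)) (w + 2 *\<^sub>R cross3 c p) c"
  unfolding twist_free_def
proof
  fix y
  have e: "w + 2 *\<^sub>R cross3 c p + 2 *\<^sub>R cross3 c y = w + 2 *\<^sub>R cross3 c (p + y)"
    by (simp add: real3_eq_iff algebra_simps)
  show "ckf (ckf a b w c p) (b + 2 * (c \<bullet> p)) (w + 2 *\<^sub>R cross3 c p) c y \<bullet> (w + 2 *\<^sub>R cross3 c p + 2 *\<^sub>R cross3 c y) = 0"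
    unfolding ckf_translate [symmetric] e using assms by (simp add: twist_free_def)
qed

lemma twist_freeD:
  assumes "twist_free a b w c"
  shows "a \<bullet> w = 0" "c \<bullet> w = 0" "b *\<^sub>R w + 2 *\<^sub>R cross3 a c = 0"
proof -
  define v where "v = b *\<^sub>R w + 2 *\<^sub>R cross3 a c"
  have e: "ckf a b w c x \<bullet> (w + 2 *\<^sub>R cross3 c x) = a \<bullet> w + v \<bullet> x + (c \<bullet> w) * (x \<bullet> x)" for x
    by (simp add: ckf_def v_def real3_inner algebra_simps)
  have f: "a \<bullet> w + v \<bullet> x + (c \<bullet> w) * (x \<bullet> x) = 0" for x
    using assms unfolding twist_free_def e by simp
  show 1: "a \<bullet> w = 0" using f [of 0] by simp
  show 2: "c \<bullet> w = 0" using f [of "ax 1"] f [of "- ax 1"] 1 by (simp add: inner_axis_axis)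
  show "b *\<^sub>R w + 2 *\<^sub>R cross3 a c = 0" using f [of v] 1 2 by (simp add: v_def)
qed

lemma ckf_zero_exists:
  assumes t: "twist_free a b w c" and nz: "b \<noteq> 0 \<or> w \<noteq> 0 \<or> c \<noteq> 0"
  obtains p where "ckf a b w c p = 0"
proof (cases "c = 0")
  case False
  define n where "n = c \<bullet> c"
  have n: "n > 0" using False by (simp add: n_def)
  define s where "s = (1 / (2 * n)) *\<^sub>R (cross3 c w - b *\<^sub>R c)"
  have b: "b + 2 * (c \<bullet> s) = 0"
  proof -
    have "c \<bullet> cross3 c w = 0" by (simp add: real3_inner algebra_simps)
    then have "2 * (c \<bullet> s) = - b" using n by (simp add: s_def inner_diff_right n_def [symmetric])
    then show ?thesis by simp
  qed
  have w: "w + 2 *\<^sub>R cross3 c s = 0"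
  proof -
    have "cross3 c (cross3 c w - b *\<^sub>R c) = (c \<bullet> w) *\<^sub>R c - n *\<^sub>R w"
      by (simp add: n_def real3_eq_iff real3_inner algebra_simps)
    then have "cross3 c (cross3 c w - b *\<^sub>R c) = - n *\<^sub>R w" using twist_freeD(2) [OF t] by simp
    then have "2 *\<^sub>R cross3 c s = - w" using n by (simp add: s_def cross_mult_right)
    then show ?thesis by simp
  qed
  define a' where "a' = ckf a b w c s"
  have t': "twist_free a' 0 0 c" using twist_free_translate [OF t, of s] unfolding b w a'_def .
  have X: "ckf a b w c (s + y) = ckf a' 0 0 c y" for y unfolding ckf_translate b w a'_def ..
  define \<alpha> where "\<alpha> = (a' \<bullet> c) / n"
  have a': "a' = \<alpha> *\<^sub>R c"
  proof -
    have "cross3 a' c = 0" using twist_freeD(3) [OF t'] by simp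
    then have "cross3 c (cross3 a' c) = 0" by simp
    moreover have "cross3 c (cross3 a' c) = n *\<^sub>R a' - (a' \<bullet> c) *\<^sub>R c"
      by (simp add: n_def real3_eq_iff real3_inner algebra_simps)
    ultimately have "n *\<^sub>R a' = n *\<^sub>R (\<alpha> *\<^sub>R c)" using n by (simp add: \<alpha>_def)
    then show ?thesis using n by (simp only: scaleR_cancel_left) simp
  qed
  show thesis
  proof (cases "\<alpha> \<le> 0")
    case True
    define r where "r = sqrt (- \<alpha> / n)"
    have "0 \<le> - \<alpha> / n" using True n by (simp add: divide_nonpos_pos)
    then have "r * r = - \<alpha> / n" unfolding r_def by (rule real_sqrt_mult_self [THEN trans, OF abs_of_nonneg])
    then have r: "r * r * n = - \<alpha>" using n by simp
    have "ckf a' 0 0 c (r *\<^sub>R c) = (\<alpha> + r * r * n) *\<^sub>R c"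
      by (simp add: ckf_def a' n_def real3_eq_iff algebra_simps)
    then show thesis using that [of "s + r *\<^sub>R c"] X r by simp
  next
    case False
    obtain d where d: "d \<noteq> 0" "orthogonal c d" using orthogonal_to_vector_exists [of c] by auto
    define y where "y = (sqrt \<alpha> / norm d) *\<^sub>R d"
    have "c \<bullet> y = 0" using d(2) by (simp add: y_def orthogonal_def)
    moreover have "y \<bullet> y = \<alpha>" using False d(1) by (simp add: y_def dot_square_norm power2_eq_square)
    ultimately have "ckf a' 0 0 c y = 0" by (simp add: ckf_def a')
    then show thesis using that [of "s + y"] X by simp
  qed
next
  case c: True
  show thesis
  proof (cases "b = 0")
    case False
    then have "w = 0" using twist_freeD(3) [OF t] c by simp
    then show thesis using that [of "- (1 / b) *\<^sub>R a"] False c by (simp add: ckf_def)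
  next
    case True
    define n where "n = w \<bullet> w"
    have n: "n \<noteq> 0" using nz c True by (simp add: n_def)
    have "cross3 w (cross3 w a) = (a \<bullet> w) *\<^sub>R w - n *\<^sub>R a"
      by (simp add: n_def real3_eq_iff real3_inner algebra_simps)
    then have "cross3 w ((1 / n) *\<^sub>R cross3 w a) = - a"
      using twist_freeD(1) [OF t] n by (simp add: cross_mult_right)
    then show thesis using that [of "(1 / n) *\<^sub>R cross3 w a"] True c by (simp add: ckf_def)
  qed
qed

lemma ckf_elliptic:
  assumes w: "w \<noteq> 0" and c: "c \<bullet> w = 0"
  defines "\<omega> \<equiv> (1 / norm w) *\<^sub>R w" and "e \<equiv> (1 / (norm w)\<^sup>2) *\<^sub>R cross3 c w"
  shows "ckf 0 0 w c y = norm w *\<^sub>R ell \<omega> e y" "norm \<omega> = 1" "\<omega> \<bullet> e = 0"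
proof -
  have n: "norm w > 0" using w by simp
  show "norm \<omega> = 1" using n by (simp add: \<omega>_def)
  show "\<omega> \<bullet> e = 0" by (simp add: \<omega>_def e_def) (simp add: real3_inner algebra_simps)
  have "cross3 w (cross3 c w) = (w \<bullet> w) *\<^sub>R c - (c \<bullet> w) *\<^sub>R w"
    by (simp add: real3_eq_iff real3_inner algebra_simps)
  then have "cross3 w (cross3 c w) = (norm w)\<^sup>2 *\<^sub>R c" by (simp add: c power2_norm_eq_inner)
  then have "cross3 \<omega> e = (1 / norm w) *\<^sub>R c"
    using n by (simp add: \<omega>_def e_def cross_mult_left cross_mult_right power2_eq_square)
  then show "ckf 0 0 w c y = norm w *\<^sub>R ell \<omega> e y"
    using n by (simp add: ckf_def ell_def \<omega>_def cross_mult_left scaleR_add_right scaleR_diff_right)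
qed

lemma curl_translate: "curl (\<lambda>x. A (x + p)) x = curl A (x + p)"
  by (simp add: curl_def partial_def add_ac)

lemma C_upto_translate: "C_upto k f \<Longrightarrow> C_upto k (\<lambda>x. f (x + p))"
proof (induction k arbitrary: f)
  case 0
  then have "continuous_on UNIV f" by simp
  then have "continuous_on UNIV (\<lambda>x. f (x + p))"
    by (rule continuous_on_compose2) (auto intro!: continuous_intros)
  then show ?case by simp
next
  case (Suc k)
  have "((\<lambda>x. f (x + p)) has_derivative (\<lambda>v. pd v f (x + p))) (at x)" for x
  proof -
    have "((\<lambda>x. x + p) has_derivative (\<lambda>v. v)) (at x)" by (auto intro!: derivative_eq_intros)
    from diff_chain_at [OF this C_upto_has_derivative [OF Suc.prems]] show ?thesis by (simp add: o_def)
  qed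
  then show ?case
    by (rule C_upto_SucI) (rule Suc.IH [OF C_upto_pd [OF Suc.prems]])
qed

lemma pd_translate:
  assumes "f differentiable at (x + p)"
  shows "pd v (\<lambda>x. f (x + p)) x = pd v f (x + p)"
proof -
  have "((\<lambda>x. x + p) has_derivative (\<lambda>v. v)) (at x)" by (auto intro!: derivative_eq_intros)
  from pd_eq [OF diff_chain_at [OF this has_derivative_pd [OF assms]]] show ?thesis by (simp add: o_def)
qed

lemma weak_dirac_translate:
  assumes W: "weak_dirac A \<psi> (\<lambda>x. 0)" and A: "continuous_on UNIV A"
  shows "weak_dirac (\<lambda>x. A (x + p)) (\<lambda>x. \<psi> (x + p)) (\<lambda>x. 0)"
  unfolding weak_dirac_def
proof (intro conjI allI impI)
  have sq: "sq_int \<psi>" by (rule weak_dirac_sq_int(1) [OF W])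
  then have m: "\<psi> \<in> borel_measurable borel" and i: "integrable lborel (\<lambda>x. (norm (\<psi> x))\<^sup>2)" by (auto simp: sq_int_def)
  have t: "(\<lambda>x. x + p) \<in> borel_measurable borel" for p :: "real^3" by simp
  show "sq_int (\<lambda>x. \<psi> (x + p))"
    unfolding sq_int_def
  proof
    show "(\<lambda>x. \<psi> (x + p)) \<in> borel_measurable lborel" using measurable_compose [OF t m] by simp
    have "integrable (distr lborel borel (\<lambda>x. p + x)) (\<lambda>x. (norm (\<psi> x))\<^sup>2)" using i by (simp add: lborel_distr_plus)
    then show "integrable lborel (\<lambda>x. (norm (\<psi> (x + p)))\<^sup>2)"
      using integrable_distr [of "\<lambda>x. p + x" lborel borel "\<lambda>x. (norm (\<psi> x))\<^sup>2"] by (simp add: add.commute)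
  qed
  show "sq_int (\<lambda>x::real^3. (0 :: complex^2))" using W by (rule weak_dirac_sq_int(2))
  fix \<phi> :: spinor and r assume \<phi>: "C_upto (Suc 0) \<phi>" "supp_in \<phi> r"
  define \<phi>' where "\<phi>' x = \<phi> (x + - p)" for x
  have \<phi>': "C_upto (Suc 0) \<phi>'" unfolding \<phi>'_def by (rule C_upto_translate [OF \<phi>(1)])
  have \<phi>'s: "supp_in \<phi>' (r + norm p)"
    unfolding supp_in_def
  proof (intro allI impI)
    fix x :: "real^3" assume "r + norm p < norm x"
    moreover have "norm x \<le> norm (x + - p) + norm p" using norm_triangle_ineq [of "x + - p" p] by simp
    ultimately have "r < norm (x + - p)" by linarith
    then show "\<phi>' x = 0" using \<phi>(2) by (simp add: \<phi>'_def supp_in_def)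
  qed
  have d: "dirac (\<lambda>x. A (x + p)) \<phi> x = dirac A \<phi>' (x + p)" for x
  proof -
    have "\<phi> differentiable at (x + p + - p)" using \<phi>(1) by (simp add: C_upto_Suc_iff)
    from pd_translate [OF this] have "pd v \<phi>' (x + p) = pd v \<phi> x" for v by (simp add: \<phi>'_def [abs_def])
    then show ?thesis by (simp add: dirac_def \<phi>'_def)
  qed
  have dm: "dirac A \<phi>' \<in> borel_measurable borel"
    by (rule borel_measurable_continuous_onI [OF dirac_continuous [OF \<phi>' A]])
  have "(LINT x|lborel. dirac (\<lambda>x. A (x + p)) \<phi> x \<bullet> \<psi> (x + p)) = (LINT x|lborel. dirac A \<phi>' (x + p) \<bullet> \<psi> (x + p))"
    by (simp only: d)
  also have "\<dots> = (LINT x|lborel. dirac A \<phi>' x \<bullet> \<psi> x)"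
    by (rule integral_translate [of "\<lambda>x. dirac A \<phi>' x \<bullet> \<psi> x" p]) (intro borel_measurable_inner dm m)
  also have "\<dots> = (LINT x|lborel. \<phi>' x \<bullet> 0)" by (rule weak_diracD [OF W \<phi>' \<phi>'s])
  finally show "(LINT x|lborel. dirac (\<lambda>x. A (x + p)) \<phi> x \<bullet> \<psi> (x + p)) = (LINT x|lborel. \<phi> x \<bullet> 0)" by simp
qed

lemma AE_translate:
  fixes \<psi> :: "'a::euclidean_space \<Rightarrow> 'b::euclidean_space"
  assumes "AE x in (lborel :: 'a measure). \<psi> (x + p) = 0" and m: "\<psi> \<in> borel_measurable borel"
  shows "AE x in (lborel :: 'a measure). \<psi> x = 0"
proof -
  have "AE x in distr (lborel :: 'a measure) borel ((+) p). \<psi> x = 0"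
    using assms by (subst AE_distr_iff) (simp_all add: add.commute)
  then show ?thesis unfolding lborel_distr_plus .
qed



lemma curl_C_upto:
  assumes "C_upto (Suc k) A"
  shows "C_upto k (curl A)"
proof -
  have "curl A = (\<lambda>x. \<Sum>j\<in>UNIV. cross3 (ax j) (pd (ax j) A x))"
    using assms by (intro ext curl_eq) (simp add: C_upto_Suc_iff)
  then show ?thesis
    by (simp only:) (intro C_upto_sum C_upto_linear [OF bounded_bilinear.bounded_linear_right [OF bounded_bilinear_cross3]] C_upto_pd [OF assms])
qed

lemma div_curl_eq_0:
  assumes A: "C_upto 2 A"
  shows "(\<Sum>i\<in>UNIV. pd (ax i) (curl A) x $ i) = 0"
proof -
  have A2: "C_upto (Suc (Suc 0)) A" using A by (simp only: numeral_2_eq_2)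
  have d: "A differentiable at x" for x using A2 by (simp add: C_upto_Suc_iff)
  have d2: "pd v A differentiable at x" for v x using C_upto_pd [OF A2, of v] by (simp add: C_upto_Suc_iff)
  have e: "curl A = (\<lambda>x. \<Sum>j\<in>UNIV. cross3 (ax j) (pd (ax j) A x))" by (intro ext curl_eq d)
  have p: "pd u (curl A) x = (\<Sum>j\<in>UNIV. cross3 (ax j) (pd u (pd (ax j) A) x))" for u
    unfolding e
    by (rule pd_eq [of _ "\<lambda>u. \<Sum>j\<in>UNIV. cross3 (ax j) (pd u (pd (ax j) A) x)"])
      (intro has_derivative_sum bounded_linear.has_derivative [OF bounded_bilinear.bounded_linear_right [OF bounded_bilinear_cross3]] has_derivative_pd d2)
  have c: "pd (ax 1) (pd (ax 2) A) x = pd (ax 2) (pd (ax 1) A) x" "pd (ax 1) (pd (ax 3) A) x = pd (ax 3) (pd (ax 1) A) x"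
     "pd (ax 2) (pd (ax 3) A) x = pd (ax 3) (pd (ax 2) A) x"
    by (rule pd_commute [OF A])+
  show ?thesis unfolding p by (simp add: sum_3 c)
qed

text \<open>curl (B x X) = 0\<close>
lemma parallel_divergence_free_derivative:
  assumes dB: "B differentiable at x" and div: "(\<Sum>i\<in>UNIV. pd (ax i) B x $ i) = 0"
    and par: "\<And>x. cross3 (X x) (B x) = 0" and X: "(X has_derivative (\<lambda>u. l *\<^sub>R u + cross3 r u)) (at x)"
    and nz: "X x \<noteq> 0"
  shows "pd (X x) (\<lambda>x. (B x \<bullet> X x)\<^sup>2 * (X x \<bullet> X x)) x = 0"
proof -
  define n where "n = X x \<bullet> X x"
  have n: "n \<noteq> 0" using nz by (simp add: n_def)
  define f where "f = (B x \<bullet> X x) / n"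
  have B: "B x = f *\<^sub>R X x"
  proof -
    have "cross3 (X x) (cross3 (X x) (B x)) = (B x \<bullet> X x) *\<^sub>R X x - n *\<^sub>R B x"
      by (simp add: n_def real3_eq_iff real3_inner algebra_simps)
    then have "n *\<^sub>R B x = n *\<^sub>R (f *\<^sub>R X x)" using par [of x] n by (simp add: f_def)
    then show ?thesis using n by (simp only: scaleR_cancel_left) simp
  qed
  have "((\<lambda>x. cross3 (X x) (B x)) has_derivative (\<lambda>u. cross3 (X x) (pd u B x) + cross3 (l *\<^sub>R u + cross3 r u) (B x))) (at x)"
    by (rule bounded_bilinear.FDERIV [OF bounded_bilinear_cross3 X has_derivative_pd [OF dB]])
  then have "cross3 (X x) (pd u B x) + cross3 (l *\<^sub>R u + cross3 r u) (B x) = 0" for u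
    using pd_eq [of "\<lambda>x. cross3 (X x) (B x)" _ x u] unfolding par by (simp add: pd_eq [OF has_derivative_const])
  then have "cross3 (X x) (cross3 (X x) (pd u B x) + f *\<^sub>R cross3 (l *\<^sub>R u + cross3 r u) (X x)) = 0" for u
    unfolding B by (simp add: cross_mult_right)
  moreover have "cross3 y (cross3 y z + f *\<^sub>R cross3 v y) = ((y \<bullet> z) *\<^sub>R y - (y \<bullet> y) *\<^sub>R z) + f *\<^sub>R ((y \<bullet> y) *\<^sub>R v - (y \<bullet> v) *\<^sub>R y)" for y z v :: "real^3"
    by (simp add: real3_eq_iff real3_inner algebra_simps)
  ultimately have k: "n *\<^sub>R pd u B x = (X x \<bullet> pd u B x) *\<^sub>R X x + f *\<^sub>R (n *\<^sub>R (l *\<^sub>R u + cross3 r u) - (X x \<bullet> (l *\<^sub>R u + cross3 r u)) *\<^sub>R X x)" for u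
    by (simp add: n_def algebra_simps)
  have t: "n * pd (ax i) B x $ i = X x $ i * (X x \<bullet> pd (ax i) B x) + f * (n * (l *\<^sub>R ax i + cross3 r (ax i)) $ i - (X x \<bullet> (l *\<^sub>R ax i + cross3 r (ax i))) * X x $ i)" for i
    using arg_cong [OF k [of "ax i"], of "\<lambda>v. v $ i"] by (simp add: mult.commute)
  have bas: "X x \<bullet> pd (X x) B x = X x $ 1 * (X x \<bullet> pd (ax 1) B x) + X x $ 2 * (X x \<bullet> pd (ax 2) B x) + X x $ 3 * (X x \<bullet> pd (ax 3) B x)"
    by (subst pd_ax_sum [OF dB]) (simp add: sum_3 inner_add_right)
  have "n * (\<Sum>i\<in>UNIV. pd (ax i) B x $ i) = X x \<bullet> pd (X x) B x + 2 * f * l * n"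
    unfolding sum_3 distrib_left t bas by (simp add: n_def real3_inner algebra_simps)
  then have XB: "X x \<bullet> pd (X x) B x = - 2 * f * l * n" unfolding div by simp
  have dG: "((\<lambda>x. (B x \<bullet> X x)\<^sup>2 * (X x \<bullet> X x)) has_derivative (\<lambda>u. (B x \<bullet> X x)\<^sup>2 * (X x \<bullet> (l *\<^sub>R u + cross3 r u) + (l *\<^sub>R u + cross3 r u) \<bullet> X x)
     + (2 * (B x \<bullet> X x) * (B x \<bullet> (l *\<^sub>R u + cross3 r u) + pd u B x \<bullet> X x)) * (X x \<bullet> X x))) (at x)"
    by (rule has_derivative_eq_rhs [OF has_derivative_mult [OF has_derivative_power [OF has_derivative_inner [OF has_derivative_pd [OF dB] X]] has_derivative_inner [OF X X]]])
      (simp add: fun_eq_iff)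
  have r: "X x \<bullet> cross3 r (X x) = 0" by (simp add: real3_inner algebra_simps)
  have "pd (X x) B x \<bullet> X x = - 2 * f * l * n" using XB by (simp add: inner_commute)
  then show ?thesis
    using pd_eq [OF dG, of "X x"]
    by (simp add: B r inner_add_right inner_add_left inner_commute [of "cross3 r (X x)" "X x"] n_def [symmetric] power2_eq_square algebra_simps)
qed

text \<open>flow to the zero\<close>
lemma curl_eq_0_half:
  assumes A: "C_upto 2 A" and par: "\<And>x. cross3 (ckf 0 b 0 c x) (curl A x) = 0"
    and nz: "b \<noteq> 0 \<or> c \<noteq> 0" and b: "b \<ge> 0" and d: "d \<bullet> c = 0" "d \<bullet> y \<noteq> 0"
  shows "curl A y = 0"
proof -
  define X where "X = ckf 0 b 0 c"
  define B where "B = curl A"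
  have A2: "C_upto (Suc (Suc 0)) A" using A by (simp only: numeral_2_eq_2)
  have B1: "C_upto (Suc 0) B" unfolding B_def by (rule curl_C_upto [OF A2])
  have dB: "B differentiable at x" for x using B1 by (simp add: C_upto_Suc_iff)
  have X1: "C_upto (Suc 0) X"
    unfolding X_def
    by (rule C_upto_SucI [OF ckf_has_derivative])
      (simp, intro continuous_intros bounded_bilinear.continuous_on [OF bounded_bilinear_cross3])
  define G where "G x = (B x \<bullet> X x)\<^sup>2 * (X x \<bullet> X x)" for x
  have G1: "C_upto (Suc 0) G"
    unfolding G_def power2_eq_square by (intro C_upto_mult C_upto_inner B1 X1)
  have dX: "(X has_derivative (\<lambda>u. (b + 2 * (c \<bullet> x)) *\<^sub>R u + cross3 (0 + 2 *\<^sub>R cross3 c x) u)) (at x)" for x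
    unfolding X_def by (rule ckf_has_derivative)
  have pG: "pd (X x) G x = 0" if "X x \<noteq> 0" for x
    unfolding G_def [abs_def]
    by (rule parallel_divergence_free_derivative [OF dB _ _ dX that])
      (use par div_curl_eq_0 [OF A] in \<open>simp_all add: B_def X_def\<close>)
  have pG0: "pd (X x) G x = 0" for x
  proof (cases "X x = 0")
    case True
    have "G differentiable at x" using G1 by (simp add: C_upto_Suc_iff)
    then show ?thesis using pd_add_dir(2) [of G x 0 0] True by simp
  qed (rule pG)
  have y: "y \<noteq> 0" using d(2) by auto
  define k0 where "k0 = inv3 y"
  define w where "w = b *\<^sub>R k0 + c"
  define k where "k s = k0 + s *\<^sub>R w" for s
  have dk0: "d \<bullet> k0 \<noteq> 0" using d(2) y by (simp add: k0_def inv3_def)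
  have dw: "d \<bullet> w = b * (d \<bullet> k0)" by (simp add: w_def inner_add_right d(1))
  have w0: "w \<noteq> 0"
  proof
    assume w: "w = 0"
    then have "b = 0" using dw dk0 by simp
    then show False using w nz by (simp add: w_def)
  qed
  have kn: "k s \<noteq> 0" if "s \<ge> 0" for s
  proof -
    have "d \<bullet> k s = (1 + s * b) * (d \<bullet> k0)" by (simp add: k_def inner_add_right dw algebra_simps)
    moreover have "1 + s * b \<noteq> 0" using mult_nonneg_nonneg [OF that b] by linarith
    ultimately show ?thesis using dk0 by auto
  qed
  have dk: "(k has_vector_derivative w) (at s)" for s
    unfolding k_def [abs_def] has_vector_derivative_def by (auto intro!: derivative_eq_intros)
  have dG: "((\<lambda>s. G (inv3 (k s))) has_real_derivative 0) (at s)" if s: "s \<ge> 0" for s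
  proof -
    define z where "z = k s"
    define n where "n = z \<bullet> z"
    have n: "n \<noteq> 0" using kn [OF s] by (simp add: n_def z_def)
    have sb: "1 + b * s \<noteq> 0" using mult_nonneg_nonneg [OF b s] by linarith
    have bz: "b *\<^sub>R z + c = (1 + b * s) *\<^sub>R w"
      by (simp add: z_def k_def w_def algebra_simps)
    define g' where "g' = (1 / n) *\<^sub>R w - (2 * (z \<bullet> w) / n\<^sup>2) *\<^sub>R z"
    have g: "((\<lambda>s. inv3 (k s)) has_vector_derivative g') (at s)"
      using inv3_derivative [OF dk kn [OF s]] by (simp add: g'_def z_def n_def)
    have "(1 + b * s) *\<^sub>R g' = (1 / n) *\<^sub>R (b *\<^sub>R z + c) - (2 * (z \<bullet> (b *\<^sub>R z + c)) / n\<^sup>2) *\<^sub>R z"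
      unfolding bz by (simp add: g'_def scaleR_diff_right mult_ac)
    also have "\<dots> = - X (inv3 z)"
    proof -
      have i0: "z \<bullet> (b *\<^sub>R z + c) = b * n + c \<bullet> z" by (simp add: inner_add_right n_def inner_commute)
      have i1: "inv3 z \<bullet> inv3 z = 1 / n" using n by (simp add: inv3_def n_def)
      have i2: "c \<bullet> inv3 z = (c \<bullet> z) / n" by (simp add: inv3_def n_def)
      have i3: "inv3 z = (1 / n) *\<^sub>R z" by (simp add: inv3_def n_def)
      show ?thesis
        unfolding i0 X_def ckf_def i1 i2 unfolding i3 using n
        by (simp add: real3_eq_iff power2_eq_square field_simps)
    qed
    finally have "(1 / (1 + b * s)) *\<^sub>R ((1 + b * s) *\<^sub>R g') = (1 / (1 + b * s)) *\<^sub>R (- X (inv3 z))" by (rule arg_cong)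
    then have e: "g' = (- 1 / (1 + b * s)) *\<^sub>R X (inv3 z)" using sb by simp
    have "G differentiable at (inv3 z)" using G1 by (simp add: C_upto_Suc_iff)
    then have "pd g' G (inv3 z) = 0" unfolding e by (simp only: pd_add_dir(2) pG0 scaleR_zero_right)
    moreover have "((\<lambda>s. G (inv3 (k s))) has_vector_derivative pd g' G (inv3 z)) (at s)"
    proof -
      have "(G has_derivative (\<lambda>v. pd v G (inv3 (k s)))) (at (inv3 (k s)))" by (rule C_upto_has_derivative [OF G1])
      from diff_chain_at [OF g [unfolded has_vector_derivative_def] this]
      show ?thesis
        using pd_add_dir(2) [of G "inv3 (k s)"] G1
        by (simp add: has_vector_derivative_def o_def z_def C_upto_Suc_iff)
    qed
    ultimately show ?thesis by (simp add: has_real_derivative_iff_has_vector_derivative)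
  qed
  have const: "G (inv3 (k s)) = G y" if "s \<ge> 0" for s
  proof -
    have "\<exists>c. \<forall>s\<in>{0..}. G (inv3 (k s)) = c"
      by (rule has_field_derivative_zero_constant) (auto intro: has_field_derivative_at_within dG)
    then have "G (inv3 (k s)) = G (inv3 (k 0))" using that by auto
    then show ?thesis using y by (simp add: k_def k0_def inv3_simps)
  qed
  have "filterlim (\<lambda>n. norm (k (real n))) at_top sequentially"
  proof (rule filterlim_at_top_mono)
    show "filterlim (\<lambda>n. - norm k0 + real n * norm w) at_top sequentially"
      by (intro filterlim_tendsto_add_at_top [OF tendsto_const] filterlim_at_top_mult_tendsto_pos [OF tendsto_const] filterlim_real_sequentially) (use w0 in simp)
    show "eventually (\<lambda>n. - norm k0 + real n * norm w \<le> norm (k (real n))) sequentially"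
    proof (intro always_eventually allI)
      fix n
      show "- norm k0 + real n * norm w \<le> norm (k (real n))"
        using norm_triangle_ineq2 [of "real n *\<^sub>R w" "- k0"] by (simp add: k_def add.commute)
    qed
  qed
  then have "(\<lambda>n. inverse (norm (k (real n)))) \<longlonglongrightarrow> 0" by (rule tendsto_inverse_0_at_top)
  moreover have "inverse (norm (k (real n))) = norm (inv3 (k (real n)))" for n
    using kn [of "real n"] by (simp add: inv3_def dot_square_norm power2_eq_square field_simps)
  ultimately have "(\<lambda>n. inv3 (k (real n))) \<longlonglongrightarrow> 0" using tendsto_norm_zero_cancel by simp
  moreover have "isCont G 0"
    using C_upto_imp_continuous_on [OF G1, of UNIV] by (simp add: continuous_on_eq_continuous_at)
  ultimately have "(\<lambda>n. G (inv3 (k (real n)))) \<longlonglongrightarrow> G 0" by (rule isCont_tendsto_compose [rotated])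
  then have "G y = G 0" by (simp add: const LIMSEQ_const_iff)
  moreover have "G 0 = 0" by (simp add: G_def X_def ckf_def)
  ultimately have Gy: "G y = 0" by simp
  have Xy: "X y \<noteq> 0"
  proof
    assume X0: "X y = 0"
    have "d \<bullet> X y = (b + 2 * (c \<bullet> y)) * (d \<bullet> y)"
      by (simp add: X_def ckf_def inner_add_right inner_diff_right d(1) algebra_simps)
    then have bc: "b + 2 * (c \<bullet> y) = 0" using X0 d(2) by simp
    have "X y = (b + 2 * (c \<bullet> y)) *\<^sub>R y - (y \<bullet> y) *\<^sub>R c" by (simp add: X_def ckf_def scaleR_add_left)
    then have "c = 0" using X0 bc y by simp
    with bc nz show False by simp
  qed
  then have "B y \<bullet> X y = 0" using Gy by (simp add: G_def)
  moreover have "cross3 (X y) (cross3 (X y) (B y)) = (B y \<bullet> X y) *\<^sub>R X y - (X y \<bullet> X y) *\<^sub>R B y"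
    by (simp add: real3_eq_iff real3_inner algebra_simps)
  moreover have "cross3 (X y) (B y) = 0" using par by (simp add: X_def B_def)
  ultimately show ?thesis using Xy by (simp add: B_def)
qed

lemma curl_eq_0_of_radial:
  assumes A: "C_upto 2 A" and par: "\<And>x. cross3 (ckf 0 b 0 c x) (curl A x) = 0" and nz: "b \<noteq> 0 \<or> c \<noteq> 0"
  shows "curl A y = 0"
proof (rule ccontr)
  assume ne: "curl A y \<noteq> 0"
  obtain d where d: "d \<noteq> 0" "orthogonal c d" using orthogonal_to_vector_exists [of c] by auto
  have dc: "d \<bullet> c = 0" using d(2) by (simp add: orthogonal_def inner_commute)
  have 1: "curl A x = 0" if "d \<bullet> x \<noteq> 0" for x
  proof (cases "b \<ge> 0")
    case True
    show ?thesis by (rule curl_eq_0_half [OF A par nz True dc that])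
  next
    case False
    have "ckf 0 (- b) 0 (- c) x = - ckf 0 b 0 c x" for x by (simp add: ckf_def)
    then have "cross3 (ckf 0 (- b) 0 (- c) x) (curl A x) = 0" for x using par by (simp add: cross_minus_left)
    from curl_eq_0_half [OF A this, of d x] show ?thesis using False dc that nz by simp
  qed
  have A2: "C_upto (Suc (Suc 0)) A" using A by (simp only: numeral_2_eq_2)
  have "open {x. curl A x \<noteq> 0}"
    by (intro open_Collect_neq C_upto_imp_continuous_on [OF curl_C_upto [OF A2]] continuous_on_const)
  moreover have "{x. curl A x \<noteq> 0} \<subseteq> {x. d \<bullet> x = 0}" using 1 by auto
  ultimately have "{x. curl A x \<noteq> 0} \<subseteq> interior {x. d \<bullet> x = 0}" by (rule interior_maximal [rotated])
  then show False using ne d(1) by (simp add: interior_hyperplane)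
qed

lemma no_weak_solution_ckf:
  assumes W: "weak_dirac A \<psi> (\<lambda>x. 0)" and A: "smooth A"
    and t: "twist_free a b w c" and nz: "\<exists>x. ckf a b w c x \<noteq> 0"
    and par: "\<And>x. cross3 (ckf a b w c x) (curl A x) = 0"
  shows "AE x in lborel. \<psi> x = 0"
proof -
  have As: "C_upto k A" for k using A by (simp add: smooth_def)
  show ?thesis
  proof (cases "b = 0 \<and> w = 0 \<and> c = 0")
    case True
    then have X: "ckf a b w c = (\<lambda>x. a)" by (simp add: ckf_def fun_eq_iff)
    have a: "a \<noteq> 0" using nz unfolding X by simp
    show ?thesis
    proof (rule no_weak_solution_const [OF W As])
      show "norm ((1 / norm a) *\<^sub>R a) = 1" using a by simp
      show "cross3 ((1 / norm a) *\<^sub>R a) (curl A x) = 0" for x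
        using par [of x] unfolding X by (simp add: cross_mult_left)
    qed
  next
    case False
    then obtain p where p: "ckf a b w c p = 0" using ckf_zero_exists [OF t] by blast
    define b' w' where "b' = b + 2 * (c \<bullet> p)" "w' = w + 2 *\<^sub>R cross3 c p"
    have X: "ckf a b w c (p + y) = ckf 0 b' w' c y" for y unfolding ckf_translate p b'_w'_def ..
    have t': "twist_free 0 b' w' c" using twist_free_translate [OF t, of p] unfolding p b'_w'_def .
    note tw = twist_freeD [OF t']
    have bw: "b' = 0 \<or> w' = 0" using tw(3) by simp
    define A' where "A' = (\<lambda>x. A (x + p))"
    have A': "C_upto k A'" for k unfolding A'_def by (rule C_upto_translate [OF As])
    have par': "cross3 (ckf 0 b' w' c y) (curl A' y) = 0" for y
      using par [of "p + y"] unfolding X A'_def curl_translate by (simp add: add.commute)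
    have W': "weak_dirac A' (\<lambda>x. \<psi> (x + p)) (\<lambda>x. 0)"
      unfolding A'_def by (rule weak_dirac_translate [OF W C_upto_imp_continuous_on [OF As]])
    have "AE x in lborel. \<psi> (x + p) = 0"
    proof (cases "w' = 0")
      case w: True
      have "b' \<noteq> 0 \<or> c \<noteq> 0"
      proof (rule ccontr)
        assume "\<not> (b' \<noteq> 0 \<or> c \<noteq> 0)"
        then have "ckf 0 b' w' c y = 0" for y using w by (simp add: ckf_def)
        then have "ckf a b w c x = 0" for x using X [of "x - p"] by simp
        with nz show False by simp
      qed
      then have "curl A' y = 0" for y
        by (intro curl_eq_0_of_radial [OF A' par' [unfolded w]])
      then show ?thesis
        using no_weak_solution_const [OF W' A', of "axis 1 1"] by (simp add: norm_eq_1 inner_axis_axis)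
    next
      case False
      then have b': "b' = 0" using bw by simp
      note el = ckf_elliptic [OF False tw(2)]
      define \<omega> e where "\<omega> = (1 / norm w') *\<^sub>R w'" "e = (1 / (norm w')\<^sup>2) *\<^sub>R cross3 c w'"
      interpret elliptic_dirac \<omega> e A'
      proof
        show "norm \<omega> = 1" "\<omega> \<bullet> e = 0" unfolding \<omega>_e_def by (rule el)+
        show "C_upto (Suc 0) A'" by (rule A')
        show "cross3 (ell \<omega> e x) (curl A' x) = 0" for x
          using par' [of x] False unfolding b' el(1) \<omega>_e_def by (simp add: cross_mult_left)
      qed
      show ?thesis by (rule no_weak_solution [OF W'])
    qed
    then show ?thesis
      by (rule AE_translate) (use weak_dirac_sq_int(1) [OF W] in \<open>simp add: sq_int_def\<close>)
  qed
qed

theorem theorem1p1: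
  fixes X A :: "real^3 \<Rightarrow> real^3"
  assumes "conformal_killing X"
    and "\<exists>x. X x \<noteq> 0"
    and "\<forall>x. X x \<bullet> curl X x = 0"
    and "smooth A"
    and "everywhere_parallel (curl A) X"
  shows "\<not> (\<exists>\<psi>. zero_mode A \<psi>)"
proof
  assume "\<exists>\<psi>. zero_mode A \<psi>"
  then obtain \<psi> where W: "weak_dirac A \<psi> (\<lambda>x. 0)" and n0: "\<not> (AE x in lborel. \<psi> x = 0)"
    using zero_mode_iff [OF assms(4)] by auto
  obtain a b w c where X: "X = ckf a b w c" by (rule conformal_killing_ckf [OF assms(1)])
  have "twist_free a b w c"
    using assms(3) unfolding twist_free_def X curl_ckf by simp
  moreover have "cross3 (X x) (curl A x) = 0" for x
    using assms(5) unfolding everywhere_parallel_def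
    by (cases "X x = 0") (auto simp: cross_mult_right cross_zero_left)
  ultimately have "AE x in lborel. \<psi> x = 0"
    using no_weak_solution_ckf [OF W assms(4)] assms(2) unfolding X by blast
  with n0 show False ..
qed


end
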